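(* Let $U$ be a solution on $[t_0,\infty)$ of the two-dimensional incompressible Navier--Stokes equations $\frac{dU}{dt}+\nu AU+B(U,U)=f$ satisfying the working assumptions stated in the context, and let $c_1>0$. For every $\delta>0$ there exist $\lambda>0$ (large enough) and $h>0$ (small enough) such that, if $I_h$ is a type-II interpolant observable with constant $c_1$ and length scale $h$, $u$ is the approximating solution produced from $U$ by spectrally-filtered discrete-in-time downscaling data assimilation with parameters $\delta,\lambda,I_h$, and $W=\operatorname{curl}U$, $w=\operatorname{curl}u$ are the corresponding vorticities, then $\|W(t)-w(t)\|\to0$ as $t\to\infty$. Moreover, the rate of convergence is exponential in time: there are constants $K,\alpha>0$ with $\|W(t)-w(t)\|\le Ke^{-\alpha(t-t_0)}$ for all $t\ge t_0$.
   Context: **Spaces and operators.** $\Omega=[0,L]^2$ with periodic boundary conditions, $\nu>0$, $f\in L^\infty([t_0,\infty);H)$. $\mathcal V$ is the set of divergence-free $L$-periodic $\mathbb{R}^2$-valued trigonometric polynomials with zero spatial average; $H$ is its closure in $L^2(\Omega;\mathbb{R}^2)$, $V$ its closure in $H^1(\Omega;\mathbb{R}^2)$, $V^*$ the dual of $V$; $P_\sigma$ is the orthogonal projection of $L^2(\Omega;\mathbb{R}^2)$ onto $H$. $A:V\to V^*$ and $B:V\times V\to V^*$ are the continuous extensions of $Au=-P_\sigma\Delta u$ and $B(u,v)=P_\sigma(u\cdot\nabla v)$, $u,v\in\mathcal V$. $\mathcal D(A)=H^2(\Omega)\cap V$. Let $\mathcal J=\{\frac{2\pi}{L}(n_1,n_2):(n_1,n_2)\in\mathbb{Z}^2\setminus\{(0,0)\}\}$.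 For $U=\sum_{k\in\mathcal J}\widehat U_ke^{ik\cdot x}$ (vector- or scalar-valued) put $\|U\|_\alpha^2=L^2\sum_{k\in\mathcal J}|k|^{2\alpha}|\widehat U_k|^2$, $|U|=\|U\|_0$, $\|U\|=\|U\|_1$, $|AU|=\|U\|_2$, $\|AU\|=\|U\|_3$. $\lambda_1=(2\pi/L)^2$. For $\Phi=(\Phi_1,\Phi_2)$, $\operatorname{curl}\Phi=\partial\Phi_2/\partial x_1-\partial\Phi_1/\partial x_2$ (a scalar). **Semi-process.** $S(t,s;u_s)$ denotes the value at time $t\ge s$ of the solution of $\frac{du}{dt}+\nu Au+B(u,u)=f$ with $u(s)=u_s$. **Type-II interpolant observable.** A linear operator $I_h:\mathcal D(A)\to L^2(\Omega;\mathbb{R}^2)$ is a type-II interpolant observable (with constant $c_1>0$ and length scale $h>0$) if $\|U-I_hU\|_{L^2}^2\le c_1h^2(\|U\|^2+h^2|AU|^2)$ for all $U\in\mathcal D(A)$. **Spectral filter.** For $\lambda>0$, $P_\lambda U=\sum_{|k|^2\le\lambda}\widehat U_ke^{ik\cdot x}$ on $H$; $J=P_\lambda P_\sigma I_h$ and $E=I-J$. **Algorithm (spectrally-filtered discrete-in-time downscaling data assimilation).** Let $t_n=t_0+n\delta$. Given $U$, define $u_0=JU(t_0)$, $u_{n+1}=E\,S(t_{n+1},t_n;u_n)+JU(t_{n+1})$, and $u(t)=S(t,t_n;u_n)$ for $t\in[t_n,t_{n+1})$, $n=0,1,2,\dots$. **Working assumptions (type-II case).** There are constants $\rho_H,\rho_V,\rho_A$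 (determined by $f$, $\Omega$, $\nu$) such that, for all $t\ge t_0$, $|U(t)|\le\rho_H$, $\|U(t)\|\le\rho_V$, $|AU(t)|\le\rho_A$, and for every $\delta>0$, $\int_t^{t+\delta}|AU(s)|^2ds\le\left(\frac1\nu+\frac{\delta\lambda_1}{2}\right)\rho_V^2$ and $\int_t^{t+\delta}\|AU(s)\|^2ds<\infty$. For solutions with other initial conditions, the norms and time integrals appearing in these bounds are assumed to be finite at times after the initial time. *)

theory Defs
  imports "HOL-Analysis.Analysis"
begin

text \<open>
  Fields on the torus are functions on the plane of which only the values on
  \<open>\<Omega> = [0,L]\<^sup>2\<close> matter. Elements of \<open>L\<^sup>2(\<Omega>)\<close> are represented by functions, and equality
  in \<open>L\<^sup>2(\<Omega>)\<close> is equality almost everywhere with respect to \<open>torus L\<close>.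
\<close>

type_synonym vfield = "real^2 \<Rightarrow> real^2"

definition torus :: "real \<Rightarrow> (real^2) measure" where
  "torus L = lebesgue_on (cbox 0 (\<chi> i. L))"

text \<open>Norms take values in \<open>[0,\<infinity>]\<close>, so that finiteness of a norm is a genuine condition.\<close>

definition esqrt :: "ennreal \<Rightarrow> ennreal" where
  "esqrt x = (if x = \<infinity> then \<infinity> else ennreal (sqrt (enn2real x)))"

definition L2_sq :: "real \<Rightarrow> (real^2 \<Rightarrow> 'a::euclidean_space) \<Rightarrow> ennreal" where
  "L2_sq L U = (\<integral>\<^sup>+ x. ennreal ((norm (U x))^2) \<partial>torus L)"

definition L2_norm :: "real \<Rightarrow> (real^2 \<Rightarrow> 'a::euclidean_space) \<Rightarrow> ennreal" where
  "L2_norm L U = esqrt (L2_sq L U)"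

definition L2_space :: "real \<Rightarrow> (real^2 \<Rightarrow> 'a::euclidean_space) set" where
  "L2_space L = {U \<in> borel_measurable (torus L). L2_sq L U < \<infinity>}"

definition L2_inner :: "real \<Rightarrow> (real^2 \<Rightarrow> 'a::euclidean_space) \<Rightarrow> (real^2 \<Rightarrow> 'a) \<Rightarrow> real" where
  "L2_inner L U V = (\<integral> x. U x \<bullet> V x \<partial>torus L)"


section \<open>Fourier coefficients and Sobolev norms\<close>

text \<open>The set \<open>\<J>\<close> is the image of \<open>modes\<close> under the injection \<open>wave L\<close>.\<close>

definition modes :: "(int \<times> int) set" where
  "modes = UNIV - {(0, 0)}"

definition wave :: "real \<Rightarrow> int \<times> int \<Rightarrow> real^2" where
  "wave L n = (2 * pi / L) *\<^sub>R vector [of_int (fst n), of_int (snd n)]"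

text \<open>
  The component along the basis vector \<open>b\<close> of the coefficient of \<open>exp (\<i> k \<bullet> x)\<close>, \<open>k = wave L n\<close>.
  Scalar fields are the case \<open>b = 1\<close>.
\<close>

definition fcoef :: "real \<Rightarrow> (real^2 \<Rightarrow> 'a::euclidean_space) \<Rightarrow> int \<times> int \<Rightarrow> 'a \<Rightarrow> complex" where
  "fcoef L U n b =
     (\<integral> x. complex_of_real (U x \<bullet> b) * cis (- (wave L n \<bullet> x)) \<partial>torus L) / complex_of_real (L^2)"

definition sob_sq :: "real \<Rightarrow> nat \<Rightarrow> (real^2 \<Rightarrow> 'a::euclidean_space) \<Rightarrow> ennreal" where
  "sob_sq L m U = ennreal (L^2) *
     (\<Sum>\<^sub>\<infinity>n\<in>modes. ennreal (norm (wave L n) ^ (2 * m) * (\<Sum>b\<in>Basis. (cmod (fcoef L U n b))^2)))"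

definition sob_norm :: "real \<Rightarrow> nat \<Rightarrow> (real^2 \<Rightarrow> 'a::euclidean_space) \<Rightarrow> ennreal" where
  "sob_norm L m U = esqrt (sob_sq L m U)"

text \<open>The \<open>H\<^sup>1\<close> norm is the periodic one: it is infinite on fields that jump across the boundary.\<close>

definition H1_norm :: "real \<Rightarrow> (real^2 \<Rightarrow> 'a::euclidean_space) \<Rightarrow> ennreal" where
  "H1_norm L U = esqrt (L2_sq L U + sob_sq L 1 U)"


section \<open>Function spaces\<close>

definition pderiv_dir :: "2 \<Rightarrow> (real^2 \<Rightarrow> 'a::euclidean_space) \<Rightarrow> real^2 \<Rightarrow> 'a" where
  "pderiv_dir i U x = frechet_derivative U (at x) (axis i 1)"

text \<open>Taking the real part of complex trigonometric sums yields all real trigonometric polynomials.\<close>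

definition trig_poly :: "real \<Rightarrow> (real^2 \<Rightarrow> 'a::euclidean_space) \<Rightarrow> bool" where
  "trig_poly L U \<longleftrightarrow> (\<exists>F c. finite F \<and>
     U = (\<lambda>x. \<Sum>b\<in>Basis. Re (\<Sum>n\<in>F. c n b * cis (wave L n \<bullet> x)) *\<^sub>R b))"

definition trig_V :: "real \<Rightarrow> vfield set" where
  "trig_V L = {U. trig_poly L U \<and> (\<forall>x. (\<Sum>i\<in>UNIV. pderiv_dir i U x $ i) = 0) \<and>
     (\<integral> x. U x \<partial>torus L) = 0}"

definition space_H :: "real \<Rightarrow> vfield set" where
  "space_H L = {U \<in> L2_space L. \<forall>\<epsilon>>0. \<exists>p\<in>trig_V L. L2_norm L (\<lambda>x. p x - U x) < ennreal \<epsilon>}"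

definition space_V :: "real \<Rightarrow> vfield set" where
  "space_V L = {U \<in> L2_space L. \<forall>\<epsilon>>0. \<exists>p\<in>trig_V L. H1_norm L (\<lambda>x. p x - U x) < ennreal \<epsilon>}"

definition domain_A :: "real \<Rightarrow> vfield set" where
  "domain_A L = {U \<in> space_V L. sob_sq L 2 U < \<infinity>}"

definition leray :: "real \<Rightarrow> vfield \<Rightarrow> vfield" where
  "leray L g = (SOME h. h \<in> space_H L \<and> (\<forall>\<phi>\<in>space_H L. L2_inner L (\<lambda>x. g x - h x) \<phi> = 0))"


section \<open>The operators \<open>A\<close> and \<open>B\<close> and the Navier--Stokes equations\<close>

definition stokes0 :: "real \<Rightarrow> vfield \<Rightarrow> vfield" where
  "stokes0 L u = leray L (\<lambda>x. - (\<Sum>i\<in>UNIV. pderiv_dir i (pderiv_dir i u) x))"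

definition convect0 :: "real \<Rightarrow> vfield \<Rightarrow> vfield \<Rightarrow> vfield" where
  "convect0 L u v = leray L (\<lambda>x. \<Sum>i\<in>UNIV. (u x $ i) *\<^sub>R pderiv_dir i v x)"

text \<open>
  Elements of \<open>V\<^sup>*\<close> are represented by functionals on \<open>space_V L\<close>, and \<open>g \<in> H\<close> is identified with
  \<open>L2_inner L g\<close>. The continuous extension from \<open>trig_V L\<close> to \<open>space_V L\<close> is the limit along
  \<open>trig_V L\<close> in the \<open>H\<^sup>1\<close> norm.
\<close>

definition V_nhds :: "real \<Rightarrow> vfield \<Rightarrow> vfield filter" where
  "V_nhds L u = (INF \<epsilon>\<in>{0<..}. principal {p \<in> trig_V L. H1_norm L (\<lambda>x. p x - u x) < ennreal \<epsilon>})"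

definition stokes :: "real \<Rightarrow> vfield \<Rightarrow> vfield \<Rightarrow> real" where
  "stokes L u \<phi> = Lim (V_nhds L u) (\<lambda>p. L2_inner L (stokes0 L p) \<phi>)"

definition convect :: "real \<Rightarrow> vfield \<Rightarrow> vfield \<Rightarrow> vfield \<Rightarrow> real" where
  "convect L u v \<phi> =
     Lim (V_nhds L u \<times>\<^sub>F V_nhds L v) (\<lambda>(p, q). L2_inner L (convect0 L p q) \<phi>)"

text \<open>
  Membership in \<open>L\<^sup>\<infinity>([t\<^sub>0,\<infinity>); H)\<close>. Since \<open>H\<close> is separable, weak measurability is strong measurability.
\<close>

definition forcing :: "real \<Rightarrow> real \<Rightarrow> (real \<Rightarrow> vfield) \<Rightarrow> bool" where
  "forcing L t0 f \<longleftrightarrow>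
     (\<forall>t\<ge>t0. f t \<in> space_H L) \<and>
     (\<forall>\<phi>\<in>space_H L. (\<lambda>t. L2_inner L (f t) \<phi>) \<in> borel_measurable (lebesgue_on {t0..})) \<and>
     (\<exists>M. AE t in lebesgue_on {t0..}. L2_norm L (f t) \<le> ennreal M)"

text \<open>
  Solutions on \<open>[s,\<infinity>)\<close>, in \<open>C([s,\<infinity>); H) \<inter> L\<^sup>2\<^sub>l\<^sub>o\<^sub>c([s,\<infinity>); V)\<close>. The equation
  \<open>du/dt + \<nu> A u + B(u,u) = f\<close> holds in \<open>V\<^sup>*\<close>, the time derivative being the weak one:
  \<open>u(t) - u(s)\<close> is the integral over \<open>[s,t]\<close> of \<open>f - \<nu> A u - B(u,u)\<close>, tested against each
  element of \<open>V\<close>.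
\<close>

definition NSE_solution :: "real \<Rightarrow> real \<Rightarrow> (real \<Rightarrow> vfield) \<Rightarrow> real \<Rightarrow> (real \<Rightarrow> vfield) \<Rightarrow> bool" where
  "NSE_solution L \<nu> f s u \<longleftrightarrow>
     (\<forall>t\<ge>s. u t \<in> space_H L) \<and>
     (\<forall>t\<ge>s. ((\<lambda>r. L2_norm L (\<lambda>x. u r x - u t x)) \<longlongrightarrow> 0) (at t within {s..})) \<and>
     (AE t in lebesgue_on {s..}. u t \<in> space_V L) \<and>
     (\<forall>t\<ge>s. (\<integral>\<^sup>+ r\<in>{s..t}. sob_sq L 1 (u r) \<partial>lborel) < \<infinity>) \<and>
     (\<forall>\<phi>\<in>space_V L. \<forall>t\<ge>s.
        has_bochner_integral (lebesgue_on {s..t})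
          (\<lambda>r. L2_inner L (f r) \<phi> - \<nu> * stokes L (u r) \<phi> - convect L (u r) (u r) \<phi>)
          (L2_inner L (u t) \<phi> - L2_inner L (u s) \<phi>))"

text \<open>\<open>S t s v\<close> is the value at time \<open>t\<close> of the solution that starts from \<open>v\<close> at time \<open>s\<close>.\<close>

definition semi_process ::
  "real \<Rightarrow> real \<Rightarrow> (real \<Rightarrow> vfield) \<Rightarrow> real \<Rightarrow> (real \<Rightarrow> real \<Rightarrow> vfield \<Rightarrow> vfield) \<Rightarrow> bool" where
  "semi_process L \<nu> f t0 S \<longleftrightarrow> (\<forall>s\<ge>t0. \<forall>v\<in>space_H L.
     NSE_solution L \<nu> f s (\<lambda>t. S t s v) \<and> (AE x in torus L. S s s v x = v x))"


section \<open>Working assumptions\<close>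

definition reference_bounds ::
  "real \<Rightarrow> real \<Rightarrow> real \<Rightarrow> real \<Rightarrow> real \<Rightarrow> real \<Rightarrow> (real \<Rightarrow> vfield) \<Rightarrow> bool" where
  "reference_bounds L \<nu> t0 \<rho>H \<rho>V \<rho>A U \<longleftrightarrow>
     (\<forall>t\<ge>t0. sob_norm L 0 (U t) \<le> ennreal \<rho>H \<and> sob_norm L 1 (U t) \<le> ennreal \<rho>V \<and>
        sob_norm L 2 (U t) \<le> ennreal \<rho>A \<and>
        (\<forall>\<delta>>0. (\<integral>\<^sup>+ r\<in>{t..t+\<delta>}. sob_sq L 2 (U r) \<partial>lborel)
                  \<le> ennreal ((1 / \<nu> + \<delta> * (2 * pi / L)^2 / 2) * \<rho>V^2) \<and>
                (\<integral>\<^sup>+ r\<in>{t..t+\<delta>}. sob_sq L 3 (U r) \<partial>lborel) < \<infinity>))"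

definition solutions_regular :: "real \<Rightarrow> real \<Rightarrow> (real \<Rightarrow> vfield) \<Rightarrow> real \<Rightarrow> bool" where
  "solutions_regular L \<nu> f t0 \<longleftrightarrow>
     (\<forall>s\<ge>t0. \<forall>v. NSE_solution L \<nu> f s v \<longrightarrow>
        (\<forall>t>s. sob_norm L 0 (v t) < \<infinity> \<and> sob_norm L 1 (v t) < \<infinity> \<and> sob_norm L 2 (v t) < \<infinity> \<and>
           (\<forall>\<delta>>0. (\<integral>\<^sup>+ r\<in>{t..t+\<delta>}. sob_sq L 2 (v r) \<partial>lborel) < \<infinity> \<and>
                   (\<integral>\<^sup>+ r\<in>{t..t+\<delta>}. sob_sq L 3 (v r) \<partial>lborel) < \<infinity>)))"


section \<open>Downscaling data assimilation\<close>

definition type_II_observable :: "real \<Rightarrow> real \<Rightarrow> real \<Rightarrow> (vfield \<Rightarrow> vfield) \<Rightarrow> bool" where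
  "type_II_observable L c1 h I \<longleftrightarrow>
     c1 > 0 \<and> h > 0 \<and>
     (\<forall>U\<in>domain_A L. I U \<in> L2_space L) \<and>
     (\<forall>U\<in>domain_A L. \<forall>V\<in>domain_A L. \<forall>a b.
        AE x in torus L. I (\<lambda>y. a *\<^sub>R U y + b *\<^sub>R V y) x = a *\<^sub>R I U x + b *\<^sub>R I V x) \<and>
     (\<forall>U\<in>domain_A L. L2_sq L (\<lambda>x. U x - I U x)
        \<le> ennreal (c1 * h^2) * (sob_sq L 1 U + ennreal (h^2) * sob_sq L 2 U))"

text \<open>The Fourier sum is real for real \<open>U\<close>; \<open>Re\<close> only adjusts the type.\<close>

definition spectral_proj :: "real \<Rightarrow> real \<Rightarrow> vfield \<Rightarrow> vfield" where
  "spectral_proj L lam U x =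
     (\<Sum>b\<in>Basis. Re (\<Sum>n\<in>{n\<in>modes. (norm (wave L n))^2 \<le> lam}. fcoef L U n b * cis (wave L n \<bullet> x)) *\<^sub>R b)"

definition filter_J :: "real \<Rightarrow> real \<Rightarrow> (vfield \<Rightarrow> vfield) \<Rightarrow> vfield \<Rightarrow> vfield" where
  "filter_J L lam I U = spectral_proj L lam (leray L (I U))"

definition filter_E :: "real \<Rightarrow> real \<Rightarrow> (vfield \<Rightarrow> vfield) \<Rightarrow> vfield \<Rightarrow> vfield" where
  "filter_E L lam I U = (\<lambda>x. U x - filter_J L lam I U x)"

primrec downscaling_state ::
  "real \<Rightarrow> (real \<Rightarrow> real \<Rightarrow> vfield \<Rightarrow> vfield) \<Rightarrow> real \<Rightarrow> real \<Rightarrow> real \<Rightarrow> (vfield \<Rightarrow> vfield) \<Rightarrow>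
   (real \<Rightarrow> vfield) \<Rightarrow> nat \<Rightarrow> vfield" where
  "downscaling_state L S t0 \<delta> lam I U 0 = filter_J L lam I (U t0)"
| "downscaling_state L S t0 \<delta> lam I U (Suc n) =
     (\<lambda>x. filter_E L lam I
            (S (t0 + real (Suc n) * \<delta>) (t0 + real n * \<delta>) (downscaling_state L S t0 \<delta> lam I U n)) x
          + filter_J L lam I (U (t0 + real (Suc n) * \<delta>)) x)"

definition downscaling ::
  "real \<Rightarrow> (real \<Rightarrow> real \<Rightarrow> vfield \<Rightarrow> vfield) \<Rightarrow> real \<Rightarrow> real \<Rightarrow> real \<Rightarrow> (vfield \<Rightarrow> vfield) \<Rightarrow>
   (real \<Rightarrow> vfield) \<Rightarrow> real \<Rightarrow> vfield" where
  "downscaling L S t0 \<delta> lam I U t =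
     (let n = nat \<lfloor>(t - t0) / \<delta>\<rfloor> in S t (t0 + real n * \<delta>) (downscaling_state L S t0 \<delta> lam I U n))"

text \<open>
  \<open>\<omega> = \<partial>\<^sub>1 \<Phi>\<^sub>2 - \<partial>\<^sub>2 \<Phi>\<^sub>1\<close> in the sense of periodic distributions, for which trigonometric polynomials
  suffice as test functions.
\<close>

definition is_curl :: "real \<Rightarrow> vfield \<Rightarrow> (real^2 \<Rightarrow> real) \<Rightarrow> bool" where
  "is_curl L \<Phi> \<omega> \<longleftrightarrow> \<omega> \<in> L2_space L \<and>
     (\<forall>\<phi>. trig_poly L \<phi> \<longrightarrow>
        L2_inner L \<omega> \<phi> = (\<integral> x. \<Phi> x $ 1 * pderiv_dir 2 \<phi> x - \<Phi> x $ 2 * pderiv_dir 1 \<phi> x \<partial>torus L))"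

end

theory Submission
  imports Defs
begin

text \<open>
  Let \<open>v = U - u\<close>, and let \<open>V\<^sub>n\<close> be the value of \<open>v\<close> just before the assimilation time \<open>t\<^sub>n\<close>. The assimilation
  replaces it by \<open>V\<^sub>n - J V\<^sub>n = (1 - P\<^sub>\<lambda>) V\<^sub>n + P\<^sub>\<lambda> P\<^sub>\<sigma> (V\<^sub>n - I\<^sub>h V\<^sub>n)\<close>. In the norm of \<open>H\<close> this is at most
  \<open>q\<^sup>1\<^sup>/\<^sup>2 |A V\<^sub>n|\<close>, where \<open>q\<close> is as small as we like if first \<open>\<lambda>\<close> is chosen large and then \<open>h\<close> small. Between
  assimilation times \<open>v\<close> solves
  \<open>dv/dt + \<nu> A v + B(U, v) + B(v, U) - B(v, v) = 0\<close>. As long as \<open>|v|\<close> is small, the critical product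
  estimates in two dimensions absorb \<open>B(v, v)\<close> into the dissipation, also in the balance for \<open>|A v|\<close>. So
  parabolic smoothing gives \<open>|A V\<^sub>n\<^sub>+\<^sub>1| \<le> C |v(t\<^sub>n)|\<close> with \<open>C\<close> depending on \<open>\<delta>\<close>, and hence
  \<open>|A V\<^sub>n\<^sub>+\<^sub>1|\<^sup>2 \<le> |A V\<^sub>n|\<^sup>2 / 2\<close> for small \<open>q\<close>. A variant of this estimate bounds \<open>|A v|\<close> on \<open>[t\<^sub>n, t\<^sub>n\<^sub>+\<^sub>1]\<close> by its value at
  \<open>t\<^sub>n\<close>, and \<open>\<parallel>W - w\<parallel> = |A v|\<close>.

  Testing the equation in \<open>V\<^sup>*\<close> with single modes turns it into a system of ordinary differential
  equations for the Fourier coefficients of \<open>v\<close>, for which the balances are derived on finite sets of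
  modes.
\<close>

section \<open>Sums over the lattice\<close>

text \<open>Two mismatches shape the proof. The observable controls \<open>V - I V\<close> only in
  the norm of H, and passing to the second-order norm through the low-pass filter costs a power of
  \<lambda>. So a correction is only known not to enlarge the second-order norm by more than a fixed
  factor, and all contraction has to come from the gain of derivatives over one interval of length
  \<delta>. Secondly, no size of the approximating solution \<open>u\<close> is known in advance,
  only finiteness of its norms after the initial time. Hence all estimates are for the error, with
  constants that depend on bounds for the reference solution and not on \<open>u\<close>; in the
  energy balance the transport of the error by \<open>u\<close> has to disappear by skew symmetry
  rather than be estimated. Finally, at the assimilation times only continuity in H is available, so
  a differential inequality for the second-order norm cannot be started there. Both estimates of
  that norm use a time weight that vanishes at a later starting point.\<close>

lemma infsum_mono_real:
  fixes f g :: "'a \<Rightarrow> real"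
  assumes "g summable_on A" and "\<And>x. x \<in> A \<Longrightarrow> f x \<le> g x" and "\<And>x. x \<in> A \<Longrightarrow> 0 \<le> f x"
  shows "f summable_on A" "infsum f A \<le> infsum g A"
proof -
  show "f summable_on A" using assms by (rule summable_on_comparison_test)
  then show "infsum f A \<le> infsum g A" using assms by (intro infsum_mono) auto
qed

lemma summable_on_bounded_sums:
  fixes f :: "'a \<Rightarrow> real"
  assumes "\<And>x. x \<in> A \<Longrightarrow> 0 \<le> f x" and "\<And>F. finite F \<Longrightarrow> F \<subseteq> A \<Longrightarrow> sum f F \<le> B"
  shows "f summable_on A" "infsum f A \<le> B"
proof -
  show "f summable_on A"
    by (rule nonneg_bdd_above_summable_on) (use assms in \<open>auto intro!: bdd_aboveI2[where M=B]\<close>)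
  then show "infsum f A \<le> B" using assms(2) by (intro infsum_le_finite_sums) auto
qed

lemma infsum_Cauchy_Schwarz:
  fixes f g :: "'a \<Rightarrow> real"
  assumes f: "(\<lambda>x. (f x)\<^sup>2) summable_on A" and g: "(\<lambda>x. (g x)\<^sup>2) summable_on A"
    and nn: "\<And>x. x \<in> A \<Longrightarrow> 0 \<le> f x" "\<And>x. x \<in> A \<Longrightarrow> 0 \<le> g x"
  shows "(\<lambda>x. f x * g x) summable_on A"
    and "(infsum (\<lambda>x. f x * g x) A)\<^sup>2 \<le> infsum (\<lambda>x. (f x)\<^sup>2) A * infsum (\<lambda>x. (g x)\<^sup>2) A"
proof -
  let ?P = "infsum (\<lambda>x. (f x)\<^sup>2) A * infsum (\<lambda>x. (g x)\<^sup>2) A"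
  have P: "0 \<le> ?P" by (intro mult_nonneg_nonneg infsum_nonneg) auto
  have fin: "(\<Sum>x\<in>F. f x * g x) \<le> sqrt ?P" if "finite F" "F \<subseteq> A" for F
  proof -
    have "(\<Sum>x\<in>F. f x * g x)\<^sup>2 \<le> (\<Sum>x\<in>F. (f x)\<^sup>2) * (\<Sum>x\<in>F. (g x)\<^sup>2)"
      by (rule Cauchy_Schwarz_ineq_sum)
    also have "\<dots> \<le> ?P"
      using that by (intro mult_mono finite_sum_le_infsum f g infsum_nonneg sum_nonneg) auto
    finally show ?thesis by (rule real_le_rsqrt)
  qed
  show s: "(\<lambda>x. f x * g x) summable_on A"
    by (rule summable_on_bounded_sums(1)[where B="sqrt ?P"]) (use nn fin in auto)
  have "infsum (\<lambda>x. f x * g x) A \<le> sqrt ?P"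
    by (rule summable_on_bounded_sums(2)) (use nn fin in auto)
  then have "(infsum (\<lambda>x. f x * g x) A)\<^sup>2 \<le> (sqrt ?P)\<^sup>2"
    using nn by (intro power_mono infsum_nonneg) auto
  then show "(infsum (\<lambda>x. f x * g x) A)\<^sup>2 \<le> ?P" using P by simp
qed

lemma summable_on_power2_sum:
  fixes f g :: "'a \<Rightarrow> real"
  assumes "(\<lambda>x. (f x)\<^sup>2) summable_on A" "(\<lambda>x. (g x)\<^sup>2) summable_on A"
  shows "(\<lambda>x. (f x + g x)\<^sup>2) summable_on A"
    and "infsum (\<lambda>x. (f x + g x)\<^sup>2) A \<le> 2 * infsum (\<lambda>x. (f x)\<^sup>2) A + 2 * infsum (\<lambda>x. (g x)\<^sup>2) A"
proof -
  have s: "(\<lambda>x. 2 * (f x)\<^sup>2 + 2 * (g x)\<^sup>2) summable_on A"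
    by (intro summable_on_add summable_on_cmult_right assms)
  have le: "(f x + g x)\<^sup>2 \<le> 2 * (f x)\<^sup>2 + 2 * (g x)\<^sup>2" for x
    using sum_squares_bound[of "f x" "g x"] by (simp add: power2_sum)
  show "(\<lambda>x. (f x + g x)\<^sup>2) summable_on A"
    by (rule infsum_mono_real(1)[OF s le]) auto
  have "infsum (\<lambda>x. (f x + g x)\<^sup>2) A \<le> infsum (\<lambda>x. 2 * (f x)\<^sup>2 + 2 * (g x)\<^sup>2) A"
    by (rule infsum_mono_real(2)[OF s le]) auto
  also have "\<dots> = 2 * infsum (\<lambda>x. (f x)\<^sup>2) A + 2 * infsum (\<lambda>x. (g x)\<^sup>2) A"
    by (subst infsum_add) (auto intro!: summable_on_cmult_right assms simp: infsum_cmult_right')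
  finally show "infsum (\<lambda>x. (f x + g x)\<^sup>2) A \<le> 2 * infsum (\<lambda>x. (f x)\<^sup>2) A + 2 * infsum (\<lambda>x. (g x)\<^sup>2) A" .
qed

lemma has_sum_shift_reflect:
  fixes f :: "'a::ab_group_add \<Rightarrow> 'b::{comm_monoid_add,topological_space}"
  shows "((\<lambda>l. f (k - l)) has_sum S) UNIV \<longleftrightarrow> (f has_sum S) UNIV"
  by (rule has_sum_reindex_bij_witness[of _ "\<lambda>l. k - l" "\<lambda>l. k - l"]) auto

lemma has_sum_shift:
  fixes f :: "'a::ab_group_add \<Rightarrow> 'b::{comm_monoid_add,topological_space}"
  shows "((\<lambda>k. f (k - l)) has_sum S) UNIV \<longleftrightarrow> (f has_sum S) UNIV"
  by (rule has_sum_reindex_bij_witness[of _ "\<lambda>k. k + l" "\<lambda>k. k - l"]) auto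

text \<open>Young's inequality for l^1 against l^2. With \<alpha> written as the square of its root,
  Cauchy-Schwarz bounds the square of each row by the mass of \<alpha> times a convolution of
  \<alpha> with \<open>\<beta>^2\<close>; summing over \<open>k\<close> first gives that mass once
  more.\<close>

lemma Young_convolution:
  fixes \<alpha> \<beta> :: "'a::ab_group_add \<Rightarrow> real"
  assumes a: "\<alpha> summable_on UNIV" and b: "(\<lambda>l. (\<beta> l)\<^sup>2) summable_on UNIV"
    and nn: "\<And>l. 0 \<le> \<alpha> l" "\<And>l. 0 \<le> \<beta> l"
  shows "(\<lambda>l. \<alpha> (k - l) * \<beta> l) summable_on UNIV" (is "?f k summable_on _")
    and "(\<lambda>k. (\<Sum>\<^sub>\<infinity>l. \<alpha> (k - l) * \<beta> l)\<^sup>2) summable_on UNIV"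
    and "(\<Sum>\<^sub>\<infinity>k. (\<Sum>\<^sub>\<infinity>l. \<alpha> (k - l) * \<beta> l)\<^sup>2) \<le> (infsum \<alpha> UNIV)\<^sup>2 * (\<Sum>\<^sub>\<infinity>l. (\<beta> l)\<^sup>2)"
proof -
  have sa: "((\<lambda>l. \<alpha> (k - l)) has_sum infsum \<alpha> UNIV) UNIV" for k
    using a by (simp add: has_sum_shift_reflect)
  have sb: "((\<lambda>k. \<alpha> (k - l)) has_sum infsum \<alpha> UNIV) UNIV" for l
    using a by (simp add: has_sum_shift)
  have dbl: "((\<lambda>(l, k). \<alpha> (k - l) * (\<beta> l)\<^sup>2) has_sum (infsum \<alpha> UNIV * (\<Sum>\<^sub>\<infinity>l. (\<beta> l)\<^sup>2))) (UNIV \<times> UNIV)"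
  proof (rule has_sum_SigmaI[where g="\<lambda>l. infsum \<alpha> UNIV * (\<beta> l)\<^sup>2"])
    show r: "((\<lambda>k. case (l, k) of (l, k) \<Rightarrow> \<alpha> (k - l) * (\<beta> l)\<^sup>2) has_sum infsum \<alpha> UNIV * (\<beta> l)\<^sup>2) UNIV" for l
      using has_sum_cmult_left[OF sb[of l], of "(\<beta> l)\<^sup>2"] by simp
    show c: "((\<lambda>l. infsum \<alpha> UNIV * (\<beta> l)\<^sup>2) has_sum infsum \<alpha> UNIV * (\<Sum>\<^sub>\<infinity>l. (\<beta> l)\<^sup>2)) UNIV"
      by (rule has_sum_cmult_right[OF has_sum_infsum[OF b]])
    show "(\<lambda>(l, k). \<alpha> (k - l) * (\<beta> l)\<^sup>2) summable_on UNIV \<times> UNIV"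
      by (rule summable_on_SigmaI[OF r has_sum_imp_summable[OF c]]) (use nn in auto)
  qed
  then have dbl': "((\<lambda>(k, l). \<alpha> (k - l) * (\<beta> l)\<^sup>2) has_sum (infsum \<alpha> UNIV * (\<Sum>\<^sub>\<infinity>l. (\<beta> l)\<^sup>2))) (UNIV \<times> UNIV)"
    by (subst has_sum_swap) simp
  have row: "(\<lambda>l. \<alpha> (k - l) * (\<beta> l)\<^sup>2) summable_on UNIV" for k
    using summable_on_SigmaD1[OF has_sum_imp_summable[OF dbl'], of k] by simp
  have rows: "((\<lambda>k. \<Sum>\<^sub>\<infinity>l. \<alpha> (k - l) * (\<beta> l)\<^sup>2) has_sum (infsum \<alpha> UNIV * (\<Sum>\<^sub>\<infinity>l. (\<beta> l)\<^sup>2))) UNIV"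
    by (rule has_sum_SigmaD[OF dbl']) (use row in auto)
  have q1: "(\<lambda>l. (sqrt (\<alpha> (k - l)))\<^sup>2) summable_on UNIV" for k
    using has_sum_imp_summable[OF sa[of k]] nn by simp
  have q2: "(\<lambda>l. (sqrt (\<alpha> (k - l)) * \<beta> l)\<^sup>2) summable_on UNIV" for k
    using row[of k] nn by (simp add: power_mult_distrib)
  note CS = infsum_Cauchy_Schwarz[OF q1 q2]
  have eq: "sqrt (\<alpha> (k - l)) * (sqrt (\<alpha> (k - l)) * \<beta> l) = \<alpha> (k - l) * \<beta> l" for k l
    using nn(1)[of "k - l"] by (metis mult.assoc real_sqrt_mult_self abs_of_nonneg)
  show "?f k summable_on UNIV" for k
    using CS(1)[of k k] nn by (simp add: eq)
  have le: "(\<Sum>\<^sub>\<infinity>l. \<alpha> (k - l) * \<beta> l)\<^sup>2 \<le> infsum \<alpha> UNIV * (\<Sum>\<^sub>\<infinity>l. \<alpha> (k - l) * (\<beta> l)\<^sup>2)" for k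
    using CS(2)[of k k] nn infsumI[OF sa[of k]] by (simp add: eq power_mult_distrib)
  have s: "((\<lambda>k. infsum \<alpha> UNIV * (\<Sum>\<^sub>\<infinity>l. \<alpha> (k - l) * (\<beta> l)\<^sup>2)) has_sum
      infsum \<alpha> UNIV * (infsum \<alpha> UNIV * (\<Sum>\<^sub>\<infinity>l. (\<beta> l)\<^sup>2))) UNIV"
    by (rule has_sum_cmult_right[OF rows])
  show "(\<lambda>k. (\<Sum>\<^sub>\<infinity>l. \<alpha> (k - l) * \<beta> l)\<^sup>2) summable_on UNIV"
    by (rule infsum_mono_real(1)[OF has_sum_imp_summable[OF s] le]) auto
  have "(\<Sum>\<^sub>\<infinity>k. (\<Sum>\<^sub>\<infinity>l. \<alpha> (k - l) * \<beta> l)\<^sup>2) \<le> infsum \<alpha> UNIV * (infsum \<alpha> UNIV * (\<Sum>\<^sub>\<infinity>l. (\<beta> l)\<^sup>2))"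
    using infsum_mono_real(2)[OF has_sum_imp_summable[OF s] le] infsumI[OF s] by simp
  then show "(\<Sum>\<^sub>\<infinity>k. (\<Sum>\<^sub>\<infinity>l. \<alpha> (k - l) * \<beta> l)\<^sup>2) \<le> (infsum \<alpha> UNIV)\<^sup>2 * (\<Sum>\<^sub>\<infinity>l. (\<beta> l)\<^sup>2)"
    by (simp add: power2_eq_square mult.assoc)
qed

text \<open>Only the order \<open>1 / R\<close> matters. From
  \<open>2 (R^2 + n^2) \<ge> (R + n)^2\<close> each term is at most the difference of
  \<open>2 / (R + n)\<close> at consecutive integers, so each half-line telescopes to at most
  \<open>2 / R\<close>; the term \<open>n = 0\<close> adds at most \<open>1 / R\<close>.\<close>

lemma sum_inverse_square_shift:
  fixes R :: real assumes R: "R \<ge> 1"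
  shows "(\<lambda>n::int. 1 / (R\<^sup>2 + (of_int n)\<^sup>2)) summable_on UNIV"
    and "(\<Sum>\<^sub>\<infinity>n::int. 1 / (R\<^sup>2 + (of_int n)\<^sup>2)) \<le> 5 / R"
proof -
  have tel: "(\<Sum>n\<in>{1..N}. 1 / (R\<^sup>2 + (of_int (int n))\<^sup>2)) \<le> 2 / R" for N :: nat
  proof -
    have "(\<Sum>n\<in>{1..N}. 1 / (R\<^sup>2 + (of_int (int n))\<^sup>2)) \<le> 2 / R - 2 / (R + real N)"
    proof (induction N)
      case (Suc N)
      have "2 * (R\<^sup>2 + (real (Suc N))\<^sup>2) \<ge> (R + real (Suc N))\<^sup>2"
        using sum_squares_bound[of R "real (Suc N)"] by (simp add: power2_sum)
      also have "(R + real (Suc N))\<^sup>2 \<ge> (R + real N) * (R + real (Suc N))"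
        using R by (simp add: power2_eq_square mult_right_mono)
      finally have *: "(R + real N) * (R + real (Suc N)) \<le> 2 * (R\<^sup>2 + (real (Suc N))\<^sup>2)" by simp
      have frac: "1 / x \<le> 2 / P" if "P \<le> 2 * x" "P > 0" for x P :: real
        using that by (simp add: field_simps)
      have "1 / (R\<^sup>2 + (real (Suc N))\<^sup>2) \<le> 2 / ((R + real N) * (R + real (Suc N)))"
        by (rule frac[OF *]) (use R in \<open>auto intro!: mult_pos_pos add_pos_nonneg\<close>)
      also have "\<dots> = 2 / (R + real N) - 2 / (R + real (Suc N))"
        using R by (simp add: field_simps)
      finally show ?case using Suc by simp
    qed auto
    also have "\<dots> \<le> 2 / R" using R by simp
    finally show ?thesis .
  qed
  have fin: "(\<Sum>n\<in>F. 1 / (R\<^sup>2 + (of_int n)\<^sup>2)) \<le> 5 / R" if F: "finite F" for F :: "int set"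
  proof -
    define N where "N = nat (Max (insert 0 (abs ` F)))"
    have "F \<subseteq> {- int N..int N}"
    proof
      fix x assume "x \<in> F"
      then have "\<bar>x\<bar> \<le> Max (insert 0 (abs ` F))" using F by (intro Max_ge) auto
      then show "x \<in> {- int N..int N}" unfolding N_def by auto
    qed
    also have "{- int N..int N} \<subseteq> insert 0 (int ` {1..N} \<union> (\<lambda>n. - int n) ` {1..N})"
    proof
      fix x assume x: "x \<in> {- int N..int N}"
      show "x \<in> insert 0 (int ` {1..N} \<union> (\<lambda>n. - int n) ` {1..N})"
      proof (cases x "0::int" rule: linorder_cases)
        case less
        then have "x = - int (nat (- x))" "nat (- x) \<in> {1..N}" using x by auto
        then show ?thesis by blast
      next
        case greater
        then have "x = int (nat x)" "nat x \<in> {1..N}" using x by auto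
        then show ?thesis by blast
      qed auto
    qed
    finally have sub: "F \<subseteq> insert 0 (int ` {1..N} \<union> (\<lambda>n. - int n) ` {1..N})" .
    have "(\<Sum>n\<in>F. 1 / (R\<^sup>2 + (of_int n)\<^sup>2)) \<le>
        (\<Sum>n\<in>insert 0 (int ` {1..N} \<union> (\<lambda>n. - int n) ` {1..N}). 1 / (R\<^sup>2 + (of_int n)\<^sup>2))"
      using sub by (intro sum_mono2) auto
    also have "\<dots> = 1 / R\<^sup>2 + ((\<Sum>n\<in>int ` {1..N}. 1 / (R\<^sup>2 + (of_int n)\<^sup>2)) + (\<Sum>n\<in>(\<lambda>n. - int n) ` {1..N}. 1 / (R\<^sup>2 + (of_int n)\<^sup>2)))"
      by (subst sum.insert) (auto intro!: sum.union_disjoint)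
    also have "\<dots> = 1 / R\<^sup>2 + ((\<Sum>n\<in>{1..N}. 1 / (R\<^sup>2 + (of_int (int n))\<^sup>2)) + (\<Sum>n\<in>{1..N}. 1 / (R\<^sup>2 + (of_int (int n))\<^sup>2)))"
      by (subst (1 2) sum.reindex) (auto simp: inj_on_def)
    also have "\<dots> \<le> 1 / R + (2 / R + 2 / R)"
      using tel[of N] R by (intro add_mono) (auto simp: power2_eq_square field_simps)
    finally show ?thesis by simp
  qed
  show "(\<lambda>n::int. 1 / (R\<^sup>2 + (of_int n)\<^sup>2)) summable_on UNIV"
    by (rule summable_on_bounded_sums(1)[where B="5/R"]) (use fin in auto)
  show "(\<Sum>\<^sub>\<infinity>n::int. 1 / (R\<^sup>2 + (of_int n)\<^sup>2)) \<le> 5 / R"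
    by (rule summable_on_bounded_sums(2)) (use fin in auto)
qed

text \<open>The squared denominator dominates the product \<open>(R^2 + m^2) (R^2 + n^2)\<close>, so
  the double sum is bounded by a product of two one-dimensional ones. The decay in \<open>R\<close>
  becomes the free parameter of the Wiener norm estimate.\<close>

lemma sum_lattice_inverse_square:
  fixes R :: real assumes R: "R \<ge> 1"
  shows "(\<lambda>(m::int, n::int). 1 / (R\<^sup>2 + (of_int m)\<^sup>2 + (of_int n)\<^sup>2)\<^sup>2) summable_on UNIV"
    and "(\<Sum>\<^sub>\<infinity>(m::int, n::int). 1 / (R\<^sup>2 + (of_int m)\<^sup>2 + (of_int n)\<^sup>2)\<^sup>2) \<le> 25 / R\<^sup>2"
proof -
  let ?g = "\<lambda>n::int. 1 / (R\<^sup>2 + (of_int n)\<^sup>2)"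
  let ?s = "infsum ?g UNIV"
  note s1 = sum_inverse_square_shift[OF R]
  have hs: "((\<lambda>(m, n). ?g m * ?g n) has_sum ?s * ?s) (UNIV \<times> UNIV)"
  proof (rule has_sum_SigmaI[where g="\<lambda>m. ?g m * ?s"])
    show r: "((\<lambda>n. case (m, n) of (m, n) \<Rightarrow> ?g m * ?g n) has_sum ?g m * ?s) UNIV" for m
      using has_sum_cmult_right[OF has_sum_infsum[OF s1(1)], of "?g m"] by simp
    show c: "((\<lambda>m. ?g m * ?s) has_sum ?s * ?s) UNIV"
      by (rule has_sum_cmult_left[OF has_sum_infsum[OF s1(1)]])
    show "(\<lambda>(m, n). ?g m * ?g n) summable_on UNIV \<times> UNIV"
      by (rule summable_on_SigmaI[OF r has_sum_imp_summable[OF c]]) auto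
  qed
  have le: "(case p of (m::int, n::int) \<Rightarrow> 1 / (R\<^sup>2 + (of_int m)\<^sup>2 + (of_int n)\<^sup>2)\<^sup>2) \<le> (case p of (m, n) \<Rightarrow> ?g m * ?g n)" for p
  proof (cases p)
    case (Pair m n)
    have "(R\<^sup>2 + (of_int m)\<^sup>2) * (R\<^sup>2 + (of_int n)\<^sup>2) \<le> (R\<^sup>2 + (of_int m)\<^sup>2 + (of_int n)\<^sup>2)\<^sup>2"
      unfolding power2_eq_square[of "_ + _ + _"] by (intro mult_mono) auto
    then have "1 / (R\<^sup>2 + (of_int m)\<^sup>2 + (of_int n)\<^sup>2)\<^sup>2 \<le> 1 / ((R\<^sup>2 + (of_int m)\<^sup>2) * (R\<^sup>2 + (of_int n)\<^sup>2))"
      using R by (intro divide_left_mono) (auto intro!: mult_pos_pos add_pos_nonneg zero_less_power)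
    then show ?thesis using Pair by simp
  qed
  have nn: "0 \<le> (case p of (m::int, n::int) \<Rightarrow> 1 / (R\<^sup>2 + (of_int m)\<^sup>2 + (of_int n)\<^sup>2)\<^sup>2)" for p
    by (auto split: prod.splits)
  have su: "(\<lambda>(m, n). ?g m * ?g n) summable_on UNIV" using has_sum_imp_summable[OF hs] by simp
  show "(\<lambda>(m::int, n::int). 1 / (R\<^sup>2 + (of_int m)\<^sup>2 + (of_int n)\<^sup>2)\<^sup>2) summable_on UNIV"
    by (rule infsum_mono_real(1)[OF su le nn])
  have "(\<Sum>\<^sub>\<infinity>(m::int, n::int). 1 / (R\<^sup>2 + (of_int m)\<^sup>2 + (of_int n)\<^sup>2)\<^sup>2) \<le> ?s * ?s"
    using infsum_mono_real(2)[OF su le nn] infsumI[OF hs] by simp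
  also have "\<dots> \<le> (5 / R) * (5 / R)"
    using s1(2) R by (intro mult_mono infsum_nonneg) auto
  finally show "(\<Sum>\<^sub>\<infinity>(m::int, n::int). 1 / (R\<^sup>2 + (of_int m)\<^sup>2 + (of_int n)\<^sup>2)\<^sup>2) \<le> 25 / R\<^sup>2"
    by (simp add: power2_eq_square)
qed

section \<open>Fourier coefficients and the advection term\<close>

definition kap :: "real \<Rightarrow> int \<times> int \<Rightarrow> real" where
  "kap L n = norm (wave L n)"

text \<open>The divergence-free direction of the mode \<open>n\<close>; it vanishes for \<open>n = 0\<close>.\<close>

definition ev :: "real \<Rightarrow> int \<times> int \<Rightarrow> real^2" where
  "ev L n = (1 / kap L n) *\<^sub>R vector [- (wave L n $ 2), wave L n $ 1]"

text \<open>Up to a power of \<open>L\<close>, \<open>hs L m c\<close> is the square of the norm of index \<open>m\<close> of the field with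
  coefficients \<open>c\<close>, and \<open>ls L m c\<close> is the corresponding Wiener norm.\<close>

definition hs_summable :: "real \<Rightarrow> nat \<Rightarrow> (int \<times> int \<Rightarrow> complex) \<Rightarrow> bool" where
  "hs_summable L m c \<longleftrightarrow> (\<lambda>n. (kap L n ^ m * cmod (c n))\<^sup>2) summable_on UNIV"

definition hs :: "real \<Rightarrow> nat \<Rightarrow> (int \<times> int \<Rightarrow> complex) \<Rightarrow> real" where
  "hs L m c = (\<Sum>\<^sub>\<infinity>n. (kap L n ^ m * cmod (c n))\<^sup>2)"

definition ls_summable :: "real \<Rightarrow> nat \<Rightarrow> (int \<times> int \<Rightarrow> complex) \<Rightarrow> bool" where
  "ls_summable L m c \<longleftrightarrow> (\<lambda>n. kap L n ^ m * cmod (c n)) summable_on UNIV"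

definition ls :: "real \<Rightarrow> nat \<Rightarrow> (int \<times> int \<Rightarrow> complex) \<Rightarrow> real" where
  "ls L m c = (\<Sum>\<^sub>\<infinity>n. kap L n ^ m * cmod (c n))"

text \<open>The symmetry of the coefficients of a real field: the direction \<open>ev L n\<close> is odd in \<open>n\<close>.\<close>

definition real_coefs :: "(int \<times> int \<Rightarrow> complex) \<Rightarrow> bool" where
  "real_coefs c \<longleftrightarrow> (\<forall>n. c (- n) = - cnj (c n))"

text \<open>Since \<open>ev L (k - l)\<close> is orthogonal to its own wave vector, the derivative
  factor may be read off from the output mode \<open>k\<close> or from the input mode
  \<open>l\<close>. Both readings are used.\<close>

definition advect_coef :: "real \<Rightarrow> int \<times> int \<Rightarrow> int \<times> int \<Rightarrow> real" where
  "advect_coef L k l = (ev L (k - l) \<bullet> wave L k) * (ev L l \<bullet> ev L k)"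

text \<open>The coefficient of \<open>B(u, v)\<close> at \<open>k\<close>, for \<open>u\<close> and \<open>v\<close> with coefficients \<open>a\<close> and \<open>b\<close>.\<close>

definition advect :: "real \<Rightarrow> (int \<times> int \<Rightarrow> complex) \<Rightarrow> (int \<times> int \<Rightarrow> complex) \<Rightarrow> int \<times> int \<Rightarrow> complex" where
  "advect L a b k = (\<Sum>\<^sub>\<infinity>l. \<i> * of_real (advect_coef L k l) * a (k - l) * b l)"

lemma zero_mode: "(0 :: int \<times> int) = (0, 0)"
  by (simp add: zero_prod_def)

lemma inner_real2: "(x :: real^2) \<bullet> y = x $ 1 * y $ 1 + x $ 2 * y $ 2"
  by (simp add: inner_vec_def sum_2)

lemma wave_components: "wave L n $ 1 = 2 * pi / L * of_int (fst n)" "wave L n $ 2 = 2 * pi / L * of_int (snd n)"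
  by (simp_all add: wave_def)

lemma wave_add: "wave L (m + n) = wave L m + wave L n"
  by (simp add: vec_eq_iff forall_2 wave_components algebra_simps add_divide_distrib diff_divide_distrib)

lemma wave_zero [simp]: "wave L 0 = 0"
  by (simp add: vec_eq_iff forall_2 wave_components zero_mode)

lemma wave_uminus: "wave L (- n) = - wave L n"
  by (simp add: vec_eq_iff forall_2 wave_components)

lemma wave_diff: "wave L (m - n) = wave L m - wave L n"
  by (simp add: vec_eq_iff forall_2 wave_components algebra_simps add_divide_distrib diff_divide_distrib)

lemma kap_nonneg [simp]: "0 \<le> kap L n"
  by (simp add: kap_def)

lemma kap_zero [simp]: "kap L 0 = 0"
  by (simp add: kap_def)

lemma kap_uminus [simp]: "kap L (- n) = kap L n"
  by (simp add: kap_def wave_uminus)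

lemma kap_triangle: "kap L k \<le> kap L (k - l) + kap L l"
  using norm_triangle_ineq[of "wave L (k - l)" "wave L l"] by (simp add: kap_def wave_diff)

lemma kap_square: "(kap L n)\<^sup>2 = (2 * pi / L)\<^sup>2 * ((of_int (fst n))\<^sup>2 + (of_int (snd n))\<^sup>2)"
proof -
  have "(kap L n)\<^sup>2 = wave L n \<bullet> wave L n" by (simp add: kap_def power2_norm_eq_inner)
  also have "\<dots> = (2 * pi / L)\<^sup>2 * ((of_int (fst n))\<^sup>2 + (of_int (snd n))\<^sup>2)"
    unfolding inner_real2 wave_components by (simp add: power2_eq_square algebra_simps)
  finally show ?thesis .
qed

lemma ev_uminus: "ev L (- n) = - ev L n"
  by (simp add: ev_def wave_uminus vec_eq_iff forall_2)

lemma ev_inner_wave [simp]: "ev L n \<bullet> wave L n = 0"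
  by (simp add: ev_def inner_real2)

lemma ev_zero [simp]: "ev L 0 = 0"
  by (simp add: ev_def)

lemma norm_vector_perp: "norm (vector [- (x $ 2), x $ 1] :: real^2) = norm (x :: real^2)"
  by (simp add: norm_eq_sqrt_inner inner_real2)

lemma norm_ev: "norm (ev L n) \<le> 1"
  by (simp add: ev_def norm_vector_perp kap_def[symmetric] divide_simps)

lemma advect_coef_bound_k: "\<bar>advect_coef L k l\<bar> \<le> kap L k"
proof -
  have "\<bar>ev L (k - l) \<bullet> wave L k\<bar> \<le> norm (ev L (k - l)) * norm (wave L k)"
    by (rule Cauchy_Schwarz_ineq2)
  also have "\<dots> \<le> 1 * kap L k" unfolding kap_def by (intro mult_right_mono norm_ev) auto
  finally have 1: "\<bar>ev L (k - l) \<bullet> wave L k\<bar> \<le> kap L k" by simp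
  have "\<bar>ev L l \<bullet> ev L k\<bar> \<le> norm (ev L l) * norm (ev L k)"
    by (rule Cauchy_Schwarz_ineq2)
  also have "\<dots> \<le> 1 * 1" by (intro mult_mono norm_ev) auto
  finally have 2: "\<bar>ev L l \<bullet> ev L k\<bar> \<le> 1" by simp
  show ?thesis unfolding advect_coef_def abs_mult using mult_mono[OF 1 2] by simp
qed

text \<open>Orthogonality of \<open>ev L (k - l)\<close> to \<open>wave L (k - l)\<close> exchanges
  the two wave vectors, and \<open>ev\<close> is odd. This is the Fourier form of the skew symmetry
  of advection by a divergence-free field.\<close>

lemma advect_coef_antisym: "advect_coef L l k = - advect_coef L k l"
proof -
  have "ev L (k - l) \<bullet> wave L k = ev L (k - l) \<bullet> wave L l"
    using ev_inner_wave[of L "k - l"] by (simp add: wave_diff inner_diff_right)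
  moreover have "ev L (l - k) = - ev L (k - l)" by (metis ev_uminus minus_diff_eq)
  ultimately show ?thesis by (simp add: advect_coef_def inner_commute)
qed

lemma advect_coef_bound_l: "\<bar>advect_coef L k l\<bar> \<le> kap L l"
  using advect_coef_bound_k[of L l k] by (simp add: advect_coef_antisym[of L l k])

lemma hs_nonneg [simp]: "0 \<le> hs L m c"
  unfolding hs_def by (intro infsum_nonneg) auto

lemma ls_nonneg [simp]: "0 \<le> ls L m c"
  unfolding ls_def by (intro infsum_nonneg) auto

lemma hs_term_le: "hs_summable L m c \<Longrightarrow> (kap L n ^ m * cmod (c n))\<^sup>2 \<le> hs L m c"
  unfolding hs_summable_def hs_def
  using finite_sum_le_infsum[of "\<lambda>n. (kap L n ^ m * cmod (c n))\<^sup>2" UNIV "{n}"] by auto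

lemma hs_mono:
  assumes "hs_summable L m c" "\<And>n. cmod (b n) \<le> cmod (c n)"
  shows "hs_summable L m b" "hs L m b \<le> hs L m c"
proof -
  have le: "(kap L n ^ m * cmod (b n))\<^sup>2 \<le> (kap L n ^ m * cmod (c n))\<^sup>2" for n
    by (intro power_mono mult_left_mono assms) auto
  show "hs_summable L m b" "hs L m b \<le> hs L m c"
    using infsum_mono_real[OF assms(1)[unfolded hs_summable_def] le] by (simp_all add: hs_summable_def hs_def)
qed

lemma hs_add:
  assumes "hs_summable L m b" "hs_summable L m c"
  shows "hs_summable L m (\<lambda>n. b n + c n)" "hs L m (\<lambda>n. b n + c n) \<le> 2 * hs L m b + 2 * hs L m c"
proof -
  have le: "(kap L n ^ m * cmod (b n + c n))\<^sup>2 \<le> (kap L n ^ m * cmod (b n) + kap L n ^ m * cmod (c n))\<^sup>2" for n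
    unfolding distrib_left[symmetric] by (intro power_mono mult_left_mono norm_triangle_ineq) auto
  note s = summable_on_power2_sum[OF assms[unfolded hs_summable_def]]
  show "hs_summable L m (\<lambda>n. b n + c n)" "hs L m (\<lambda>n. b n + c n) \<le> 2 * hs L m b + 2 * hs L m c"
    using infsum_mono_real[OF s(1) le] s(2) unfolding hs_summable_def hs_def by (auto intro: order_trans)
qed

lemma hs_uminus: "hs_summable L m (\<lambda>n. - c n) = hs_summable L m c" "hs L m (\<lambda>n. - c n) = hs L m c"
  by (simp_all add: hs_summable_def hs_def)

lemma hs_diff:
  assumes "hs_summable L m b" "hs_summable L m c"
  shows "hs_summable L m (\<lambda>n. b n - c n)" "hs L m (\<lambda>n. b n - c n) \<le> 2 * hs L m b + 2 * hs L m c"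
  using hs_add[of L m b "\<lambda>n. - c n"] assms by (simp_all add: hs_uminus)

lemma ls_diff:
  assumes "ls_summable L m b" "ls_summable L m c"
  shows "ls_summable L m (\<lambda>n. b n - c n)" "ls L m (\<lambda>n. b n - c n) \<le> ls L m b + ls L m c"
proof -
  have le: "kap L n ^ m * cmod (b n - c n) \<le> kap L n ^ m * cmod (b n) + kap L n ^ m * cmod (c n)" for n
    unfolding distrib_left[symmetric] by (intro mult_left_mono norm_triangle_ineq4) auto
  have s: "(\<lambda>n. kap L n ^ m * cmod (b n) + kap L n ^ m * cmod (c n)) summable_on UNIV"
    using assms by (intro summable_on_add) (auto simp: ls_summable_def)
  show "ls_summable L m (\<lambda>n. b n - c n)" "ls L m (\<lambda>n. b n - c n) \<le> ls L m b + ls L m c"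
    using infsum_mono_real[OF s le] infsum_add[OF assms[unfolded ls_summable_def]]
    by (simp_all add: ls_summable_def ls_def)
qed

lemma finite_support_summable:
  assumes "finite {n. c n \<noteq> 0}"
  shows "hs_summable L m c" "ls_summable L m c"
  unfolding hs_summable_def ls_summable_def
  by (rule finite_nonzero_values_imp_summable_on, rule finite_subset[OF _ assms], auto)+

text \<open>Cauchy-Schwarz for the weights \<open>kap^m\<close> and \<open>kap^(m + 2)\<close>,
  whose product is the square of the middle weight.\<close>

lemma hs_log_convex:
  assumes "hs_summable L m c" "hs_summable L (m + 2) c"
  shows "hs_summable L (m + 1) c" "(hs L (m + 1) c)\<^sup>2 \<le> hs L m c * hs L (m + 2) c"
proof -
  have eq: "kap L n ^ m * cmod (c n) * (kap L n ^ (m + 2) * cmod (c n)) = (kap L n ^ (m + 1) * cmod (c n))\<^sup>2" for n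
    by (simp add: power_add power2_eq_square algebra_simps)
  show "hs_summable L (m + 1) c" "(hs L (m + 1) c)\<^sup>2 \<le> hs L m c * hs L (m + 2) c"
    using infsum_Cauchy_Schwarz[OF assms[unfolded hs_summable_def], unfolded eq]
    by (auto simp: hs_summable_def hs_def)
qed

lemma hs_interpolate:
  assumes s: "hs_summable L i c" "hs_summable L j c" and C: "A \<ge> 0" "B \<ge> 0"
    and le: "\<And>n. (kap L n ^ m)\<^sup>2 \<le> A * (kap L n ^ i)\<^sup>2 + B * (kap L n ^ j)\<^sup>2"
  shows "hs_summable L m c" "hs L m c \<le> A * hs L i c + B * hs L j c"
proof -
  have le': "(kap L n ^ m * cmod (c n))\<^sup>2 \<le> A * (kap L n ^ i * cmod (c n))\<^sup>2 + B * (kap L n ^ j * cmod (c n))\<^sup>2" for n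
    using mult_right_mono[OF le, of "(cmod (c n))\<^sup>2" n] by (simp add: power_mult_distrib algebra_simps)
  have su: "(\<lambda>n. A * (kap L n ^ i * cmod (c n))\<^sup>2 + B * (kap L n ^ j * cmod (c n))\<^sup>2) summable_on UNIV"
    using s unfolding hs_summable_def by (intro summable_on_add summable_on_cmult_right)
  have eq: "(\<Sum>\<^sub>\<infinity>n. A * (kap L n ^ i * cmod (c n))\<^sup>2 + B * (kap L n ^ j * cmod (c n))\<^sup>2) = A * hs L i c + B * hs L j c"
    using s unfolding hs_summable_def hs_def
    by (subst infsum_add) (auto intro: summable_on_cmult_right simp: infsum_cmult_right')
  show "hs_summable L m c" "hs L m c \<le> A * hs L i c + B * hs L j c"
    using infsum_mono_real[OF su le'] eq by (simp_all add: hs_summable_def hs_def)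
qed

section \<open>Wiener norms and the Poincare inequality\<close>

locale torus_domain =
  fixes L :: real
  assumes L_pos: "L > 0"
begin

text \<open>The least modulus of a nonzero wave vector, hence the square root of the first
  eigenvalue of the Stokes operator.\<close>

definition kap1 :: real where "kap1 = 2 * pi / L"

lemma kap1_pos: "kap1 > 0" using L_pos by (simp add: kap1_def)

lemma kap_ge: "n \<noteq> 0 \<Longrightarrow> kap1 \<le> kap L n"
proof -
  assume n: "n \<noteq> 0"
  have "1 \<le> (fst n)\<^sup>2 + (snd n)\<^sup>2"
  proof -
    have "0 < (fst n)\<^sup>2 + (snd n)\<^sup>2"
      using n by (auto simp: zero_mode prod_eq_iff sum_power2_gt_zero_iff)
    then show ?thesis by simp
  qed
  then have "1 \<le> (of_int (fst n))\<^sup>2 + (of_int (snd n) :: real)\<^sup>2"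
    by (metis of_int_1 of_int_add of_int_le_iff of_int_power)
  then have "kap1\<^sup>2 \<le> (kap L n)\<^sup>2" unfolding kap_square kap1_def[symmetric]
    using mult_left_mono[of 1 _ "kap1\<^sup>2"] by simp
  then show ?thesis by (rule power2_le_imp_le) simp
qed

lemma kap_pos: "n \<noteq> 0 \<Longrightarrow> 0 < kap L n"
  using kap_ge[of n] kap1_pos by simp

lemma norm_ev_eq: "n \<noteq> 0 \<Longrightarrow> norm (ev L n) = 1"
  using kap_pos[of n] by (simp add: ev_def norm_vector_perp kap_def[symmetric])

lemma ev_components: "n \<noteq> 0 \<Longrightarrow> ev L n $ 1 = - (wave L n $ 2) / kap L n \<and> ev L n $ 2 = wave L n $ 1 / kap L n"
  by (simp add: ev_def)

definition clat :: real where "clat = 25 / kap1\<^sup>2"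

lemma clat_pos: "clat > 0" using kap1_pos by (simp add: clat_def)

lemma lattice_sum:
  assumes T: "T \<ge> kap1\<^sup>2"
  shows "(\<lambda>n. (1 / (T + (kap L n)\<^sup>2))\<^sup>2) summable_on UNIV"
    and "(\<Sum>\<^sub>\<infinity>n. (1 / (T + (kap L n)\<^sup>2))\<^sup>2) \<le> clat / T"
proof -
  \<comment> \<open>Wave vectors form the integer lattice scaled by \<open>kap1\<close>; after this
    rescaling the condition on \<open>T\<close> reads \<open>R \<ge> 1\<close>.\<close>
  define R where "R = sqrt T / kap1"
  have T0: "T > 0" using T kap1_pos by (meson less_le_trans zero_less_power)
  have R1: "R \<ge> 1" unfolding R_def using T kap1_pos by (simp add: real_le_rsqrt)
  have TR: "T = kap1\<^sup>2 * R\<^sup>2" using T0 kap1_pos by (simp add: R_def power_divide)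
  have eq: "(1 / (T + (kap L n)\<^sup>2))\<^sup>2 = 1 / kap1^4 * (case n of (m, n) \<Rightarrow> 1 / (R\<^sup>2 + (of_int m)\<^sup>2 + (of_int n)\<^sup>2)\<^sup>2)" for n
  proof -
    have "T + (kap L n)\<^sup>2 = kap1\<^sup>2 * (R\<^sup>2 + (of_int (fst n))\<^sup>2 + (of_int (snd n))\<^sup>2)"
      unfolding TR kap_square kap1_def[symmetric] by (simp add: algebra_simps)
    then show ?thesis by (simp add: case_prod_beta power_divide power_mult_distrib flip: power_mult)
  qed
  show "(\<lambda>n. (1 / (T + (kap L n)\<^sup>2))\<^sup>2) summable_on UNIV"
    unfolding eq by (intro summable_on_cmult_right sum_lattice_inverse_square R1)
  have "(\<Sum>\<^sub>\<infinity>n. (1 / (T + (kap L n)\<^sup>2))\<^sup>2) \<le> 1 / kap1^4 * (25 / R\<^sup>2)"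
    unfolding eq infsum_cmult_right' by (intro mult_left_mono sum_lattice_inverse_square R1) auto
  also have "\<dots> = clat / T" unfolding clat_def TR by (simp add: power2_eq_square power4_eq_xxxx)
  finally show "(\<Sum>\<^sub>\<infinity>n. (1 / (T + (kap L n)\<^sup>2))\<^sup>2) \<le> clat / T" .
qed

text \<open>Cauchy-Schwarz against the weight \<open>T + kap^2\<close>, whose inverse is square
  summable with a sum of order \<open>1 / T\<close>. The parameter stays free: a large
  \<open>T\<close> makes the share of the higher norm small, and the balanced \<open>T\<close> gives
  a bound by the geometric mean of the two norms.\<close>

lemma ls_bound:
  assumes s: "hs_summable L m c" "hs_summable L (m + 2) c" and T: "T \<ge> kap1\<^sup>2"
  shows "ls_summable L m c" "(ls L m c)\<^sup>2 \<le> 2 * clat * (T * hs L m c + hs L (m + 2) c / T)"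
proof -
  have T0: "T > 0" using T kap1_pos by (meson less_le_trans zero_less_power)
  let ?w = "\<lambda>n. (T + (kap L n)\<^sup>2) * (kap L n ^ m * cmod (c n))"
  have w: "?w n = T * (kap L n ^ m * cmod (c n)) + kap L n ^ (m + 2) * cmod (c n)" for n
    by (simp add: power_add power2_eq_square algebra_simps)
  have s1: "(\<lambda>n. (T * (kap L n ^ m * cmod (c n)))\<^sup>2) summable_on UNIV"
    unfolding power_mult_distrib[of T] using s(1) by (intro summable_on_cmult_right) (simp add: hs_summable_def)
  note W = summable_on_power2_sum[OF s1 s(2)[unfolded hs_summable_def], folded w]
  have hs1: "(\<Sum>\<^sub>\<infinity>n. (T * (kap L n ^ m * cmod (c n)))\<^sup>2) = T\<^sup>2 * hs L m c"
    unfolding power_mult_distrib[of T] hs_def by (rule infsum_cmult_right')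
  have eq: "1 / (T + (kap L n)\<^sup>2) * ?w n = kap L n ^ m * cmod (c n)" for n
  proof -
    have "T + (kap L n)\<^sup>2 \<noteq> 0" using T0 by (smt (verit) zero_le_power2)
    then show ?thesis by simp
  qed
  have nn: "0 \<le> 1 / (T + (kap L n)\<^sup>2)" "0 \<le> ?w n" for n using T0 by auto
  note CS = infsum_Cauchy_Schwarz[OF lattice_sum(1)[OF T] W(1) nn, unfolded eq]
  show "ls_summable L m c" using CS(1) by (simp add: ls_summable_def)
  have "(ls L m c)\<^sup>2 \<le> (\<Sum>\<^sub>\<infinity>n. (1 / (T + (kap L n)\<^sup>2))\<^sup>2) * (\<Sum>\<^sub>\<infinity>n. (?w n)\<^sup>2)"
    using CS(2) by (simp add: ls_def)
  also have "\<dots> \<le> clat / T * (2 * (T\<^sup>2 * hs L m c) + 2 * hs L (m + 2) c)"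
    using W(2) clat_pos T0 unfolding hs1
    by (intro mult_mono lattice_sum[OF T] infsum_nonneg) (auto simp: hs_def)
  also have "\<dots> = 2 * clat * (T * hs L m c + hs L (m + 2) c / T)"
    using T0 by (simp add: field_simps power2_eq_square)
  finally show "(ls L m c)\<^sup>2 \<le> 2 * clat * (T * hs L m c + hs L (m + 2) c / T)" .
qed

text \<open>The Poincare inequality. The hypothesis \<open>c 0 = 0\<close> expresses the zero
  average: the constant mode is the only one with \<open>kap L n < kap1\<close>.\<close>

lemma hs_down:
  assumes "hs_summable L (m + i) c" "c 0 = 0"
  shows "hs_summable L m c" "hs L m c \<le> (1 / kap1 ^ i)\<^sup>2 * hs L (m + i) c"
proof -
  have le: "(kap L n ^ m * cmod (c n))\<^sup>2 \<le> (1 / kap1 ^ i)\<^sup>2 * (kap L n ^ (m + i) * cmod (c n))\<^sup>2" for n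
  proof (cases "n = 0")
    case False
    have "kap1 ^ i \<le> kap L n ^ i" using kap_ge[OF False] kap1_pos by (intro power_mono) auto
    then have "1 \<le> 1 / kap1 ^ i * kap L n ^ i" using kap1_pos by simp
    then have "kap L n ^ m * cmod (c n) * 1 \<le> kap L n ^ m * cmod (c n) * (1 / kap1 ^ i * kap L n ^ i)"
      by (intro mult_left_mono) auto
    then have "(kap L n ^ m * cmod (c n))\<^sup>2 \<le> (1 / kap1 ^ i * (kap L n ^ (m + i) * cmod (c n)))\<^sup>2"
      by (intro power_mono) (auto simp: power_add algebra_simps)
    then show ?thesis by (simp only: power_mult_distrib)
  qed (use assms in auto)
  have s: "(\<lambda>n. (1 / kap1 ^ i)\<^sup>2 * (kap L n ^ (m + i) * cmod (c n))\<^sup>2) summable_on UNIV"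
    using assms(1) by (intro summable_on_cmult_right) (simp add: hs_summable_def)
  show "hs_summable L m c" "hs L m c \<le> (1 / kap1 ^ i)\<^sup>2 * hs L (m + i) c"
    using infsum_mono_real[OF s le] unfolding hs_summable_def hs_def by (auto simp: infsum_cmult_right')
qed

end

text \<open>For a solution \<open>U\<close> with coefficients \<open>a\<close> and another solution \<open>u\<close>, these are the coefficients of
  \<open>B(U, U) - B(u, u)\<close>, where \<open>v\<close> stands for \<open>U - u\<close>.\<close>

definition pert :: "real \<Rightarrow> (int \<times> int \<Rightarrow> complex) \<Rightarrow> (int \<times> int \<Rightarrow> complex) \<Rightarrow> int \<times> int \<Rightarrow> complex" where
  "pert L a v k = advect L a v k + advect L v a k - advect L v v k"

section \<open>Bounds and skew symmetry of the advection term\<close>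

lemma summable_on_norm_le:
  fixes f :: "'a \<Rightarrow> 'b::banach"
  assumes "g summable_on A" "\<And>x. x \<in> A \<Longrightarrow> norm (f x) \<le> g x"
  shows "f summable_on A" "norm (infsum f A) \<le> infsum g A"
proof -
  have n: "(\<lambda>x. norm (f x)) summable_on A" by (rule Infinite_Sum.abs_summable_on_comparison_test'[OF assms])
  show "f summable_on A" by (rule Infinite_Sum.abs_summable_summable[OF n])
  have "norm (infsum f A) \<le> infsum (\<lambda>x. norm (f x)) A" by (rule norm_infsum_bound[OF n])
  also have "\<dots> \<le> infsum g A" by (rule infsum_mono[OF n assms])
  finally show "norm (infsum f A) \<le> infsum g A" .
qed

lemma advect_term_le_l:
  "cmod (\<i> * of_real (advect_coef L k l) * a (k - l) * b l) \<le> cmod (a (k - l)) * (kap L l * cmod (b l))"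
proof -
  have "cmod (\<i> * of_real (advect_coef L k l) * a (k - l) * b l) = \<bar>advect_coef L k l\<bar> * (cmod (a (k - l)) * cmod (b l))"
    by (simp add: norm_mult)
  also have "\<dots> \<le> kap L l * (cmod (a (k - l)) * cmod (b l))"
    by (intro mult_right_mono advect_coef_bound_l) auto
  finally show ?thesis by (simp add: ac_simps)
qed

lemma advect_term_le_k:
  "cmod (\<i> * of_real (advect_coef L k l) * a (k - l) * b l) \<le> kap L k * (cmod (a (k - l)) * cmod (b l))"
proof -
  have "cmod (\<i> * of_real (advect_coef L k l) * a (k - l) * b l) = \<bar>advect_coef L k l\<bar> * (cmod (a (k - l)) * cmod (b l))"
    by (simp add: norm_mult)
  also have "\<dots> \<le> kap L k * (cmod (a (k - l)) * cmod (b l))"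
    by (intro mult_right_mono advect_coef_bound_k) auto
  finally show ?thesis .
qed

lemma advect_term_dominated:
  assumes "g summable_on UNIV"
    and "\<And>l. cmod (\<i> * of_real (advect_coef L k l) * a (k - l) * b l) \<le> g l"
  shows "(\<lambda>l. \<i> * of_real (advect_coef L k l) * a (k - l) * b l) summable_on UNIV"
    and "cmod (advect L a b k) \<le> infsum g UNIV"
  unfolding advect_def
  using summable_on_norm_le[where A=UNIV and f="\<lambda>l. \<i> * of_real (advect_coef L k l) * a (k - l) * b l", OF assms(1)] assms(2)
  by simp_all

lemma hs0_summable_iff: "hs_summable L 0 c \<longleftrightarrow> (\<lambda>n. (cmod (c n))\<^sup>2) summable_on UNIV"
  by (simp add: hs_summable_def)

lemma hs0_eq: "hs L 0 c = (\<Sum>\<^sub>\<infinity>n. (cmod (c n))\<^sup>2)"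
  by (simp add: hs_def)

lemma convolution_hs0:
  assumes "hs_summable L 0 a" "hs_summable L 0 b"
  shows "(\<lambda>l. cmod (a (k - l)) * cmod (b l)) summable_on UNIV"
    and "(\<Sum>\<^sub>\<infinity>l. cmod (a (k - l)) * cmod (b l)) \<le> sqrt (hs L 0 a) * sqrt (hs L 0 b)"
proof -
  have sa: "((\<lambda>l. (cmod (a (k - l)))\<^sup>2) has_sum hs L 0 a) UNIV"
    using has_sum_infsum[OF assms(1)[unfolded hs0_summable_iff]]
    by (subst has_sum_shift_reflect[where f="\<lambda>l. (cmod (a l))\<^sup>2"]) (simp add: hs0_eq)
  note CS = infsum_Cauchy_Schwarz[OF has_sum_imp_summable[OF sa] assms(2)[unfolded hs0_summable_iff]]
  show "(\<lambda>l. cmod (a (k - l)) * cmod (b l)) summable_on UNIV" using CS(1) by simp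
  have "(\<Sum>\<^sub>\<infinity>l. cmod (a (k - l)) * cmod (b l))\<^sup>2 \<le> hs L 0 a * hs L 0 b"
    using CS(2) infsumI[OF sa] by (simp add: hs0_eq)
  then show "(\<Sum>\<^sub>\<infinity>l. cmod (a (k - l)) * cmod (b l)) \<le> sqrt (hs L 0 a) * sqrt (hs L 0 b)"
    by (metis real_le_rsqrt real_sqrt_mult)
qed

text \<open>With the derivative on the output mode, finite energy of both factors is enough for each
  single coefficient. So the coefficients make sense for all fields in H.\<close>

lemma advect_summable:
  assumes "hs_summable L 0 a" "hs_summable L 0 b"
  shows "(\<lambda>l. \<i> * of_real (advect_coef L k l) * a (k - l) * b l) summable_on UNIV"
    and "cmod (advect L a b k) \<le> kap L k * (sqrt (hs L 0 a) * sqrt (hs L 0 b))"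
proof -
  note c = convolution_hs0[OF assms, of k]
  have s: "(\<lambda>l. kap L k * (cmod (a (k - l)) * cmod (b l))) summable_on UNIV"
    by (intro summable_on_cmult_right c)
  have le: "cmod (\<i> * of_real (advect_coef L k l) * a (k - l) * b l) \<le> kap L k * (cmod (a (k - l)) * cmod (b l))" for l
    by (rule advect_term_le_k)
  note n = advect_term_dominated[OF s le]
  show "(\<lambda>l. \<i> * of_real (advect_coef L k l) * a (k - l) * b l) summable_on UNIV" by (rule n(1))
  show "cmod (advect L a b k) \<le> kap L k * (sqrt (hs L 0 a) * sqrt (hs L 0 b))"
    using n(2) mult_left_mono[OF c(2) kap_nonneg[of L k]] by (simp add: infsum_cmult_right')
qed

lemma advect_add_left:
  assumes "hs_summable L 0 a" "hs_summable L 0 a'" "hs_summable L 0 b"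
  shows "advect L (\<lambda>n. a n + a' n) b k = advect L a b k + advect L a' b k"
  unfolding advect_def
  using infsum_add[OF advect_summable(1)[OF assms(1,3)] advect_summable(1)[OF assms(2,3)]]
  by (simp add: algebra_simps)

lemma advect_add_right:
  assumes "hs_summable L 0 a" "hs_summable L 0 b" "hs_summable L 0 b'"
  shows "advect L a (\<lambda>n. b n + b' n) k = advect L a b k + advect L a b' k"
  unfolding advect_def
  using infsum_add[OF advect_summable(1)[OF assms(1,2)] advect_summable(1)[OF assms(1,3)]]
  by (simp add: algebra_simps)

lemma advect_uminus_left: "advect L (\<lambda>n. - a n) b k = - advect L a b k"
  unfolding advect_def by (simp add: infsum_uminus)

lemma advect_uminus_right: "advect L a (\<lambda>n. - b n) k = - advect L a b k"
  unfolding advect_def by (simp add: infsum_uminus)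

lemma advect_diff_left:
  assumes "hs_summable L 0 a" "hs_summable L 0 a'" "hs_summable L 0 b"
  shows "advect L (\<lambda>n. a n - a' n) b k = advect L a b k - advect L a' b k"
  using advect_add_left[of L a "\<lambda>n. - a' n" b k] assms by (simp add: hs_uminus advect_uminus_left)

lemma advect_diff_right:
  assumes "hs_summable L 0 a" "hs_summable L 0 b" "hs_summable L 0 b'"
  shows "advect L a (\<lambda>n. b n - b' n) k = advect L a b k - advect L a b' k"
  using advect_add_right[of L a b "\<lambda>n. - b' n" k] assms by (simp add: hs_uminus advect_uminus_right)

lemma advect_difference:
  assumes "hs_summable L 0 a" "hs_summable L 0 b"
  shows "advect L a a k - advect L b b k = pert L a (\<lambda>n. a n - b n) k"
  using assms by (simp add: pert_def advect_diff_left advect_diff_right hs_diff)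

text \<open>Here the derivative falls on the second factor, and Young's inequality is applied to the
  majorizing convolution. The convolution \<open>c\<close> is part of the conclusion because the
  gradient bound and the skew symmetry work with it directly.\<close>

lemma advect_conv_l:
  assumes a: "ls_summable L 0 a" and b: "hs_summable L 1 b"
  defines "c \<equiv> \<lambda>k. \<Sum>\<^sub>\<infinity>l. cmod (a (k - l)) * (kap L l * cmod (b l))"
  shows "(\<lambda>l. cmod (a (k - l)) * (kap L l * cmod (b l))) summable_on UNIV"
    and "cmod (advect L a b k) \<le> c k" and "0 \<le> c k"
    and "(\<lambda>k. (c k)\<^sup>2) summable_on UNIV" and "(\<Sum>\<^sub>\<infinity>k. (c k)\<^sup>2) \<le> (ls L 0 a)\<^sup>2 * hs L 1 b"
proof -
  have sa: "(\<lambda>l. cmod (a l)) summable_on UNIV" using a by (simp add: ls_summable_def)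
  have sb: "(\<lambda>l. (kap L l * cmod (b l))\<^sup>2) summable_on UNIV" using b by (simp add: hs_summable_def)
  note Y = Young_convolution[OF sa sb]
  show s: "(\<lambda>l. cmod (a (k - l)) * (kap L l * cmod (b l))) summable_on UNIV" using Y(1) by simp
  show "cmod (advect L a b k) \<le> c k"
    unfolding c_def by (rule advect_term_dominated(2)[OF s]) (rule advect_term_le_l)
  show "0 \<le> c k" unfolding c_def by (intro infsum_nonneg) auto
  show "(\<lambda>k. (c k)\<^sup>2) summable_on UNIV" using Y(2) by (simp add: c_def)
  show "(\<Sum>\<^sub>\<infinity>k. (c k)\<^sup>2) \<le> (ls L 0 a)\<^sup>2 * hs L 1 b"
    using Y(3) by (simp add: c_def ls_def hs_def)
qed

lemma advect_hs0:
  assumes a: "ls_summable L 0 a" and b: "hs_summable L 1 b"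
  shows "hs_summable L 0 (advect L a b)" "hs L 0 (advect L a b) \<le> (ls L 0 a)\<^sup>2 * hs L 1 b"
proof -
  note c = advect_conv_l[OF a b]
  have le: "(cmod (advect L a b k))\<^sup>2 \<le> (\<Sum>\<^sub>\<infinity>l. cmod (a (k - l)) * (kap L l * cmod (b l)))\<^sup>2" for k
    by (intro power_mono c) auto
  show "hs_summable L 0 (advect L a b)" "hs L 0 (advect L a b) \<le> (ls L 0 a)\<^sup>2 * hs L 1 b"
    using infsum_mono_real[OF c(4) le] c(5) by (simp_all add: hs0_summable_iff hs0_eq)
qed

text \<open>Here the derivative falls on the output, so that the second factor need only be in \<open>\<ell>\<^sup>1\<close>.\<close>

lemma advect_conv_k:
  assumes a: "hs_summable L 0 a" and b: "ls_summable L 0 b"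
  obtains c where "\<And>k. cmod (advect L a b k) \<le> kap L k * c k" "\<And>k. 0 \<le> c k"
    "(\<lambda>k. (c k)\<^sup>2) summable_on UNIV" "(\<Sum>\<^sub>\<infinity>k. (c k)\<^sup>2) \<le> (ls L 0 b)\<^sup>2 * hs L 0 a"
proof -
  define c where "c k = (\<Sum>\<^sub>\<infinity>l. cmod (b (k - l)) * cmod (a l))" for k
  have sb: "(\<lambda>l. cmod (b l)) summable_on UNIV" using b by (simp add: ls_summable_def)
  have sa: "(\<lambda>l. (cmod (a l))\<^sup>2) summable_on UNIV" using a by (simp add: hs0_summable_iff)
  note Y = Young_convolution[OF sb sa]
  have hs': "((\<lambda>l. cmod (a (k - l)) * cmod (b l)) has_sum c k) UNIV" for k
  proof -
    have "((\<lambda>l. cmod (b (k - l)) * cmod (a l)) has_sum c k) UNIV" using Y(1) by (simp add: c_def)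
    then show ?thesis
      by (subst (asm) has_sum_shift_reflect[symmetric, of _ _ k]) (simp add: mult.commute)
  qed
  have "cmod (advect L a b k) \<le> kap L k * c k" for k
  proof -
    have h: "((\<lambda>l. kap L k * (cmod (a (k - l)) * cmod (b l))) has_sum kap L k * c k) UNIV"
      by (rule has_sum_cmult_right[OF hs'])
    have "cmod (advect L a b k) \<le> (\<Sum>\<^sub>\<infinity>l. kap L k * (cmod (a (k - l)) * cmod (b l)))"
      by (rule advect_term_dominated(2)[OF has_sum_imp_summable[OF h]]) (rule advect_term_le_k)
    then show ?thesis by (simp only: infsumI[OF h])
  qed
  moreover have "0 \<le> c k" for k unfolding c_def by (intro infsum_nonneg) auto
  moreover have "(\<lambda>k. (c k)\<^sup>2) summable_on UNIV" using Y(2) by (simp add: c_def)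
  moreover have "(\<Sum>\<^sub>\<infinity>k. (c k)\<^sup>2) \<le> (ls L 0 b)\<^sup>2 * hs L 0 a"
    using Y(3) by (simp add: c_def ls_def hs_def)
  ultimately show ?thesis by (rule that)
qed

text \<open>The extra weight is distributed by \<open>kap L k \<le> kap L (k - l) + kap L l\<close>.
  The product with both derivatives on \<open>b\<close> is settled here. The product of two first
  derivatives enters through the bound \<open>B\<close>, because either of its factors can play the
  role of the l^1 factor.\<close>

lemma advect_hs1_split:
  assumes su: "\<And>k. (\<lambda>l. (kap L (k - l) * cmod (a (k - l))) * (kap L l * cmod (b l))) summable_on UNIV"
    and sq: "(\<lambda>k. (\<Sum>\<^sub>\<infinity>l. (kap L (k - l) * cmod (a (k - l))) * (kap L l * cmod (b l)))\<^sup>2) summable_on UNIV"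
    and B: "(\<Sum>\<^sub>\<infinity>k. (\<Sum>\<^sub>\<infinity>l. (kap L (k - l) * cmod (a (k - l))) * (kap L l * cmod (b l)))\<^sup>2) \<le> B"
    and a: "ls_summable L 0 a" and b: "hs_summable L 1 b" "hs_summable L 2 b"
  shows "hs_summable L 1 (advect L a b)" "hs L 1 (advect L a b) \<le> 2 * (B + (ls L 0 a)\<^sup>2 * hs L 2 b)"
proof -
  let ?c = "\<lambda>k. \<Sum>\<^sub>\<infinity>l. (kap L (k - l) * cmod (a (k - l))) * (kap L l * cmod (b l))"
  let ?d = "\<lambda>k. \<Sum>\<^sub>\<infinity>l. cmod (a (k - l)) * (kap L l ^ 2 * cmod (b l))"
  have sa: "(\<lambda>l. cmod (a l)) summable_on UNIV" using a by (simp add: ls_summable_def)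
  have sb: "(\<lambda>l. (kap L l ^ 2 * cmod (b l))\<^sup>2) summable_on UNIV" using b by (simp add: hs_summable_def)
  note Y = Young_convolution[OF sa sb]
  have Y1: "(\<lambda>l. cmod (a (k - l)) * (kap L l ^ 2 * cmod (b l))) summable_on UNIV" for k using Y(1) by simp
  have pt: "kap L k * cmod (advect L a b k) \<le> ?c k + ?d k" for k
  proof -
    note c = advect_conv_l[OF a b(1)]
    have "kap L k * cmod (advect L a b k) \<le> kap L k * (\<Sum>\<^sub>\<infinity>l. cmod (a (k - l)) * (kap L l * cmod (b l)))"
      by (intro mult_left_mono c) auto
    also have "\<dots> = (\<Sum>\<^sub>\<infinity>l. kap L k * (cmod (a (k - l)) * (kap L l * cmod (b l))))"
      by (rule infsum_cmult_right'[symmetric])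
    also have "\<dots> \<le> (\<Sum>\<^sub>\<infinity>l. (kap L (k - l) * cmod (a (k - l))) * (kap L l * cmod (b l)) + cmod (a (k - l)) * (kap L l ^ 2 * cmod (b l)))"
    proof (intro infsum_mono summable_on_cmult_right c summable_on_add su Y1)
      fix l
      have "kap L k * (cmod (a (k - l)) * (kap L l * cmod (b l))) \<le> (kap L (k - l) + kap L l) * (cmod (a (k - l)) * (kap L l * cmod (b l)))"
        by (intro mult_right_mono kap_triangle) auto
      then show "kap L k * (cmod (a (k - l)) * (kap L l * cmod (b l))) \<le> (kap L (k - l) * cmod (a (k - l))) * (kap L l * cmod (b l)) + cmod (a (k - l)) * (kap L l ^ 2 * cmod (b l))"
        by (simp add: algebra_simps power2_eq_square)
    qed
    also have "\<dots> = ?c k + ?d k" by (rule infsum_add[OF su Y1])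
    finally show ?thesis .
  qed
  have le: "(kap L k ^ 1 * cmod (advect L a b k))\<^sup>2 \<le> (?c k + ?d k)\<^sup>2" for k
    using pt[of k] by (intro power_mono) auto
  have d2: "(\<lambda>k. (?d k)\<^sup>2) summable_on UNIV" "(\<Sum>\<^sub>\<infinity>k. (?d k)\<^sup>2) \<le> (ls L 0 a)\<^sup>2 * hs L 2 b"
    using Y(2,3) by (simp_all add: ls_def hs_def)
  note S = summable_on_power2_sum[OF sq d2(1)]
  show "hs_summable L 1 (advect L a b)"
    using infsum_mono_real(1)[OF S(1) le] by (simp add: hs_summable_def)
  have "hs L 1 (advect L a b) \<le> (\<Sum>\<^sub>\<infinity>k. (?c k + ?d k)\<^sup>2)"
    using infsum_mono_real(2)[OF S(1) le] by (simp add: hs_def)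
  also have "\<dots> \<le> 2 * B + 2 * ((ls L 0 a)\<^sup>2 * hs L 2 b)"
    using S(2) B d2(2) by linarith
  finally show "hs L 1 (advect L a b) \<le> 2 * (B + (ls L 0 a)\<^sup>2 * hs L 2 b)" by simp
qed

lemma advect_hs1_left:
  assumes a: "ls_summable L 0 a" "ls_summable L 1 a" and b: "hs_summable L 1 b" "hs_summable L 2 b"
  shows "hs_summable L 1 (advect L a b)"
    "hs L 1 (advect L a b) \<le> 2 * ((ls L 1 a)\<^sup>2 * hs L 1 b + (ls L 0 a)\<^sup>2 * hs L 2 b)"
proof -
  have sa: "(\<lambda>l. kap L l * cmod (a l)) summable_on UNIV" using a by (simp add: ls_summable_def)
  have sb: "(\<lambda>l. (kap L l * cmod (b l))\<^sup>2) summable_on UNIV" using b by (simp add: hs_summable_def)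
  note Y = Young_convolution[OF sa sb]
  show "hs_summable L 1 (advect L a b)"
    "hs L 1 (advect L a b) \<le> 2 * ((ls L 1 a)\<^sup>2 * hs L 1 b + (ls L 0 a)\<^sup>2 * hs L 2 b)"
    using advect_hs1_split[where a=a and b=b and B="(ls L 1 a)\<^sup>2 * hs L 1 b", OF _ _ _ a(1) b] Y by (auto simp: ls_def hs_def)
qed

text \<open>The variant for a reference field that advects the error: the derivatives of such a
  field are bounded in l^2 but not in l^1, so the derivative of \<open>b\<close> is taken in l^1.
  The convolution commutes, which gives Young's inequality with the roles exchanged.\<close>

lemma advect_hs1_right:
  assumes a: "ls_summable L 0 a" "hs_summable L 1 a" and b: "hs_summable L 1 b" "hs_summable L 2 b" "ls_summable L 1 b"
  shows "hs_summable L 1 (advect L a b)"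
    "hs L 1 (advect L a b) \<le> 2 * ((ls L 1 b)\<^sup>2 * hs L 1 a + (ls L 0 a)\<^sup>2 * hs L 2 b)"
proof -
  have sa: "(\<lambda>l. (kap L l * cmod (a l))\<^sup>2) summable_on UNIV" using a by (simp add: hs_summable_def)
  have sb: "(\<lambda>l. kap L l * cmod (b l)) summable_on UNIV" using b by (simp add: ls_summable_def)
  note Y = Young_convolution[OF sb sa]
  have h: "((\<lambda>l. (kap L (k - l) * cmod (a (k - l))) * (kap L l * cmod (b l))) has_sum
     (\<Sum>\<^sub>\<infinity>l. (kap L (k - l) * cmod (b (k - l))) * (kap L l * cmod (a l)))) UNIV" for k
  proof -
    have "((\<lambda>l. (kap L (k - l) * cmod (b (k - l))) * (kap L l * cmod (a l))) has_sum
      (\<Sum>\<^sub>\<infinity>l. (kap L (k - l) * cmod (b (k - l))) * (kap L l * cmod (a l)))) UNIV" using Y(1) by simp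
    then show ?thesis
      by (subst (asm) has_sum_shift_reflect[symmetric, of _ _ k]) (simp add: mult.commute mult.left_commute)
  qed
  have e: "(\<Sum>\<^sub>\<infinity>l. (kap L (k - l) * cmod (a (k - l))) * (kap L l * cmod (b l))) =
     (\<Sum>\<^sub>\<infinity>l. (kap L (k - l) * cmod (b (k - l))) * (kap L l * cmod (a l)))" for k
    by (rule infsumI[OF h])
  show "hs_summable L 1 (advect L a b)"
    "hs L 1 (advect L a b) \<le> 2 * ((ls L 1 b)\<^sup>2 * hs L 1 a + (ls L 0 a)\<^sup>2 * hs L 2 b)"
    using advect_hs1_split[where a=a and b=b and B="(ls L 1 b)\<^sup>2 * hs L 1 a", OF has_sum_imp_summable[OF h] _ _ a(1) b(1,2)] Y(2,3)
    by (auto simp: ls_def hs_def e)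
qed

text \<open>The double sum turns into minus its conjugate when \<open>k\<close> and \<open>l\<close>
  are exchanged: \<open>advect_coef\<close> is antisymmetric, and \<open>real_coefs a\<close> links
  the modes \<open>k - l\<close> and \<open>l - k\<close>. The majorant of
  \<open>advect_conv_l\<close> gives the absolute summability that justifies the exchange.\<close>

lemma advect_skew:
  assumes a: "ls_summable L 0 a" "real_coefs a" and z: "hs_summable L 0 z" "hs_summable L 1 z"
  shows "(\<lambda>k. cnj (z k) * advect L a z k) summable_on UNIV"
    and "Re (\<Sum>\<^sub>\<infinity>k. cnj (z k) * advect L a z k) = 0"
proof -
  define f where "f k l = cnj (z k) * (\<i> * of_real (advect_coef L k l) * a (k - l) * z l)" for k l
  define c where "c k = (\<Sum>\<^sub>\<infinity>l. cmod (a (k - l)) * (kap L l * cmod (z l)))" for k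
  note C = advect_conv_l[OF a(1) z(2), folded c_def]
  have row: "(\<lambda>l. norm (f k l)) summable_on UNIV" "(\<Sum>\<^sub>\<infinity>l. norm (f k l)) \<le> cmod (z k) * c k" for k
  proof -
    have le: "norm (f k l) \<le> cmod (z k) * (cmod (a (k - l)) * (kap L l * cmod (z l)))" for l
      unfolding f_def norm_mult[of "cnj _"] using mult_left_mono[OF advect_term_le_l norm_ge_zero] by simp
    have s: "(\<lambda>l. cmod (z k) * (cmod (a (k - l)) * (kap L l * cmod (z l)))) summable_on UNIV"
      by (intro summable_on_cmult_right C)
    show "(\<lambda>l. norm (f k l)) summable_on UNIV" "(\<Sum>\<^sub>\<infinity>l. norm (f k l)) \<le> cmod (z k) * c k"
      using infsum_mono_real[OF s le] by (auto simp: infsum_cmult_right' c_def)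
  qed
  have "(\<lambda>k. cmod (z k) * c k) summable_on UNIV"
    using infsum_Cauchy_Schwarz(1)[OF z(1)[unfolded hs0_summable_iff] C(4)] C(3) by auto
  then have "(\<lambda>k. \<Sum>\<^sub>\<infinity>l. norm (f k l)) summable_on UNIV"
    by (rule infsum_mono_real(1)[OF _ row(2)]) (auto intro: infsum_nonneg)
  then have "(\<lambda>x. norm ((\<lambda>(k, l). f k l) x)) summable_on UNIV \<times> UNIV"
    using row(1) by (subst Infinite_Sum.abs_summable_on_Sigma_iff) (auto simp: infsum_nonneg)
  then have s: "(\<lambda>(k, l). f k l) summable_on UNIV \<times> UNIV" by (rule Infinite_Sum.abs_summable_summable)
  have fk: "(\<Sum>\<^sub>\<infinity>l. f k l) = cnj (z k) * advect L a z k" for k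
    unfolding f_def advect_def by (rule infsum_cmult_right')
  show "(\<lambda>k. cnj (z k) * advect L a z k) summable_on UNIV"
    using summable_on_Sigma_banach[OF s] by (simp add: fk)
  have sym: "f l k = - cnj (f k l)" for k l
  proof -
    have "a (l - k) = - cnj (a (k - l))" using a(2) unfolding real_coefs_def by (metis minus_diff_eq)
    then show ?thesis unfolding f_def advect_coef_antisym[of L l k] by (simp add: algebra_simps)
  qed
  define S where "S = (\<Sum>\<^sub>\<infinity>k. \<Sum>\<^sub>\<infinity>l. f k l)"
  have "S = (\<Sum>\<^sub>\<infinity>l. \<Sum>\<^sub>\<infinity>k. f k l)" unfolding S_def by (rule infsum_swap_banach[OF s])
  also have "\<dots> = (\<Sum>\<^sub>\<infinity>l. \<Sum>\<^sub>\<infinity>k. - cnj (f l k))" by (subst sym) simp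
  also have "\<dots> = - cnj S" unfolding S_def by (simp add: infsum_uminus)
  finally have "Re S = 0" by (metis complex_cnj(1) complex.sel(1) complex_surj equal_neg_zero uminus_complex.sel(1))
  then show "Re (\<Sum>\<^sub>\<infinity>k. cnj (z k) * advect L a z k) = 0" by (simp add: S_def fk)
qed

lemma cmod_sum3_square: "(cmod (x + y - w))\<^sup>2 \<le> 3 * ((cmod x)\<^sup>2 + (cmod y)\<^sup>2 + (cmod w)\<^sup>2)"
proof -
  have "cmod (x + y - w) \<le> cmod x + cmod y + cmod w"
    by (meson norm_triangle_ineq norm_triangle_ineq4 add_right_mono order_trans)
  then have "(cmod (x + y - w))\<^sup>2 \<le> (cmod x + cmod y + cmod w)\<^sup>2" by (intro power_mono) auto
  also have "\<dots> \<le> 3 * ((cmod x)\<^sup>2 + (cmod y)\<^sup>2 + (cmod w)\<^sup>2)"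
    using sum_squares_bound[of "cmod x" "cmod y"] sum_squares_bound[of "cmod x" "cmod w"] sum_squares_bound[of "cmod y" "cmod w"]
    by (simp add: power2_eq_square algebra_simps)
  finally show ?thesis .
qed

lemma hs_sum3:
  assumes "hs_summable L m x" "hs_summable L m y" "hs_summable L m w"
  shows "hs_summable L m (\<lambda>k. x k + y k - w k)"
    and "hs L m (\<lambda>k. x k + y k - w k) \<le> 3 * (hs L m x + hs L m y + hs L m w)"
proof -
  have le: "(kap L k ^ m * cmod (x k + y k - w k))\<^sup>2 \<le>
    3 * ((kap L k ^ m * cmod (x k))\<^sup>2 + (kap L k ^ m * cmod (y k))\<^sup>2 + (kap L k ^ m * cmod (w k))\<^sup>2)" for k
    using mult_left_mono[OF cmod_sum3_square[of "x k" "y k" "w k"], of "(kap L k ^ m)\<^sup>2"]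
    by (simp add: power_mult_distrib algebra_simps)
  have s: "(\<lambda>k. 3 * ((kap L k ^ m * cmod (x k))\<^sup>2 + (kap L k ^ m * cmod (y k))\<^sup>2 + (kap L k ^ m * cmod (w k))\<^sup>2)) summable_on UNIV"
    using assms unfolding hs_summable_def by (intro summable_on_cmult_right summable_on_add)
  have "infsum (\<lambda>k. 3 * ((kap L k ^ m * cmod (x k))\<^sup>2 + (kap L k ^ m * cmod (y k))\<^sup>2 + (kap L k ^ m * cmod (w k))\<^sup>2)) UNIV
      = 3 * (hs L m x + hs L m y + hs L m w)"
    using assms unfolding hs_summable_def hs_def
    by (subst infsum_cmult_right', subst infsum_add, (auto intro: summable_on_add)[2], subst infsum_add) auto
  then show "hs_summable L m (\<lambda>k. x k + y k - w k)"
    and "hs L m (\<lambda>k. x k + y k - w k) \<le> 3 * (hs L m x + hs L m y + hs L m w)"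
    using infsum_mono_real[OF s le] by (simp_all add: hs_summable_def hs_def)
qed

text \<open>The Sobolev indices are to remain the numerals 0 to 3.\<close>

declare add_2_eq_Suc [simp del] add_2_eq_Suc' [simp del] plus_1_eq_Suc [simp del] One_nat_def [simp del]

context torus_domain begin

text \<open>Mode by mode with \<open>x = kap^2\<close>:
  \<open>x^2 \<le> \<theta> x^3 + 1 / \<theta>^2\<close>, by cases on whether
  \<open>\<theta> x\<close> exceeds 1. The first-order bound follows from
  \<open>x \<le> 1 + x^2\<close>.\<close>

lemma hs_interp:
  assumes s: "hs_summable L 0 v" "hs_summable L 3 v" and \<theta>: "\<theta> > 0"
  shows "hs_summable L 2 v" "hs_summable L 1 v"
    and "hs L 2 v \<le> \<theta> * hs L 3 v + 1 / \<theta>\<^sup>2 * hs L 0 v"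
    and "hs L 1 v \<le> \<theta> * hs L 3 v + (1 + 1 / \<theta>\<^sup>2) * hs L 0 v"
proof -
  have le2: "(kap L n ^ 2)\<^sup>2 \<le> \<theta> * (kap L n ^ 3)\<^sup>2 + 1 / \<theta>\<^sup>2 * (kap L n ^ 0)\<^sup>2" for n
  proof -
    define x where "x = (kap L n)\<^sup>2"
    have x: "0 \<le> x" by (simp add: x_def)
    have "x\<^sup>2 \<le> \<theta> * x ^ 3 + 1 / \<theta>\<^sup>2"
    proof (cases "1 \<le> \<theta> * x")
      case True
      then have "1 * x\<^sup>2 \<le> \<theta> * x * x\<^sup>2" by (intro mult_right_mono) auto
      then show ?thesis using \<theta> by (simp add: power3_eq_cube power2_eq_square mult.assoc) (smt (verit) divide_nonneg_nonneg mult_nonneg_nonneg)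
    next
      case False
      then have "x \<le> 1 / \<theta>" using \<theta> by (simp add: field_simps)
      then have "x\<^sup>2 \<le> (1 / \<theta>)\<^sup>2" using x by (intro power_mono) auto
      also have "\<dots> \<le> \<theta> * x ^ 3 + 1 / \<theta>\<^sup>2" using \<theta> x by (simp add: power_divide)
      finally show ?thesis .
    qed
    then show ?thesis by (simp add: x_def flip: power_mult)
  qed
  show s2: "hs_summable L 2 v" and b2: "hs L 2 v \<le> \<theta> * hs L 3 v + 1 / \<theta>\<^sup>2 * hs L 0 v"
    using hs_interpolate[OF s(2,1) _ _ le2] \<theta> by auto
  have le1: "(kap L n ^ 1)\<^sup>2 \<le> 1 * (kap L n ^ 0)\<^sup>2 + 1 * (kap L n ^ 2)\<^sup>2" for n
    using sum_squares_bound[of 1 "(kap L n)\<^sup>2"] by simp (smt (verit) zero_le_power2)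
  show "hs_summable L 1 v" using hs_interpolate(1)[OF s(1) s2 _ _ le1] by auto
  have "hs L 1 v \<le> 1 * hs L 0 v + 1 * hs L 2 v" by (rule hs_interpolate(2)[OF s(1) s2 _ _ le1]) auto
  then show "hs L 1 v \<le> \<theta> * hs L 3 v + (1 + 1 / \<theta>\<^sup>2) * hs L 0 v" using b2 by (simp add: algebra_simps)
qed

definition csob :: real where "csob = 4 * clat / kap1\<^sup>2"

lemma csob_nonneg: "csob \<ge> 0" using clat_pos by (simp add: csob_def)

text \<open>The embedding of H^2 into the Wiener algebra: \<open>ls_bound\<close> at the smallest
  admissible \<open>T\<close>, with the lower norm removed by Poincare.\<close>

lemma ls0_bound:
  assumes "hs_summable L 2 v" "v 0 = 0"
  shows "ls_summable L 0 v" "(ls L 0 v)\<^sup>2 \<le> csob * hs L 2 v"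
proof -
  have s: "hs_summable L 0 v" "hs L 0 v \<le> (1 / kap1 ^ 2)\<^sup>2 * hs L 2 v"
    using hs_down[of 0 2 v] assms by auto
  have s2: "hs_summable L (0 + 2) v" using assms by simp
  note B = ls_bound[OF s(1) s2 order_refl]
  show "ls_summable L 0 v" by (rule B(1))
  have "(ls L 0 v)\<^sup>2 \<le> 2 * clat * (kap1\<^sup>2 * hs L 0 v + hs L 2 v / kap1\<^sup>2)" using B(2) by simp
  also have "\<dots> \<le> 2 * clat * (kap1\<^sup>2 * ((1 / kap1 ^ 2)\<^sup>2 * hs L 2 v) + hs L 2 v / kap1\<^sup>2)"
    using s(2) clat_pos by (intro mult_left_mono add_mono) auto
  also have "\<dots> = csob * hs L 2 v" using kap1_pos by (simp add: csob_def field_simps power2_eq_square)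
  finally show "(ls L 0 v)\<^sup>2 \<le> csob * hs L 2 v" .
qed

lemma ls0_interp:
  assumes "\<epsilon> > 0"
  obtains C where "C \<ge> 0" "\<And>v. hs_summable L 0 v \<Longrightarrow> hs_summable L 3 v \<Longrightarrow> (ls L 0 v)\<^sup>2 \<le> \<epsilon> * hs L 3 v + C * hs L 0 v"
proof -
  define \<theta> where "\<theta> = \<epsilon> * kap1\<^sup>2 / (2 * clat)"
  have \<theta>: "\<theta> > 0" using assms clat_pos kap1_pos by (simp add: \<theta>_def)
  have "(ls L 0 v)\<^sup>2 \<le> \<epsilon> * hs L 3 v + 2 * clat * (kap1\<^sup>2 + 1 / \<theta>\<^sup>2 / kap1\<^sup>2) * hs L 0 v"
    if s: "hs_summable L 0 v" "hs_summable L 3 v" for v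
  proof -
    have s2: "hs_summable L (0 + 2) v" using hs_interp(1)[OF s \<theta>] by simp
    have "(ls L 0 v)\<^sup>2 \<le> 2 * clat * (kap1\<^sup>2 * hs L 0 v + hs L 2 v / kap1\<^sup>2)"
      using ls_bound(2)[OF s(1) s2 order_refl] by simp
    also have "\<dots> \<le> 2 * clat * (kap1\<^sup>2 * hs L 0 v + (\<theta> * hs L 3 v + 1 / \<theta>\<^sup>2 * hs L 0 v) / kap1\<^sup>2)"
      using hs_interp(3)[OF s \<theta>] clat_pos by (intro mult_left_mono add_mono divide_right_mono) auto
    also have "\<dots> = 2 * clat * \<theta> / kap1\<^sup>2 * hs L 3 v + 2 * clat * (kap1\<^sup>2 + 1 / \<theta>\<^sup>2 / kap1\<^sup>2) * hs L 0 v"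
      by (simp add: add_divide_distrib algebra_simps)
    also have "2 * clat * \<theta> / kap1\<^sup>2 = \<epsilon>" using clat_pos kap1_pos by (simp add: \<theta>_def)
    finally show ?thesis .
  qed
  then show ?thesis using clat_pos by (intro that[of "2 * clat * (kap1\<^sup>2 + 1 / \<theta>\<^sup>2 / kap1\<^sup>2)"]) auto
qed

lemma ls1_interp:
  assumes "\<epsilon> > 0"
  obtains C where "C \<ge> 0" "\<And>v. hs_summable L 0 v \<Longrightarrow> hs_summable L 3 v \<Longrightarrow> ls_summable L 1 v \<and> (ls L 1 v)\<^sup>2 \<le> \<epsilon> * hs L 3 v + C * hs L 0 v"
proof -
  \<comment> \<open>The norm of order 3 enters \<open>ls_bound\<close> directly with the factor
    \<open>2 clat / T\<close>, so \<open>T\<close> is taken large first. Then \<theta> is chosen to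
    undo the factor \<open>T\<close> in front of \<open>hs L 1 v\<close>.\<close>
  define T where "T = max (kap1\<^sup>2) (4 * clat / \<epsilon>)"
  have T: "T \<ge> kap1\<^sup>2" "T > 0" "T \<ge> 4 * clat / \<epsilon>"
    using kap1_pos by (auto simp: T_def less_max_iff_disj)
  have T\<epsilon>: "2 * clat / T \<le> \<epsilon> / 2" using T(2,3) assms by (simp add: field_simps)
  define \<theta> where "\<theta> = \<epsilon> / (4 * clat * T)"
  have \<theta>: "\<theta> > 0" using assms clat_pos T by (simp add: \<theta>_def)
  define C where "C = 2 * clat * T * (1 + 1 / \<theta>\<^sup>2)"
  have "ls_summable L 1 v \<and> (ls L 1 v)\<^sup>2 \<le> \<epsilon> * hs L 3 v + C * hs L 0 v"
    if s: "hs_summable L 0 v" "hs_summable L 3 v" for v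
  proof -
    have s1: "hs_summable L 1 v" using hs_interp(2)[OF s \<theta>] .
    have s3: "hs_summable L (1 + 2) v" using s by (simp)
    note B = ls_bound[OF s1 s3 T(1)]
    have "(ls L 1 v)\<^sup>2 \<le> 2 * clat * (T * hs L 1 v + hs L 3 v / T)" using B(2) by (simp)
    also have "\<dots> \<le> 2 * clat * (T * (\<theta> * hs L 3 v + (1 + 1 / \<theta>\<^sup>2) * hs L 0 v) + hs L 3 v / T)"
      using hs_interp(4)[OF s \<theta>] clat_pos T by (intro mult_left_mono add_mono) auto
    also have "\<dots> = (2 * clat * T * \<theta> + 2 * clat / T) * hs L 3 v + C * hs L 0 v"
      by (simp add: C_def algebra_simps)
    also have "\<dots> \<le> (\<epsilon> / 2 + \<epsilon> / 2) * hs L 3 v + C * hs L 0 v"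
      using T\<epsilon> clat_pos T by (intro add_right_mono mult_right_mono) (auto simp: \<theta>_def)
    finally show ?thesis using B(1) by simp
  qed
  then show ?thesis using clat_pos T by (intro that[of C]) (auto simp: C_def)
qed

text \<open>The two products that the quadratic term produces are scale invariant: they are controlled
  by the dissipation as soon as the energy is small.\<close>

lemma critical_products:
  assumes s: "hs_summable L 0 v" "hs_summable L 3 v" and v0: "v 0 = 0"
  shows "(ls L 1 v)\<^sup>2 * hs L 1 v \<le> 4 * clat * (hs L 0 v * hs L 3 v)"
    and "(ls L 0 v)\<^sup>2 * hs L 2 v \<le> 4 * clat * (hs L 0 v * hs L 3 v)"
proof -
  have s1: "hs_summable L 1 v" and s2: "hs_summable L 2 v" using hs_interp[OF s, of 1] by auto
  let ?h = "\<lambda>m. hs L m v"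
  have l1: "(?h 1)\<^sup>2 \<le> ?h 0 * ?h 2" using hs_log_convex(2)[of L 0 v] s s2 by (simp)
  have l2: "(?h 2)\<^sup>2 \<le> ?h 1 * ?h 3" using hs_log_convex(2)[of L 1 v] s s1 by (simp)
  have gen: "(ls L m v)\<^sup>2 \<le> 4 * clat * sqrt (?h m * ?h (m + 2))" if sm: "hs_summable L m v" "hs_summable L (m + 2) v" and pos: "?h m > 0" for m
  proof -
    \<comment> \<open>The value that makes the two terms of \<open>ls_bound\<close> equal; Poincare
      shows that it is admissible.\<close>
    define T where "T = sqrt (?h (m + 2) / ?h m)"
    have "kap1 ^ 4 * ?h m \<le> ?h (m + 2)"
      using hs_down(2)[OF sm(2) v0] kap1_pos by (simp add: field_simps power2_eq_square power4_eq_xxxx)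
    then have q: "(kap1\<^sup>2)\<^sup>2 \<le> ?h (m + 2) / ?h m" using pos by (simp add: field_simps flip: power_mult)
    then have T: "T \<ge> kap1\<^sup>2" unfolding T_def by (rule real_le_rsqrt)
    have T0: "T > 0" using T kap1_pos by (meson less_le_trans zero_less_power)
    have p2: "?h (m + 2) > 0" using q pos kap1_pos by (smt (verit) divide_nonpos_pos zero_less_power)
    have e1: "T * ?h m = sqrt (?h m * ?h (m + 2))"
      unfolding T_def using pos p2 by (simp add: real_sqrt_divide real_sqrt_mult real_div_sqrt field_simps)
    have e2: "?h (m + 2) / T = sqrt (?h m * ?h (m + 2))"
      unfolding T_def using pos p2 by (simp add: real_sqrt_divide real_sqrt_mult real_div_sqrt field_simps)
    show ?thesis using ls_bound(2)[OF sm T] unfolding e1 e2 by simp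
  qed
  have fin: "sqrt (x * y) * x \<le> h0 * h3" if "x ^ 3 * y \<le> (h0 * h3)\<^sup>2" "x \<ge> 0" "h0 \<ge> 0" "h3 \<ge> 0" for x y h0 h3 :: real
  proof -
    have "sqrt (x * y) * x = sqrt (x ^ 3 * y)"
      using that(2) by (simp add: real_sqrt_mult power3_eq_cube)
    also have "\<dots> \<le> sqrt ((h0 * h3)\<^sup>2)" using that(1) by (rule real_sqrt_le_mono)
    also have "\<dots> = h0 * h3" using that by simp
    finally show ?thesis .
  qed
  have cancel: "x ^ 3 \<le> B" if "x ^ 4 \<le> B * x" "x \<ge> 0" "B \<ge> 0" for x B :: real
  proof (cases "x = 0")
    case False
    then have "x > 0" using that by simp
    moreover have "x ^ 3 * x \<le> B * x" using that(1) by (simp add: power4_eq_xxxx power3_eq_cube)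
    ultimately show ?thesis by simp
  qed (use that in auto)
  show "(ls L 1 v)\<^sup>2 * ?h 1 \<le> 4 * clat * (?h 0 * ?h 3)"
  proof (cases "?h 1 = 0")
    case True
    then show ?thesis using clat_pos by simp
  next
    case False
    then have pos: "?h 1 > 0" using hs_nonneg[of L 1 v] by linarith
    \<comment> \<open>Log-convexity eliminates the index 2:
      \<open>h1^4 \<le> h0^2 h2^2 \<le> h0^2 h1 h3\<close>, and one factor \<open>h1\<close>
      cancels.\<close>
    have "(?h 1) ^ 4 \<le> (?h 0 * ?h 2)\<^sup>2" using power_mono[OF l1, of 2] by (simp flip: power_mult)
    also have "\<dots> = (?h 0)\<^sup>2 * (?h 2)\<^sup>2" by (simp add: power_mult_distrib)
    also have "\<dots> \<le> (?h 0)\<^sup>2 * (?h 1 * ?h 3)" by (intro mult_left_mono l2) auto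
    also have "\<dots> = (?h 0)\<^sup>2 * ?h 3 * ?h 1" by simp
    finally have c: "(?h 1) ^ 3 \<le> (?h 0)\<^sup>2 * ?h 3" by (rule cancel) auto
    have "(?h 1) ^ 3 * ?h 3 \<le> (?h 0 * ?h 3)\<^sup>2"
      using mult_right_mono[OF c, of "?h 3"] by (simp add: power2_eq_square algebra_simps)
    then have f: "sqrt (?h 1 * ?h 3) * ?h 1 \<le> ?h 0 * ?h 3" by (rule fin) auto
    have "(ls L 1 v)\<^sup>2 \<le> 4 * clat * sqrt (?h 1 * ?h 3)" using gen[of 1] s s1 pos by (simp)
    then have "(ls L 1 v)\<^sup>2 * ?h 1 \<le> 4 * clat * sqrt (?h 1 * ?h 3) * ?h 1" by (rule mult_right_mono) auto
    also have "\<dots> \<le> 4 * clat * (?h 0 * ?h 3)" using f clat_pos by (simp add: mult.assoc)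
    finally show ?thesis .
  qed
  show "(ls L 0 v)\<^sup>2 * ?h 2 \<le> 4 * clat * (?h 0 * ?h 3)"
  proof (cases "?h 0 = 0 \<or> ?h 2 = 0")
    case True
    then show ?thesis
    proof
      assume z: "?h 0 = 0"
      then have "?h 1 = 0" using l1 by simp
      then have "?h 2 = 0" using l2 by simp
      then show ?thesis using clat_pos by simp
    qed (use clat_pos in simp)
  next
    case False
    then have pos: "?h 0 > 0" using hs_nonneg[of L 0 v] by linarith
    \<comment> \<open>The mirror image of the chain above now eliminates the index 1.\<close>
    have "(?h 2) ^ 4 \<le> (?h 1 * ?h 3)\<^sup>2" using power_mono[OF l2, of 2] by (simp flip: power_mult)
    also have "\<dots> = (?h 1)\<^sup>2 * (?h 3)\<^sup>2" by (simp add: power_mult_distrib)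
    also have "\<dots> \<le> ?h 0 * ?h 2 * (?h 3)\<^sup>2" by (intro mult_right_mono l1) auto
    also have "\<dots> = ?h 0 * (?h 3)\<^sup>2 * ?h 2" by simp
    finally have c: "(?h 2) ^ 3 \<le> ?h 0 * (?h 3)\<^sup>2" by (rule cancel) auto
    have "(?h 2) ^ 3 * ?h 0 \<le> (?h 0 * ?h 3)\<^sup>2"
      using mult_right_mono[OF c, of "?h 0"] by (simp add: power2_eq_square algebra_simps)
    then have f: "sqrt (?h 2 * ?h 0) * ?h 2 \<le> ?h 0 * ?h 3" by (rule fin) auto
    have "(ls L 0 v)\<^sup>2 \<le> 4 * clat * sqrt (?h 2 * ?h 0)" using gen[of 0] s s2 pos by (simp add: mult.commute)
    then have "(ls L 0 v)\<^sup>2 * ?h 2 \<le> 4 * clat * sqrt (?h 2 * ?h 0) * ?h 2" by (rule mult_right_mono) auto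
    also have "\<dots> \<le> 4 * clat * (?h 0 * ?h 3)" using f clat_pos by (simp add: mult.assoc)
    finally show ?thesis .
  qed
qed

text \<open>All that is used of the reference field at one time. A single number \<rho> bounds its
  Wiener norm and its norms of order 1 and 2, so that later constants depend on the reference
  solution through \<rho> only.\<close>

definition ref_coefs :: "real \<Rightarrow> (int \<times> int \<Rightarrow> complex) \<Rightarrow> bool" where
  "ref_coefs \<rho> a \<longleftrightarrow> real_coefs a \<and> hs_summable L 0 a \<and> hs_summable L 1 a \<and> hs_summable L 2 a \<and>
     ls_summable L 0 a \<and> ls L 0 a \<le> \<rho> \<and> hs L 1 a \<le> \<rho>\<^sup>2 \<and> hs L 2 a \<le> \<rho>\<^sup>2"

lemma ref_coefsD:
  assumes "ref_coefs \<rho> a"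
  shows "real_coefs a" "hs_summable L 0 a" "hs_summable L 1 a" "hs_summable L 2 a" "ls_summable L 0 a"
    "ls L 0 a \<le> \<rho>" "hs L 1 a \<le> \<rho>\<^sup>2" "hs L 2 a \<le> \<rho>\<^sup>2" "(ls L 0 a)\<^sup>2 \<le> \<rho>\<^sup>2" "0 \<le> \<rho>"
proof -
  show "real_coefs a" "hs_summable L 0 a" "hs_summable L 1 a" "hs_summable L 2 a" "ls_summable L 0 a"
    "ls L 0 a \<le> \<rho>" "hs L 1 a \<le> \<rho>\<^sup>2" "hs L 2 a \<le> \<rho>\<^sup>2" using assms by (auto simp: ref_coefs_def)
  then show "(ls L 0 a)\<^sup>2 \<le> \<rho>\<^sup>2" "0 \<le> \<rho>"
    using ls_nonneg[of L 0 a] order_trans[OF ls_nonneg[of L 0 a]] by (auto intro: power_mono)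
qed

text \<open>In the terms linear in \<open>v\<close>, interpolation provides any fraction of the
  dissipation norm \<open>hs L 3 v\<close>. The quadratic term scales exactly like the dissipation
  and leaves no such freedom: \<open>critical_products\<close> bounds it by \<open>hs L 0 v\<close>
  times that norm. This is the origin of the threshold \<kappa>.\<close>

lemma pert_hs1:
  assumes "\<eta> > 0"
  obtains C \<kappa> where "C \<ge> 0" "\<kappa> > 0"
    "\<And>a v. ref_coefs \<rho> a \<Longrightarrow> v 0 = 0 \<Longrightarrow> hs_summable L 0 v \<Longrightarrow> hs_summable L 3 v \<Longrightarrow> hs L 0 v \<le> \<kappa> \<Longrightarrow>
      hs_summable L 1 (pert L a v) \<and> hs L 1 (pert L a v) \<le> \<eta> * hs L 3 v + C * hs L 0 v"
proof -
  define q where "q = \<rho>\<^sup>2 + 1"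
  have pp: "q > 0" by (simp add: q_def add_nonneg_pos)
  \<comment> \<open>The interpolated norms occur with total weight \<open>12 + 6 + 6 = 24\<close>
    times \<open>\<rho>^2\<close>; this \<epsilon> grants them half of \<eta> and keeps the other
    half for the quadratic term. The 1 in \<open>q\<close> covers \<open>\<rho> = 0\<close>.\<close>
  define \<epsilon> where "\<epsilon> = \<eta> / 48 / q"
  have \<epsilon>: "\<epsilon> > 0" using assms pp by (simp add: \<epsilon>_def)
  have "\<epsilon> * \<rho>\<^sup>2 \<le> \<epsilon> * q" using \<epsilon> by (simp add: q_def)
  also have "\<dots> = \<eta> / 48" using pp unfolding \<epsilon>_def by simp
  finally have \<epsilon>\<eta>: "24 * \<rho>\<^sup>2 * \<epsilon> \<le> \<eta> / 2" by (simp add: ac_simps)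
  obtain C1 where C1: "C1 \<ge> 0" "\<And>v. hs_summable L 0 v \<Longrightarrow> hs_summable L 3 v \<Longrightarrow> ls_summable L 1 v \<and> (ls L 1 v)\<^sup>2 \<le> \<epsilon> * hs L 3 v + C1 * hs L 0 v"
    using ls1_interp[OF \<epsilon>] by metis
  obtain C0 where C0: "C0 \<ge> 0" "\<And>v. hs_summable L 0 v \<Longrightarrow> hs_summable L 3 v \<Longrightarrow> (ls L 0 v)\<^sup>2 \<le> \<epsilon> * hs L 3 v + C0 * hs L 0 v"
    using ls0_interp[OF \<epsilon>] by metis
  define \<kappa> where "\<kappa> = \<eta> / (96 * clat)"
  have \<kappa>: "\<kappa> > 0" using assms clat_pos by (simp add: \<kappa>_def)
  define C where "C = \<rho>\<^sup>2 * (12 * C1 + 6 / \<epsilon>\<^sup>2 + 6 * C0)"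
  have main: "hs_summable L 1 (pert L a v) \<and> hs L 1 (pert L a v) \<le> \<eta> * hs L 3 v + C * hs L 0 v"
    if a: "ref_coefs \<rho> a" and v0: "v 0 = 0" and s: "hs_summable L 0 v" "hs_summable L 3 v" and sm: "hs L 0 v \<le> \<kappa>" for a v
  proof -
    note A = ref_coefsD[OF a]
    have s1: "hs_summable L 1 v" and s2: "hs_summable L 2 v" using hs_interp[OF s, of 1] by auto
    have l0: "ls_summable L 0 v" by (rule ls0_bound(1)[OF s2 v0])
    have l1: "ls_summable L 1 v" "(ls L 1 v)\<^sup>2 \<le> \<epsilon> * hs L 3 v + C1 * hs L 0 v" using C1(2)[OF s] by auto
    note X0 = C0(2)[OF s]
    note X2 = hs_interp(3)[OF s \<epsilon>]
    note B1 = advect_hs1_right[OF A(5,3) s1 s2 l1(1)]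
    note B2 = advect_hs1_left[OF l0 l1(1) A(3,4)]
    note B3 = advect_hs1_left[OF l0 l1(1) s1 s2]
    note S = hs_sum3[OF B1(1) B2(1) B3(1), folded pert_def[abs_def]]
    note crit = critical_products[OF s v0]
    have "hs L 1 (pert L a v) \<le> 3 * (2 * ((ls L 1 v)\<^sup>2 * hs L 1 a + (ls L 0 a)\<^sup>2 * hs L 2 v) +
        2 * ((ls L 1 v)\<^sup>2 * hs L 1 a + (ls L 0 v)\<^sup>2 * hs L 2 a) +
        2 * ((ls L 1 v)\<^sup>2 * hs L 1 v + (ls L 0 v)\<^sup>2 * hs L 2 v))"
      using S(2) B1(2) B2(2) B3(2) unfolding pert_def[abs_def] by argo
    also have "\<dots> \<le> 3 * (2 * ((ls L 1 v)\<^sup>2 * \<rho>\<^sup>2 + \<rho>\<^sup>2 * hs L 2 v) + 2 * ((ls L 1 v)\<^sup>2 * \<rho>\<^sup>2 + (ls L 0 v)\<^sup>2 * \<rho>\<^sup>2) +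
        2 * (4 * clat * (hs L 0 v * hs L 3 v) + 4 * clat * (hs L 0 v * hs L 3 v)))"
      by (intro mult_left_mono add_mono mult_right_mono A crit) auto
    also have "\<dots> = \<rho>\<^sup>2 * (12 * (ls L 1 v)\<^sup>2 + 6 * hs L 2 v + 6 * (ls L 0 v)\<^sup>2) + 48 * clat * (hs L 0 v * hs L 3 v)"
      by (simp add: algebra_simps)
    also have "\<dots> \<le> \<rho>\<^sup>2 * (12 * (\<epsilon> * hs L 3 v + C1 * hs L 0 v) + 6 * (\<epsilon> * hs L 3 v + 1 / \<epsilon>\<^sup>2 * hs L 0 v) + 6 * (\<epsilon> * hs L 3 v + C0 * hs L 0 v))
        + 48 * clat * (\<kappa> * hs L 3 v)"
      using clat_pos by (intro add_mono mult_left_mono mult_right_mono l1 X2 X0 sm) auto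
    also have "\<dots> = (24 * \<rho>\<^sup>2 * \<epsilon> + 48 * clat * \<kappa>) * hs L 3 v + C * hs L 0 v"
      by (simp add: C_def algebra_simps)
    also have "\<dots> \<le> (\<eta> / 2 + \<eta> / 2) * hs L 3 v + C * hs L 0 v"
      using \<epsilon>\<eta> clat_pos by (intro add_right_mono mult_right_mono add_mono) (auto simp: \<kappa>_def)
    finally show ?thesis using S(1) by (simp add: pert_def[abs_def])
  qed
  have "C \<ge> 0" using C0(1) C1(1) by (simp add: C_def)
  then show ?thesis using \<kappa> main by (rule that)
qed

lemma pert_hs0:
  assumes a: "ref_coefs \<rho> a" and l0: "ls_summable L 0 v" and s1: "hs_summable L 1 v"
  shows "hs_summable L 0 (pert L a v)"
    and "hs L 0 (pert L a v) \<le> 3 * (\<rho>\<^sup>2 * hs L 1 v + (ls L 0 v)\<^sup>2 * \<rho>\<^sup>2 + (ls L 0 v)\<^sup>2 * hs L 1 v)"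
proof -
  note A = ref_coefsD[OF a]
  note B1 = advect_hs0[OF A(5) s1]
  note B2 = advect_hs0[OF l0 A(3)]
  note B3 = advect_hs0[OF l0 s1]
  note S = hs_sum3[OF B1(1) B2(1) B3(1)]
  show "hs_summable L 0 (pert L a v)" using S(1) by (simp add: pert_def[abs_def])
  have "hs L 0 (pert L a v) \<le> 3 * ((ls L 0 a)\<^sup>2 * hs L 1 v + (ls L 0 v)\<^sup>2 * hs L 1 a + (ls L 0 v)\<^sup>2 * hs L 1 v)"
    using S(2) B1(2) B2(2) B3(2) unfolding pert_def[abs_def] by argo
  also have "\<dots> \<le> 3 * (\<rho>\<^sup>2 * hs L 1 v + (ls L 0 v)\<^sup>2 * \<rho>\<^sup>2 + (ls L 0 v)\<^sup>2 * hs L 1 v)"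
    by (intro mult_left_mono add_mono mult_right_mono A order_refl) auto
  finally show "hs L 0 (pert L a v) \<le> 3 * (\<rho>\<^sup>2 * hs L 1 v + (ls L 0 v)\<^sup>2 * \<rho>\<^sup>2 + (ls L 0 v)\<^sup>2 * hs L 1 v)" .
qed

text \<open>A crude bound for \<open>v\<close> of any size, meant for domination in time. The power
  2 is tolerable because Young's inequality in \<open>energy_dominated\<close> divides it by
  \<open>1 + hs L 2 v\<close>.\<close>

lemma pert_hs0_growth:
  obtains C where "C \<ge> 0"
    "\<And>a v. ref_coefs \<rho> a \<Longrightarrow> v 0 = 0 \<Longrightarrow> hs_summable L 2 v \<Longrightarrow> hs L 0 (pert L a v) \<le> C * (1 + hs L 2 v)\<^sup>2"
proof -
  define d where "d = (1 / kap1 ^ 1)\<^sup>2"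
  define C where "C = 3 * (\<rho>\<^sup>2 * d + csob * \<rho>\<^sup>2 + csob * d)"
  have "hs L 0 (pert L a v) \<le> C * (1 + hs L 2 v)\<^sup>2" if a: "ref_coefs \<rho> a" and v0: "v 0 = 0" and s: "hs_summable L 2 v" for a v
  proof -
    have s': "hs_summable L (1 + 1) v" using s by (simp)
    note D = hs_down[OF s' v0, folded d_def]
    note l = ls0_bound[OF s v0]
    let ?h = "1 + hs L 2 v"
    have h1: "1 \<le> ?h" by simp
    have h2: "hs L 2 v \<le> ?h" by simp
    have d1: "hs L 1 v \<le> d * ?h" using D(2) mult_left_mono[OF h2, of d] by (simp add: d_def)
    have d2: "(ls L 0 v)\<^sup>2 \<le> csob * ?h" using l(2) mult_left_mono[OF h2 csob_nonneg] by simp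
    have hh: "?h \<le> ?h\<^sup>2" using mult_left_mono[OF h1, of ?h] by (simp add: power2_eq_square)
    have d0: "d \<ge> 0" by (simp add: d_def)
    have "hs L 0 (pert L a v) \<le> 3 * (\<rho>\<^sup>2 * hs L 1 v + (ls L 0 v)\<^sup>2 * \<rho>\<^sup>2 + (ls L 0 v)\<^sup>2 * hs L 1 v)"
      by (rule pert_hs0(2)[OF a l(1) D(1)])
    also have "\<dots> \<le> 3 * (\<rho>\<^sup>2 * (d * ?h) + csob * ?h * \<rho>\<^sup>2 + csob * ?h * (d * ?h))"
      using csob_nonneg d0 h1 by (intro mult_left_mono add_mono mult_mono d1 d2) auto
    also have "\<dots> \<le> 3 * (\<rho>\<^sup>2 * (d * ?h\<^sup>2) + csob * ?h\<^sup>2 * \<rho>\<^sup>2 + csob * ?h * (d * ?h))"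
      using csob_nonneg d0 by (intro mult_left_mono add_mono mult_right_mono hh) auto
    also have "\<dots> = C * ?h\<^sup>2" by (simp add: C_def power2_eq_square algebra_simps)
    finally show ?thesis .
  qed
  then show ?thesis using csob_nonneg by (intro that[of C]) (auto simp: C_def d_def)
qed

end

section \<open>Energy balances of the perturbation equation\<close>

lemma Young_weighted: "\<theta> > 0 \<Longrightarrow> 2 * x * y \<le> \<theta> * x\<^sup>2 + y\<^sup>2 / (\<theta> :: real)"
proof -
  assume \<theta>: "\<theta> > 0"
  have "0 \<le> (\<theta> * x - y)\<^sup>2 / \<theta>" using \<theta> by simp
  also have "\<dots> = \<theta> * x\<^sup>2 + y\<^sup>2 / \<theta> - 2 * x * y"
    using \<theta> by (simp add: power2_diff power_mult_distrib field_simps power2_eq_square)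
  finally show ?thesis by simp
qed

lemma Re_cnj_mult_le: "2 * Re (cnj z * w) \<le> 2 * cmod z * cmod w"
  using complex_Re_le_cmod[of "cnj z * w"] by (simp add: norm_mult)

lemma infsum_lincomb:
  fixes f g :: "'a \<Rightarrow> real"
  assumes "f summable_on A" "g summable_on A"
  shows "(\<lambda>x. c * f x + d * g x) summable_on A"
    and "(\<Sum>\<^sub>\<infinity>x\<in>A. c * f x + d * g x) = c * infsum f A + d * infsum g A"
  using infsum_add[OF summable_on_cmult_right[OF assms(1), of c] summable_on_cmult_right[OF assms(2), of d]]
  by (auto intro!: summable_on_add summable_on_cmult_right assms simp: infsum_cmult_right')

lemma Re_cnj_self: "Re (cnj z * (- of_real c * z)) = - c * (cmod z)\<^sup>2"
  by (simp add: cmod_power2) (simp add: power2_eq_square algebra_simps)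

context torus_domain begin

text \<open>The time derivative of the squared modulus of \<open>z k\<close> along the error
  equation, when \<open>z\<close> differs from \<open>v\<close> by a field that is constant in
  time.\<close>

definition edens :: "real \<Rightarrow> (int \<times> int \<Rightarrow> complex) \<Rightarrow> (int \<times> int \<Rightarrow> complex) \<Rightarrow> (int \<times> int \<Rightarrow> complex) \<Rightarrow> int \<times> int \<Rightarrow> real" where
  "edens \<nu> a v z k = 2 * Re (cnj (z k) * (- of_real (\<nu> * (kap L k)\<^sup>2) * v k - pert L a v k))"

text \<open>Young's inequality with the weight \<open>1 + hs L 2 v\<close> leaves a majorant that is
  linear in \<open>hs L 2 v\<close>, hence integrable in time as long as \<open>hs L 0 z\<close> is
  bounded. It permits the passage from finitely many modes to all of them.\<close>

lemma energy_dominated: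
  assumes \<nu>: "\<nu> > 0"
  obtains C where "C \<ge> 0"
    "\<And>a v z. ref_coefs \<rho> a \<Longrightarrow> v 0 = 0 \<Longrightarrow> hs_summable L 2 v \<Longrightarrow> hs_summable L 0 z \<Longrightarrow>
      (\<lambda>k. \<bar>edens \<nu> a v z k\<bar>) summable_on UNIV \<and>
      (\<Sum>\<^sub>\<infinity>k. \<bar>edens \<nu> a v z k\<bar>) \<le> (1 + hs L 2 v) * (hs L 0 z + C)"
proof -
  obtain C where C: "C \<ge> 0" "\<And>a v. ref_coefs \<rho> a \<Longrightarrow> v 0 = 0 \<Longrightarrow> hs_summable L 2 v \<Longrightarrow> hs L 0 (pert L a v) \<le> C * (1 + hs L 2 v)\<^sup>2"
    using pert_hs0_growth by metis
  have "(\<lambda>k. \<bar>edens \<nu> a v z k\<bar>) summable_on UNIV \<and>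
      (\<Sum>\<^sub>\<infinity>k. \<bar>edens \<nu> a v z k\<bar>) \<le> (1 + hs L 2 v) * (hs L 0 z + (2 * \<nu>\<^sup>2 + 2 * C))"
    if a: "ref_coefs \<rho> a" and v0: "v 0 = 0" and s: "hs_summable L 2 v" and z: "hs_summable L 0 z" for a v z
  proof -
    define th where "th = 1 + hs L 2 v"
    have \<theta>: "th > 0" "th \<ge> 1" "hs L 2 v \<le> th" using hs_nonneg[of L 2 v] unfolding th_def by linarith+
    have s': "hs_summable L (1 + 1) v" using s by (simp only: one_add_one)
    have s1: "hs_summable L 1 v" by (rule hs_down(1)[OF s' v0])
    have sp: "hs_summable L 0 (pert L a v)" by (rule pert_hs0(1)[OF a ls0_bound(1)[OF s v0] s1])
    let ?g = "\<lambda>k. th * (cmod (z k))\<^sup>2 + (2 * \<nu>\<^sup>2 / th * (kap L k ^ 2 * cmod (v k))\<^sup>2 + 2 / th * (cmod (pert L a v k))\<^sup>2)"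
    have sg: "?g summable_on UNIV"
      using s z sp by (intro summable_on_add summable_on_cmult_right) (auto simp: hs_summable_def)
    have ig: "infsum ?g UNIV = th * hs L 0 z + (2 * \<nu>\<^sup>2 / th * hs L 2 v + 2 / th * hs L 0 (pert L a v))"
    proof -
      note f = z[unfolded hs0_summable_iff] s[unfolded hs_summable_def] sp[unfolded hs0_summable_iff]
      note i = infsum_lincomb[OF f(2,3), of "2 * \<nu>\<^sup>2 / th" "2 / th"]
      show ?thesis
        using infsum_add[OF summable_on_cmult_right[OF f(1), of th] i(1)] i(2)
        by (simp add: infsum_cmult_right' hs0_eq hs_def[of L 2])
    qed
    have le: "\<bar>edens \<nu> a v z k\<bar> \<le> ?g k" for k
    proof -
      let ?w = "- of_real (\<nu> * (kap L k)\<^sup>2) * v k - pert L a v k"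
      have "\<bar>edens \<nu> a v z k\<bar> \<le> 2 * cmod (z k) * cmod ?w"
        unfolding edens_def using abs_Re_le_cmod[of "cnj (z k) * ?w"] by (simp add: norm_mult)
      also have "\<dots> \<le> th * (cmod (z k))\<^sup>2 + (cmod ?w)\<^sup>2 / th" by (rule Young_weighted[OF \<theta>(1)])
      also have "(cmod ?w)\<^sup>2 \<le> (\<nu> * (kap L k ^ 2 * cmod (v k)) + cmod (pert L a v k))\<^sup>2"
        using norm_triangle_ineq4[of "- of_real (\<nu> * (kap L k)\<^sup>2) * v k" "pert L a v k"] \<nu>
        by (intro power_mono) (auto simp: norm_mult norm_power)
      also have "\<dots> \<le> 2 * (\<nu> * (kap L k ^ 2 * cmod (v k)))\<^sup>2 + 2 * (cmod (pert L a v k))\<^sup>2"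
        using sum_squares_bound[of "\<nu> * (kap L k ^ 2 * cmod (v k))" "cmod (pert L a v k)"] by (simp add: power2_sum)
      also have "(\<nu> * (kap L k ^ 2 * cmod (v k)))\<^sup>2 = \<nu>\<^sup>2 * (kap L k ^ 2 * cmod (v k))\<^sup>2" by (rule power_mult_distrib)
      finally show ?thesis using \<theta>(1) by (simp add: divide_right_mono add_divide_distrib)
    qed
    have "(\<Sum>\<^sub>\<infinity>k. \<bar>edens \<nu> a v z k\<bar>) \<le> infsum ?g UNIV" by (rule infsum_mono_real(2)[OF sg le]) auto
    also have "\<dots> \<le> th * hs L 0 z + (2 * \<nu>\<^sup>2 / th * hs L 2 v + 2 / th * (C * th\<^sup>2))"
      unfolding ig using \<theta> C(2)[OF a v0 s, folded th_def] by (intro add_left_mono mult_left_mono) auto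
    also have "2 * \<nu>\<^sup>2 / th * hs L 2 v \<le> 2 * \<nu>\<^sup>2 * th"
    proof -
      have "2 * \<nu>\<^sup>2 / th * hs L 2 v \<le> 2 * \<nu>\<^sup>2 / 1 * th"
        using \<theta> by (intro mult_mono divide_left_mono) auto
      then show ?thesis by simp
    qed
    also have "2 / th * (C * th\<^sup>2) = 2 * C * th" using \<theta>(1) by (simp add: power2_eq_square)
    finally show ?thesis using infsum_mono_real(1)[OF sg le] by (simp add: th_def[symmetric] algebra_simps)
  qed
  then show ?thesis using C(1) by (intro that[of "2 * \<nu>\<^sup>2 + 2 * C"]) auto
qed

text \<open>With \<open>w = a - v\<close>, the coefficients of the approximating solution, the
  nonlinear term is \<open>B(w, z) + B(z, a - p)\<close> plus the perturbation term of
  \<open>p\<close> alone. The first part is skew in \<open>z\<close> and drops out, whatever the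
  size of \<open>w\<close>. The second has its derivative on the output mode and uses up the
  dissipation; what remains is a source. So the bound holds for errors of any size.\<close>

lemma energy_bound:
  assumes \<nu>: "\<nu> > 0" and \<tau>: "\<tau> > 0" and a: "ref_coefs \<rho> a" and v: "real_coefs v" "v 0 = 0" "hs_summable L 2 v"
    and p: "finite {n. p n \<noteq> 0}" "ls L 0 p \<le> M"
    and z: "\<And>n. v n = z n + p n"
    and es: "edens \<nu> a v z summable_on UNIV"
  shows "(\<Sum>\<^sub>\<infinity>k. edens \<nu> a v z k) \<le> ((\<rho> + M)\<^sup>2 / (2 * \<nu>) + 1 / \<tau>) * hs L 0 z +
     2 * \<tau> * (3 * (\<rho>\<^sup>2 * hs L 1 p + (ls L 0 p)\<^sup>2 * \<rho>\<^sup>2 + (ls L 0 p)\<^sup>2 * hs L 1 p) + \<nu>\<^sup>2 * hs L 2 p)"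
proof -
  note A = ref_coefsD[OF a]
  note P = finite_support_summable[OF p(1), of L]
  have s2: "hs_summable L (1 + 1) v" using v(3) by (simp only: one_add_one)
  have v1: "hs_summable L 1 v" by (rule hs_down(1)[OF s2 v(2)])
  have v0: "hs_summable L 0 v" using hs_down(1)[of 0 2 v] v by simp
  have vl: "ls_summable L 0 v" by (rule ls0_bound(1)[OF v(3,2)])
  have ze: "z = (\<lambda>n. v n - p n)" using z by (auto simp: fun_eq_iff)
  have ve: "v = (\<lambda>n. z n + p n)" using z by (auto simp: fun_eq_iff)
  have z0: "hs_summable L 0 z" and z1: "hs_summable L 1 z" unfolding ze by (intro hs_diff v0 v1 P)+
  define w where "w = (\<lambda>n. a n - v n)"
  have wl: "ls_summable L 0 w" unfolding w_def by (rule ls_diff(1)[OF A(5) vl])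
  have w0: "hs_summable L 0 w" unfolding w_def by (rule hs_diff(1)[OF A(2) v0])
  have wr: "real_coefs w" using A(1) v(1) by (simp add: w_def real_coefs_def)
  define b where "b = (\<lambda>n. a n - p n)"
  have bl: "ls_summable L 0 b" "ls L 0 b \<le> \<rho> + M"
    using ls_diff[OF A(5) P(2)] A(6) p(2) unfolding b_def by auto
  have b0: "hs_summable L 0 b" unfolding b_def by (intro hs_diff A P)
  have dec: "pert L a v k = advect L w z k + advect L z b k + pert L a p k" for k
  proof -
    have 1: "advect L a v k = advect L a z k + advect L a p k" unfolding ve by (rule advect_add_right[OF A(2) z0 P(1)])
    have 2: "advect L v a k = advect L z a k + advect L p a k" unfolding ve by (rule advect_add_left[OF z0 P(1) A(2)])
    have 3: "advect L v v k = advect L v z k + advect L v p k" by (subst (2) ve) (rule advect_add_right[OF v0 z0 P(1)])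
    have 4: "advect L v p k = advect L z p k + advect L p p k" by (subst ve) (rule advect_add_left[OF z0 P(1) P(1)])
    have 5: "advect L w z k = advect L a z k - advect L v z k" unfolding w_def by (rule advect_diff_left[OF A(2) v0 z0])
    have 6: "advect L z b k = advect L z a k - advect L z p k" unfolding b_def by (rule advect_diff_right[OF z0 A(2) P(1)])
    show ?thesis unfolding pert_def 1 2 3 4 5 6 by simp
  qed
  obtain c where c: "\<And>k. cmod (advect L z b k) \<le> kap L k * c k" "\<And>k. 0 \<le> c k"
    "(\<lambda>k. (c k)\<^sup>2) summable_on UNIV" "(\<Sum>\<^sub>\<infinity>k. (c k)\<^sup>2) \<le> (ls L 0 b)\<^sup>2 * hs L 0 z"
    using advect_conv_k[OF z0 bl(1)] by metis
  note G = pert_hs0[OF a P(2) P(1)]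
  note sk = advect_skew[OF wl wr z0 z1]
  let ?X = "\<lambda>k. (1 / (2 * \<nu>) * (c k)\<^sup>2 + 1 / \<tau> * (cmod (z k))\<^sup>2) + (2 * \<tau> * (cmod (pert L a p k))\<^sup>2 + 2 * \<tau> * \<nu>\<^sup>2 * (kap L k ^ 2 * cmod (p k))\<^sup>2)"
  let ?Y = "\<lambda>k. - 2 * Re (cnj (z k) * advect L w z k)"
  have le: "edens \<nu> a v z k \<le> ?X k + ?Y k" for k
  proof -
    let ?\<kappa> = "kap L k"
    have "edens \<nu> a v z k = 2 * Re (cnj (z k) * (- of_real (\<nu> * ?\<kappa>\<^sup>2) * z k)) + 2 * Re (cnj (z k) * (- of_real (\<nu> * ?\<kappa>\<^sup>2) * p k))
      + ?Y k + 2 * Re (cnj (z k) * (- advect L z b k)) + 2 * Re (cnj (z k) * (- pert L a p k))"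
      unfolding edens_def dec z by (simp add: algebra_simps)
    also have "2 * Re (cnj (z k) * (- of_real (\<nu> * ?\<kappa>\<^sup>2) * z k)) = - 2 * \<nu> * (?\<kappa> * cmod (z k))\<^sup>2"
      by (simp only: Re_cnj_self power_mult_distrib) simp
    also have "2 * Re (cnj (z k) * (- of_real (\<nu> * ?\<kappa>\<^sup>2) * p k)) \<le> 2 * cmod (z k) * (\<nu> * (?\<kappa> ^ 2 * cmod (p k)))"
      using Re_cnj_mult_le[of "z k" "- of_real (\<nu> * ?\<kappa>\<^sup>2) * p k"] \<nu> by (simp add: norm_mult norm_power)
    \<comment> \<open>The derivative on the output mode is paired with \<open>z k\<close>, and
      \<open>kap L k * cmod (z k)\<close> is the quantity that the dissipation controls.\<close>
    also have "2 * Re (cnj (z k) * (- advect L z b k)) \<le> 2 * (?\<kappa> * cmod (z k)) * c k"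
    proof -
      have "2 * Re (cnj (z k) * (- advect L z b k)) \<le> 2 * cmod (z k) * cmod (- advect L z b k)" by (rule Re_cnj_mult_le)
      also have "\<dots> \<le> 2 * cmod (z k) * (?\<kappa> * c k)" using c(1)[of k] by (intro mult_left_mono) auto
      finally show ?thesis by (simp add: ac_simps)
    qed
    also have "\<dots> \<le> 2 * \<nu> * (?\<kappa> * cmod (z k))\<^sup>2 + (c k)\<^sup>2 / (2 * \<nu>)" using \<nu> by (intro Young_weighted) auto
    also have "2 * Re (cnj (z k) * (- pert L a p k)) \<le> 2 * cmod (z k) * cmod (pert L a p k)"
      using Re_cnj_mult_le[of "z k" "- pert L a p k"] by simp
    finally have 1: "edens \<nu> a v z k \<le> (c k)\<^sup>2 / (2 * \<nu>) + ?Y k + 2 * cmod (z k) * (\<nu> * (?\<kappa> ^ 2 * cmod (p k)) + cmod (pert L a p k))"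
      by (simp add: algebra_simps)
    have "2 * cmod (z k) * (\<nu> * (?\<kappa> ^ 2 * cmod (p k)) + cmod (pert L a p k)) \<le>
       1 / \<tau> * (cmod (z k))\<^sup>2 + (\<nu> * (?\<kappa> ^ 2 * cmod (p k)) + cmod (pert L a p k))\<^sup>2 / (1 / \<tau>)"
      using \<tau> by (intro Young_weighted) auto
    also have "(\<nu> * (?\<kappa> ^ 2 * cmod (p k)) + cmod (pert L a p k))\<^sup>2 / (1 / \<tau>) \<le> (2 * (\<nu> * (?\<kappa> ^ 2 * cmod (p k)))\<^sup>2 + 2 * (cmod (pert L a p k))\<^sup>2) / (1 / \<tau>)"
      using sum_squares_bound[of "\<nu> * (?\<kappa> ^ 2 * cmod (p k))" "cmod (pert L a p k)"] \<tau>
      by (intro divide_right_mono) (auto simp: power2_sum)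
    finally show ?thesis using 1 by (simp add: power_mult_distrib algebra_simps)
  qed
  have sX1: "(\<lambda>k. 1 / (2 * \<nu>) * (c k)\<^sup>2 + 1 / \<tau> * (cmod (z k))\<^sup>2) summable_on UNIV"
    using c(3) z0 unfolding hs0_summable_iff by (intro summable_on_add summable_on_cmult_right)
  have sX2: "(\<lambda>k. 2 * \<tau> * (cmod (pert L a p k))\<^sup>2 + 2 * \<tau> * \<nu>\<^sup>2 * (kap L k ^ 2 * cmod (p k))\<^sup>2) summable_on UNIV"
    using G(1) P(1)[of 2] unfolding hs0_summable_iff unfolding hs_summable_def by (intro summable_on_add summable_on_cmult_right)
  have sX: "?X summable_on UNIV" by (intro summable_on_add sX1 sX2)
  have sR: "((\<lambda>k. Re (cnj (z k) * advect L w z k)) has_sum 0) UNIV"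
    using has_sum_Re[OF has_sum_infsum[OF sk(1)]] sk(2) by simp
  have sY: "(?Y has_sum 0) UNIV" using has_sum_cmult_right[OF sR, of "-2"] by simp
  have "(\<Sum>\<^sub>\<infinity>k. edens \<nu> a v z k) \<le> (\<Sum>\<^sub>\<infinity>k. ?X k + ?Y k)"
    by (rule infsum_mono[OF es summable_on_add[OF sX has_sum_imp_summable[OF sY]] le])
  also have "\<dots> = infsum ?X UNIV"
    using infsum_add[OF sX has_sum_imp_summable[OF sY]] infsumI[OF sY] by simp
  also have "\<dots> = (1 / (2 * \<nu>) * (\<Sum>\<^sub>\<infinity>k. (c k)\<^sup>2) + 1 / \<tau> * hs L 0 z) + (2 * \<tau> * hs L 0 (pert L a p) + 2 * \<tau> * \<nu>\<^sup>2 * hs L 2 p)"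
  proof -
    have i1: "(\<Sum>\<^sub>\<infinity>k. 1 / (2 * \<nu>) * (c k)\<^sup>2 + 1 / \<tau> * (cmod (z k))\<^sup>2) = 1 / (2 * \<nu>) * (\<Sum>\<^sub>\<infinity>k. (c k)\<^sup>2) + 1 / \<tau> * hs L 0 z"
      using c(3) z0 unfolding hs0_summable_iff hs0_eq by (subst infsum_add) (auto intro: summable_on_cmult_right simp only: infsum_cmult_right')
    have i2: "(\<Sum>\<^sub>\<infinity>k. 2 * \<tau> * (cmod (pert L a p k))\<^sup>2 + 2 * \<tau> * \<nu>\<^sup>2 * (kap L k ^ 2 * cmod (p k))\<^sup>2) = 2 * \<tau> * hs L 0 (pert L a p) + 2 * \<tau> * \<nu>\<^sup>2 * hs L 2 p"
      using G(1) P(1)[of 2] unfolding hs0_summable_iff hs0_eq unfolding hs_summable_def hs_def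
      by (subst infsum_add) (auto intro: summable_on_cmult_right simp only: infsum_cmult_right')
    show ?thesis using infsum_add[OF sX1 sX2] unfolding i1 i2 .
  qed
  also have "\<dots> \<le> (1 / (2 * \<nu>) * ((\<rho> + M)\<^sup>2 * hs L 0 z) + 1 / \<tau> * hs L 0 z) +
      (2 * \<tau> * (3 * (\<rho>\<^sup>2 * hs L 1 p + (ls L 0 p)\<^sup>2 * \<rho>\<^sup>2 + (ls L 0 p)\<^sup>2 * hs L 1 p)) + 2 * \<tau> * \<nu>\<^sup>2 * hs L 2 p)"
  proof -
    have "(ls L 0 b)\<^sup>2 \<le> (\<rho> + M)\<^sup>2" using bl(2) by (intro power_mono) auto
    then have "(\<Sum>\<^sub>\<infinity>k. (c k)\<^sup>2) \<le> (\<rho> + M)\<^sup>2 * hs L 0 z"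
      using c(4) by (meson hs_nonneg mult_right_mono order_trans)
    then show ?thesis using G(2) \<nu> \<tau> by (intro add_mono mult_left_mono) auto
  qed
  finally show ?thesis by (simp add: algebra_simps)
qed

text \<open>Of the dissipation \<open>2 \<nu>\<close>, Young's inequality spends one quarter on
  \<open>p\<close> and one quarter on the nonlinear term, which leaves \<nu>. The weight
  \<open>kap^4\<close> is split into \<open>kap^3\<close> on \<open>z\<close> and \<open>kap\<close>
  on the nonlinear term, hence \<open>hs L 1\<close>.\<close>

lemma energy2_finite_bound:
  assumes \<nu>: "\<nu> > 0" and K: "finite K" and z: "\<And>n. v n = z n + p n"
    and p: "hs_summable L 3 p" and N: "hs_summable L 1 (pert L a v)"
  shows "(\<Sum>k\<in>K. kap L k ^ 4 * edens \<nu> a v z k) \<le>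
    - \<nu> * (\<Sum>k\<in>K. (kap L k ^ 3 * cmod (z k))\<^sup>2) + 2 * \<nu> * hs L 3 p + 2 / \<nu> * hs L 1 (pert L a v)"
proof -
  have le: "kap L k ^ 4 * edens \<nu> a v z k \<le> - \<nu> * (kap L k ^ 3 * cmod (z k))\<^sup>2 +
      (2 * \<nu> * (kap L k ^ 3 * cmod (p k))\<^sup>2 + 2 / \<nu> * (kap L k ^ 1 * cmod (pert L a v k))\<^sup>2)" for k
  proof -
    let ?\<kappa> = "kap L k" and ?N = "pert L a v k"
    have "edens \<nu> a v z k = 2 * Re (cnj (z k) * (- of_real (\<nu> * ?\<kappa>\<^sup>2) * z k)) + 2 * Re (cnj (z k) * (- of_real (\<nu> * ?\<kappa>\<^sup>2) * p k))
      + 2 * Re (cnj (z k) * (- ?N))"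
      unfolding edens_def z by (simp add: algebra_simps)
    also have "2 * Re (cnj (z k) * (- of_real (\<nu> * ?\<kappa>\<^sup>2) * z k)) = - 2 * \<nu> * (?\<kappa> * cmod (z k))\<^sup>2"
      by (simp only: Re_cnj_self power_mult_distrib) simp
    also have "2 * Re (cnj (z k) * (- of_real (\<nu> * ?\<kappa>\<^sup>2) * p k)) \<le> 2 * cmod (z k) * (\<nu> * ?\<kappa> ^ 2 * cmod (p k))"
      using Re_cnj_mult_le[of "z k" "- of_real (\<nu> * ?\<kappa>\<^sup>2) * p k"] \<nu> by (simp add: norm_mult norm_power)
    also have "2 * Re (cnj (z k) * (- ?N)) \<le> 2 * cmod (z k) * cmod ?N"
      using Re_cnj_mult_le[of "z k" "- ?N"] by simp
    finally have "?\<kappa> ^ 4 * edens \<nu> a v z k \<le> ?\<kappa> ^ 4 * (- 2 * \<nu> * (?\<kappa> * cmod (z k))\<^sup>2 + 2 * cmod (z k) * (\<nu> * ?\<kappa> ^ 2 * cmod (p k)) + 2 * cmod (z k) * cmod ?N)"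
      by (intro mult_left_mono) auto
    also have "\<dots> = - 2 * \<nu> * (?\<kappa> ^ 3 * cmod (z k))\<^sup>2 + 2 * (?\<kappa> ^ 3 * cmod (z k)) * (\<nu> * (?\<kappa> ^ 3 * cmod (p k))) + 2 * (?\<kappa> ^ 3 * cmod (z k)) * (?\<kappa> * cmod ?N)"
      by (simp add: power_mult_distrib algebra_simps power2_eq_square power3_eq_cube power4_eq_xxxx)
    also have "2 * (?\<kappa> ^ 3 * cmod (z k)) * (\<nu> * (?\<kappa> ^ 3 * cmod (p k))) \<le> \<nu> / 2 * (?\<kappa> ^ 3 * cmod (z k))\<^sup>2 + (\<nu> * (?\<kappa> ^ 3 * cmod (p k)))\<^sup>2 / (\<nu> / 2)"
      using \<nu> by (intro Young_weighted) auto
    also have "2 * (?\<kappa> ^ 3 * cmod (z k)) * (?\<kappa> * cmod ?N) \<le> \<nu> / 2 * (?\<kappa> ^ 3 * cmod (z k))\<^sup>2 + (?\<kappa> * cmod ?N)\<^sup>2 / (\<nu> / 2)"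
      using \<nu> by (intro Young_weighted) auto
    also have "(\<nu> * (?\<kappa> ^ 3 * cmod (p k)))\<^sup>2 / (\<nu> / 2) = 2 * \<nu> * (?\<kappa> ^ 3 * cmod (p k))\<^sup>2"
      using \<nu> by (simp add: power_mult_distrib power2_eq_square)
    finally show ?thesis by (simp add: algebra_simps)
  qed
  have "(\<Sum>k\<in>K. kap L k ^ 4 * edens \<nu> a v z k) \<le> (\<Sum>k\<in>K. - \<nu> * (kap L k ^ 3 * cmod (z k))\<^sup>2 +
      (2 * \<nu> * (kap L k ^ 3 * cmod (p k))\<^sup>2 + 2 / \<nu> * (kap L k ^ 1 * cmod (pert L a v k))\<^sup>2))"
    by (intro sum_mono le)
  also have "\<dots> = - \<nu> * (\<Sum>k\<in>K. (kap L k ^ 3 * cmod (z k))\<^sup>2) +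
      (2 * \<nu> * (\<Sum>k\<in>K. (kap L k ^ 3 * cmod (p k))\<^sup>2) + 2 / \<nu> * (\<Sum>k\<in>K. (kap L k ^ 1 * cmod (pert L a v k))\<^sup>2))"
    by (simp only: sum.distrib sum_distrib_left)
  also have "\<dots> \<le> - \<nu> * (\<Sum>k\<in>K. (kap L k ^ 3 * cmod (z k))\<^sup>2) + (2 * \<nu> * hs L 3 p + 2 / \<nu> * hs L 1 (pert L a v))"
    using K p N \<nu> unfolding hs_def hs_summable_def
    by (intro add_left_mono add_mono mult_left_mono finite_sum_le_infsum) auto
  finally show ?thesis by simp
qed

end

section \<open>Exhaustion by boxes of modes, and measurability in time\<close>

definition mbox :: "nat \<Rightarrow> (int \<times> int) set" where
  "mbox N = {- int N..int N} \<times> {- int N..int N}"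

lemma finite_mbox [simp]: "finite (mbox N)"
  by (simp add: mbox_def)

text \<open>Replaces unordered sums by limits of a sequence, as measurability and the convergence
  theorems for integrals require.\<close>

lemma mbox_exhausts: "filterlim mbox (finite_subsets_at_top UNIV) sequentially"
  unfolding filterlim_finite_subsets_at_top
proof (intro allI impI)
  fix X :: "(int \<times> int) set" assume "finite X \<and> X \<subseteq> UNIV"
  then have f: "finite X" by simp
  define b where "b = Max (insert 0 ((\<lambda>n. max \<bar>fst n\<bar> \<bar>snd n\<bar>) ` X))"
  have "X \<subseteq> mbox N" if "N \<ge> nat b" for N
  proof
    fix n assume n: "n \<in> X"
    have "max \<bar>fst n\<bar> \<bar>snd n\<bar> \<le> b" unfolding b_def using f n by (intro Max_ge) auto
    then show "n \<in> mbox N" using that by (cases n) (auto simp: mbox_def)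
  qed
  then show "\<forall>\<^sub>F N in sequentially. finite (mbox N) \<and> X \<subseteq> mbox N \<and> mbox N \<subseteq> UNIV"
    by (intro eventually_sequentiallyI[of "nat b"]) auto
qed

lemma mbox_sum_tendsto: "(f has_sum S) UNIV \<Longrightarrow> (\<lambda>N. sum f (mbox N)) \<longlonglongrightarrow> S"
  unfolding has_sum_def by (rule filterlim_compose[OF _ mbox_exhausts])

lemma mbox_superset: "finite F \<Longrightarrow> \<exists>N. F \<subseteq> mbox N"
  using mbox_exhausts unfolding filterlim_finite_subsets_at_top
  by (metis (mono_tags, lifting) eventually_happens sequentially_bot subset_UNIV trivial_limit_sequentially)

text \<open>The norm with value \<infinity> where the sum diverges, while \<open>hs\<close> has the
  default value 0 of \<open>infsum\<close> there. As a countable supremum of finite sums it is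
  measurable in time.\<close>

definition hs_sup :: "real \<Rightarrow> nat \<Rightarrow> (int \<times> int \<Rightarrow> complex) \<Rightarrow> ennreal" where
  "hs_sup L m c = (SUP N. ennreal (\<Sum>n\<in>mbox N. (kap L n ^ m * cmod (c n))\<^sup>2))"

lemma hs_sup_eq:
  "hs_summable L m c \<Longrightarrow> hs_sup L m c = ennreal (hs L m c)"
  "\<not> hs_summable L m c \<Longrightarrow> hs_sup L m c = \<infinity>"
proof -
  let ?f = "\<lambda>n. (kap L n ^ m * cmod (c n))\<^sup>2"
  show "hs_sup L m c = ennreal (hs L m c)" if "hs_summable L m c"
  proof -
    have "(?f has_sum hs L m c) UNIV" using that by (simp add: hs_summable_def hs_def)
    then have lim: "(\<lambda>N. sum ?f (mbox N)) \<longlonglongrightarrow> hs L m c" by (rule mbox_sum_tendsto)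
    have "incseq (\<lambda>N. ennreal (sum ?f (mbox N)))"
      by (intro monoI ennreal_leI sum_mono2) (auto simp: mbox_def)
    then have "(\<lambda>N. ennreal (sum ?f (mbox N))) \<longlonglongrightarrow> hs_sup L m c" unfolding hs_sup_def by (rule LIMSEQ_SUP)
    moreover have "(\<lambda>N. ennreal (sum ?f (mbox N))) \<longlonglongrightarrow> ennreal (hs L m c)" by (rule tendsto_ennrealI[OF lim])
    ultimately show ?thesis by (rule LIMSEQ_unique)
  qed
  show "hs_sup L m c = \<infinity>" if ns: "\<not> hs_summable L m c"
  proof (rule ccontr)
    assume "hs_sup L m c \<noteq> \<infinity>"
    then obtain B where B: "B \<ge> 0" "hs_sup L m c = ennreal B"
      by (cases "hs_sup L m c") auto
    have "sum ?f (mbox N) \<le> B" for N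
    proof -
      have "ennreal (sum ?f (mbox N)) \<le> ennreal B" unfolding B(2)[symmetric] hs_sup_def by (rule SUP_upper) simp
      then show ?thesis using B(1) by simp
    qed
    then have "sum ?f F \<le> B" if "finite F" for F
      using mbox_superset[OF that] sum_mono2[of "mbox _" F ?f] by (meson finite_mbox order_trans zero_le_power2)
    then have "?f summable_on UNIV" by (intro summable_on_bounded_sums(1)[where B=B]) auto
    then show False using ns by (simp add: hs_summable_def)
  qed
qed

text \<open>In the divergent case both sides take a default value, and both defaults are 0. So
  \<open>hs\<close> inherits measurability from \<open>hs_sup\<close> everywhere.\<close>

lemma hs_eq_enn2real: "hs L m c = enn2real (hs_sup L m c)"
proof (cases "hs_summable L m c")
  case True
  then show ?thesis by (simp add: hs_sup_eq)
next
  case False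
  then have "hs L m c = 0" by (simp add: hs_def hs_summable_def infsum_not_exists)
  then show ?thesis using hs_sup_eq(2)[OF False] by (simp only: infinity_ennreal_def enn2real_top)
qed

lemma hs_sup_measurable:
  assumes "\<And>n. (\<lambda>r. c r n) \<in> borel_measurable M"
  shows "(\<lambda>r. hs_sup L m (c r)) \<in> borel_measurable M"
  unfolding hs_sup_def using assms by measurable

lemma hs_measurable:
  assumes "\<And>n. (\<lambda>r. c r n) \<in> borel_measurable M"
  shows "(\<lambda>r. hs L m (c r)) \<in> borel_measurable M"
  unfolding hs_eq_enn2real using hs_sup_measurable[OF assms] by measurable

lemma hs0_continuity_bound:
  assumes "hs_summable L 0 b" "hs_summable L 0 c"
  shows "\<bar>hs L 0 b - hs L 0 c\<bar> \<le> hs L 0 (\<lambda>n. b n - c n) + 2 * (sqrt (hs L 0 c) * sqrt (hs L 0 (\<lambda>n. b n - c n)))"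
proof -
  let ?d = "\<lambda>n. b n - c n"
  have d: "hs_summable L 0 ?d" by (rule hs_diff(1)[OF assms])
  have sb: "(\<lambda>n. (cmod (b n))\<^sup>2) summable_on UNIV" and sc: "(\<lambda>n. (cmod (c n))\<^sup>2) summable_on UNIV"
    and sd: "(\<lambda>n. (cmod (?d n))\<^sup>2) summable_on UNIV" using assms d by (simp_all add: hs0_summable_iff)
  note CS = infsum_Cauchy_Schwarz[OF sc sd]
  have CS1: "(\<lambda>n. cmod (c n) * cmod (?d n)) summable_on UNIV" using CS(1) by simp
  have CS2: "(\<Sum>\<^sub>\<infinity>n. cmod (c n) * cmod (?d n)) \<le> sqrt (hs L 0 c) * sqrt (hs L 0 ?d)"
    using CS(2) by (simp add: hs0_eq real_le_rsqrt flip: real_sqrt_mult)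
  have sg: "(\<lambda>n. (cmod (?d n))\<^sup>2 + 2 * (cmod (c n) * cmod (?d n))) summable_on UNIV"
    by (intro summable_on_add summable_on_cmult_right sd CS1)
  have sdiff: "(\<lambda>n. (cmod (b n))\<^sup>2 - (cmod (c n))\<^sup>2) summable_on UNIV"
    using summable_on_add[OF sb summable_on_uminus[THEN iffD2, OF sc]] by simp
  have e: "hs L 0 b - hs L 0 c = (\<Sum>\<^sub>\<infinity>n. (cmod (b n))\<^sup>2 - (cmod (c n))\<^sup>2)"
    unfolding hs0_eq using infsum_add[OF sb summable_on_uminus[THEN iffD2, OF sc]] by (simp add: infsum_uminus)
  have le: "\<bar>(cmod (b n))\<^sup>2 - (cmod (c n))\<^sup>2\<bar> \<le> (cmod (?d n))\<^sup>2 + 2 * (cmod (c n) * cmod (?d n))" for n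
  proof -
    have t: "\<bar>cmod (b n) - cmod (c n)\<bar> \<le> cmod (?d n)" by (rule norm_triangle_ineq3)
    have "\<bar>(cmod (b n))\<^sup>2 - (cmod (c n))\<^sup>2\<bar> = \<bar>cmod (b n) - cmod (c n)\<bar> * (cmod (b n) + cmod (c n))"
      by (simp add: power2_eq_square abs_mult[symmetric] square_diff_square_factored abs_mult mult.commute)
    also have "\<dots> \<le> cmod (?d n) * (cmod (?d n) + 2 * cmod (c n))"
      using t by (intro mult_mono) (auto simp: norm_triangle_sub)
    finally show ?thesis by (simp add: power2_eq_square algebra_simps)
  qed
  have "\<bar>hs L 0 b - hs L 0 c\<bar> \<le> (\<Sum>\<^sub>\<infinity>n. (cmod (?d n))\<^sup>2 + 2 * (cmod (c n) * cmod (?d n)))"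
    unfolding e using summable_on_norm_le(2)[OF sg, of "\<lambda>n. (cmod (b n))\<^sup>2 - (cmod (c n))\<^sup>2"] le by auto
  also have "\<dots> = hs L 0 ?d + 2 * (\<Sum>\<^sub>\<infinity>n. cmod (c n) * cmod (?d n))"
    by (subst infsum_add[OF sd summable_on_cmult_right[OF CS1]]) (simp only: hs0_eq infsum_cmult_right')
  also have "\<dots> \<le> hs L 0 ?d + 2 * (sqrt (hs L 0 c) * sqrt (hs L 0 ?d))" using CS2 by simp
  finally show ?thesis .
qed

lemma has_real_derivative_cmod_square:
  assumes "(f has_vector_derivative f') (at r)"
  shows "((\<lambda>r. (cmod (f r))\<^sup>2) has_real_derivative 2 * Re (cnj (f r) * f')) (at r)"
proof -
  have "((\<lambda>r. f r \<bullet> f r) has_derivative (\<lambda>h. f r \<bullet> (h *\<^sub>R f') + (h *\<^sub>R f') \<bullet> f r)) (at r)"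
    using assms[unfolded has_vector_derivative_def] by (intro has_derivative_inner)
  moreover have "(\<lambda>h. f r \<bullet> (h *\<^sub>R f') + (h *\<^sub>R f') \<bullet> f r) = (*) (2 * Re (cnj (f r) * f'))"
    by (auto simp: fun_eq_iff inner_complex_def algebra_simps)
  moreover have "(\<lambda>r. f r \<bullet> f r) = (\<lambda>r. (cmod (f r))\<^sup>2)" by (simp add: power2_norm_eq_inner)
  ultimately show ?thesis by (simp add: has_field_derivative_def)
qed

text \<open>The properties of the error between two solutions on which the estimates rest. At the
  initial time \<open>s\<close> only finite energy and continuity in H are available; finite
  second-order norms, the time integrals and the equation itself hold strictly after
  \<open>s\<close>.\<close>

locale pert_flow = torus_domain +
  fixes \<nu> \<rho> s :: real and a v :: "real \<Rightarrow> int \<times> int \<Rightarrow> complex"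
  assumes nu_pos: "\<nu> > 0"
    and ref: "\<And>r. r \<ge> s \<Longrightarrow> ref_coefs \<rho> (a r)"
    and v_real: "\<And>r. r \<ge> s \<Longrightarrow> real_coefs (v r)"
    and v_zero: "\<And>r. r \<ge> s \<Longrightarrow> v r 0 = 0"
    and v_hs0: "\<And>r. r \<ge> s \<Longrightarrow> hs_summable L 0 (v r)"
    and v_cont: "\<And>t. t \<ge> s \<Longrightarrow> ((\<lambda>r. hs L 0 (\<lambda>n. v r n - v t n)) \<longlongrightarrow> 0) (at t within {s..})"
    and v_hs2: "\<And>r. r > s \<Longrightarrow> hs_summable L 2 (v r)"
    and v_int2: "\<And>s' t. s < s' \<Longrightarrow> integrable lborel (\<lambda>r. indicator {s'..t} r * hs L 2 (v r))"
    and v_hs3: "\<And>s' t. s < s' \<Longrightarrow> AE r in lborel. r \<in> {s'..t} \<longrightarrow> hs_summable L 3 (v r)"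
    and v_int3: "\<And>s' t. s < s' \<Longrightarrow> integrable lborel (\<lambda>r. indicator {s'..t} r * hs L 3 (v r))"
    and v_deriv: "\<And>r n. r > s \<Longrightarrow> ((\<lambda>r. v r n) has_vector_derivative
        (- of_real (\<nu> * (kap L n)\<^sup>2) * v r n - pert L (a r) (v r) n)) (at r)"
    and pert_cont: "\<And>n. continuous_on {s<..} (\<lambda>r. pert L (a r) (v r) n)"
begin

lemma v_continuous: "continuous_on {s<..} (\<lambda>r. v r n)"
  by (intro continuous_at_imp_continuous_on ballI has_vector_derivative_continuous[OF v_deriv]) simp

text \<open>Continuity includes the initial time: this is the bridge by which
  \<open>energy_estimate\<close> reaches \<open>s\<close>.\<close>

lemma hs0_continuous:
  assumes p: "hs_summable L 0 p"
  shows "continuous_on {s..} (\<lambda>r. hs L 0 (\<lambda>n. v r n - p n))"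
  unfolding continuous_on_def
proof
  fix t assume "t \<in> {s..}"
  then have t: "t \<ge> s" by simp
  let ?z = "\<lambda>r n. v r n - p n"
  let ?d = "\<lambda>r. hs L 0 (\<lambda>n. v r n - v t n)"
  have z: "hs_summable L 0 (?z r)" if "r \<ge> s" for r by (rule hs_diff(1)[OF v_hs0[OF that] p])
  have lim: "((\<lambda>r. ?d r + 2 * (sqrt (hs L 0 (?z t)) * sqrt (?d r))) \<longlongrightarrow> 0 + 2 * (sqrt (hs L 0 (?z t)) * sqrt 0)) (at t within {s..})"
    by (intro tendsto_intros v_cont t)
  have "((\<lambda>r. hs L 0 (?z r) - hs L 0 (?z t)) \<longlongrightarrow> 0) (at t within {s..})"
  proof (rule Lim_null_comparison)
    show "\<forall>\<^sub>F r in at t within {s..}. norm (hs L 0 (?z r) - hs L 0 (?z t)) \<le> ?d r + 2 * (sqrt (hs L 0 (?z t)) * sqrt (?d r))"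
      unfolding eventually_at_filter
    proof (rule always_eventually, intro allI impI)
      fix r assume "r \<in> {s..}"
      then have "r \<ge> s" by simp
      from hs0_continuity_bound[OF z[OF this] z[OF t]]
      show "norm (hs L 0 (?z r) - hs L 0 (?z t)) \<le> ?d r + 2 * (sqrt (hs L 0 (?z t)) * sqrt (?d r))" by simp
    qed
  qed (use lim in simp)
  then show "((\<lambda>r. hs L 0 (?z r)) \<longlongrightarrow> hs L 0 (?z t)) (at t within {s..})" by (rule LIM_zero_cancel)
qed

lemma edens_continuous:
  "continuous_on {s<..} (\<lambda>r. edens \<nu> (a r) (v r) (\<lambda>n. v r n - p n) k)"
  unfolding edens_def by (intro continuous_intros v_continuous pert_cont)

text \<open>On finitely many modes the balance is the fundamental theorem of calculus. The weight
  \<phi> is an integrating factor in \<open>energy_estimate\<close> and a power of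
  \<open>r - s'\<close> in \<open>smoothing_estimate\<close>; the constant field \<open>p\<close>
  serves \<open>persistence\<close>.\<close>

lemma weighted_energy_identity:
  fixes p :: "int \<times> int \<Rightarrow> complex"
  assumes s': "s < s'" "s' \<le> t" and K: "finite K"
    and \<phi>: "\<And>r. (\<phi> has_real_derivative \<phi>' r) (at r)" "continuous_on UNIV \<phi>'"
  defines "z \<equiv> \<lambda>r n. v r n - p n"
  shows "has_bochner_integral lborel
     (\<lambda>r. indicator {s'..t} r *\<^sub>R (\<phi>' r * (\<Sum>k\<in>K. (kap L k ^ m * cmod (z r k))\<^sup>2) +
        \<phi> r * (\<Sum>k\<in>K. (kap L k ^ m)\<^sup>2 * edens \<nu> (a r) (v r) (z r) k)))
     (\<phi> t * (\<Sum>k\<in>K. (kap L k ^ m * cmod (z t k))\<^sup>2) - \<phi> s' * (\<Sum>k\<in>K. (kap L k ^ m * cmod (z s' k))\<^sup>2))"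
proof (rule has_bochner_integral_FTC_Icc[OF s'(2)])
  fix r assume r: "s' \<le> r" "r \<le> t"
  then have rs: "r > s" using s' by simp
  have d: "((\<lambda>r. (cmod (z r k))\<^sup>2) has_real_derivative edens \<nu> (a r) (v r) (z r) k) (at r)" for k
    unfolding edens_def z_def
    by (rule has_real_derivative_cmod_square) (auto intro!: derivative_eq_intros v_deriv[OF rs])
  have "((\<lambda>r. \<phi> r * (\<Sum>k\<in>K. (kap L k ^ m)\<^sup>2 * (cmod (z r k))\<^sup>2)) has_real_derivative
     \<phi>' r * (\<Sum>k\<in>K. (kap L k ^ m)\<^sup>2 * (cmod (z r k))\<^sup>2) + \<phi> r * (\<Sum>k\<in>K. (kap L k ^ m)\<^sup>2 * edens \<nu> (a r) (v r) (z r) k)) (at r)"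
    by (rule derivative_eq_intros \<phi> d refl DERIV_sum DERIV_cmult)+ (simp add: mult.commute)
  then show "((\<lambda>r. \<phi> r * (\<Sum>k\<in>K. (kap L k ^ m * cmod (z r k))\<^sup>2)) has_vector_derivative
     \<phi>' r * (\<Sum>k\<in>K. (kap L k ^ m * cmod (z r k))\<^sup>2) + \<phi> r * (\<Sum>k\<in>K. (kap L k ^ m)\<^sup>2 * edens \<nu> (a r) (v r) (z r) k)) (at r within {s'..t})"
    unfolding power_mult_distrib by (simp add: has_real_derivative_iff_has_vector_derivative has_vector_derivative_at_within)
next
  have sub: "{s'..t} \<subseteq> {s<..}" using s' by auto
  have c\<phi>: "continuous_on {s'..t} \<phi>" using \<phi>(1) by (intro continuous_at_imp_continuous_on) (auto intro: DERIV_isCont)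
  show "continuous_on {s'..t} (\<lambda>r. \<phi>' r * (\<Sum>k\<in>K. (kap L k ^ m * cmod (z r k))\<^sup>2) + \<phi> r * (\<Sum>k\<in>K. (kap L k ^ m)\<^sup>2 * edens \<nu> (a r) (v r) (z r) k))"
    unfolding z_def
    by (intro continuous_intros c\<phi> continuous_on_subset[OF \<phi>(2)] continuous_on_subset[OF v_continuous sub] continuous_on_subset[OF edens_continuous sub]) auto
qed

section \<open>Smoothing and persistence\<close>

lemma set_integrable_const_mult:
  "integrable lborel (\<lambda>r. indicator {s'..t} r * f r) \<Longrightarrow> integrable lborel (\<lambda>r. indicator {s'..t} r * (c + d * f r))" for f :: "real \<Rightarrow> real"
proof -
  assume f: "integrable lborel (\<lambda>r. indicator {s'..t} r * f r)"
  have "integrable lborel (\<lambda>r. c * indicator {s'..t} r + d * (indicator {s'..t} r * f r))"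
    by (intro Bochner_Integration.integrable_add integrable_mult_right f) (auto intro!: integrable_real_indicator emeasure_compact_finite)
  then show ?thesis by (simp add: algebra_simps)
qed

lemma integral_indicator_const: "s' \<le> t \<Longrightarrow> (\<integral>r. indicator {s'..t} r * c \<partial>lborel) = (t - s') * (c :: real)"
  by simp

text \<open>Gronwall's inequality by an integrating factor. The weight \<open>1 / \<tau>\<close> in
  \<Lambda> contributes only a factor e over a time \<tau>, and it makes the total source
  \<open>\<tau> * D\<close> quadratic in \<tau>, the power that \<open>persistence\<close>
  requires.\<close>

lemma energy_estimate:
  assumes t: "s \<le> t" "t \<le> s + \<tau>" and \<tau>: "\<tau> > 0" and p: "finite {n. p n \<noteq> 0}" "ls L 0 p \<le> M"
  defines "\<Lambda> \<equiv> (\<rho> + M)\<^sup>2 / (2 * \<nu>) + 1 / \<tau>"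
    and "D \<equiv> 2 * \<tau> * (3 * (\<rho>\<^sup>2 * hs L 1 p + (ls L 0 p)\<^sup>2 * \<rho>\<^sup>2 + (ls L 0 p)\<^sup>2 * hs L 1 p) + \<nu>\<^sup>2 * hs L 2 p)"
  shows "hs L 0 (\<lambda>n. v t n - p n) \<le> exp (\<Lambda> * \<tau>) * (hs L 0 (\<lambda>n. v s n - p n) + \<tau> * D)"
proof -
  define z where "z = (\<lambda>r n. v r n - p n)"
  define x where "x r = hs L 0 (z r)" for r
  note P = finite_support_summable[OF p(1), of L]
  have \<Lambda>0: "\<Lambda> \<ge> 0" using nu_pos \<tau> by (simp add: \<Lambda>_def)
  have D0: "D \<ge> 0" using \<tau> by (simp add: D_def)
  have cx: "continuous_on {s..} x" unfolding x_def[abs_def] z_def by (rule hs0_continuous[OF P(1)])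
  have z0: "hs_summable L 0 (z r)" if "r \<ge> s" for r unfolding z_def by (intro hs_diff v_hs0 that P)
  obtain C where C: "C \<ge> 0" "\<And>a v z. ref_coefs \<rho> a \<Longrightarrow> v 0 = 0 \<Longrightarrow> hs_summable L 2 v \<Longrightarrow> hs_summable L 0 z \<Longrightarrow>
      (\<lambda>k. \<bar>edens \<nu> a v z k\<bar>) summable_on UNIV \<and>
      (\<Sum>\<^sub>\<infinity>k. \<bar>edens \<nu> a v z k\<bar>) \<le> (1 + hs L 2 v) * (hs L 0 z + C)"
    using energy_dominated[OF nu_pos, of \<rho>] by metis
  \<comment> \<open>The integrated balance is available from any \<open>s' > s\<close>; the limit of
    \<open>s'\<close> to \<open>s\<close> is taken at the end, by continuity of
    \<open>x\<close>.\<close>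
  have step: "x t \<le> exp (\<Lambda> * \<tau>) * (x s' + \<tau> * D)" if s': "s < s'" "s' \<le> t" for s'
  proof -
    define \<phi> where "\<phi> r = exp (- \<Lambda> * (r - s'))" for r
    have d\<phi>: "(\<phi> has_real_derivative - \<Lambda> * \<phi> r) (at r)" for r
      unfolding \<phi>_def by (auto intro!: derivative_eq_intros)
    have c\<phi>: "continuous_on UNIV (\<lambda>r. - \<Lambda> * \<phi> r)" unfolding \<phi>_def by (intro continuous_intros)
    have \<phi>01: "0 \<le> \<phi> r" "r \<ge> s' \<Longrightarrow> \<phi> r \<le> 1" for r using \<Lambda>0 by (auto simp: \<phi>_def)
    define e where "e r k = edens \<nu> (a r) (v r) (z r) k" for r k
    define Y where "Y N r = (\<Sum>k\<in>mbox N. (cmod (z r k))\<^sup>2)" for N r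
    define g where "g N r = - \<Lambda> * \<phi> r * Y N r + \<phi> r * (\<Sum>k\<in>mbox N. e r k)" for N r
    have id: "has_bochner_integral lborel (\<lambda>r. indicator {s'..t} r * g N r) (\<phi> t * Y N t - \<phi> s' * Y N s')" for N
      using weighted_energy_identity[where m=0 and p=p, OF s' finite_mbox[of N] d\<phi> c\<phi>] by (simp add: g_def Y_def e_def z_def)
    have Es: "(\<lambda>k. \<bar>e r k\<bar>) summable_on UNIV" "(\<Sum>\<^sub>\<infinity>k. \<bar>e r k\<bar>) \<le> (1 + hs L 2 (v r)) * (x r + C)" if "r > s" for r
      using C(2)[OF ref[of r] v_zero[of r] v_hs2[of r] z0[of r]] that by (auto simp: e_def x_def)
    have es: "e r summable_on UNIV" if "r > s" for r
      using Es(1)[OF that] summable_on_iff_abs_summable_on_real[of "e r" UNIV] by simp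
    have Ylim: "(\<lambda>N. Y N r) \<longlonglongrightarrow> x r" if "r \<ge> s" for r
      unfolding Y_def x_def hs0_eq
      by (rule mbox_sum_tendsto) (use z0[OF that] in \<open>simp add: hs0_summable_iff\<close>)
    define h where "h r = - \<Lambda> * \<phi> r * x r + \<phi> r * infsum (e r) UNIV" for r
    have glim: "(\<lambda>N. g N r) \<longlonglongrightarrow> h r" if "r > s" for r
      unfolding g_def h_def
      by (intro tendsto_intros Ylim mbox_sum_tendsto has_sum_infsum es that) (use that in auto)
    have "continuous_on {s'..t} x" by (rule continuous_on_subset[OF cx]) (use s' in auto)
    then have "bounded (x ` {s'..t})" by (intro compact_imp_bounded compact_continuous_image) auto
    then obtain X where "\<forall>y\<in>x ` {s'..t}. norm y \<le> X" unfolding bounded_iff by blast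
    then have X: "x r \<le> X" if "r \<in> {s'..t}" for r using that by (auto dest: bspec)
    have x0: "0 \<le> x r" for r by (simp add: x_def)
    have X0: "0 \<le> X" using X[of s'] x0[of s'] s' by simp
    \<comment> \<open>One majorant for all \<open>N\<close>: \<open>x\<close> is bounded on the
      compact interval, and \<open>hs L 2 (v r)\<close> is integrable over it.\<close>
    define w where "w r = indicator {s'..t} r * ((\<Lambda> * X + X + C) + (X + C) * hs L 2 (v r))" for r :: real
    have w: "integrable lborel w" unfolding w_def by (intro set_integrable_const_mult v_int2 s')
    have bd: "norm (indicator {s'..t} r * g N r) \<le> w r" for N r
    proof (cases "r \<in> {s'..t}")
      case True
      then have r: "r > s" "r \<ge> s" "r \<ge> s'" using s' by auto
      have "Y N r \<le> x r" unfolding Y_def x_def hs0_eq using z0[OF r(2)]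
        by (intro finite_sum_le_infsum) (auto simp: hs0_summable_iff)
      then have Y: "\<bar>Y N r\<bar> \<le> X" using X[OF True] by (auto simp: Y_def sum_nonneg abs_of_nonneg intro: order_trans)
      have "\<bar>\<Sum>k\<in>mbox N. e r k\<bar> \<le> (\<Sum>k\<in>mbox N. \<bar>e r k\<bar>)" by (rule sum_abs)
      also have "\<dots> \<le> (\<Sum>\<^sub>\<infinity>k. \<bar>e r k\<bar>)" by (intro finite_sum_le_infsum Es r) auto
      also have "\<dots> \<le> (1 + hs L 2 (v r)) * (X + C)"
        using Es(2)[OF r(1)] X[OF True] by (meson add_right_mono hs_nonneg mult_left_mono order_trans add_nonneg_nonneg zero_le_one)
      finally have E: "\<bar>\<Sum>k\<in>mbox N. e r k\<bar> \<le> (1 + hs L 2 (v r)) * (X + C)" .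
      have "\<bar>g N r\<bar> \<le> \<Lambda> * \<phi> r * \<bar>Y N r\<bar> + \<phi> r * \<bar>\<Sum>k\<in>mbox N. e r k\<bar>"
        unfolding g_def using \<Lambda>0 \<phi>01(1)[of r] abs_triangle_ineq[of "- \<Lambda> * \<phi> r * Y N r" "\<phi> r * (\<Sum>k\<in>mbox N. e r k)"]
        by (simp add: abs_mult)
      also have "\<dots> \<le> \<Lambda> * 1 * X + 1 * ((1 + hs L 2 (v r)) * (X + C))"
        using \<Lambda>0 \<phi>01 r Y E by (intro add_mono mult_mono) auto
      finally show ?thesis using True by (simp add: w_def algebra_simps)
    qed (simp add: w_def)
    have conv: "integrable lborel (\<lambda>r. indicator {s'..t} r * h r) \<and> (\<lambda>N. \<integral>r. indicator {s'..t} r * g N r \<partial>lborel) \<longlonglongrightarrow> (\<integral>r. indicator {s'..t} r * h r \<partial>lborel)"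
    proof -
      have pw: "(\<lambda>N. indicator {s'..t} r * g N r) \<longlonglongrightarrow> indicator {s'..t} r * h r" for r
      proof (cases "r \<in> {s'..t}")
        case True
        then have "r > s" using s' by auto
        then show ?thesis using glim[of r] True by simp
      qed simp
      have mg: "(\<lambda>r. indicator {s'..t} r * g N r) \<in> borel_measurable lborel" for N
        using id[of N] by (auto simp: has_bochner_integral_iff dest: borel_measurable_integrable)
      have mh: "(\<lambda>r. indicator {s'..t} r * h r) \<in> borel_measurable lborel"
        by (rule borel_measurable_LIMSEQ_real[OF pw mg])
      have pwa: "AE r in lborel. (\<lambda>N. indicator {s'..t} r * g N r) \<longlonglongrightarrow> indicator {s'..t} r * h r"
        using pw by (intro AE_I2)
      have bda: "AE r in lborel. norm (indicator {s'..t} r * g N r) \<le> w r" for N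
        using bd by (intro AE_I2)
      show ?thesis
        using integrable_dominated_convergence[OF mh mg w pwa bda] integral_dominated_convergence[OF mh mg w pwa bda] by simp
    qed
    have gI: "(\<integral>r. indicator {s'..t} r * g N r \<partial>lborel) = \<phi> t * Y N t - \<phi> s' * Y N s'" for N
      using id[of N] by (simp add: has_bochner_integral_iff)
    have "(\<lambda>N. \<phi> t * Y N t - \<phi> s' * Y N s') \<longlonglongrightarrow> \<phi> t * x t - \<phi> s' * x s'"
      using s' by (intro tendsto_intros Ylim) auto
    then have eq: "\<phi> t * x t - \<phi> s' * x s' = (\<integral>r. indicator {s'..t} r * h r \<partial>lborel)"
      using conv unfolding gI by (blast intro: LIMSEQ_unique)
    have hle: "h r \<le> D" if r: "r \<in> {s'..t}" for r
    proof -
      have r': "r > s" "r \<ge> s" "r \<ge> s'" using r s' by auto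
      have "infsum (e r) UNIV \<le> \<Lambda> * x r + D" unfolding e_def x_def \<Lambda>_def D_def
        by (rule energy_bound[OF nu_pos \<tau> ref[OF r'(2)] v_real[OF r'(2)] v_zero[OF r'(2)] v_hs2[OF r'(1)] p])
          (use es[OF r'(1)] in \<open>auto simp: z_def e_def[abs_def]\<close>)
      then have "\<phi> r * infsum (e r) UNIV \<le> \<phi> r * (\<Lambda> * x r + D)" by (intro mult_left_mono \<phi>01)
      then have "h r \<le> \<phi> r * D" by (simp add: h_def algebra_simps)
      also have "\<dots> \<le> 1 * D" using \<phi>01(2)[OF r'(3)] D0 by (intro mult_right_mono) auto
      finally show ?thesis by simp
    qed
    have "(\<integral>r. indicator {s'..t} r * h r \<partial>lborel) \<le> (\<integral>r. indicator {s'..t} r * D \<partial>lborel)"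
    proof (rule integral_mono)
      show "integrable lborel (\<lambda>r. indicator {s'..t} r * D :: real)"
        by (intro integrable_mult_left) (auto intro!: integrable_real_indicator emeasure_compact_finite)
    qed (use conv hle in \<open>auto simp: indicator_def\<close>)
    also have "\<dots> = (t - s') * D" by (rule integral_indicator_const[OF s'(2)])
    also have "\<dots> \<le> \<tau> * D" using s' t D0 by (intro mult_right_mono) auto
    finally have "\<phi> t * x t \<le> x s' + \<tau> * D" using eq by (simp add: \<phi>_def)
    then have "exp (\<Lambda> * (t - s')) * (\<phi> t * x t) \<le> exp (\<Lambda> * (t - s')) * (x s' + \<tau> * D)" by (intro mult_left_mono) auto
    then have "x t \<le> exp (\<Lambda> * (t - s')) * (x s' + \<tau> * D)"
      by (simp add: \<phi>_def mult.assoc[symmetric] flip: exp_add)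
    also have "\<dots> \<le> exp (\<Lambda> * \<tau>) * (x s' + \<tau> * D)"
      using s' t \<Lambda>0 x0[of s'] D0 \<tau> by (intro mult_right_mono) (auto intro!: mult_left_mono)
    finally show ?thesis .
  qed
  have "x t \<le> exp (\<Lambda> * \<tau>) * (x s + \<tau> * D)"
  proof (cases "t = s")
    case True
    have "1 * (x s + 0) \<le> exp (\<Lambda> * \<tau>) * (x s + \<tau> * D)"
      using \<Lambda>0 \<tau> D0 by (intro mult_mono add_mono) (auto simp: x_def)
    then show ?thesis using True by simp
  next
    case False
    then have st: "s < t" using t by simp
    have "((\<lambda>r. exp (\<Lambda> * \<tau>) * (x r + \<tau> * D)) \<longlongrightarrow> exp (\<Lambda> * \<tau>) * (x s + \<tau> * D)) (at s within {s..})"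
      using cx by (intro tendsto_intros) (auto simp: continuous_on_def)
    then have "((\<lambda>r. exp (\<Lambda> * \<tau>) * (x r + \<tau> * D)) \<longlongrightarrow> exp (\<Lambda> * \<tau>) * (x s + \<tau> * D)) (at_right s)"
      by (rule tendsto_within_subset) auto
    then show ?thesis
    proof (rule tendsto_lowerbound)
      show "\<forall>\<^sub>F r in at_right s. x t \<le> exp (\<Lambda> * \<tau>) * (x r + \<tau> * D)"
        unfolding eventually_at_right[OF st] using step st by (intro exI[of _ t]) auto
    qed simp
  qed
  then show ?thesis by (simp add: x_def z_def)
qed

text \<open>From \<open>x = 6 / c\<close> on, the cubic term alone dominates; below that value the
  square is bounded, and \<open>108 = 3 * 36\<close>.\<close>

lemma cubic_absorb:
  fixes x c :: real assumes "x \<ge> 0" "c > 0"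
  shows "3 * x\<^sup>2 \<le> c / 2 * x ^ 3 + 108 / c\<^sup>2"
proof (cases "x \<ge> 6 / c")
  case True
  then have "6 \<le> c * x" using assms by (simp add: field_simps)
  then have "6 * x\<^sup>2 \<le> c * x * x\<^sup>2" by (intro mult_right_mono) auto
  then have "3 * x\<^sup>2 \<le> c / 2 * x ^ 3" by (simp add: power3_eq_cube power2_eq_square mult.assoc)
  then show ?thesis using assms by (meson add_increasing2 divide_nonneg_nonneg zero_le_power2 zero_le_numeral)
next
  case False
  then have "x\<^sup>2 \<le> (6 / c)\<^sup>2" using assms by (intro power_mono) auto
  then have "3 * x\<^sup>2 \<le> 108 / c\<^sup>2" by (simp add: power_divide)
  moreover have "0 \<le> c / 2 * x ^ 3" using assms by simp
  ultimately show ?thesis by linarith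
qed

text \<open>The weight \<open>(r - s')^3\<close> vanishes at \<open>s'\<close>, so the initial
  second-order norm does not enter. Its derivative is absorbed mode by mode: in the scaling variable
  \<open>x = (r - s') kap^2\<close> it produces \<open>3 x^2\<close> times the energy of the mode,
  which \<open>cubic_absorb\<close> bounds by half of the dissipation, \<open>\<nu> / 2\<close>
  times \<open>x^3\<close>, and a constant.\<close>

lemma smoothing_estimate:
  assumes t: "s < s'" "s' < t" and p: "finite {n. p n \<noteq> 0}"
    and C: "C \<ge> 0" "\<And>a v. ref_coefs \<rho> a \<Longrightarrow> v 0 = 0 \<Longrightarrow> hs_summable L 0 v \<Longrightarrow> hs_summable L 3 v \<Longrightarrow> hs L 0 v \<le> \<kappa> \<Longrightarrow>
      hs_summable L 1 (pert L a v) \<and> hs L 1 (pert L a v) \<le> \<nu>\<^sup>2 / 16 * hs L 3 v + C * hs L 0 v"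
    and V: "\<And>r. r \<in> {s'..t} \<Longrightarrow> hs L 0 (v r) \<le> V" "V \<le> \<kappa>"
    and X: "\<And>r. r \<in> {s'..t} \<Longrightarrow> hs L 0 (\<lambda>n. v r n - p n) \<le> X"
  shows "(t - s') ^ 3 * hs L 2 (\<lambda>n. v t n - p n) \<le>
    (t - s') * (108 / \<nu>\<^sup>2 * X + (t - s') ^ 3 * (9 / 4 * \<nu> * hs L 3 p + 2 / \<nu> * (C * V)))"
proof -
  define z where "z = (\<lambda>r n. v r n - p n)"
  note P = finite_support_summable[OF p(1), of L]
  define \<phi> where "\<phi> r = (r - s') ^ 3" for r
  \<comment> \<open>\<open>9 / 4 = 2 + 1 / 4\<close>: the 2 stems from
    \<open>energy2_finite_bound\<close>. The rest is \<open>2 / \<nu>\<close> times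
    \<open>\<nu>\<^sup>2 / 16\<close> times 2, from bounding \<open>hs L 3 v\<close> by
    \<open>2 hs L 3 z + 2 hs L 3 p\<close>; the same \<open>\<nu> / 4\<close> stays in front of
    \<open>hs L 3 z\<close>.\<close>
  define R where "R = 9 / 4 * \<nu> * hs L 3 p + 2 / \<nu> * (C * V)"
  define Q where "Q = 108 / \<nu>\<^sup>2 * X + (t - s') ^ 3 * R"
  have d\<phi>: "(\<phi> has_real_derivative 3 * (r - s')\<^sup>2) (at r)" for r
    unfolding \<phi>_def by (auto intro!: derivative_eq_intros)
  have c\<phi>: "continuous_on UNIV (\<lambda>r. 3 * (r - s')\<^sup>2)" by (intro continuous_intros)
  define Y where "Y N r = (\<Sum>k\<in>mbox N. (kap L k ^ 2 * cmod (z r k))\<^sup>2)" for N r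
  define H where "H N r = (\<Sum>k\<in>mbox N. (kap L k ^ 3 * cmod (z r k))\<^sup>2)" for N r
  define g where "g N r = 3 * (r - s')\<^sup>2 * Y N r + \<phi> r * (\<Sum>k\<in>mbox N. kap L k ^ 4 * edens \<nu> (a r) (v r) (z r) k)" for N r
  have V0: "0 \<le> V" by (rule order_trans[OF hs_nonneg V(1)[of s']]) (use t in auto)
  have R0: "0 \<le> R" unfolding R_def using nu_pos C(1) V0 by simp
  have id: "has_bochner_integral lborel (\<lambda>r. indicator {s'..t} r * g N r) (\<phi> t * Y N t)" for N
    using weighted_energy_identity[where m=2 and p=p, OF t(1) less_imp_le[OF t(2)] finite_mbox[of N] d\<phi> c\<phi>]
    by (simp add: g_def Y_def z_def \<phi>_def flip: power_mult)
  have z2: "hs_summable L 2 (z r)" if "r > s" for r unfolding z_def by (intro hs_diff v_hs2 that P)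
  have sub: "{s'..t} \<subseteq> {s<..}" using t by auto
  have zm: "(\<lambda>r. indicator {s'..t} r * z r n) \<in> borel_measurable lborel" for n
  proof -
    have "continuous_on {s'..t} (\<lambda>r. z r n)" unfolding z_def
      by (intro continuous_intros continuous_on_subset[OF v_continuous sub])
    then have "integrable lborel (\<lambda>r. indicator {s'..t} r *\<^sub>R z r n)"
      by (intro borel_integrable_compact) auto
    then have "(\<lambda>r. indicator {s'..t} r *\<^sub>R z r n) \<in> borel_measurable lborel" by (rule borel_measurable_integrable)
    then show ?thesis by (simp add: scaleR_conv_of_real) (simp add: indicator_def of_bool_def if_distrib cong: if_cong)
  qed
  have h3m: "(\<lambda>r. indicator {s'..t} r * hs L 3 (z r)) \<in> borel_measurable lborel"
  proof -
    have "(\<lambda>r. hs L 3 (\<lambda>n. indicator {s'..t} r * z r n)) \<in> borel_measurable lborel" by (rule hs_measurable[OF zm])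
    moreover have "hs L 3 (\<lambda>n. indicator {s'..t} r * z r n) = indicator {s'..t} r * hs L 3 (z r)" for r
      by (cases "r \<in> {s'..t}") (auto simp: hs_def)
    ultimately show ?thesis by simp
  qed
  have ae: "AE r in lborel. r \<in> {s'..t} \<longrightarrow> hs_summable L 3 (v r)" by (rule v_hs3[OF t(1)])
  have z3: "hs_summable L 3 (z r)" "hs L 3 (z r) \<le> 2 * hs L 3 p + 2 * hs L 3 (v r)" if "hs_summable L 3 (v r)" for r
    using hs_diff[OF that P(1)] by (auto simp: z_def)
  define w where "w r = indicator {s'..t} r * ((t - s') ^ 3 * (2 * hs L 3 p) + (t - s') ^ 3 * 2 * hs L 3 (v r))" for r :: real
  have w: "integrable lborel w" unfolding w_def by (intro set_integrable_const_mult v_int3 t)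
  have \<phi>b: "0 \<le> \<phi> r" "\<phi> r \<le> (t - s') ^ 3" if "r \<in> {s'..t}" for r
    using that by (auto simp: \<phi>_def intro!: power_mono)
  have \<phi>m: "(\<lambda>r. \<phi> r) \<in> borel_measurable lborel" unfolding \<phi>_def by measurable
  define I where "I r = indicator {s'..t} r * (\<phi> r * hs L 3 (z r))" for r :: real
  have Im: "I \<in> borel_measurable lborel"
  proof -
    have "(\<lambda>r. \<phi> r * (indicator {s'..t} r * hs L 3 (z r))) \<in> borel_measurable lborel"
      by (rule borel_measurable_times[OF \<phi>m h3m])
    then show ?thesis by (simp add: I_def[abs_def] algebra_simps)
  qed
  have Ib: "AE r in lborel. norm (I r) \<le> w r"
    using ae
  proof eventually_elim
    case (elim r)
    show ?case
    proof (cases "r \<in> {s'..t}")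
      case True
      have "\<phi> r * hs L 3 (z r) \<le> (t - s') ^ 3 * (2 * hs L 3 p + 2 * hs L 3 (v r))"
        using \<phi>b[OF True] z3(2) elim True by (intro mult_mono) auto
      then show ?thesis using True \<phi>b[OF True] by (simp add: I_def w_def algebra_simps)
    qed (simp add: I_def w_def)
  qed
  have Ii: "integrable lborel I" by (rule Bochner_Integration.integrable_bound[OF w Im]) (use Ib in \<open>auto elim!: eventually_mono\<close>)
  have Hlim: "(\<lambda>N. \<integral>r. indicator {s'..t} r * (\<phi> r * H N r) \<partial>lborel) \<longlonglongrightarrow> integral\<^sup>L lborel I"
    and Hint: "\<And>N. integrable lborel (\<lambda>r. indicator {s'..t} r * (\<phi> r * H N r))"
  proof -
    have cH: "continuous_on {s'..t} (\<lambda>r. \<phi> r * H N r)" for N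
      unfolding H_def z_def \<phi>_def
      by (intro continuous_intros continuous_on_subset[OF v_continuous sub])
    have i: "integrable lborel (\<lambda>r. indicator {s'..t} r *\<^sub>R (\<phi> r * H N r))" for N
      by (intro borel_integrable_compact cH) auto
    then show i': "\<And>N. integrable lborel (\<lambda>r. indicator {s'..t} r * (\<phi> r * H N r))" by simp
    have mH: "(\<lambda>r. indicator {s'..t} r * (\<phi> r * H N r)) \<in> borel_measurable lborel" for N
      by (rule borel_measurable_integrable[OF i'])
    have pw: "AE r in lborel. (\<lambda>N. indicator {s'..t} r * (\<phi> r * H N r)) \<longlonglongrightarrow> I r"
      using ae
    proof eventually_elim
      case (elim r)
      show ?case
      proof (cases "r \<in> {s'..t}")
        case True
        then have "(\<lambda>N. H N r) \<longlonglongrightarrow> hs L 3 (z r)"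
          unfolding H_def hs_def using z3(1)[of r] elim by (intro mbox_sum_tendsto) (auto simp: hs_summable_def)
        then show ?thesis unfolding I_def by (intro tendsto_intros)
      qed (simp add: I_def)
    qed
    have bd: "AE r in lborel. norm (indicator {s'..t} r * (\<phi> r * H N r)) \<le> w r" for N
      using ae Ib
    proof eventually_elim
      case (elim r)
      show ?case
      proof (cases "r \<in> {s'..t}")
        case True
        have "H N r \<le> hs L 3 (z r)" unfolding H_def hs_def
          using z3(1)[of r] elim True by (intro finite_sum_le_infsum) (auto simp: hs_summable_def)
        moreover have "0 \<le> H N r" unfolding H_def by (intro sum_nonneg) auto
        ultimately have "norm (indicator {s'..t} r * (\<phi> r * H N r)) \<le> norm (I r)"
          using True \<phi>b[OF True] by (simp add: I_def mult_left_mono)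
        then show ?thesis using elim by linarith
      qed (simp add: w_def)
    qed
    show "(\<lambda>N. \<integral>r. indicator {s'..t} r * (\<phi> r * H N r) \<partial>lborel) \<longlonglongrightarrow> integral\<^sup>L lborel I"
      by (rule integral_dominated_convergence[OF Im mH w pw bd])
  qed
  \<comment> \<open>For fixed \<open>N\<close> the dissipation covers only the modes of the box,
    whereas the nonlinear term involves all modes. So the full integral \<open>I\<close> is carried
    along with its factor \<open>\<nu> / 4\<close>, and is outweighed by the dissipation only in the
    limit over \<open>N\<close>.\<close>
  have bound: "\<phi> t * Y N t \<le> - (\<nu> / 2) * (\<integral>r. indicator {s'..t} r * (\<phi> r * H N r) \<partial>lborel) + (\<nu> / 4 * integral\<^sup>L lborel I + (t - s') * Q)" for N
  proof -
    let ?J = "\<lambda>r. - (\<nu> / 2) * (indicator {s'..t} r * (\<phi> r * H N r)) + (\<nu> / 4 * I r + indicator {s'..t} r * Q)"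
    have cQ: "integrable lborel (\<lambda>r. indicator {s'..t} r * Q :: real)"
      by (intro integrable_mult_left) (auto intro!: integrable_real_indicator emeasure_compact_finite)
    have Ji: "integrable lborel ?J" by (intro Bochner_Integration.integrable_add integrable_mult_right Hint Ii cQ)
    have le: "AE r in lborel. indicator {s'..t} r * g N r \<le> ?J r"
      using ae
    proof eventually_elim
      case (elim r)
      show ?case
      proof (cases "r \<in> {s'..t}")
        case True
        then have r: "r > s" "r \<ge> s" using t by auto
        have v3: "hs_summable L 3 (v r)" using elim True by simp
        have vk: "hs L 0 (v r) \<le> \<kappa>" using V(1)[OF True] V(2) by simp
        note N1 = C(2)[OF ref[OF r(2)] v_zero[OF r(2)] v_hs0[OF r(2)] v3 vk]
        have "(\<Sum>k\<in>mbox N. kap L k ^ 4 * edens \<nu> (a r) (v r) (z r) k) \<le> - \<nu> * H N r + 2 * \<nu> * hs L 3 p + 2 / \<nu> * hs L 1 (pert L (a r) (v r))"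
          unfolding H_def using N1 by (intro energy2_finite_bound nu_pos finite_mbox P) (auto simp: z_def)
        also have "\<dots> \<le> - \<nu> * H N r + 2 * \<nu> * hs L 3 p + 2 / \<nu> * (\<nu>\<^sup>2 / 16 * (2 * hs L 3 (z r) + 2 * hs L 3 p) + C * V)"
        proof -
          have "hs L 3 (v r) \<le> 2 * hs L 3 (z r) + 2 * hs L 3 p"
            using hs_add(2)[OF z3(1)[OF v3] P(1)[of 3]] by (simp add: z_def)
          then have "hs L 1 (pert L (a r) (v r)) \<le> \<nu>\<^sup>2 / 16 * (2 * hs L 3 (z r) + 2 * hs L 3 p) + C * V"
            using N1 V(1)[OF True] C(1) by (meson add_mono mult_left_mono order_trans divide_nonneg_nonneg zero_le_power2 zero_le_numeral)
          then show ?thesis using nu_pos by (intro add_left_mono mult_left_mono) auto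
        qed
        also have "\<dots> = - \<nu> * H N r + \<nu> / 4 * hs L 3 (z r) + R"
          using nu_pos by (simp add: R_def field_simps power2_eq_square)
        finally have E: "(\<Sum>k\<in>mbox N. kap L k ^ 4 * edens \<nu> (a r) (v r) (z r) k) \<le> - \<nu> * H N r + \<nu> / 4 * hs L 3 (z r) + R" .
        have A: "3 * (r - s')\<^sup>2 * Y N r \<le> \<nu> / 2 * (\<phi> r * H N r) + 108 / \<nu>\<^sup>2 * X"
        proof -
          have pt: "3 * (r - s')\<^sup>2 * (kap L k ^ 2 * cmod (z r k))\<^sup>2 \<le> \<nu> / 2 * (\<phi> r * (kap L k ^ 3 * cmod (z r k))\<^sup>2) + 108 / \<nu>\<^sup>2 * (cmod (z r k))\<^sup>2" for k
          proof -
            have "3 * ((r - s') * (kap L k)\<^sup>2)\<^sup>2 \<le> \<nu> / 2 * ((r - s') * (kap L k)\<^sup>2) ^ 3 + 108 / \<nu>\<^sup>2"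
              using True by (intro cubic_absorb nu_pos) auto
            then have "3 * ((r - s') * (kap L k)\<^sup>2)\<^sup>2 * (cmod (z r k))\<^sup>2 \<le> (\<nu> / 2 * ((r - s') * (kap L k)\<^sup>2) ^ 3 + 108 / \<nu>\<^sup>2) * (cmod (z r k))\<^sup>2"
              by (rule mult_right_mono) simp
            then show ?thesis by (simp add: \<phi>_def power_mult_distrib distrib_right mult.assoc flip: power_mult)
          qed
          have "3 * (r - s')\<^sup>2 * Y N r \<le> (\<Sum>k\<in>mbox N. \<nu> / 2 * (\<phi> r * (kap L k ^ 3 * cmod (z r k))\<^sup>2) + 108 / \<nu>\<^sup>2 * (cmod (z r k))\<^sup>2)"
            unfolding Y_def sum_distrib_left by (intro sum_mono pt)
          also have "\<dots> = \<nu> / 2 * (\<phi> r * H N r) + 108 / \<nu>\<^sup>2 * (\<Sum>k\<in>mbox N. (cmod (z r k))\<^sup>2)"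
            unfolding H_def by (simp only: sum.distrib sum_distrib_left)
          also have "\<dots> \<le> \<nu> / 2 * (\<phi> r * H N r) + 108 / \<nu>\<^sup>2 * X"
          proof -
            have "hs_summable L 0 (z r)" unfolding z_def by (intro hs_diff v_hs0 r P)
            then have "(\<Sum>k\<in>mbox N. (cmod (z r k))\<^sup>2) \<le> hs L 0 (z r)" unfolding hs0_eq hs0_summable_iff
              by (intro finite_sum_le_infsum) auto
            also have "\<dots> \<le> X" using X[OF True] by (simp add: z_def)
            finally show ?thesis by (intro add_left_mono mult_left_mono) auto
          qed
          finally show ?thesis .
        qed
        have "g N r \<le> \<nu> / 2 * (\<phi> r * H N r) + 108 / \<nu>\<^sup>2 * X + \<phi> r * (- \<nu> * H N r + \<nu> / 4 * hs L 3 (z r) + R)"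
          unfolding g_def by (intro add_mono A mult_left_mono E \<phi>b True)
        also have "\<dots> = - (\<nu> / 2) * (\<phi> r * H N r) + \<nu> / 4 * (\<phi> r * hs L 3 (z r)) + (108 / \<nu>\<^sup>2 * X + \<phi> r * R)"
          by (simp add: algebra_simps)
        also have "\<phi> r * R \<le> (t - s') ^ 3 * R" using \<phi>b[OF True] R0 by (intro mult_right_mono) auto
        finally show ?thesis using True by (simp add: I_def Q_def)
      qed (simp add: I_def)
    qed
    have "\<phi> t * Y N t = (\<integral>r. indicator {s'..t} r * g N r \<partial>lborel)" using id[of N] by (simp add: has_bochner_integral_iff)
    also have "\<dots> \<le> integral\<^sup>L lborel ?J"
      by (rule integral_mono_AE[OF _ Ji le]) (use id[of N] in \<open>simp add: has_bochner_integral_iff\<close>)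
    also have "\<dots> = - (\<nu> / 2) * (\<integral>r. indicator {s'..t} r * (\<phi> r * H N r) \<partial>lborel) + (\<nu> / 4 * integral\<^sup>L lborel I + (t - s') * Q)"
    proof -
      have "integral\<^sup>L lborel ?J = (\<integral>r. - (\<nu> / 2) * (indicator {s'..t} r * (\<phi> r * H N r)) \<partial>lborel) + (\<integral>r. \<nu> / 4 * I r + indicator {s'..t} r * Q \<partial>lborel)"
        by (intro Bochner_Integration.integral_add Bochner_Integration.integrable_add integrable_mult_right Hint Ii cQ)
      also have "(\<integral>r. \<nu> / 4 * I r + indicator {s'..t} r * Q \<partial>lborel) = (\<integral>r. \<nu> / 4 * I r \<partial>lborel) + (\<integral>r. indicator {s'..t} r * Q \<partial>lborel)"
        by (intro Bochner_Integration.integral_add integrable_mult_right Ii cQ)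
      also have "(\<integral>r. indicator {s'..t} r * Q \<partial>lborel) = (t - s') * Q" using t by (intro integral_indicator_const) auto
      finally show ?thesis by (simp only: integral_mult_right_zero)
    qed
    finally show ?thesis .
  qed
  have "(\<lambda>N. Y N t) \<longlonglongrightarrow> hs L 2 (z t)"
    unfolding Y_def hs_def using z2[of t] t by (intro mbox_sum_tendsto) (auto simp: hs_summable_def)
  then have "(\<lambda>N. \<phi> t * Y N t) \<longlonglongrightarrow> \<phi> t * hs L 2 (z t)" by (intro tendsto_intros)
  moreover have "(\<lambda>N. - (\<nu> / 2) * (\<integral>r. indicator {s'..t} r * (\<phi> r * H N r) \<partial>lborel) + (\<nu> / 4 * integral\<^sup>L lborel I + (t - s') * Q))
     \<longlonglongrightarrow> - (\<nu> / 2) * integral\<^sup>L lborel I + (\<nu> / 4 * integral\<^sup>L lborel I + (t - s') * Q)"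
    by (intro tendsto_intros Hlim)
  ultimately have "\<phi> t * hs L 2 (z t) \<le> - (\<nu> / 2) * integral\<^sup>L lborel I + (\<nu> / 4 * integral\<^sup>L lborel I + (t - s') * Q)"
    by (rule LIMSEQ_le) (use bound in auto)
  moreover have "0 \<le> integral\<^sup>L lborel I"
    by (intro integral_nonneg_AE AE_I2) (auto simp: I_def indicator_def \<phi>_def)
  then have "0 \<le> \<nu> * integral\<^sup>L lborel I" using nu_pos by simp
  ultimately have "\<phi> t * hs L 2 (z t) \<le> (t - s') * Q" by linarith
  then show ?thesis by (simp add: \<phi>_def z_def Q_def R_def)
qed

end

lemma hs_zero [simp]: "hs L m (\<lambda>n. 0) = 0" "ls L m (\<lambda>n. 0) = 0"
  by (simp_all add: hs_def ls_def)

lemma (in torus_domain) finite_low_modes: "finite {n. (kap L n)\<^sup>2 \<le> B}"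
proof (rule finite_subset)
  show "{n. (kap L n)\<^sup>2 \<le> B} \<subseteq> mbox (nat \<lceil>B / kap1\<^sup>2\<rceil>)"
  proof
    fix n assume "n \<in> {n. (kap L n)\<^sup>2 \<le> B}"
    then have "(real_of_int (fst n))\<^sup>2 + (real_of_int (snd n))\<^sup>2 \<le> B / kap1\<^sup>2"
      using kap1_pos kap_square[of L n, folded kap1_def] by (simp add: pos_le_divide_eq mult.commute)
    then have "real_of_int ((fst n)\<^sup>2 + (snd n)\<^sup>2) \<le> B / kap1\<^sup>2" by simp
    then have le: "(fst n)\<^sup>2 + (snd n)\<^sup>2 \<le> \<lceil>B / kap1\<^sup>2\<rceil>" by linarith
    have sq: "\<bar>i\<bar> \<le> i\<^sup>2" for i :: int
      using mult_left_mono[of 1 "\<bar>i\<bar>" "\<bar>i\<bar>"] by (cases "i = 0") (auto simp: power2_eq_square)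
    have "\<bar>fst n\<bar> \<le> \<lceil>B / kap1\<^sup>2\<rceil>" "\<bar>snd n\<bar> \<le> \<lceil>B / kap1\<^sup>2\<rceil>"
      using le sq[of "fst n"] sq[of "snd n"] zero_le_power2[of "fst n"] zero_le_power2[of "snd n"] by linarith+
    moreover have "n \<in> mbox (nat c)" if "\<bar>fst n\<bar> \<le> c" "\<bar>snd n\<bar> \<le> c" for c
      using that by (cases n) (auto simp: mbox_def)
    ultimately show "n \<in> mbox (nat \<lceil>B / kap1\<^sup>2\<rceil>)" by blast
  qed
qed simp

context pert_flow begin

text \<open>The case \<open>p = 0\<close> with \<tau> = \<delta>; the summand 1 in the exponent is
  the \<open>1 / \<tau>\<close> of \<open>energy_estimate\<close> times \<tau>.\<close>

lemma energy_growth: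
  assumes "\<delta> > 0" "s \<le> t" "t \<le> s + \<delta>"
  shows "hs L 0 (v t) \<le> exp (\<rho>\<^sup>2 / (2 * \<nu>) * \<delta> + 1) * hs L 0 (v s)"
  using energy_estimate[OF assms(2,3,1), of "\<lambda>n. 0" 0] assms(1) by (simp add: distrib_right)

text \<open>The second half of the interval carries the time weight; the first half keeps away from
  the initial time, where the second-order norm is not controlled. The condition on
  \<open>E * hs L 0 (v s)\<close> keeps the energy below \<kappa> throughout.\<close>

lemma smoothing:
  assumes \<delta>: "\<delta> > 0"
    and C: "C \<ge> 0" "\<And>a v. ref_coefs \<rho> a \<Longrightarrow> v 0 = 0 \<Longrightarrow> hs_summable L 0 v \<Longrightarrow> hs_summable L 3 v \<Longrightarrow> hs L 0 v \<le> \<kappa> \<Longrightarrow>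
      hs_summable L 1 (pert L a v) \<and> hs L 1 (pert L a v) \<le> \<nu>\<^sup>2 / 16 * hs L 3 v + C * hs L 0 v"
  defines "E \<equiv> exp (\<rho>\<^sup>2 / (2 * \<nu>) * \<delta> + 1)"
  assumes small: "E * hs L 0 (v s) \<le> \<kappa>"
  shows "hs L 2 (v (s + \<delta>)) \<le> (4 / \<delta>\<^sup>2) * (108 / \<nu>\<^sup>2 + \<delta> ^ 3 / 8 * (2 / \<nu> * C)) * E * hs L 0 (v s)"
proof -
  have V: "hs L 0 (v r) \<le> E * hs L 0 (v s)" if "r \<in> {s + \<delta> / 2..s + \<delta>}" for r
    unfolding E_def by (rule energy_growth[OF \<delta>]) (use that \<delta> in auto)
  have "(\<delta> / 2) ^ 3 * hs L 2 (v (s + \<delta>)) \<le> (\<delta> / 2) * (108 / \<nu>\<^sup>2 * (E * hs L 0 (v s)) + (\<delta> / 2) ^ 3 * (2 / \<nu> * (C * (E * hs L 0 (v s)))))"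
    using smoothing_estimate[of "s + \<delta> / 2" "s + \<delta>" "\<lambda>n. 0", OF _ _ _ C V small] V \<delta> by simp
  then have "(\<delta> / 2) * ((\<delta> / 2)\<^sup>2 * hs L 2 (v (s + \<delta>))) \<le> (\<delta> / 2) * (108 / \<nu>\<^sup>2 * (E * hs L 0 (v s)) + (\<delta> / 2) ^ 3 * (2 / \<nu> * (C * (E * hs L 0 (v s)))))"
    by (simp add: power3_eq_cube power2_eq_square mult.assoc)
  then have "(\<delta> / 2)\<^sup>2 * hs L 2 (v (s + \<delta>)) \<le> 108 / \<nu>\<^sup>2 * (E * hs L 0 (v s)) + (\<delta> / 2) ^ 3 * (2 / \<nu> * (C * (E * hs L 0 (v s))))"
    using \<delta> by (subst (asm) mult_le_cancel_left_pos) auto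
  also have "\<dots> = (108 / \<nu>\<^sup>2 + \<delta> ^ 3 / 8 * (2 / \<nu> * C)) * (E * hs L 0 (v s))"
    by (simp add: power_divide algebra_simps)
  finally have "(4 / \<delta>\<^sup>2) * ((\<delta> / 2)\<^sup>2 * hs L 2 (v (s + \<delta>))) \<le> (4 / \<delta>\<^sup>2) * ((108 / \<nu>\<^sup>2 + \<delta> ^ 3 / 8 * (2 / \<nu> * C)) * (E * hs L 0 (v s)))"
    by (intro mult_left_mono) auto
  moreover have "(4 / \<delta>\<^sup>2) * ((\<delta> / 2)\<^sup>2 * hs L 2 (v (s + \<delta>))) = hs L 2 (v (s + \<delta>))"
    using \<delta> by (simp add: power_divide)
  ultimately show ?thesis by (simp only: mult.assoc)
qed

text \<open>At time \<open>s + \<tau>\<close> the initial value is split at frequency \<open>\<tau>\<^sup>-\<^sup>1\<^sup>/\<^sup>2\<close>: the low part \<open>p\<close> is kept as a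
  constant in time, and for the rest the smoothing estimate loses nothing.\<close>

lemma persistence:
  assumes \<delta>: "\<delta> > 0"
    and C: "C \<ge> 0" "\<And>a v. ref_coefs \<rho> a \<Longrightarrow> v 0 = 0 \<Longrightarrow> hs_summable L 0 v \<Longrightarrow> hs_summable L 3 v \<Longrightarrow> hs L 0 v \<le> \<kappa> \<Longrightarrow>
      hs_summable L 1 (pert L a v) \<and> hs L 1 (pert L a v) \<le> \<nu>\<^sup>2 / 16 * hs L 3 v + C * hs L 0 v"
  defines "E \<equiv> exp (\<rho>\<^sup>2 / (2 * \<nu>) * \<delta> + 1)"
  assumes small: "E * hs L 0 (v s) \<le> \<kappa>" and init: "hs_summable L 2 (v s)" "hs L 2 (v s) \<le> M"
    and t: "s < t" "t \<le> s + \<delta>"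
  defines "d1 \<equiv> (1 / kap1 ^ 1)\<^sup>2" and "d2 \<equiv> (1 / kap1 ^ 2)\<^sup>2"
  defines "K \<equiv> exp ((\<rho> + sqrt (csob * M))\<^sup>2 / (2 * \<nu>) * \<delta> + 1) * (1 + 2 * (3 * (\<rho>\<^sup>2 * d1 + csob * \<rho>\<^sup>2 + csob * M * d1) + \<nu>\<^sup>2))"
  shows "hs L 2 (v t) \<le> (2 * (4 * (108 / \<nu>\<^sup>2) * K + 9 / 8 * \<nu> + \<delta> / \<nu> * (C * E * d2)) + 2) * hs L 2 (v s)"
proof -
  define \<tau> where "\<tau> = t - s"
  have \<tau>: "\<tau> > 0" "\<tau> \<le> \<delta>" using t by (auto simp: \<tau>_def)
  define p where "p n = (if (kap L n)\<^sup>2 \<le> 1 / \<tau> then v s n else 0)" for n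
  define m where "m = hs L 2 (v s)"
  have m: "0 \<le> m" "m \<le> M" using init by (auto simp: m_def)
  have p0: "p 0 = 0" using v_zero by (simp add: p_def)
  have fin: "finite {n. p n \<noteq> 0}" by (rule finite_subset[OF _ finite_low_modes[of "1 / \<tau>"]]) (auto simp: p_def)
  note P = finite_support_summable[OF fin, of L]
  have p2: "hs L 2 p \<le> m" unfolding m_def by (rule hs_mono(2)[OF init(1)]) (auto simp: p_def)
  have p1: "hs L 1 p \<le> d1 * m"
  proof -
    have "hs_summable L (1 + 1) p" by (rule P)
    from hs_down(2)[OF this p0] have "hs L 1 p \<le> d1 * hs L 2 p" by (simp add: d1_def)
    also have "\<dots> \<le> d1 * m" by (intro mult_left_mono p2) (simp add: d1_def)
    finally show ?thesis .
  qed
  have d0: "d1 \<ge> 0" "d2 \<ge> 0" by (auto simp: d1_def d2_def)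
  have pl: "(ls L 0 p)\<^sup>2 \<le> csob * m"
    using ls0_bound(2)[OF P(1) p0] mult_left_mono[OF p2 csob_nonneg] by linarith
  have pl2: "(ls L 0 p)\<^sup>2 \<le> csob * M" using pl mult_left_mono[OF m(2) csob_nonneg] by linarith
  then have plM: "ls L 0 p \<le> sqrt (csob * M)" by (rule real_le_rsqrt)
  \<comment> \<open>The low modes satisfy \<open>kap^2 \<le> 1 / \<tau>\<close>, so the third-order
    norm costs one factor \<open>1 / \<tau>\<close>, which the length of the time interval
    returns.\<close>
  have p3: "hs L 3 p \<le> m / \<tau>"
  proof -
    have le: "(kap L n ^ 3 * cmod (p n))\<^sup>2 \<le> 1 / \<tau> * (kap L n ^ 2 * cmod (v s n))\<^sup>2" for n
    proof (cases "(kap L n)\<^sup>2 \<le> 1 / \<tau>")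
      case True
      then have "(kap L n)\<^sup>2 * (kap L n ^ 2 * cmod (v s n))\<^sup>2 \<le> 1 / \<tau> * (kap L n ^ 2 * cmod (v s n))\<^sup>2"
        by (intro mult_right_mono) auto
      then show ?thesis using True by (simp add: p_def power3_eq_cube power2_eq_square ac_simps)
    qed (use \<tau> in \<open>simp add: p_def\<close>)
    have "hs L 3 p \<le> (\<Sum>\<^sub>\<infinity>n. 1 / \<tau> * (kap L n ^ 2 * cmod (v s n))\<^sup>2)"
      unfolding hs_def by (rule infsum_mono_real(2)[OF summable_on_cmult_right le]) (use init in \<open>auto simp: hs_summable_def\<close>)
    also have "\<dots> = 1 / \<tau> * m" unfolding m_def hs_def by (rule infsum_cmult_right')
    finally show ?thesis by simp
  qed
  define z where "z r = (\<lambda>n. v r n - p n)" for r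
  \<comment> \<open>The high modes satisfy \<open>kap^2 > 1 / \<tau>\<close>, so the remainder
    starts with an energy of order \<open>\<tau>^2\<close>. This offsets the second inverse power of
    \<tau> in the smoothing estimate.\<close>
  have zs: "hs L 0 (z s) \<le> \<tau>\<^sup>2 * m"
  proof -
    have le: "(kap L n ^ 0 * cmod (z s n))\<^sup>2 \<le> \<tau>\<^sup>2 * (kap L n ^ 2 * cmod (v s n))\<^sup>2" for n
    proof (cases "(kap L n)\<^sup>2 \<le> 1 / \<tau>")
      case False
      then have "1 \<le> \<tau> * (kap L n)\<^sup>2" using \<tau> by (simp add: field_simps)
      then have "1 * cmod (v s n) \<le> \<tau> * (kap L n)\<^sup>2 * cmod (v s n)" by (intro mult_right_mono) auto
      then have "(cmod (v s n))\<^sup>2 \<le> (\<tau> * ((kap L n)\<^sup>2 * cmod (v s n)))\<^sup>2" by (intro power_mono) (auto simp: mult.assoc)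
      then show ?thesis using False by (simp add: z_def p_def power_mult_distrib)
    qed (simp add: z_def p_def)
    have "hs L 0 (z s) \<le> (\<Sum>\<^sub>\<infinity>n. \<tau>\<^sup>2 * (kap L n ^ 2 * cmod (v s n))\<^sup>2)"
      unfolding hs_def by (rule infsum_mono_real(2)[OF summable_on_cmult_right le]) (use init in \<open>auto simp: hs_summable_def\<close>)
    then show ?thesis by (simp add: infsum_cmult_right' m_def hs_def)
  qed
  define G where "G = 3 * (\<rho>\<^sup>2 * d1 + csob * \<rho>\<^sup>2 + csob * M * d1) + \<nu>\<^sup>2"
  have G: "3 * (\<rho>\<^sup>2 * hs L 1 p + (ls L 0 p)\<^sup>2 * \<rho>\<^sup>2 + (ls L 0 p)\<^sup>2 * hs L 1 p) + \<nu>\<^sup>2 * hs L 2 p \<le> G * m"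
  proof -
    have "3 * (\<rho>\<^sup>2 * hs L 1 p + (ls L 0 p)\<^sup>2 * \<rho>\<^sup>2 + (ls L 0 p)\<^sup>2 * hs L 1 p) + \<nu>\<^sup>2 * hs L 2 p \<le>
        3 * (\<rho>\<^sup>2 * (d1 * m) + csob * m * \<rho>\<^sup>2 + csob * M * (d1 * m)) + \<nu>\<^sup>2 * m"
      using csob_nonneg m by (intro add_mono mult_left_mono mult_mono p1 p2 pl pl2) auto
    then show ?thesis by (simp add: G_def algebra_simps)
  qed
  have G0: "G \<ge> 0" using csob_nonneg d0 m by (auto simp: G_def intro!: add_nonneg_nonneg mult_nonneg_nonneg)
  have X: "hs L 0 (z r) \<le> K * \<tau>\<^sup>2 * m" if r: "r \<in> {s..t}" for r
  proof -
    let ?\<Lambda> = "(\<rho> + sqrt (csob * M))\<^sup>2 / (2 * \<nu>) + 1 / \<tau>"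
    let ?B = "3 * (\<rho>\<^sup>2 * hs L 1 p + (ls L 0 p)\<^sup>2 * \<rho>\<^sup>2 + (ls L 0 p)\<^sup>2 * hs L 1 p) + \<nu>\<^sup>2 * hs L 2 p"
    have "hs L 0 (z r) \<le> exp (?\<Lambda> * \<tau>) * (hs L 0 (z s) + \<tau> * (2 * \<tau> * ?B))"
      unfolding z_def using r by (intro energy_estimate \<tau> fin plM) (auto simp: \<tau>_def)
    also have "\<dots> \<le> exp ((\<rho> + sqrt (csob * M))\<^sup>2 / (2 * \<nu>) * \<delta> + 1) * (\<tau>\<^sup>2 * m + \<tau> * (2 * \<tau> * (G * m)))"
    proof (intro mult_mono add_mono mult_left_mono zs G)
      have "?\<Lambda> * \<tau> = (\<rho> + sqrt (csob * M))\<^sup>2 / (2 * \<nu>) * \<tau> + 1" using \<tau> by (simp add: distrib_right)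
      also have "\<dots> \<le> (\<rho> + sqrt (csob * M))\<^sup>2 / (2 * \<nu>) * \<delta> + 1"
        using \<tau> nu_pos by (intro add_right_mono mult_left_mono) auto
      finally show "exp (?\<Lambda> * \<tau>) \<le> exp ((\<rho> + sqrt (csob * M))\<^sup>2 / (2 * \<nu>) * \<delta> + 1)" by simp
    qed (use \<tau> in auto)
    also have "\<dots> = K * \<tau>\<^sup>2 * m" unfolding K_def G_def[symmetric] by (simp add: power2_eq_square algebra_simps)
    finally show ?thesis .
  qed
  have E0: "E > 0" by (simp add: E_def)
  have Eb: "hs L 0 (v s) \<le> d2 * m" using hs_down(2)[of 0 2 "v s"] init v_zero[of s] by (simp add: m_def d2_def)
  define s' where "s' = s + \<tau> / 2"
  have s': "s < s'" "s' < t" "t - s' = \<tau> / 2" using \<tau> by (auto simp: s'_def \<tau>_def field_simps)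
  have V: "hs L 0 (v r) \<le> E * hs L 0 (v s)" if "r \<in> {s'..t}" for r
    unfolding E_def by (rule energy_growth[OF \<delta>]) (use that s' t in auto)
  have X': "hs L 0 (\<lambda>n. v r n - p n) \<le> K * \<tau>\<^sup>2 * m" if "r \<in> {s'..t}" for r
    using X[of r] that s' by (auto simp: z_def)
  define V0 where "V0 = E * hs L 0 (v s)"
  have "(\<tau> / 2) ^ 3 * hs L 2 (z t) \<le> (\<tau> / 2) * (108 / \<nu>\<^sup>2 * (K * \<tau>\<^sup>2 * m) + (\<tau> / 2) ^ 3 * (9 / 4 * \<nu> * hs L 3 p + 2 / \<nu> * (C * V0)))"
    using smoothing_estimate[OF s'(1,2) fin C V[folded V0_def] small[folded V0_def] X'] by (simp add: z_def s'(3))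
  also have "\<dots> = (\<tau> / 2) ^ 3 * (4 * (108 / \<nu>\<^sup>2) * K * m + (\<tau> / 2) * (9 / 4 * \<nu> * hs L 3 p + 2 / \<nu> * (C * V0)))"
    by (simp add: power3_eq_cube power2_eq_square algebra_simps)
  finally have "hs L 2 (z t) \<le> 4 * (108 / \<nu>\<^sup>2) * K * m + (\<tau> / 2) * (9 / 4 * \<nu> * hs L 3 p + 2 / \<nu> * (C * V0))"
    using \<tau> by (subst (asm) mult_le_cancel_left_pos) auto
  also have "\<dots> \<le> 4 * (108 / \<nu>\<^sup>2) * K * m + (\<tau> / 2) * (9 / 4 * \<nu> * (m / \<tau>) + 2 / \<nu> * (C * (E * (d2 * m))))"
    unfolding V0_def using \<tau> nu_pos C(1) E0 by (intro add_left_mono mult_left_mono add_mono p3 Eb) auto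
  also have "\<dots> = 4 * (108 / \<nu>\<^sup>2) * K * m + 9 / 8 * \<nu> * m + \<tau> * (C * E * d2 / \<nu> * m)"
    using \<tau> by (simp add: field_simps)
  also have "\<dots> \<le> 4 * (108 / \<nu>\<^sup>2) * K * m + 9 / 8 * \<nu> * m + \<delta> * (C * E * d2 / \<nu> * m)"
    using \<tau> nu_pos C(1) E0 d0 m by (intro add_left_mono mult_right_mono) auto
  also have "\<dots> = (4 * (108 / \<nu>\<^sup>2) * K + 9 / 8 * \<nu> + \<delta> / \<nu> * (C * E * d2)) * m"
    by (simp add: algebra_simps)
  finally have zt: "hs L 2 (z t) \<le> (4 * (108 / \<nu>\<^sup>2) * K + 9 / 8 * \<nu> + \<delta> / \<nu> * (C * E * d2)) * m" .
  have zsum: "hs_summable L 2 (z t)" unfolding z_def by (intro hs_diff v_hs2 t P)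
  have "hs L 2 (v t) \<le> 2 * hs L 2 (z t) + 2 * hs L 2 p"
    using hs_add(2)[OF zsum P(1)[of 2]] by (simp add: z_def)
  also have "\<dots> \<le> 2 * ((4 * (108 / \<nu>\<^sup>2) * K + 9 / 8 * \<nu> + \<delta> / \<nu> * (C * E * d2)) * m) + 2 * m"
    by (intro add_mono mult_left_mono zt p2) auto
  finally show ?thesis by (simp add: m_def algebra_simps)
qed

end

text \<open>The order of the constants matters. \<kappa> and \<open>C2\<close> depend on \<nu>,
  \<delta>, \<rho> and \<open>L\<close>, and the assimilation parameters are chosen from them.
  \<open>C3\<close> may depend on the bound \<open>M\<close> of the initial second-order norm, since
  it enters the final estimate only as a prefactor.\<close>

theorem (in torus_domain) flow_estimates:
  assumes \<nu>: "\<nu> > 0" and \<delta>: "\<delta> > 0"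
  obtains \<kappa> C2 where "\<kappa> > 0" "C2 \<ge> 0"
    "\<And>s a v. pert_flow L \<nu> \<rho> s a v \<Longrightarrow> hs L 0 (v s) \<le> \<kappa> \<Longrightarrow> hs L 2 (v (s + \<delta>)) \<le> C2 * hs L 0 (v s)"
    "\<And>M. M \<ge> 0 \<Longrightarrow> \<exists>C3\<ge>0. \<forall>s a v t. pert_flow L \<nu> \<rho> s a v \<longrightarrow> hs L 0 (v s) \<le> \<kappa> \<longrightarrow> hs_summable L 2 (v s) \<longrightarrow>
       hs L 2 (v s) \<le> M \<longrightarrow> s \<le> t \<longrightarrow> t \<le> s + \<delta> \<longrightarrow> hs L 2 (v t) \<le> C3 * hs L 2 (v s)"
proof -
  have "\<nu>\<^sup>2 / 16 > 0" using \<nu> by simp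
  then obtain C \<kappa>0 where C: "C \<ge> 0" "\<kappa>0 > 0"
    "\<And>a v. ref_coefs \<rho> a \<Longrightarrow> v 0 = 0 \<Longrightarrow> hs_summable L 0 v \<Longrightarrow> hs_summable L 3 v \<Longrightarrow> hs L 0 v \<le> \<kappa>0 \<Longrightarrow>
      hs_summable L 1 (pert L a v) \<and> hs L 1 (pert L a v) \<le> \<nu>\<^sup>2 / 16 * hs L 3 v + C * hs L 0 v"
    using pert_hs1[of "\<nu>\<^sup>2 / 16" \<rho>] by metis
  define E where "E = exp (\<rho>\<^sup>2 / (2 * \<nu>) * \<delta> + 1)"
  have E: "E > 0" by (simp add: E_def)
  define C2 where "C2 = (4 / \<delta>\<^sup>2) * (108 / \<nu>\<^sup>2 + \<delta> ^ 3 / 8 * (2 / \<nu> * C)) * E"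
  have small: "E * hs L 0 c \<le> \<kappa>0" if "hs L 0 c \<le> \<kappa>0 / E" for c
    using that E by (simp add: field_simps)
  show ?thesis
  proof (rule that[of "\<kappa>0 / E" C2])
    show "\<kappa>0 / E > 0" using C E by simp
    show "C2 \<ge> 0" using C E \<nu> \<delta> by (simp add: C2_def)
    show "hs L 2 (v (s + \<delta>)) \<le> C2 * hs L 0 (v s)" if f: "pert_flow L \<nu> \<rho> s a v" and k: "hs L 0 (v s) \<le> \<kappa>0 / E" for s a v
      using pert_flow.smoothing[OF f \<delta> C(1,3)] small[OF k] by (simp add: C2_def E_def)
    fix M :: real assume M: "M \<ge> 0"
    define d1 where "d1 = (1 / kap1 ^ 1)\<^sup>2"
    define d2 where "d2 = (1 / kap1 ^ 2)\<^sup>2"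
    define K where "K = exp ((\<rho> + sqrt (csob * M))\<^sup>2 / (2 * \<nu>) * \<delta> + 1) * (1 + 2 * (3 * (\<rho>\<^sup>2 * d1 + csob * \<rho>\<^sup>2 + csob * M * d1) + \<nu>\<^sup>2))"
    define C3 where "C3 = 2 * (4 * (108 / \<nu>\<^sup>2) * K + 9 / 8 * \<nu> + \<delta> / \<nu> * (C * E * d2)) + 2"
    have d0: "d1 \<ge> 0" "d2 \<ge> 0" by (auto simp: d1_def d2_def)
    have K0: "K \<ge> 0" using csob_nonneg d0 M by (auto simp: K_def intro!: add_nonneg_nonneg mult_nonneg_nonneg)
    \<comment> \<open>A constant of at least 1 also covers \<open>t = s\<close>, which
      \<open>persistence\<close> excludes.\<close>
    have C31: "C3 \<ge> 1" unfolding C3_def using K0 C(1) E d0 \<nu> \<delta>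
      by (intro order_trans[OF _ add_mono[OF mult_nonneg_nonneg order_refl]]) (auto intro!: add_nonneg_nonneg mult_nonneg_nonneg)
    have "hs L 2 (v t) \<le> C3 * hs L 2 (v s)"
      if f: "pert_flow L \<nu> \<rho> s a v" and k: "hs L 0 (v s) \<le> \<kappa>0 / E" and i: "hs_summable L 2 (v s)" "hs L 2 (v s) \<le> M" and t: "s \<le> t" "t \<le> s + \<delta>" for s a v t
    proof (cases "s = t")
      case True
      then show ?thesis using mult_right_mono[OF C31 hs_nonneg[of L 2 "v s"]] by simp
    next
      case False
      then have st: "s < t" using t by simp
      show ?thesis
        using pert_flow.persistence[OF f \<delta> C(1,3) small[OF k, unfolded E_def] i st t(2)]
        by (simp add: C3_def K_def d1_def d2_def E_def)
    qed
    then show "\<exists>C3\<ge>0. \<forall>s a v t. pert_flow L \<nu> \<rho> s a v \<longrightarrow> hs L 0 (v s) \<le> \<kappa>0 / E \<longrightarrow> hs_summable L 2 (v s) \<longrightarrow>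
       hs L 2 (v s) \<le> M \<longrightarrow> s \<le> t \<longrightarrow> t \<le> s + \<delta> \<longrightarrow> hs L 2 (v t) \<le> C3 * hs L 2 (v s)"
      using C31 by (intro exI[of _ C3]) auto
  qed
qed

section \<open>The space \<open>H\<close> in terms of Fourier coefficients\<close>

definition emode :: "real \<Rightarrow> int \<times> int \<Rightarrow> real^2 \<Rightarrow> complex" where
  "emode L n x = cis (wave L n \<bullet> x)"

lemma cmod_emode [simp]: "cmod (emode L n x) = 1"
  by (simp add: emode_def)

lemma emode_zero [simp]: "emode L 0 x = 1"
  by (simp add: emode_def)

lemma emode_add: "emode L (m + n) x = emode L m x * emode L n x"
  by (simp add: emode_def wave_add inner_add_left cis_mult)

lemma emode_uminus: "emode L (- n) x = cnj (emode L n x)"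
  by (simp add: emode_def wave_uminus cis_cnj)

lemma emode_diff: "emode L (m - n) x = emode L m x * cnj (emode L n x)"
  by (metis emode_add emode_uminus uminus_add_conv_diff add.commute)

lemma continuous_on_emode [continuous_intros]: "continuous_on A (emode L n)"
  unfolding emode_def by (intro continuous_intros)

definition l2 :: "real \<Rightarrow> (real^2 \<Rightarrow> 'a::euclidean_space) \<Rightarrow> real" where
  "l2 L U = (\<integral>x. (norm (U x))\<^sup>2 \<partial>torus L)"

text \<open>A divergence-free field with zero average is determined by these scalar coefficients.\<close>

definition coef :: "real \<Rightarrow> vfield \<Rightarrow> int \<times> int \<Rightarrow> complex" where
  "coef L u n = fcoef L u n (ev L n)"

lemma fcoef_emode:
  "fcoef L U n b = (\<integral>x. of_real (U x \<bullet> b) * cnj (emode L n x) \<partial>torus L) / of_real (L\<^sup>2)"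
  by (simp add: fcoef_def emode_def cis_cnj)

lemma L2_sq_add_le:
  fixes U V :: "real^2 \<Rightarrow> 'a::euclidean_space"
  shows "(norm (U x + V x))\<^sup>2 \<le> 2 * (norm (U x))\<^sup>2 + 2 * (norm (V x))\<^sup>2"
proof -
  have "(norm (U x + V x))\<^sup>2 \<le> (norm (U x) + norm (V x))\<^sup>2" by (intro power_mono norm_triangle_ineq) auto
  then show ?thesis using sum_squares_bound[of "norm (U x)" "norm (V x)"] by (simp add: power2_sum)
qed

section \<open>Integration over the torus and orthogonality of the exponentials\<close>

context torus_domain begin

lemma emeasure_torus_finite: "emeasure (torus L) (space (torus L)) < \<infinity>"
proof -
  have "emeasure (torus L) (cbox 0 (\<chi> i. L)) = emeasure lebesgue (cbox 0 (\<chi> i. L) :: (real^2) set)"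
    unfolding torus_def by (rule emeasure_restrict_space) auto
  also have "\<dots> = emeasure lborel (cbox 0 (\<chi> i. L) :: (real^2) set)" by simp
  also have "\<dots> < \<infinity>" by (rule emeasure_lborel_cbox_finite)
  finally show ?thesis by (simp add: torus_def)
qed

sublocale torus: finite_measure "torus L"
  by (rule finite_measureI) (use emeasure_torus_finite in auto)

lemma continuous_measurable_torus:
  fixes f :: "real^2 \<Rightarrow> 'b::{banach, second_countable_topology}"
  assumes "continuous_on UNIV f"
  shows "f \<in> borel_measurable (torus L)"
proof -
  have "f \<in> borel_measurable lborel" using assms by (simp add: borel_measurable_continuous_onI)
  then have "f \<in> borel_measurable lebesgue" by (rule measurable_completion)
  then show ?thesis unfolding torus_def by (rule measurable_restrict_space1)
qed

lemma continuous_bounded_torus: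
  fixes f :: "real^2 \<Rightarrow> 'b::{banach, second_countable_topology}"
  assumes "continuous_on UNIV f"
  obtains B where "\<And>x. x \<in> space (torus L) \<Longrightarrow> norm (f x) \<le> B"
proof -
  have "bounded (f ` cbox 0 (\<chi> i. L))"
    by (intro compact_imp_bounded compact_continuous_image compact_cbox continuous_on_subset[OF assms]) auto
  then obtain B where "\<forall>y\<in>f ` cbox 0 (\<chi> i. L). norm y \<le> B" unfolding bounded_iff by blast
  then show ?thesis by (intro that[of B]) (auto simp: torus_def)
qed

lemma continuous_integrable_torus:
  fixes f :: "real^2 \<Rightarrow> 'b::{banach, second_countable_topology}"
  assumes "continuous_on UNIV f"
  shows "integrable (torus L) f"
proof -
  obtain B where "\<And>x. x \<in> space (torus L) \<Longrightarrow> norm (f x) \<le> B" using continuous_bounded_torus[OF assms] by blast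
  then show ?thesis
    by (intro torus.integrable_const_bound[of _ B] AE_I2 continuous_measurable_torus assms) auto
qed

lemma integral_torus_continuous:
  fixes f :: "real^2 \<Rightarrow> 'b::{banach, second_countable_topology}"
  assumes "continuous_on UNIV f"
  shows "integral\<^sup>L (torus L) f = (\<integral>x. indicator (cbox 0 (\<chi> i. L)) x *\<^sub>R f x \<partial>lborel)"
proof -
  have m: "f \<in> borel_measurable lborel" using assms by (simp add: borel_measurable_continuous_onI)
  have "integral\<^sup>L (torus L) f = (\<integral>x. indicator (cbox 0 (\<chi> i. L)) x *\<^sub>R f x \<partial>lebesgue)"
    unfolding torus_def by (rule integral_restrict_space) simp
  also have "\<dots> = (\<integral>x. indicator (cbox 0 (\<chi> i. L)) x *\<^sub>R f x \<partial>lborel)"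
    by (rule integral_completion) (intro borel_measurable_scaleR borel_measurable_indicator m, simp)
  finally show ?thesis .
qed

lemma integral_cis_period:
  "integrable lborel (\<lambda>y. indicator {0..L} y *\<^sub>R cis (2 * pi / L * of_int i * y))"
  "(\<integral>y. indicator {0..L} y *\<^sub>R cis (2 * pi / L * of_int i * y) \<partial>lborel) = (if i = 0 then of_real L else 0)"
proof -
  define c where "c = 2 * pi / L * of_int i"
  have cont: "continuous_on {0..L} (\<lambda>y. cis (c * y))" by (intro continuous_intros)
  show "integrable lborel (\<lambda>y. indicator {0..L} y *\<^sub>R cis (2 * pi / L * of_int i * y))"
    unfolding c_def[symmetric] by (intro borel_integrable_compact cont) auto
  show "(\<integral>y. indicator {0..L} y *\<^sub>R cis (2 * pi / L * of_int i * y) \<partial>lborel) = (if i = 0 then of_real L else 0)"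
  proof (cases "i = 0")
    case True
    then show ?thesis using L_pos by (simp add: scaleR_conv_of_real)
  next
    case False
    then have c0: "c \<noteq> 0" using L_pos by (simp add: c_def)
    have d: "((\<lambda>y. cis (c * y) / (\<i> * of_real c)) has_vector_derivative cis (c * y)) (at y within {0..L})" for y
    proof -
      have "((\<lambda>y. cis (c * y)) has_vector_derivative c *\<^sub>R (\<i> * cis (c * y))) (at y within {0..L})"
      proof -
        have "((\<lambda>z. exp (\<i> * of_real c * z)) has_field_derivative \<i> * of_real c * exp (\<i> * of_real c * of_real y)) (at (of_real y))"
          by (auto intro!: derivative_eq_intros)
        from has_vector_derivative_real_field[OF this, of "{0..L}"]
        show ?thesis by (simp add: cis_conv_exp scaleR_conv_of_real ac_simps)
      qed
      then have "((\<lambda>y. cis (c * y) / (\<i> * of_real c)) has_vector_derivative c *\<^sub>R (\<i> * cis (c * y)) / (\<i> * of_real c)) (at y within {0..L})"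
        by (rule has_vector_derivative_divide)
      then show ?thesis using c0 by (simp add: scaleR_conv_of_real)
    qed
    have cL: "c * L = 2 * pi * of_int i" using L_pos by (simp add: c_def)
    have "has_bochner_integral lborel (\<lambda>y. indicator {0..L} y *\<^sub>R cis (c * y)) (cis (c * L) / (\<i> * of_real c) - cis (c * 0) / (\<i> * of_real c))"
      by (rule has_bochner_integral_FTC_Icc[OF _ d cont]) (use L_pos in auto)
    then show ?thesis using False unfolding c_def[symmetric]
      by (simp add: has_bochner_integral_iff cL cis_multiple_2pi)
  qed
qed

text \<open>The exponential and the indicator of the square both factor over the coordinates, which
  reduces the claim to integrals over one period.\<close>

lemma integral_emode: "(\<integral>x. emode L n x \<partial>torus L) = (if n = 0 then of_real (L\<^sup>2) else 0)"
proof -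
  define k where "k b = (if b = axis 1 1 then fst n else snd n)" for b :: "real^2"
  define g where "g b y = indicator {0..L} y *\<^sub>R cis (2 * pi / L * of_int (k b) * y)" for b :: "real^2" and y :: real
  have B2: "(Basis :: (real^2) set) = {axis 1 1, axis 2 1}"
    by (auto simp: Basis_vec_def UNIV_2)
  have ne: "axis 1 1 \<noteq> (axis 2 1 :: real^2)" by (simp add: axis_eq_axis)
  have fac: "indicator (cbox 0 (\<chi> i. L)) x *\<^sub>R emode L n x = (\<Prod>b\<in>Basis. g b (x \<bullet> b))" for x :: "real^2"
  proof -
    have "(\<Prod>b\<in>Basis. g b (x \<bullet> b)) = g (axis 1 1) (x $ 1) * g (axis 2 1) (x $ 2)"
      unfolding B2 using ne by (simp add: inner_axis)
    also have "\<dots> = indicator (cbox 0 (\<chi> i. L)) x *\<^sub>R emode L n x"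
      using ne by (auto simp: g_def k_def emode_def inner_real2 wave_components cis_mult indicator_def mem_box_cart forall_2 algebra_simps)
    finally show ?thesis by simp
  qed
  have gi: "integrable lborel (g b)" and gv: "integral\<^sup>L lborel (g b) = (if k b = 0 then of_real L else 0)" for b
    unfolding g_def using integral_cis_period[of "k b"] by auto
  interpret P: product_sigma_finite "\<lambda>b::real^2. lborel :: real measure" by standard
  have gm: "g b \<in> borel_measurable borel" for b using borel_measurable_integrable[OF gi] by simp
  have pm: "(\<lambda>x. \<Prod>b\<in>Basis. g b (x \<bullet> b)) \<in> borel_measurable (borel :: (real^2) measure)"
    by (intro borel_measurable_prod measurable_compose[OF _ gm]) auto
  have "(\<integral>x. emode L n x \<partial>torus L) = (\<integral>x. (\<Prod>b\<in>Basis. g b (x \<bullet> b)) \<partial>(lborel :: (real^2) measure))"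
    by (simp add: integral_torus_continuous[OF continuous_on_emode] fac)
  also have "\<dots> = (\<integral>f. (\<Prod>b\<in>Basis. g b ((\<Sum>b\<in>Basis. f b *\<^sub>R b) \<bullet> b)) \<partial>(\<Pi>\<^sub>M b\<in>(Basis :: (real^2) set). lborel))"
    unfolding lborel_eq[where 'a="real^2"] by (rule integral_distr) (simp, rule pm)
  also have "\<dots> = (\<integral>f. (\<Prod>b\<in>Basis. g b (f b)) \<partial>(\<Pi>\<^sub>M b\<in>(Basis :: (real^2) set). lborel))"
    by (intro Bochner_Integration.integral_cong prod.cong refl) (simp add: inner_sum_left inner_Basis if_distrib cong: if_cong)
  also have "\<dots> = (\<Prod>b\<in>Basis. integral\<^sup>L lborel (g b))"
    by (rule P.product_integral_prod) (auto intro: gi)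
  also have "\<dots> = (if n = 0 then of_real (L\<^sup>2) else 0)"
    unfolding B2 gv using ne by (cases n) (auto simp: k_def zero_mode power2_eq_square)
  finally show ?thesis .
qed

lemma emode_orthogonal:
  "(\<integral>x. emode L m x * cnj (emode L n x) \<partial>torus L) = (if m = n then of_real (L\<^sup>2) else 0)"
  using integral_emode[of "m - n"] by (simp add: emode_diff[symmetric])

lemma L2_spaceD:
  assumes "U \<in> L2_space L"
  shows "U \<in> borel_measurable (torus L)" "integrable (torus L) (\<lambda>x. (norm (U x))\<^sup>2)"
    "L2_sq L U = ennreal (l2 L U)"
proof -
  show m: "U \<in> borel_measurable (torus L)" using assms by (simp add: L2_space_def)
  then show i: "integrable (torus L) (\<lambda>x. (norm (U x))\<^sup>2)"
    using assms by (intro integrableI_bounded) (auto simp: L2_space_def L2_sq_def)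
  show "L2_sq L U = ennreal (l2 L U)"
    unfolding L2_sq_def l2_def by (rule nn_integral_eq_integral[OF i]) auto
qed

lemma L2_spaceI:
  assumes "U \<in> borel_measurable (torus L)" "integrable (torus L) (\<lambda>x. (norm (U x))\<^sup>2)"
  shows "U \<in> L2_space L"
  using assms by (simp add: L2_space_def L2_sq_def nn_integral_eq_integral)

lemma l2_nonneg [simp]: "0 \<le> l2 L U"
  unfolding l2_def by (rule integral_nonneg_AE) auto

lemma continuous_L2:
  fixes f :: "real^2 \<Rightarrow> 'a::euclidean_space"
  assumes "continuous_on UNIV f"
  shows "f \<in> L2_space L"
  by (intro L2_spaceI continuous_measurable_torus continuous_integrable_torus continuous_intros assms)

lemma L2_space_add:
  fixes U V :: "real^2 \<Rightarrow> 'a::euclidean_space"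
  assumes "U \<in> L2_space L" "V \<in> L2_space L"
  shows "(\<lambda>x. U x + V x) \<in> L2_space L" "l2 L (\<lambda>x. U x + V x) \<le> 2 * l2 L U + 2 * l2 L V"
proof -
  note u = L2_spaceD[OF assms(1)] and v = L2_spaceD[OF assms(2)]
  have i: "integrable (torus L) (\<lambda>x. 2 * (norm (U x))\<^sup>2 + 2 * (norm (V x))\<^sup>2)"
    by (intro Bochner_Integration.integrable_add integrable_mult_right u(2) v(2))
  have m: "(\<lambda>x. U x + V x) \<in> borel_measurable (torus L)" by (intro borel_measurable_add u(1) v(1))
  have s: "integrable (torus L) (\<lambda>x. (norm (U x + V x))\<^sup>2)"
  proof (rule Bochner_Integration.integrable_bound[OF i])
    show "(\<lambda>x. (norm (U x + V x))\<^sup>2) \<in> borel_measurable (torus L)"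
      using m by simp
    show "AE x in torus L. norm ((norm (U x + V x))\<^sup>2) \<le> norm (2 * (norm (U x))\<^sup>2 + 2 * (norm (V x))\<^sup>2)"
      using L2_sq_add_le[of U _ V] by (intro AE_I2) simp
  qed
  show "(\<lambda>x. U x + V x) \<in> L2_space L" by (rule L2_spaceI[OF m s])
  have "l2 L (\<lambda>x. U x + V x) \<le> (\<integral>x. 2 * (norm (U x))\<^sup>2 + 2 * (norm (V x))\<^sup>2 \<partial>torus L)"
    unfolding l2_def by (intro integral_mono s i L2_sq_add_le)
  also have "\<dots> = (\<integral>x. 2 * (norm (U x))\<^sup>2 \<partial>torus L) + (\<integral>x. 2 * (norm (V x))\<^sup>2 \<partial>torus L)"
    by (intro Bochner_Integration.integral_add integrable_mult_right u(2) v(2))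
  also have "\<dots> = 2 * l2 L U + 2 * l2 L V" by (simp add: l2_def)
  finally show "l2 L (\<lambda>x. U x + V x) \<le> 2 * l2 L U + 2 * l2 L V" .
qed

lemma L2_space_scale:
  fixes U :: "real^2 \<Rightarrow> 'a::euclidean_space"
  assumes "U \<in> L2_space L"
  shows "(\<lambda>x. c *\<^sub>R U x) \<in> L2_space L" "l2 L (\<lambda>x. c *\<^sub>R U x) = c\<^sup>2 * l2 L U"
proof -
  note u = L2_spaceD[OF assms]
  have e: "(norm (c *\<^sub>R U x))\<^sup>2 = c\<^sup>2 * (norm (U x))\<^sup>2" for x by (simp add: power_mult_distrib)
  show "(\<lambda>x. c *\<^sub>R U x) \<in> L2_space L"
    by (rule L2_spaceI, intro borel_measurable_scaleR borel_measurable_const u(1)) (unfold e, intro integrable_mult_right u(2))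
  show "l2 L (\<lambda>x. c *\<^sub>R U x) = c\<^sup>2 * l2 L U" unfolding l2_def e by (rule integral_mult_right_zero)
qed

lemma L2_space_diff:
  fixes U V :: "real^2 \<Rightarrow> 'a::euclidean_space"
  assumes "U \<in> L2_space L" "V \<in> L2_space L"
  shows "(\<lambda>x. U x - V x) \<in> L2_space L" "l2 L (\<lambda>x. U x - V x) \<le> 2 * l2 L U + 2 * l2 L V"
proof -
  have e: "(\<lambda>x. U x - V x) = (\<lambda>x. U x + (- 1) *\<^sub>R V x)" by simp
  note s = L2_space_scale[OF assms(2), of "- 1"]
  show "(\<lambda>x. U x - V x) \<in> L2_space L" unfolding e by (rule L2_space_add(1)[OF assms(1) s(1)])
  show "l2 L (\<lambda>x. U x - V x) \<le> 2 * l2 L U + 2 * l2 L V"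
    unfolding e using L2_space_add(2)[OF assms(1) s(1)] unfolding s(2) by (simp only: power2_minus) simp
qed

lemma L2_product_integrable:
  fixes U V :: "real^2 \<Rightarrow> 'a::euclidean_space"
  assumes "U \<in> L2_space L" "V \<in> L2_space L"
  shows "integrable (torus L) (\<lambda>x. U x \<bullet> V x)"
proof -
  note u = L2_spaceD[OF assms(1)] and v = L2_spaceD[OF assms(2)]
  have i: "integrable (torus L) (\<lambda>x. (norm (U x))\<^sup>2 + (norm (V x))\<^sup>2)"
    by (intro Bochner_Integration.integrable_add u(2) v(2))
  show ?thesis
  proof (rule Bochner_Integration.integrable_bound[OF i])
    show "(\<lambda>x. U x \<bullet> V x) \<in> borel_measurable (torus L)" by (intro borel_measurable_inner u(1) v(1))
    show "AE x in torus L. norm (U x \<bullet> V x) \<le> norm ((norm (U x))\<^sup>2 + (norm (V x))\<^sup>2)"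
    proof (rule AE_I2)
      fix x
      have "\<bar>U x \<bullet> V x\<bar> \<le> norm (U x) * norm (V x)" by (rule Cauchy_Schwarz_ineq2)
      also have "\<dots> \<le> (norm (U x))\<^sup>2 + (norm (V x))\<^sup>2"
        using sum_squares_bound[of "norm (U x)" "norm (V x)"] mult_nonneg_nonneg[OF norm_ge_zero[of "U x"] norm_ge_zero[of "V x"]]
        by linarith
      finally show "norm (U x \<bullet> V x) \<le> norm ((norm (U x))\<^sup>2 + (norm (V x))\<^sup>2)" by simp
    qed
  qed
qed

lemma L2_integrable_mult:
  fixes U :: "real^2 \<Rightarrow> 'a::euclidean_space"
  assumes "U \<in> L2_space L" and g: "continuous_on UNIV g"
  shows "integrable (torus L) (\<lambda>x. of_real (U x \<bullet> b) * (g x :: complex))"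
proof -
  obtain B where B: "\<And>x. x \<in> space (torus L) \<Longrightarrow> norm (g x) \<le> B" using continuous_bounded_torus[OF g] by blast
  have i: "integrable (torus L) (\<lambda>x. U x \<bullet> b)"
    by (rule L2_product_integrable[OF assms(1)]) (intro continuous_L2 continuous_intros)
  have i': "integrable (torus L) (\<lambda>x. B * \<bar>U x \<bullet> b\<bar>)" using i by (intro integrable_mult_right integrable_abs)
  show ?thesis
  proof (rule Bochner_Integration.integrable_bound[OF i'])
    show "(\<lambda>x. of_real (U x \<bullet> b) * g x) \<in> borel_measurable (torus L)"
      using L2_spaceD(1)[OF assms(1)] continuous_measurable_torus[OF g] by auto
    show "AE x in torus L. norm (of_real (U x \<bullet> b) * g x) \<le> norm (B * \<bar>U x \<bullet> b\<bar>)"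
    proof (rule AE_I2)
      fix x assume "x \<in> space (torus L)"
      then have "\<bar>U x \<bullet> b\<bar> * norm (g x) \<le> \<bar>U x \<bullet> b\<bar> * B" using B by (intro mult_left_mono) auto
      then show "norm (of_real (U x \<bullet> b) * g x) \<le> norm (B * \<bar>U x \<bullet> b\<bar>)"
        by (simp add: norm_mult mult.commute)
    qed
  qed
qed

lemma fcoef_add:
  fixes U V :: "real^2 \<Rightarrow> 'a::euclidean_space"
  assumes "U \<in> L2_space L" "V \<in> L2_space L"
  shows "fcoef L (\<lambda>x. U x + V x) n b = fcoef L U n b + fcoef L V n b"
proof -
  have i: "integrable (torus L) (\<lambda>x. of_real (U x \<bullet> b) * cnj (emode L n x))"
    and j: "integrable (torus L) (\<lambda>x. of_real (V x \<bullet> b) * cnj (emode L n x))"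
    by (intro L2_integrable_mult assms continuous_intros)+
  show ?thesis
    unfolding fcoef_emode inner_add_left of_real_add distrib_right Bochner_Integration.integral_add[OF i j]
    by (rule add_divide_distrib)
qed

lemma fcoef_scale: "fcoef L (\<lambda>x. c *\<^sub>R U x) n b = of_real c * fcoef L U n b"
  by (simp add: fcoef_emode mult.assoc)

lemma fcoef_diff:
  fixes U V :: "real^2 \<Rightarrow> 'a::euclidean_space"
  assumes "U \<in> L2_space L" "V \<in> L2_space L"
  shows "fcoef L (\<lambda>x. U x - V x) n b = fcoef L U n b - fcoef L V n b"
proof -
  have e: "(\<lambda>x. U x - V x) = (\<lambda>x. U x + (- 1) *\<^sub>R V x)" by simp
  show ?thesis
    unfolding e fcoef_add[OF assms(1) L2_space_scale(1)[OF assms(2)]] fcoef_scale by simp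
qed

lemma fcoef_sum_Basis:
  fixes U :: "real^2 \<Rightarrow> 'a::euclidean_space"
  assumes "U \<in> L2_space L"
  shows "fcoef L U n y = (\<Sum>b\<in>Basis. of_real (y \<bullet> b) * fcoef L U n b)"
proof -
  have i: "integrable (torus L) (\<lambda>x. of_real (U x \<bullet> b) * cnj (emode L n x))" for b
    by (intro L2_integrable_mult assms continuous_intros)
  have e: "complex_of_real (U x \<bullet> y) = (\<Sum>b\<in>Basis. of_real (y \<bullet> b) * of_real (U x \<bullet> b))" for x
    unfolding euclidean_inner[of "U x" y] of_real_sum of_real_mult by (simp only: mult.commute)
  have "(\<integral>x. of_real (U x \<bullet> y) * cnj (emode L n x) \<partial>torus L) =
      (\<integral>x. (\<Sum>b\<in>Basis. of_real (y \<bullet> b) * (of_real (U x \<bullet> b) * cnj (emode L n x))) \<partial>torus L)"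
    unfolding e sum_distrib_right mult.assoc ..
  also have "\<dots> = (\<Sum>b\<in>Basis. \<integral>x. of_real (y \<bullet> b) * (of_real (U x \<bullet> b) * cnj (emode L n x)) \<partial>torus L)"
    by (intro Bochner_Integration.integral_sum integrable_mult_right i)
  also have "\<dots> = (\<Sum>b\<in>Basis. of_real (y \<bullet> b) * (\<integral>x. of_real (U x \<bullet> b) * cnj (emode L n x) \<partial>torus L))"
    by (simp only: integral_mult_right_zero)
  finally show ?thesis
    unfolding fcoef_emode by (simp only: sum_divide_distrib times_divide_eq_right)
qed

lemma fcoef_uminus_mode: "fcoef L U (- n) b = cnj (fcoef L U n b)"
proof -
  have "(\<integral>x. of_real (U x \<bullet> b) * cnj (emode L (- n) x) \<partial>torus L) = (\<integral>x. cnj (of_real (U x \<bullet> b) * cnj (emode L n x)) \<partial>torus L)"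
    unfolding emode_uminus complex_cnj_mult complex_cnj_complex_of_real ..
  also have "\<dots> = cnj (\<integral>x. of_real (U x \<bullet> b) * cnj (emode L n x) \<partial>torus L)" by (rule Bochner_Integration.integral_cnj)
  finally show ?thesis unfolding fcoef_emode by (simp only: complex_cnj_divide complex_cnj_complex_of_real)
qed

lemma coef_real: "real_coefs (coef L u)"
  unfolding real_coefs_def coef_def
proof
  fix n
  have "fcoef L u (- n) (ev L (- n)) = - fcoef L u (- n) (ev L n)"
    unfolding ev_uminus fcoef_emode inner_minus_right of_real_minus mult_minus_left Bochner_Integration.integral_minus
    by (rule minus_divide_left[symmetric])
  then show "fcoef L u (- n) (ev L (- n)) = - cnj (fcoef L u n (ev L n))" by (simp only: fcoef_uminus_mode)
qed

lemma coef_zero [simp]: "coef L u 0 = 0"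
  unfolding coef_def fcoef_emode ev_zero inner_zero_right of_real_0 mult_zero_left Bochner_Integration.integral_zero div_0 ..

text \<open>Expands the nonnegative integral of the squared distance between the component and its
  Fourier sum \<open>T\<close>. The direction \<open>b\<close> is arbitrary, so components along the
  wave vector, which \<open>coef\<close> does not record, are covered too;
  \<open>space_H_fcoef\<close> relies on this.\<close>

lemma bessel_scalar:
  fixes U :: "real^2 \<Rightarrow> 'a::euclidean_space"
  assumes U: "U \<in> L2_space L" and F: "finite F"
  shows "L\<^sup>2 * (\<Sum>n\<in>F. (cmod (fcoef L U n b))\<^sup>2) \<le> (\<integral>x. (U x \<bullet> b)\<^sup>2 \<partial>torus L)"
proof -
  let ?c = "\<lambda>n. fcoef L U n b"
  define T where "T x = (\<Sum>n\<in>F. ?c n * emode L n x)" for x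
  have cT: "continuous_on UNIV T" unfolding T_def by (intro continuous_intros)
  have iU2: "integrable (torus L) (\<lambda>x. (U x \<bullet> b)\<^sup>2)"
  proof -
    have i: "integrable (torus L) (\<lambda>x. (norm b)\<^sup>2 * (norm (U x))\<^sup>2)"
      by (intro integrable_mult_right L2_spaceD(2)[OF U])
    show ?thesis
    proof (rule Bochner_Integration.integrable_bound[OF i])
      show "(\<lambda>x. (U x \<bullet> b)\<^sup>2) \<in> borel_measurable (torus L)" using L2_spaceD(1)[OF U] by simp
      show "AE x in torus L. norm ((U x \<bullet> b)\<^sup>2) \<le> norm ((norm b)\<^sup>2 * (norm (U x))\<^sup>2)"
      proof (rule AE_I2)
        fix x
        have "\<bar>U x \<bullet> b\<bar>\<^sup>2 \<le> (norm (U x) * norm b)\<^sup>2" by (intro power_mono Cauchy_Schwarz_ineq2) auto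
        then show "norm ((U x \<bullet> b)\<^sup>2) \<le> norm ((norm b)\<^sup>2 * (norm (U x))\<^sup>2)"
          by (simp add: power_mult_distrib mult.commute)
      qed
    qed
  qed
  have i: "integrable (torus L) (\<lambda>x. of_real (U x \<bullet> b) * cnj (T x))"
    by (intro L2_integrable_mult U continuous_intros cT)
  have v1: "(\<integral>x. of_real (U x \<bullet> b) * cnj (T x) \<partial>torus L) = of_real (L\<^sup>2 * (\<Sum>n\<in>F. (cmod (?c n))\<^sup>2))"
  proof -
    have "(\<integral>x. of_real (U x \<bullet> b) * cnj (T x) \<partial>torus L) = (\<integral>x. (\<Sum>n\<in>F. cnj (?c n) * (of_real (U x \<bullet> b) * cnj (emode L n x))) \<partial>torus L)"
      by (simp add: T_def sum_distrib_left ac_simps)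
    also have "\<dots> = (\<Sum>n\<in>F. cnj (?c n) * (\<integral>x. of_real (U x \<bullet> b) * cnj (emode L n x) \<partial>torus L))"
    proof -
      have "integrable (torus L) (\<lambda>x. of_real (U x \<bullet> b) * cnj (emode L n x))" for n
        by (intro L2_integrable_mult U continuous_intros)
      then show ?thesis by simp
    qed
    also have "\<dots> = (\<Sum>n\<in>F. cnj (?c n) * (of_real (L\<^sup>2) * ?c n))"
      using L_pos by (simp add: fcoef_emode)
    also have "\<dots> = of_real (L\<^sup>2 * (\<Sum>n\<in>F. (cmod (?c n))\<^sup>2))"
      by (simp add: sum_distrib_left complex_norm_square ac_simps del: of_real_power)
    finally show ?thesis .
  qed
  have v2: "(\<integral>x. T x * cnj (T x) \<partial>torus L) = of_real (L\<^sup>2 * (\<Sum>n\<in>F. (cmod (?c n))\<^sup>2))"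
  proof -
    have "(\<integral>x. T x * cnj (T x) \<partial>torus L) = (\<integral>x. (\<Sum>m\<in>F. \<Sum>n\<in>F. (?c m * cnj (?c n)) * (emode L m x * cnj (emode L n x))) \<partial>torus L)"
      by (simp add: T_def sum_product ac_simps)
    also have "\<dots> = (\<Sum>m\<in>F. \<Sum>n\<in>F. (?c m * cnj (?c n)) * (\<integral>x. emode L m x * cnj (emode L n x) \<partial>torus L))"
    proof -
      have "integrable (torus L) (\<lambda>x. emode L m x * cnj (emode L n x))" for m n
        by (intro continuous_integrable_torus continuous_intros)
      then show ?thesis by simp
    qed
    also have "\<dots> = (\<Sum>m\<in>F. (?c m * cnj (?c m)) * of_real (L\<^sup>2))"
      using F by (simp add: emode_orthogonal if_distrib sum.delta' cong: if_cong)
    also have "\<dots> = of_real (L\<^sup>2 * (\<Sum>n\<in>F. (cmod (?c n))\<^sup>2))"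
      by (simp add: sum_distrib_left complex_norm_square ac_simps del: of_real_power)
    finally show ?thesis .
  qed
  have iT: "integrable (torus L) (\<lambda>x. T x * cnj (T x))" by (intro continuous_integrable_torus continuous_intros cT)
  have ex: "(cmod (of_real (U x \<bullet> b) - T x))\<^sup>2 = (U x \<bullet> b)\<^sup>2 - 2 * Re (of_real (U x \<bullet> b) * cnj (T x)) + Re (T x * cnj (T x))" for x
    by (simp add: cmod_power2) (simp add: power2_eq_square algebra_simps)
  have "0 \<le> (\<integral>x. (cmod (of_real (U x \<bullet> b) - T x))\<^sup>2 \<partial>torus L)" by (rule integral_nonneg_AE) auto
  also have "\<dots> = (\<integral>x. (U x \<bullet> b)\<^sup>2 \<partial>torus L) - 2 * Re (\<integral>x. of_real (U x \<bullet> b) * cnj (T x) \<partial>torus L) + Re (\<integral>x. T x * cnj (T x) \<partial>torus L)"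
    unfolding ex using iU2 integrable_Re[OF i] integrable_Re[OF iT] integral_Re[OF i] integral_Re[OF iT] by simp
  also have "\<dots> = (\<integral>x. (U x \<bullet> b)\<^sup>2 \<partial>torus L) - L\<^sup>2 * (\<Sum>n\<in>F. (cmod (?c n))\<^sup>2)"
    unfolding v1 v2 by simp
  finally show ?thesis by simp
qed

end

section \<open>Divergence-free trigonometric polynomials\<close>

definition texp :: "real \<Rightarrow> (int \<times> int) set \<Rightarrow> (int \<times> int \<Rightarrow> complex) \<Rightarrow> vfield" where
  "texp L F c x = (\<Sum>n\<in>F. Re (c n * emode L n x) *\<^sub>R ev L n)"

definition sym_set :: "(int \<times> int) set \<Rightarrow> bool" where
  "sym_set F \<longleftrightarrow> finite F \<and> (\<forall>n. - n \<in> F \<longleftrightarrow> n \<in> F)"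

lemma sym_setD: "sym_set F \<Longrightarrow> finite F" "sym_set F \<Longrightarrow> - n \<in> F \<longleftrightarrow> n \<in> F"
  unfolding sym_set_def by blast+

lemma sym_set_mbox: "sym_set (mbox N)"
  unfolding sym_set_def mbox_def by auto

lemma sum_sym_set:
  assumes "sym_set F" shows "(\<Sum>n\<in>F. g (- n)) = (\<Sum>n\<in>F. g n)"
  by (rule sum.reindex_bij_witness[of _ uminus uminus]) (use assms in \<open>auto simp: sym_set_def\<close>)

lemma sum_conj_real:
  assumes "sym_set F" "\<And>n. n \<in> F \<Longrightarrow> T (- n) = cnj (T n)"
  shows "(\<Sum>n\<in>F. T n) = of_real (\<Sum>n\<in>F. Re (T n))"
proof -
  have "cnj (\<Sum>n\<in>F. T n) = (\<Sum>n\<in>F. T (- n))" using assms(2) by (simp add: cnj_sum)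
  also have "\<dots> = (\<Sum>n\<in>F. T n)" by (rule sum_sym_set[OF assms(1)])
  finally have "(\<Sum>n\<in>F. T n) \<in> \<real>" by (simp add: Reals_cnj_iff)
  then have "(\<Sum>n\<in>F. T n) = of_real (Re (\<Sum>n\<in>F. T n))" by (rule of_real_Re[symmetric])
  then show ?thesis unfolding Re_sum .
qed

lemma continuous_on_texp [continuous_intros]: "continuous_on A (texp L F c)"
  unfolding texp_def by (intro continuous_intros)

lemma emode_has_derivative:
  "((\<lambda>x. Re (c * emode L n x)) has_derivative (\<lambda>h. Re (\<i> * of_real (wave L n \<bullet> h) * c * emode L n x))) (at x)"
proof -
  have 1: "((\<lambda>t. exp (\<i> * of_real t)) has_vector_derivative \<i> * exp (\<i> * of_real t)) (at t)" for t :: real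
  proof -
    have "((\<lambda>z. exp (\<i> * z)) has_field_derivative \<i> * exp (\<i> * of_real t)) (at (of_real t))"
      by (auto intro!: derivative_eq_intros)
    from has_vector_derivative_real_field[OF this, of UNIV] show ?thesis by simp
  qed
  have 2: "((\<lambda>x. wave L n \<bullet> x) has_derivative (\<lambda>h. wave L n \<bullet> h)) (at x)"
    by (auto intro!: derivative_eq_intros)
  have 3: "(emode L n has_derivative (\<lambda>h. (wave L n \<bullet> h) *\<^sub>R (\<i> * emode L n x))) (at x)"
    using has_derivative_compose[OF 2 1[unfolded has_vector_derivative_def]]
    by (simp add: emode_def[abs_def] cis_conv_exp)
  have 4: "((\<lambda>x. c * emode L n x) has_derivative (\<lambda>h. c * ((wave L n \<bullet> h) *\<^sub>R (\<i> * emode L n x)))) (at x)"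
    by (intro derivative_intros 3)
  have "(\<lambda>h. Re (c * ((wave L n \<bullet> h) *\<^sub>R (\<i> * emode L n x)))) = (\<lambda>h. Re (\<i> * of_real (wave L n \<bullet> h) * c * emode L n x))"
    by (simp add: scaleR_conv_of_real ac_simps)
  then show ?thesis
    using bounded_linear.has_derivative[OF bounded_linear_Re 4] by simp
qed

lemma pderiv_dirI:
  assumes "(U has_derivative D) (at x)"
  shows "pderiv_dir i U x = D (axis i 1)"
  unfolding pderiv_dir_def by (simp add: frechet_derivative_at[OF assms, symmetric])

lemma pderiv_texp: "pderiv_dir i (texp L F c) = texp L F (\<lambda>n. \<i> * of_real (wave L n $ i) * c n)"
proof
  fix x
  have "((\<lambda>x. Re (c n * emode L n x) *\<^sub>R ev L n) has_derivative (\<lambda>h. Re (\<i> * of_real (wave L n \<bullet> h) * c n * emode L n x) *\<^sub>R ev L n)) (at x)" for n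
    by (intro has_derivative_scaleR_left emode_has_derivative)
  then have "(texp L F c has_derivative (\<lambda>h. \<Sum>n\<in>F. Re (\<i> * of_real (wave L n \<bullet> h) * c n * emode L n x) *\<^sub>R ev L n)) (at x)"
    unfolding texp_def[abs_def] by (intro has_derivative_sum)
  from pderiv_dirI[OF this] show "pderiv_dir i (texp L F c) x = texp L F (\<lambda>n. \<i> * of_real (wave L n $ i) * c n) x"
    by (simp add: texp_def inner_axis)
qed

lemma texp_inner: "texp L F c x \<bullet> y = (\<Sum>n\<in>F. Re (c n * emode L n x) * (ev L n \<bullet> y))"
  by (simp add: texp_def inner_sum_left)

text \<open>Opposite modes contribute conjugate terms, since \<open>c\<close> and \<open>ev\<close>
  change sign together; so the complex sum is already real.\<close>

lemma texp_inner_complex: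
  assumes F: "sym_set F" and c: "real_coefs c"
  shows "complex_of_real (texp L F c x \<bullet> y) = (\<Sum>n\<in>F. (c n * of_real (ev L n \<bullet> y)) * emode L n x)"
proof -
  have "(\<Sum>n\<in>F. (c n * of_real (ev L n \<bullet> y)) * emode L n x) = of_real (\<Sum>n\<in>F. Re ((c n * of_real (ev L n \<bullet> y)) * emode L n x))"
  proof (rule sum_conj_real[OF F])
    fix n
    have "c (- n) = - cnj (c n)" using c unfolding real_coefs_def by blast
    then show "(c (- n) * of_real (ev L (- n) \<bullet> y)) * emode L (- n) x = cnj ((c n * of_real (ev L n \<bullet> y)) * emode L n x)"
      by (simp add: ev_uminus emode_uminus)
  qed
  moreover have "Re ((c n * of_real (ev L n \<bullet> y)) * emode L n x) = Re (c n * emode L n x) * (ev L n \<bullet> y)" for n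
    by (simp add: algebra_simps)
  ultimately show ?thesis by (simp only: texp_inner)
qed

text \<open>The vector \<open>(x, y)\<close> is orthogonal to \<open>(a, b)\<close>, hence equal to
  its projection onto the unit vector \<open>(- b, a) / q\<close>.\<close>

lemma perp_projection:
  fixes a b q x y :: complex
  assumes "a * x + b * y = 0" "q \<noteq> 0" "q\<^sup>2 = a\<^sup>2 + b\<^sup>2"
  shows "(- b / q * x + a / q * y) * (- b / q) = x" "(- b / q * x + a / q * y) * (a / q) = y"
proof -
  have 1: "b * (b * x - a * y) = q\<^sup>2 * x" and 2: "a * (a * y - b * x) = q\<^sup>2 * y"
    using assms(1,3) by algebra+
  have "(- b / q * x + a / q * y) * (- b / q) = b * (b * x - a * y) / q\<^sup>2"
    "(- b / q * x + a / q * y) * (a / q) = a * (a * y - b * x) / q\<^sup>2"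
    using assms(2) by (simp_all add: field_simps power2_eq_square)
  then show "(- b / q * x + a / q * y) * (- b / q) = x" "(- b / q * x + a / q * y) * (a / q) = y"
    unfolding 1 2 using assms(2) by simp_all
qed

lemma Basis_real2: "(Basis :: (real^2) set) = {axis 1 1, axis 2 1}"
  by (auto simp: Basis_vec_def UNIV_2)

lemma sum_Basis_real2: "(\<Sum>b\<in>(Basis :: (real^2) set). g b) = g (axis 1 1) + g (axis 2 1)"
proof -
  have "axis 1 1 \<noteq> (axis 2 1 :: real^2)" by (simp add: axis_eq_axis)
  then show ?thesis unfolding Basis_real2 by simp
qed

context torus_domain begin

lemma fcoef_of_expansion:
  assumes F: "finite F" and e: "\<And>x. complex_of_real (U x \<bullet> b) = (\<Sum>m\<in>F. d m * emode L m x)"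
  shows "fcoef L U n b = (if n \<in> F then d n else 0)"
proof -
  have i: "integrable (torus L) (\<lambda>x. emode L m x * cnj (emode L n x))" for m
    by (intro continuous_integrable_torus continuous_intros)
  have "(\<integral>x. of_real (U x \<bullet> b) * cnj (emode L n x) \<partial>torus L) = (\<integral>x. (\<Sum>m\<in>F. d m * (emode L m x * cnj (emode L n x))) \<partial>torus L)"
    unfolding e sum_distrib_right mult.assoc ..
  also have "\<dots> = (\<Sum>m\<in>F. \<integral>x. d m * (emode L m x * cnj (emode L n x)) \<partial>torus L)"
    by (intro Bochner_Integration.integral_sum integrable_mult_right i)
  also have "\<dots> = (\<Sum>m\<in>F. d m * (if m = n then of_real (L\<^sup>2) else 0))"
    by (simp only: integral_mult_right_zero emode_orthogonal)
  also have "\<dots> = (if n \<in> F then d n * of_real (L\<^sup>2) else 0)"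
  proof -
    have "(\<Sum>m\<in>F. d m * (if m = n then of_real (L\<^sup>2) else 0)) = (\<Sum>m\<in>F. if m = n then d m * of_real (L\<^sup>2) else 0)"
      by (intro sum.cong) auto
    then show ?thesis using F by simp
  qed
  finally show ?thesis unfolding fcoef_emode using L_pos by simp
qed

text \<open>\<open>texp\<close> takes real parts and is thus a real field for any \<open>F\<close>
  and \<open>c\<close>; the symmetry of both makes \<open>c\<close> its coefficient sequence. The
  mode 0 is lost because \<open>ev L 0 = 0\<close>.\<close>

lemma coef_texp:
  assumes F: "sym_set F" and c: "real_coefs c"
  shows "fcoef L (texp L F c) n y = (if n \<in> F then c n * of_real (ev L n \<bullet> y) else 0)"
    and "coef L (texp L F c) n = (if n \<in> F \<and> n \<noteq> 0 then c n else 0)"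
proof -
  show *: "fcoef L (texp L F c) n y = (if n \<in> F then c n * of_real (ev L n \<bullet> y) else 0)" for y
    by (rule fcoef_of_expansion[OF sym_setD(1)[OF F] texp_inner_complex[OF F c]])
  have "ev L n \<bullet> ev L n = (if n = 0 then 0 else 1)"
    using norm_ev_eq[of n] by (simp add: power2_norm_eq_inner[symmetric])
  then show "coef L (texp L F c) n = (if n \<in> F \<and> n \<noteq> 0 then c n else 0)"
    unfolding coef_def * by simp
qed

lemma texp_L2: "texp L F c \<in> L2_space L"
  by (intro continuous_L2 continuous_intros)

lemma texp_trig_V:
  assumes F: "finite F" shows "texp L F c \<in> trig_V L"
proof -
  have "texp L F c = (\<lambda>x. \<Sum>b\<in>Basis. Re (\<Sum>n\<in>F. (c n * of_real (ev L n \<bullet> b)) * cis (wave L n \<bullet> x)) *\<^sub>R b)"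
  proof
    fix x
    have "texp L F c x = (\<Sum>b\<in>Basis. (texp L F c x \<bullet> b) *\<^sub>R b)" by (rule euclidean_representation[symmetric])
    also have "\<dots> = (\<Sum>b\<in>Basis. Re (\<Sum>n\<in>F. (c n * of_real (ev L n \<bullet> b)) * cis (wave L n \<bullet> x)) *\<^sub>R b)"
      unfolding texp_inner Re_sum emode_def
      by (intro sum.cong refl arg_cong2[where f=scaleR]) (simp add: algebra_simps)
    finally show "texp L F c x = (\<Sum>b\<in>Basis. Re (\<Sum>n\<in>F. (c n * of_real (ev L n \<bullet> b)) * cis (wave L n \<bullet> x)) *\<^sub>R b)" .
  qed
  then have t: "trig_poly L (texp L F c)" unfolding trig_poly_def
    by (intro exI[of _ F] exI[of _ "\<lambda>n b. c n * of_real (ev L n \<bullet> b)"] conjI F)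
  have d: "(\<Sum>i\<in>UNIV. pderiv_dir i (texp L F c) x $ i) = 0" for x
  proof -
    have "(\<Sum>i\<in>UNIV. pderiv_dir i (texp L F c) x $ i) = (\<Sum>i\<in>UNIV. \<Sum>n\<in>F. Re (\<i> * c n * emode L n x) * (ev L n $ i * wave L n $ i))"
      unfolding pderiv_texp texp_def by (simp add: sum_2 algebra_simps)
    also have "\<dots> = (\<Sum>n\<in>F. Re (\<i> * c n * emode L n x) * (ev L n \<bullet> wave L n))"
      by (subst sum.swap) (simp add: inner_vec_def sum_distrib_left del: ev_inner_wave)
    finally show ?thesis by simp
  qed
  have m: "(\<integral>x. texp L F c x \<partial>torus L) = 0"
  proof -
    have ic: "integrable (torus L) (\<lambda>x. c n * emode L n x)" for n by (intro continuous_integrable_torus continuous_intros)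
    have ir: "integrable (torus L) (\<lambda>x. Re (c n * emode L n x))" for n by (rule integrable_Re[OF ic])
    have z: "(\<integral>x. Re (c n * emode L n x) \<partial>torus L) *\<^sub>R ev L n = 0" for n
    proof (cases "n = 0")
      case True
      then show ?thesis by (simp only: ev_zero scaleR_zero_right)
    next
      case False
      have "(\<integral>x. Re (c n * emode L n x) \<partial>torus L) = Re (\<integral>x. c n * emode L n x \<partial>torus L)" by (rule integral_Re[OF ic])
      also have "\<dots> = Re (c n * 0)" using False by (simp only: integral_mult_right_zero integral_emode if_False)
      finally show ?thesis by simp
    qed
    have "(\<integral>x. texp L F c x \<partial>torus L) = (\<Sum>n\<in>F. \<integral>x. Re (c n * emode L n x) *\<^sub>R ev L n \<partial>torus L)"
      unfolding texp_def by (intro Bochner_Integration.integral_sum integrable_scaleR_left ir)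
    also have "\<dots> = (\<Sum>n\<in>F. (\<integral>x. Re (c n * emode L n x) \<partial>torus L) *\<^sub>R ev L n)"
      by (intro sum.cong refl integral_scaleR_left ir)
    finally show ?thesis by (simp only: z sum.neutral_const)
  qed
  show ?thesis using t d m by (simp add: trig_V_def)
qed

text \<open>Vanishing divergence makes each coefficient vector orthogonal to its wave vector, so in
  two dimensions it is a multiple of \<open>ev\<close>; the vanishing average removes the mode
  0.\<close>

lemma trig_V_expansion:
  assumes p: "p \<in> trig_V L"
  obtains F where "sym_set F" "p = texp L F (coef L p)" "\<And>n. n \<notin> F \<Longrightarrow> coef L p n = 0"
proof -
  from p obtain F0 c where F0: "finite F0" and pe: "p = (\<lambda>x. \<Sum>b\<in>Basis. Re (\<Sum>n\<in>F0. c n b * cis (wave L n \<bullet> x)) *\<^sub>R b)"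
    unfolding trig_V_def trig_poly_def by blast
  define F where "F = F0 \<union> uminus ` F0"
  have Fm: "- n \<in> F" if "n \<in> F" for n
    using that unfolding F_def by (metis UnE UnI1 UnI2 imageE imageI minus_minus)
  have F: "sym_set F" unfolding sym_set_def
  proof (intro conjI allI iffI Fm)
    show "finite F" using F0 by (simp add: F_def)
    show "n \<in> F" if "- n \<in> F" for n using Fm[OF that] by (simp only: minus_minus)
  qed
  have fF: "finite F" by (rule sym_setD(1)[OF F])
  define c' where "c' n b = (if n \<in> F0 then c n b else 0)" for n b
  \<comment> \<open>The representation in \<open>trig_poly\<close> need not have conjugate
    coefficients at opposite modes. This symmetrization leaves the real part of the sum unchanged
    and yields the true Fourier coefficients.\<close>
  define d where "d n b = (c' n b + cnj (c' (- n) b)) / 2" for n b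
  have dc: "d (- n) b = cnj (d n b)" for n b by (simp add: d_def add.commute)
  have re: "Re (\<Sum>n\<in>F0. c n b * cis (wave L n \<bullet> x)) = Re (\<Sum>n\<in>F. d n b * emode L n x)" for b x
  proof -
    let ?S = "\<Sum>n\<in>F. c' n b * emode L n x"
    have S: "(\<Sum>n\<in>F0. c n b * cis (wave L n \<bullet> x)) = ?S"
      unfolding c'_def emode_def F_def using F0 by (intro sum.mono_neutral_cong_left) auto
    have "cnj ?S = (\<Sum>n\<in>F. cnj (c' n b) * emode L (- n) x)" unfolding cnj_sum complex_cnj_mult emode_uminus ..
    also have "\<dots> = (\<Sum>n\<in>F. cnj (c' (- n) b) * emode L n x)"
      using sum_sym_set[OF F, of "\<lambda>n. cnj (c' (- n) b) * emode L n x"] by (simp only: minus_minus)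
    finally have C: "cnj ?S = (\<Sum>n\<in>F. cnj (c' (- n) b) * emode L n x)" .
    have "(\<Sum>n\<in>F. d n b * emode L n x) = (?S + cnj ?S) / 2"
      unfolding C sum.distrib[symmetric] sum_divide_distrib d_def by (intro sum.cong refl) (simp add: distrib_right)
    then show ?thesis unfolding S complex_add_cnj by simp
  qed
  have pd: "p = (\<lambda>x. \<Sum>b\<in>Basis. Re (\<Sum>n\<in>F. d n b * emode L n x) *\<^sub>R b)"
    unfolding pe re ..
  have real_sum: "(\<Sum>n\<in>F. g n * d n b * emode L n x) = of_real (Re (\<Sum>n\<in>F. g n * d n b * emode L n x))"
    if "\<And>n. g (- n) = cnj (g n)" for g b x
    unfolding Re_sum by (rule sum_conj_real[OF F]) (simp add: that dc emode_uminus)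
  have pb: "complex_of_real (p x \<bullet> b) = (\<Sum>n\<in>F. d n b * emode L n x)" if b: "b \<in> Basis" for x b
  proof -
    have "p x \<bullet> b = Re (\<Sum>n\<in>F. d n b * emode L n x)" unfolding pd by (rule inner_sum_left_Basis[OF b])
    then show ?thesis using real_sum[of "\<lambda>_. 1" b x] by simp
  qed
  have fc: "fcoef L p n b = (if n \<in> F then d n b else 0)" if "b \<in> Basis" for n b
    by (rule fcoef_of_expansion[OF fF pb[OF that]])
  have bas: "axis i 1 \<in> (Basis :: (real^2) set)" for i by (rule axis_in_Basis_iff[THEN iffD2]) simp
  have dv: "(\<Sum>i\<in>UNIV. of_real (wave L n $ i) * d n (axis i 1)) = 0" if n: "n \<in> F" for n
  proof -
    have der: "(p has_derivative (\<lambda>h. \<Sum>b\<in>Basis. Re (\<Sum>n\<in>F. \<i> * of_real (wave L n \<bullet> h) * d n b * emode L n x) *\<^sub>R b)) (at x)" for x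
      unfolding pd Re_sum
      by (intro has_derivative_sum has_derivative_scaleR_left emode_has_derivative)
    have pdir: "complex_of_real (pderiv_dir i p x $ i) = (\<Sum>n\<in>F. \<i> * of_real (wave L n $ i) * d n (axis i 1) * emode L n x)" for i x
    proof -
      have "pderiv_dir i p x $ i = pderiv_dir i p x \<bullet> axis i 1" by (simp add: inner_axis)
      also have "\<dots> = Re (\<Sum>n\<in>F. \<i> * of_real (wave L n \<bullet> axis i 1) * d n (axis i 1) * emode L n x)"
        unfolding pderiv_dirI[OF der] by (rule inner_sum_left_Basis[OF bas])
      finally show ?thesis
        using real_sum[of "\<lambda>n. \<i> * of_real (wave L n $ i)" "axis i 1" x] by (simp add: inner_axis wave_uminus)
    qed
    have "complex_of_real ((\<lambda>x. \<Sum>i\<in>UNIV. pderiv_dir i p x $ i) x \<bullet> 1) = (\<Sum>n\<in>F. (\<Sum>i\<in>UNIV. \<i> * of_real (wave L n $ i) * d n (axis i 1)) * emode L n x)" for x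
      by (simp add: pdir sum_distrib_right sum.swap[of _ F])
    from fcoef_of_expansion[OF fF this, of n] n
    have "(\<Sum>i\<in>UNIV. \<i> * of_real (wave L n $ i) * d n (axis i 1)) = fcoef L (\<lambda>x. \<Sum>i\<in>UNIV. pderiv_dir i p x $ i) n 1" by simp
    also have "(\<lambda>x. \<Sum>i\<in>UNIV. pderiv_dir i p x $ i) = (\<lambda>x. 0)" using p by (simp add: trig_V_def)
    also have "fcoef L (\<lambda>x. 0 :: real) n 1 = 0"
      unfolding fcoef_emode inner_zero_left of_real_0 mult_zero_left Bochner_Integration.integral_zero div_0 ..
    finally have "\<i> * (\<Sum>i\<in>UNIV. of_real (wave L n $ i) * d n (axis i 1)) = 0" by (simp add: sum_distrib_left mult.assoc)
    then show ?thesis by simp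
  qed
  have mean: "fcoef L p 0 b = 0" for b
  proof -
    have ip: "integrable (torus L) p"
    proof (rule continuous_integrable_torus)
      show "continuous_on UNIV p" unfolding pd by (intro continuous_intros)
    qed
    have "(\<integral>x. complex_of_real (p x \<bullet> b) * cnj (emode L 0 x) \<partial>torus L) = (\<integral>x. complex_of_real (p x \<bullet> b) \<partial>torus L)"
      by (simp only: emode_zero complex_cnj_one mult_1_right)
    also have "\<dots> = of_real (\<integral>x. p x \<bullet> b \<partial>torus L)" by (rule integral_complex_of_real)
    also have "(\<integral>x. p x \<bullet> b \<partial>torus L) = (\<integral>x. p x \<partial>torus L) \<bullet> b" by (rule integral_inner_left) (use ip in simp)
    also have "\<dots> = 0" using p by (simp add: trig_V_def)
    finally show ?thesis unfolding fcoef_emode by simp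
  qed
  have pL2: "p \<in> L2_space L"
  proof (rule continuous_L2)
    show "continuous_on UNIV p" unfolding pd by (intro continuous_intros)
  qed
  have div_free: "fcoef L p n b = coef L p n * of_real (ev L n \<bullet> b)" if b: "b \<in> Basis" for n b
  proof (cases "n \<in> F \<and> n \<noteq> 0")
    case True
    then have n: "n \<in> F" "n \<noteq> 0" by auto
    define k1 where "k1 = wave L n $ 1"
    define k2 where "k2 = wave L n $ 2"
    define \<kappa> where "\<kappa> = kap L n"
    have \<kappa>: "\<kappa> \<noteq> 0" "\<kappa>\<^sup>2 = k1\<^sup>2 + k2\<^sup>2"
      using kap_pos[OF n(2)]
      by (simp add: \<kappa>_def) (simp add: \<kappa>_def k1_def k2_def kap_def power2_norm_eq_inner inner_real2 power2_eq_square[symmetric])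
    define D1 where "D1 = fcoef L p n (axis 1 1)"
    define D2 where "D2 = fcoef L p n (axis 2 1)"
    have dvn: "of_real k1 * D1 + of_real k2 * D2 = 0"
      using dv[OF n(1)] fc[OF bas, of n] n(1) by (simp add: sum_2 D1_def D2_def k1_def k2_def)
    have e: "ev L n \<bullet> axis 1 1 = - k2 / \<kappa>" "ev L n \<bullet> axis 2 1 = k1 / \<kappa>"
      using ev_components[OF n(2)] by (simp_all add: inner_axis k1_def k2_def \<kappa>_def)
    have co: "coef L p n = of_real (- k2 / \<kappa>) * D1 + of_real (k1 / \<kappa>) * D2"
      unfolding coef_def fcoef_sum_Basis[OF pL2, of n "ev L n"] sum_Basis_real2 e D1_def D2_def ..
    have \<kappa>c: "complex_of_real \<kappa> \<noteq> 0" "(complex_of_real \<kappa>)\<^sup>2 = (of_real k1)\<^sup>2 + (of_real k2)\<^sup>2"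
      using \<kappa> by (simp_all flip: of_real_power of_real_add)
    have r: "coef L p n * of_real (- k2 / \<kappa>) = D1" "coef L p n * of_real (k1 / \<kappa>) = D2"
      using perp_projection[OF dvn \<kappa>c] by (simp_all add: co)
    have "b = axis 1 1 \<or> b = axis 2 1" using b by (simp add: Basis_real2)
    then show ?thesis using r e by (auto simp: D1_def D2_def)
  next
    case False
    show ?thesis
    proof (cases "n = 0")
      case True
      then show ?thesis by (simp only: mean ev_zero inner_zero_left of_real_0 mult_zero_right)
    next
      case nz: False
      then have z: "fcoef L p n b = 0" if "b \<in> Basis" for b using False fc[OF that] by simp
      then show ?thesis using b unfolding coef_def fcoef_sum_Basis[OF pL2, of n "ev L n"] by simp
    qed
  qed
  have "p = texp L F (coef L p)"
  proof
    fix x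
    have "p x \<bullet> b = texp L F (coef L p) x \<bullet> b" if b: "b \<in> Basis" for b
    proof -
      have "complex_of_real (p x \<bullet> b) = (\<Sum>n\<in>F. fcoef L p n b * emode L n x)"
        unfolding pb[OF b] by (intro sum.cong refl) (simp add: fc[OF b])
      also have "\<dots> = complex_of_real (texp L F (coef L p) x \<bullet> b)"
        unfolding texp_inner_complex[OF F coef_real] by (intro sum.cong refl) (simp add: div_free[OF b])
      finally show ?thesis by (simp only: of_real_eq_iff)
    qed
    then show "p x = texp L F (coef L p) x" by (rule euclidean_eqI)
  qed
  moreover have "coef L p n = 0" if "n \<notin> F" for n
  proof -
    have "fcoef L p n b = 0" if "b \<in> Basis" for b using fc[OF that] \<open>n \<notin> F\<close> by simp
    then show ?thesis unfolding coef_def fcoef_sum_Basis[OF pL2, of n "ev L n"] by simp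
  qed
  ultimately show ?thesis using F that by blast
qed

end

lemma Re_mult_cnj: "Re (z * cnj z) = (cmod z)\<^sup>2"
  by (simp add: cmod_power2) (simp add: power2_eq_square)

lemma tendsto_zero_bounded:
  fixes f g :: "'a \<Rightarrow> real"
  assumes "\<And>i. 0 \<le> f i" "\<And>i. f i \<le> g i" "(g \<longlongrightarrow> 0) F"
  shows "(f \<longlongrightarrow> 0) F"
  by (rule Lim_null_comparison[OF _ assms(3)]) (simp add: assms)

section \<open>Fourier expansion in H\<close>

context torus_domain begin

lemma inner_texp:
  assumes U: "U \<in> L2_space L"
  shows "L2_inner L U (texp L F c) = L\<^sup>2 * (\<Sum>n\<in>F. Re (c n * cnj (coef L U n)))"
proof -
  have i: "integrable (torus L) (\<lambda>x. of_real (U x \<bullet> ev L n) * emode L n x)" for n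
    by (intro L2_integrable_mult U continuous_intros)
  have ic: "integrable (torus L) (\<lambda>x. c n * (of_real (U x \<bullet> ev L n) * emode L n x))" for n
    by (intro integrable_mult_right i)
  have v: "(\<integral>x. of_real (U x \<bullet> ev L n) * emode L n x \<partial>torus L) = of_real (L\<^sup>2) * cnj (coef L U n)" for n
  proof -
    have "(\<integral>x. of_real (U x \<bullet> ev L n) * emode L n x \<partial>torus L) = (\<integral>x. cnj (of_real (U x \<bullet> ev L n) * cnj (emode L n x)) \<partial>torus L)"
      unfolding complex_cnj_mult complex_cnj_complex_of_real complex_cnj_cnj ..
    also have "\<dots> = cnj (\<integral>x. of_real (U x \<bullet> ev L n) * cnj (emode L n x) \<partial>torus L)"
      by (rule Bochner_Integration.integral_cnj)
    also have "(\<integral>x. of_real (U x \<bullet> ev L n) * cnj (emode L n x) \<partial>torus L) = of_real (L\<^sup>2) * coef L U n"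
      unfolding coef_def fcoef_emode using L_pos by simp
    finally show ?thesis by simp
  qed
  have e: "U x \<bullet> texp L F c x = (\<Sum>n\<in>F. Re (c n * (of_real (U x \<bullet> ev L n) * emode L n x)))" for x
    by (simp add: texp_def inner_sum_right algebra_simps)
  have "L2_inner L U (texp L F c) = (\<Sum>n\<in>F. \<integral>x. Re (c n * (of_real (U x \<bullet> ev L n) * emode L n x)) \<partial>torus L)"
    unfolding L2_inner_def e by (intro Bochner_Integration.integral_sum integrable_Re ic)
  also have "\<dots> = (\<Sum>n\<in>F. Re (c n * (of_real (L\<^sup>2) * cnj (coef L U n))))"
    by (simp only: integral_Re[OF ic] integral_mult_right_zero v)
  also have "\<dots> = L\<^sup>2 * (\<Sum>n\<in>F. Re (c n * cnj (coef L U n)))"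
    unfolding sum_distrib_left by (intro sum.cong refl) (simp add: mult.left_commute[of "c _"] del: of_real_power)
  finally show ?thesis .
qed

lemma l2_eq_inner: "l2 L U = L2_inner L U U"
  by (simp add: l2_def L2_inner_def power2_norm_eq_inner)

lemma l2_diff:
  fixes U V :: "real^2 \<Rightarrow> 'a::euclidean_space"
  assumes "U \<in> L2_space L" "V \<in> L2_space L"
  shows "l2 L (\<lambda>x. U x - V x) = l2 L U - 2 * L2_inner L U V + l2 L V"
proof -
  have e: "(norm (U x - V x))\<^sup>2 = U x \<bullet> U x - 2 * (U x \<bullet> V x) + V x \<bullet> V x" for x
    by (simp add: power2_norm_eq_inner inner_diff_left inner_diff_right inner_commute)
  note i = L2_product_integrable
  have "l2 L (\<lambda>x. U x - V x) = (\<integral>x. U x \<bullet> U x - 2 * (U x \<bullet> V x) \<partial>torus L) + (\<integral>x. V x \<bullet> V x \<partial>torus L)"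
    unfolding l2_def e
    by (intro Bochner_Integration.integral_add Bochner_Integration.integrable_diff integrable_mult_right i assms)
  also have "(\<integral>x. U x \<bullet> U x - 2 * (U x \<bullet> V x) \<partial>torus L) = (\<integral>x. U x \<bullet> U x \<partial>torus L) - (\<integral>x. 2 * (U x \<bullet> V x) \<partial>torus L)"
    by (intro Bochner_Integration.integral_diff integrable_mult_right i assms)
  also have "(\<integral>x. 2 * (U x \<bullet> V x) \<partial>torus L) = 2 * (\<integral>x. U x \<bullet> V x \<partial>torus L)" by (rule integral_mult_right_zero)
  finally show ?thesis by (simp only: l2_eq_inner L2_inner_def)
qed

lemma l2_texp:
  assumes F: "sym_set F" and c: "real_coefs c" "c 0 = 0"
  shows "l2 L (texp L F c) = L\<^sup>2 * (\<Sum>n\<in>F. (cmod (c n))\<^sup>2)"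
proof -
  have "l2 L (texp L F c) = L\<^sup>2 * (\<Sum>n\<in>F. Re (c n * cnj (coef L (texp L F c) n)))"
    unfolding l2_eq_inner by (rule inner_texp[OF texp_L2])
  also have "(\<Sum>n\<in>F. Re (c n * cnj (coef L (texp L F c) n))) = (\<Sum>n\<in>F. (cmod (c n))\<^sup>2)"
  proof (intro sum.cong refl)
    fix n assume "n \<in> F"
    then have "coef L (texp L F c) n = c n" using c(2) by (cases "n = 0") (simp_all add: coef_texp[OF F c(1)])
    then show "Re (c n * cnj (coef L (texp L F c) n)) = (cmod (c n))\<^sup>2" by (simp only: Re_mult_cnj)
  qed
  finally show ?thesis .
qed

text \<open>Completing the square in the coefficients: among the polynomials on \<open>F\<close> the
  choice \<open>c = coef L U\<close> is the closest to \<open>U\<close>.\<close>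

lemma l2_texp_distance:
  assumes U: "U \<in> L2_space L" and F: "sym_set F" and c: "real_coefs c" "c 0 = 0"
  shows "l2 L (\<lambda>x. U x - texp L F c x) = l2 L U - L\<^sup>2 * (\<Sum>n\<in>F. (cmod (coef L U n))\<^sup>2) + L\<^sup>2 * (\<Sum>n\<in>F. (cmod (coef L U n - c n))\<^sup>2)"
proof -
  have e: "(cmod (a - b))\<^sup>2 = (cmod a)\<^sup>2 - 2 * Re (b * cnj a) + (cmod b)\<^sup>2" for a b
    by (simp add: cmod_power2) (simp add: power2_eq_square algebra_simps)
  have "l2 L (\<lambda>x. U x - texp L F c x) = l2 L U - 2 * (L\<^sup>2 * (\<Sum>n\<in>F. Re (c n * cnj (coef L U n)))) + L\<^sup>2 * (\<Sum>n\<in>F. (cmod (c n))\<^sup>2)"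
    by (simp only: l2_diff[OF U texp_L2] inner_texp[OF U] l2_texp[OF F c])
  also have "\<dots> = l2 L U - L\<^sup>2 * (\<Sum>n\<in>F. (cmod (coef L U n))\<^sup>2) + L\<^sup>2 * (\<Sum>n\<in>F. (cmod (coef L U n - c n))\<^sup>2)"
  proof -
    have "(\<Sum>n\<in>F. (cmod (coef L U n - c n))\<^sup>2) = (\<Sum>n\<in>F. (cmod (coef L U n))\<^sup>2) - 2 * (\<Sum>n\<in>F. Re (c n * cnj (coef L U n))) + (\<Sum>n\<in>F. (cmod (c n))\<^sup>2)"
      by (simp only: e sum.distrib sum_subtractf sum_distrib_left)
    moreover have "a - 2 * (k * b) + k * c = a - k * d + k * (d - 2 * b + c)" for a b c d k :: real
      by (simp add: algebra_simps)
    ultimately show ?thesis by simp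
  qed
  finally show ?thesis .
qed

definition proj :: "nat \<Rightarrow> vfield \<Rightarrow> vfield" where
  "proj N U = texp L (mbox N) (coef L U)"

lemma l2_proj_distance:
  assumes U: "U \<in> L2_space L"
  shows "l2 L (\<lambda>x. U x - proj N U x) = l2 L U - L\<^sup>2 * (\<Sum>n\<in>mbox N. (cmod (coef L U n))\<^sup>2)"
  unfolding proj_def using l2_texp_distance[OF U sym_set_mbox coef_real coef_zero] by simp

lemma coef_bessel:
  assumes U: "U \<in> L2_space L"
  shows "hs_summable L 0 (coef L U)" "L\<^sup>2 * hs L 0 (coef L U) \<le> l2 L U"
proof -
  have b: "(\<Sum>n\<in>F. (cmod (coef L U n))\<^sup>2) \<le> l2 L U / L\<^sup>2" if F: "finite F" for F
  proof -
    obtain N where N: "F \<subseteq> mbox N" using mbox_superset[OF F] by blast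
    have "(\<Sum>n\<in>F. (cmod (coef L U n))\<^sup>2) \<le> (\<Sum>n\<in>mbox N. (cmod (coef L U n))\<^sup>2)"
      by (intro sum_mono2 N) auto
    also have "\<dots> \<le> l2 L U / L\<^sup>2"
    proof -
      have "L\<^sup>2 * (\<Sum>n\<in>mbox N. (cmod (coef L U n))\<^sup>2) \<le> l2 L U"
        using l2_nonneg[of "\<lambda>x. U x - proj N U x"] unfolding l2_proj_distance[OF U] by simp
      then show ?thesis using L_pos by (simp add: field_simps)
    qed
    finally show ?thesis .
  qed
  show "hs_summable L 0 (coef L U)" unfolding hs0_summable_iff
    by (rule summable_on_bounded_sums(1)[where B="l2 L U / L\<^sup>2"]) (use b in auto)
  have "hs L 0 (coef L U) \<le> l2 L U / L\<^sup>2" unfolding hs0_eq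
    by (rule summable_on_bounded_sums(2)) (use b in auto)
  then show "L\<^sup>2 * hs L 0 (coef L U) \<le> l2 L U" using L_pos by (simp add: field_simps)
qed

lemma coef_add:
  assumes "U \<in> L2_space L" "V \<in> L2_space L"
  shows "coef L (\<lambda>x. U x + V x) n = coef L U n + coef L V n"
  unfolding coef_def by (rule fcoef_add[OF assms])

lemma coef_diff:
  assumes "U \<in> L2_space L" "V \<in> L2_space L"
  shows "coef L (\<lambda>x. U x - V x) n = coef L U n - coef L V n"
  unfolding coef_def by (rule fcoef_diff[OF assms])

lemma L2_norm_eq: "U \<in> L2_space L \<Longrightarrow> L2_norm L U = ennreal (sqrt (l2 L U))"
  unfolding L2_norm_def by (simp add: L2_spaceD(3) esqrt_def)

lemma L2_norm_less: "U \<in> L2_space L \<Longrightarrow> \<epsilon> > 0 \<Longrightarrow> L2_norm L U < ennreal \<epsilon> \<longleftrightarrow> l2 L U < \<epsilon>\<^sup>2"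
  by (subst L2_norm_eq) (auto simp: ennreal_less_iff real_sqrt_less_iff[symmetric, of _ "\<epsilon>\<^sup>2"] simp del: real_sqrt_less_iff)

lemma trig_V_L2: "p \<in> trig_V L \<Longrightarrow> p \<in> L2_space L"
  by (metis trig_V_expansion texp_L2)

lemma l2_minus_commute: "l2 L (\<lambda>x. U x - V x) = l2 L (\<lambda>x. V x - U x)"
  unfolding l2_def by (simp only: norm_minus_commute)

text \<open>An approximating polynomial has finitely many modes. Once the box contains them, the
  Fourier projection is at least as close, by \<open>l2_texp_distance\<close>.\<close>

lemma space_H_proj:
  assumes U: "U \<in> space_H L"
  shows "U \<in> L2_space L" "(\<lambda>N. l2 L (\<lambda>x. U x - proj N U x)) \<longlonglongrightarrow> 0"
proof -
  show L2: "U \<in> L2_space L" using U by (simp add: space_H_def)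
  have "\<forall>\<^sub>F N in sequentially. l2 L (\<lambda>x. U x - proj N U x) < e" if e: "e > 0" for e
  proof -
    obtain p where p: "p \<in> trig_V L" "L2_norm L (\<lambda>x. p x - U x) < ennreal (sqrt e)"
    proof -
      have "\<forall>\<epsilon>>0. \<exists>p\<in>trig_V L. L2_norm L (\<lambda>x. p x - U x) < ennreal \<epsilon>" using U unfolding space_H_def by blast
      then show ?thesis using real_sqrt_gt_zero[OF e] that by blast
    qed
    then have pe: "l2 L (\<lambda>x. U x - p x) < e"
      using e by (subst l2_minus_commute) (simp add: L2_norm_less L2_space_diff trig_V_L2 L2)
    obtain F where F: "sym_set F" "p = texp L F (coef L p)" "\<And>n. n \<notin> F \<Longrightarrow> coef L p n = 0"
      using trig_V_expansion[OF p(1)] by blast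
    obtain N0 where N0: "F \<subseteq> mbox N0" using mbox_superset[OF sym_setD(1)[OF F(1)]] by blast
    have "l2 L (\<lambda>x. U x - proj N U x) < e" if N: "N \<ge> N0" for N
    proof -
      have "mbox N0 \<subseteq> mbox N" using N by (auto simp: mbox_def)
      then have FN: "F \<subseteq> mbox N" using N0 by blast
      have le: "(\<Sum>n\<in>F. (cmod (coef L U n))\<^sup>2) \<le> (\<Sum>n\<in>mbox N. (cmod (coef L U n))\<^sup>2)" by (intro sum_mono2 FN) auto
      have "l2 L (\<lambda>x. U x - proj N U x) \<le> l2 L U - L\<^sup>2 * (\<Sum>n\<in>F. (cmod (coef L U n))\<^sup>2)"
        unfolding l2_proj_distance[OF L2] using le by (intro diff_left_mono mult_left_mono) auto
      also have "\<dots> \<le> l2 L (\<lambda>x. U x - texp L F (coef L p) x)"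
        unfolding l2_texp_distance[OF L2 F(1) coef_real coef_zero] by (simp add: sum_nonneg)
      also have "\<dots> < e" using pe F(2) by simp
      finally show ?thesis .
    qed
    then show ?thesis by (intro eventually_sequentiallyI[of N0]) auto
  qed
  then show "(\<lambda>N. l2 L (\<lambda>x. U x - proj N U x)) \<longlonglongrightarrow> 0"
    by (intro order_tendstoI) (auto intro!: always_eventually less_le_trans[OF _ l2_nonneg])
qed

lemma space_HI:
  assumes U: "U \<in> L2_space L" and T: "\<And>i. T i \<in> trig_V L" and lim: "(\<lambda>i::nat. l2 L (\<lambda>x. U x - T i x)) \<longlonglongrightarrow> 0"
  shows "U \<in> space_H L"
  unfolding space_H_def
proof (intro CollectI conjI allI impI U)
  fix e :: real assume e: "e > 0"
  then have "\<forall>\<^sub>F i in sequentially. l2 L (\<lambda>x. U x - T i x) < e\<^sup>2" by (intro order_tendstoD(2)[OF lim]) auto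
  then obtain i where "l2 L (\<lambda>x. U x - T i x) < e\<^sup>2" by (meson eventually_happens sequentially_bot)
  then have "l2 L (\<lambda>x. T i x - U x) < e\<^sup>2" by (subst l2_minus_commute)
  then show "\<exists>p\<in>trig_V L. L2_norm L (\<lambda>x. p x - U x) < ennreal e"
    using e by (intro bexI[OF _ T[of i]]) (simp add: L2_norm_less L2_space_diff trig_V_L2 T U)
qed

lemma proj_trig_V: "proj N U \<in> trig_V L"
  unfolding proj_def by (rule texp_trig_V) simp

lemma trig_V_H: "p \<in> trig_V L \<Longrightarrow> p \<in> space_H L"
proof -
  assume p: "p \<in> trig_V L"
  have "l2 L (\<lambda>x. p x - p x) = 0" unfolding l2_def by simp
  then show ?thesis by (intro space_HI[where T="\<lambda>_. p"] trig_V_L2 p) simp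
qed

text \<open>True for \<open>proj N U\<close> as soon as the box contains \<open>n\<close>, and
  preserved in the limit by the Bessel inequality in the direction \<open>b\<close>. So the scalar
  coefficients determine all components of a field in H.\<close>

lemma space_H_fcoef:
  assumes U: "U \<in> space_H L"
  shows "fcoef L U n b = coef L U n * of_real (ev L n \<bullet> b)"
proof -
  note H = space_H_proj[OF U]
  let ?d = "fcoef L U n b - coef L U n * of_real (ev L n \<bullet> b)"
  obtain N0 where N0: "{n} \<subseteq> mbox N0" using mbox_superset[of "{n}"] by auto
  have "L\<^sup>2 * (cmod ?d)\<^sup>2 \<le> (norm b)\<^sup>2 * l2 L (\<lambda>x. U x - proj N U x)" if N: "N \<ge> N0" for N
  proof -
    have nN: "n \<in> mbox N" using N N0 by (auto simp: mbox_def)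
    have D: "(\<lambda>x. U x - proj N U x) \<in> L2_space L" by (intro L2_space_diff H trig_V_L2 proj_trig_V)
    have "fcoef L (\<lambda>x. U x - proj N U x) n b = ?d"
      unfolding fcoef_diff[OF H(1) trig_V_L2[OF proj_trig_V]] unfolding proj_def coef_texp(1)[OF sym_set_mbox coef_real]
      using nN by simp
    then have "L\<^sup>2 * (cmod ?d)\<^sup>2 \<le> (\<integral>x. ((U x - proj N U x) \<bullet> b)\<^sup>2 \<partial>torus L)"
      using bessel_scalar[OF D, of "{n}" b] by simp
    also have "\<dots> \<le> (\<integral>x. (norm b)\<^sup>2 * (norm (U x - proj N U x))\<^sup>2 \<partial>torus L)"
    proof (rule integral_mono_AE')
      show "integrable (torus L) (\<lambda>x. (norm b)\<^sup>2 * (norm (U x - proj N U x))\<^sup>2)"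
        by (intro integrable_mult_right L2_spaceD(2)[OF D])
      show "AE x in torus L. ((U x - proj N U x) \<bullet> b)\<^sup>2 \<le> (norm b)\<^sup>2 * (norm (U x - proj N U x))\<^sup>2"
      proof (rule AE_I2)
        fix x
        have "\<bar>(U x - proj N U x) \<bullet> b\<bar>\<^sup>2 \<le> (norm (U x - proj N U x) * norm b)\<^sup>2" by (intro power_mono Cauchy_Schwarz_ineq2) auto
        then show "((U x - proj N U x) \<bullet> b)\<^sup>2 \<le> (norm b)\<^sup>2 * (norm (U x - proj N U x))\<^sup>2"
          by (simp add: power_mult_distrib mult.commute)
      qed
    qed auto
    also have "\<dots> = (norm b)\<^sup>2 * l2 L (\<lambda>x. U x - proj N U x)" unfolding l2_def by (rule integral_mult_right_zero)
    finally show ?thesis .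
  qed
  then have "\<forall>\<^sub>F N in sequentially. L\<^sup>2 * (cmod ?d)\<^sup>2 \<le> (norm b)\<^sup>2 * l2 L (\<lambda>x. U x - proj N U x)"
    by (intro eventually_sequentiallyI[of N0]) auto
  moreover have "(\<lambda>N. (norm b)\<^sup>2 * l2 L (\<lambda>x. U x - proj N U x)) \<longlonglongrightarrow> (norm b)\<^sup>2 * 0"
    by (intro tendsto_intros H)
  ultimately have "L\<^sup>2 * (cmod ?d)\<^sup>2 \<le> (norm b)\<^sup>2 * 0" by (intro tendsto_lowerbound) auto
  then show ?thesis using L_pos by (simp add: mult_le_0_iff)
qed

lemma space_H_add:
  assumes "U \<in> space_H L" "V \<in> space_H L"
  shows "(\<lambda>x. U x + V x) \<in> space_H L"
proof (rule space_HI)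
  note u = space_H_proj[OF assms(1)] and v = space_H_proj[OF assms(2)]
  show "(\<lambda>x. U x + V x) \<in> L2_space L" by (intro L2_space_add u v)
  let ?T = "\<lambda>i x. proj i U x + proj i V x"
  show "?T i \<in> trig_V L" for i
  proof -
    have "?T i = texp L (mbox i) (\<lambda>n. coef L U n + coef L V n)"
      unfolding proj_def texp_def by (simp only: distrib_right plus_complex.simps scaleR_add_left sum.distrib)
    then show ?thesis by (simp only: texp_trig_V finite_mbox)
  qed
  have "l2 L (\<lambda>x. U x + V x - ?T i x) \<le> 2 * l2 L (\<lambda>x. U x - proj i U x) + 2 * l2 L (\<lambda>x. V x - proj i V x)" for i
  proof -
    have e: "(\<lambda>x. U x + V x - ?T i x) = (\<lambda>x. (U x - proj i U x) + (V x - proj i V x))" by (simp add: fun_eq_iff)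
    show ?thesis unfolding e by (intro L2_space_add(2) L2_space_diff u v trig_V_L2 proj_trig_V)
  qed
  note le = this
  have "(\<lambda>i. 2 * l2 L (\<lambda>x. U x - proj i U x) + 2 * l2 L (\<lambda>x. V x - proj i V x)) \<longlonglongrightarrow> 2 * 0 + 2 * 0"
    by (intro tendsto_intros u v)
  then have lim: "(\<lambda>i. 2 * l2 L (\<lambda>x. U x - proj i U x) + 2 * l2 L (\<lambda>x. V x - proj i V x)) \<longlonglongrightarrow> 0" by simp
  show "(\<lambda>i. l2 L (\<lambda>x. U x + V x - ?T i x)) \<longlonglongrightarrow> 0"
    by (rule tendsto_zero_bounded[OF l2_nonneg le lim])
qed

lemma space_H_uminus:
  assumes "U \<in> space_H L"
  shows "(\<lambda>x. - U x) \<in> space_H L"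
proof (rule space_HI)
  note u = space_H_proj[OF assms(1)]
  show "(\<lambda>x. - U x) \<in> L2_space L" using L2_space_scale(1)[OF u(1), of "- 1"] by simp
  show "(\<lambda>x. - proj i U x) \<in> trig_V L" for i
  proof -
    have "(\<lambda>x. - proj i U x) = texp L (mbox i) (\<lambda>n. - coef L U n)"
      unfolding proj_def texp_def by (simp only: mult_minus_left uminus_complex.simps scaleR_minus_left sum_negf)
    then show ?thesis by (simp only: texp_trig_V finite_mbox)
  qed
  have "l2 L (\<lambda>x. - U x - - proj i U x) = l2 L (\<lambda>x. U x - proj i U x)" for i
    by (subst l2_minus_commute) (simp add: l2_def)
  then show "(\<lambda>i. l2 L (\<lambda>x. - U x - - proj i U x)) \<longlonglongrightarrow> 0" using u(2) by simp
qed

lemma space_H_diff: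
  assumes "U \<in> space_H L" "V \<in> space_H L"
  shows "(\<lambda>x. U x - V x) \<in> space_H L"
  using space_H_add[OF assms(1) space_H_uminus[OF assms(2)]] by simp

lemma L2_inner_Young:
  fixes U V :: "real^2 \<Rightarrow> 'a::euclidean_space"
  assumes "U \<in> L2_space L" "V \<in> L2_space L" and \<theta>: "\<theta> > 0"
  shows "2 * \<bar>L2_inner L U V\<bar> \<le> \<theta> * l2 L U + l2 L V / \<theta>"
proof -
  note u = L2_spaceD[OF assms(1)] and v = L2_spaceD[OF assms(2)]
  have i: "integrable (torus L) (\<lambda>x. \<theta> * (norm (U x))\<^sup>2 + (norm (V x))\<^sup>2 / \<theta>)"
    by (intro Bochner_Integration.integrable_add integrable_mult_right integrable_divide u(2) v(2))
  have le: "2 * \<bar>U x \<bullet> V x\<bar> \<le> \<theta> * (norm (U x))\<^sup>2 + (norm (V x))\<^sup>2 / \<theta>" for x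
    using Cauchy_Schwarz_ineq2[of "U x" "V x"] Young_weighted[OF \<theta>, of "norm (U x)" "norm (V x)"] by linarith
  have ia: "integrable (torus L) (\<lambda>x. 2 * \<bar>U x \<bullet> V x\<bar>)"
    by (intro integrable_mult_right integrable_abs L2_product_integrable assms)
  have "2 * \<bar>L2_inner L U V\<bar> \<le> 2 * (\<integral>x. \<bar>U x \<bullet> V x\<bar> \<partial>torus L)"
    unfolding L2_inner_def using integral_abs_bound[of "torus L" "\<lambda>x. U x \<bullet> V x"] by simp
  also have "\<dots> = (\<integral>x. 2 * \<bar>U x \<bullet> V x\<bar> \<partial>torus L)" by (rule integral_mult_right_zero[symmetric])
  also have "\<dots> \<le> (\<integral>x. \<theta> * (norm (U x))\<^sup>2 + (norm (V x))\<^sup>2 / \<theta> \<partial>torus L)" by (intro integral_mono ia i le)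
  also have "\<dots> = (\<integral>x. \<theta> * (norm (U x))\<^sup>2 \<partial>torus L) + (\<integral>x. (norm (V x))\<^sup>2 / \<theta> \<partial>torus L)"
    by (intro Bochner_Integration.integral_add integrable_mult_right integrable_divide u(2) v(2))
  also have "\<dots> = \<theta> * l2 L U + l2 L V / \<theta>" unfolding l2_def by (simp only: integral_mult_right_zero integral_divide_zero)
  finally show ?thesis .
qed

lemma L2_inner_diff_right:
  fixes U V W :: "real^2 \<Rightarrow> 'a::euclidean_space"
  assumes "U \<in> L2_space L" "V \<in> L2_space L" "W \<in> L2_space L"
  shows "L2_inner L U (\<lambda>x. V x - W x) = L2_inner L U V - L2_inner L U W"
  unfolding L2_inner_def inner_diff_right
  by (intro Bochner_Integration.integral_diff L2_product_integrable assms)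

lemma L2_inner_diff_left:
  fixes U V W :: "real^2 \<Rightarrow> 'a::euclidean_space"
  assumes "U \<in> L2_space L" "V \<in> L2_space L" "W \<in> L2_space L"
  shows "L2_inner L (\<lambda>x. U x - V x) W = L2_inner L U W - L2_inner L V W"
  unfolding L2_inner_def inner_diff_left
  by (intro Bochner_Integration.integral_diff L2_product_integrable assms)

text \<open>The pairing sees only the tail of \<phi>, which tends to 0 in L^2. The weighted Young
  inequality then leaves \<theta> times \<open>l2 L w\<close>, for every
  \<open>\<theta> > 0\<close>.\<close>

lemma inner_H_zero:
  assumes w: "w \<in> L2_space L" "\<And>n. coef L w n = 0" and \<phi>: "\<phi> \<in> space_H L"
  shows "L2_inner L w \<phi> = 0"
proof -
  note H = space_H_proj[OF \<phi>]
  have eq: "L2_inner L w \<phi> = L2_inner L w (\<lambda>x. \<phi> x - proj N \<phi> x)" for N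
  proof -
    have "L2_inner L w (proj N \<phi>) = 0" unfolding proj_def inner_texp[OF w(1)] w(2) by simp
    then show ?thesis using L2_inner_diff_right[OF w(1) H(1) trig_V_L2[OF proj_trig_V]] by simp
  qed
  have "2 * \<bar>L2_inner L w \<phi>\<bar> \<le> \<theta> * l2 L w" if \<theta>: "\<theta> > 0" for \<theta>
  proof -
    have le: "2 * \<bar>L2_inner L w \<phi>\<bar> \<le> \<theta> * l2 L w + l2 L (\<lambda>x. \<phi> x - proj N \<phi> x) / \<theta>" for N
      unfolding eq[of N] by (intro L2_inner_Young w L2_space_diff H trig_V_L2 proj_trig_V \<theta>)
    have "(\<lambda>N. \<theta> * l2 L w + l2 L (\<lambda>x. \<phi> x - proj N \<phi> x) / \<theta>) \<longlonglongrightarrow> \<theta> * l2 L w + 0 / \<theta>"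
      using \<theta> by (intro tendsto_intros H) auto
    then show ?thesis using le by (intro tendsto_lowerbound[of _ "\<theta> * l2 L w"]) auto
  qed
  note b = this
  have "((\<lambda>\<theta>. \<theta> * l2 L w) \<longlongrightarrow> 0 * l2 L w) (at_right 0)" by (intro tendsto_intros)
  moreover have "\<forall>\<^sub>F \<theta> in at_right (0::real). 2 * \<bar>L2_inner L w \<phi>\<bar> \<le> \<theta> * l2 L w"
    using b by (auto simp: eventually_at_right_less eventually_at_filter)
  ultimately have "2 * \<bar>L2_inner L w \<phi>\<bar> \<le> 0 * l2 L w" by (intro tendsto_lowerbound) auto
  then show ?thesis by simp
qed

end

lemma infsum_ennreal_real:
  fixes f :: "'a \<Rightarrow> real"
  assumes nn: "\<And>x. x \<in> A \<Longrightarrow> 0 \<le> f x"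
  shows "f summable_on A \<Longrightarrow> (\<Sum>\<^sub>\<infinity>x\<in>A. ennreal (f x)) = ennreal (infsum f A)"
    and "(\<Sum>\<^sub>\<infinity>x\<in>A. ennreal (f x)) < \<infinity> \<Longrightarrow> f summable_on A"
proof -
  have eq: "(\<Sum>x\<in>F. ennreal (f x)) = ennreal (sum f F)" if "F \<subseteq> A" for F
    using that nn by (intro sum_ennreal) auto
  show "(\<Sum>\<^sub>\<infinity>x\<in>A. ennreal (f x)) = ennreal (infsum f A)" if "f summable_on A"
  proof (rule infsumI)
    have "(sum f \<longlongrightarrow> infsum f A) (finite_subsets_at_top A)" using has_sum_infsum[OF that] by (simp add: has_sum_def)
    then have "((\<lambda>F. ennreal (sum f F)) \<longlongrightarrow> ennreal (infsum f A)) (finite_subsets_at_top A)" by (rule tendsto_ennrealI)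
    moreover have "\<forall>\<^sub>F F in finite_subsets_at_top A. ennreal (sum f F) = (\<Sum>x\<in>F. ennreal (f x))"
      by (intro eventually_finite_subsets_at_top_weakI) (simp add: eq)
    ultimately show "((\<lambda>x. ennreal (f x)) has_sum ennreal (infsum f A)) A"
      unfolding has_sum_def by (rule Lim_transform_eventually)
  qed
  assume fin: "(\<Sum>\<^sub>\<infinity>x\<in>A. ennreal (f x)) < \<infinity>"
  then obtain B where B: "B \<ge> 0" "(\<Sum>\<^sub>\<infinity>x\<in>A. ennreal (f x)) = ennreal B"
    by (cases "\<Sum>\<^sub>\<infinity>x\<in>A. ennreal (f x)") auto
  have "sum f F \<le> B" if "finite F" "F \<subseteq> A" for F
  proof -
    have "ennreal (sum f F) \<le> ennreal B"
      unfolding eq[OF that(2), symmetric] B(2)[symmetric] nonneg_infsum_complete[OF zero_le]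
      by (rule SUP_upper) (use that in auto)
    then show ?thesis using B(1) by simp
  qed
  then show "f summable_on A" by (intro summable_on_bounded_sums(1)[where B=B] nn)
qed

lemma hs_tail:
  assumes c: "hs_summable L m c"
  shows "(\<lambda>N. hs L m (\<lambda>n. if n \<in> mbox N then 0 else c n)) \<longlonglongrightarrow> 0"
proof -
  let ?f = "\<lambda>n. (kap L n ^ m * cmod (c n))\<^sup>2"
  have s: "?f summable_on UNIV" using c by (simp add: hs_summable_def)
  have e: "hs L m (\<lambda>n. if n \<in> mbox N then 0 else c n) = hs L m c - sum ?f (mbox N)" for N
  proof -
    have h: "((\<lambda>n. if n \<in> mbox N then ?f n else 0) has_sum sum ?f (mbox N)) UNIV"
      by (rule has_sum_finite_neutralI[where B="mbox N"]) auto
    have eq: "(kap L n ^ m * cmod (if n \<in> mbox N then 0 else c n))\<^sup>2 = ?f n + - (if n \<in> mbox N then ?f n else 0)" for n by simp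
    have "((\<lambda>n. ?f n + - (if n \<in> mbox N then ?f n else 0)) has_sum (hs L m c + - sum ?f (mbox N))) UNIV"
      by (intro has_sum_add has_sum_uminusI h) (use has_sum_infsum[OF s] in \<open>simp add: hs_def\<close>)
    then show ?thesis unfolding hs_def[of L m "\<lambda>n. if n \<in> mbox N then 0 else c n"] eq by (simp add: infsumI)
  qed
  have "(\<lambda>N. sum ?f (mbox N)) \<longlonglongrightarrow> hs L m c"
    unfolding hs_def by (intro mbox_sum_tendsto has_sum_infsum s)
  then have "(\<lambda>N. hs L m c - sum ?f (mbox N)) \<longlonglongrightarrow> hs L m c - hs L m c" by (intro tendsto_intros)
  then show ?thesis unfolding e by simp
qed

context torus_domain begin

lemma sob_sq_infsum:
  assumes U: "U \<in> space_H L"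
  shows "sob_sq L m U = ennreal (L\<^sup>2) * (\<Sum>\<^sub>\<infinity>n\<in>modes. ennreal ((kap L n ^ m * cmod (coef L U n))\<^sup>2))"
proof -
  have "norm (wave L n) ^ (2 * m) * (\<Sum>b\<in>Basis. (cmod (fcoef L U n b))\<^sup>2) = (kap L n ^ m * cmod (coef L U n))\<^sup>2"
    if n: "n \<in> modes" for n
  proof -
    have n0: "n \<noteq> 0" using n by (simp add: modes_def zero_mode)
    have "(\<Sum>b\<in>Basis. (cmod (fcoef L U n b))\<^sup>2) = (cmod (coef L U n))\<^sup>2 * (\<Sum>b\<in>Basis. (ev L n \<bullet> b)\<^sup>2)"
      unfolding space_H_fcoef[OF U] by (simp add: norm_mult power_mult_distrib sum_distrib_left)
    also have "(\<Sum>b\<in>Basis. (ev L n \<bullet> b)\<^sup>2) = 1"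
      using norm_ev_eq[OF n0] euclidean_inner[of "ev L n" "ev L n"] by (simp add: power2_eq_square norm_eq_1)
    finally show ?thesis by (simp add: kap_def power_mult_distrib mult.commute power_mult)
  qed
  then show ?thesis unfolding sob_sq_def by (simp cong: infsum_cong)
qed

lemma sob_sq_H:
  assumes U: "U \<in> space_H L"
  shows "hs_summable L m (coef L U) \<Longrightarrow> sob_sq L m U = ennreal (L\<^sup>2 * hs L m (coef L U))"
    and "sob_sq L m U < \<infinity> \<Longrightarrow> hs_summable L m (coef L U)"
proof -
  let ?f = "\<lambda>n. (kap L n ^ m * cmod (coef L U n))\<^sup>2"
  have z: "?f n = 0" if "n \<notin> modes" for n using that by (simp add: modes_def zero_mode[symmetric])
  have su: "?f summable_on modes \<longleftrightarrow> ?f summable_on UNIV" and iu: "infsum ?f modes = infsum ?f UNIV"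
    using z by (intro summable_on_cong_neutral infsum_cong_neutral; auto)+
  show "sob_sq L m U = ennreal (L\<^sup>2 * hs L m (coef L U))" if "hs_summable L m (coef L U)"
    unfolding sob_sq_infsum[OF U] using that su iu infsum_ennreal_real(1)[of modes ?f]
    by (simp add: hs_summable_def hs_def ennreal_mult infsum_nonneg)
  assume "sob_sq L m U < \<infinity>"
  then have "(\<Sum>\<^sub>\<infinity>n\<in>modes. ennreal (?f n)) < \<infinity>"
    unfolding sob_sq_infsum[OF U] using L_pos by (auto simp: ennreal_mult_less_top)
  from infsum_ennreal_real(2)[OF _ this] show "hs_summable L m (coef L U)" using su by (simp add: hs_summable_def)
qed

lemma hs1_imp_space_V:
  assumes U: "U \<in> space_H L" and s: "hs_summable L 1 (coef L U)"
  shows "U \<in> space_V L"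
  unfolding space_V_def
proof (intro CollectI conjI allI impI)
  note H = space_H_proj[OF U]
  show "U \<in> L2_space L" by (rule H)
  fix e :: real assume e: "e > 0"
  let ?d = "\<lambda>N. \<lambda>n. if n \<in> mbox N then 0 else coef L U n"
  have cd: "coef L (\<lambda>x. proj N U x - U x) n = - ?d N n" for N n
    unfolding coef_diff[OF trig_V_L2[OF proj_trig_V] H(1)] unfolding proj_def coef_texp(2)[OF sym_set_mbox coef_real] by auto
  have "(\<lambda>N. l2 L (\<lambda>x. U x - proj N U x) + L\<^sup>2 * hs L 1 (?d N)) \<longlonglongrightarrow> 0 + L\<^sup>2 * 0"
    by (intro tendsto_intros H hs_tail s)
  then have "\<forall>\<^sub>F N in sequentially. l2 L (\<lambda>x. U x - proj N U x) + L\<^sup>2 * hs L 1 (?d N) < e\<^sup>2"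
    using e by (intro order_tendstoD(2)) auto
  then obtain N where N: "l2 L (\<lambda>x. U x - proj N U x) + L\<^sup>2 * hs L 1 (?d N) < e\<^sup>2"
    by (meson eventually_happens sequentially_bot)
  let ?w = "\<lambda>x. proj N U x - U x"
  have w: "?w \<in> space_H L" by (intro space_H_diff trig_V_H proj_trig_V U)
  have ds: "hs_summable L 1 (coef L ?w)"
    by (rule hs_mono(1)[OF s]) (simp add: cd)
  have hd: "hs L 1 (coef L ?w) = hs L 1 (?d N)"
    unfolding hs_def cd by (intro infsum_cong) simp
  have "L2_sq L ?w + sob_sq L 1 ?w = ennreal (l2 L ?w + L\<^sup>2 * hs L 1 (?d N))"
    unfolding L2_spaceD(3)[OF space_H_proj(1)[OF w]] sob_sq_H(1)[OF w ds] hd by (rule ennreal_plus[symmetric]) auto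
  then have "H1_norm L ?w = ennreal (sqrt (l2 L ?w + L\<^sup>2 * hs L 1 (?d N)))"
    unfolding H1_norm_def esqrt_def by (simp add: enn2real_ennreal add_nonneg_nonneg del: ennreal_plus)
  moreover have "sqrt (l2 L ?w + L\<^sup>2 * hs L 1 (?d N)) < e"
    using N e by (subst l2_minus_commute) (rule real_less_lsqrt, auto)
  ultimately show "\<exists>p\<in>trig_V L. H1_norm L (\<lambda>x. p x - U x) < ennreal e"
    using e by (intro bexI[OF _ proj_trig_V[of N U]]) (simp add: ennreal_less_iff)
qed

lemma hs2_imp_domain_A:
  assumes U: "U \<in> space_H L" and s: "hs_summable L 2 (coef L U)"
  shows "U \<in> domain_A L"
proof -
  have "hs_summable L (1 + 1) (coef L U)" using s by (simp only: one_add_one)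
  then have "hs_summable L 1 (coef L U)" by (rule hs_down(1)) simp
  then show ?thesis unfolding domain_A_def using hs1_imp_space_V[OF U] sob_sq_H(1)[OF U s] by simp
qed

text \<open>Integrates \<open>|U| \<le> \<theta> |U|^2 + 1 / \<theta>\<close>. With
  \<open>\<theta> = 2^i\<close> it turns increments of size \<open>(1 / 4)^i\<close> in
  \<open>l2\<close> into a summable series in L^1.\<close>

lemma torus_L1_le:
  assumes "U \<in> L2_space L" and \<theta>: "\<theta> > 0"
  shows "(\<integral>\<^sup>+x. ennreal (norm (U x)) \<partial>torus L) \<le> ennreal (\<theta> * l2 L U + measure (torus L) (space (torus L)) / \<theta>)"
proof -
  note u = L2_spaceD[OF assms(1)]
  have le: "norm (U x) \<le> \<theta> * (norm (U x))\<^sup>2 + 1 / \<theta>" for x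
    using Young_weighted[OF \<theta>, of "norm (U x)" 1] \<theta> by (smt (verit) norm_ge_zero one_power2 mult_nonneg_nonneg zero_le_power2 mult_2 mult.right_neutral)
  have i: "integrable (torus L) (\<lambda>x. \<theta> * (norm (U x))\<^sup>2 + 1 / \<theta>)"
    by (intro Bochner_Integration.integrable_add integrable_mult_right u(2) torus.integrable_const)
  have "(\<integral>\<^sup>+x. ennreal (norm (U x)) \<partial>torus L) \<le> (\<integral>\<^sup>+x. ennreal (\<theta> * (norm (U x))\<^sup>2 + 1 / \<theta>) \<partial>torus L)"
    by (intro nn_integral_mono ennreal_leI le)
  also have "\<dots> = ennreal (\<integral>x. \<theta> * (norm (U x))\<^sup>2 + 1 / \<theta> \<partial>torus L)"
    by (rule nn_integral_eq_integral[OF i]) (use \<theta> in auto)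
  also have "(\<integral>x. \<theta> * (norm (U x))\<^sup>2 + 1 / \<theta> \<partial>torus L) = (\<integral>x. \<theta> * (norm (U x))\<^sup>2 \<partial>torus L) + (\<integral>x. 1 / \<theta> \<partial>torus L)"
    by (intro Bochner_Integration.integral_add integrable_mult_right u(2) torus.integrable_const)
  also have "(\<integral>x. 1 / \<theta> \<partial>torus L) = measure (torus L) (space (torus L)) / \<theta>" by (simp only: lebesgue_integral_const real_scaleR_def times_divide_eq_right mult_1_right)
  also have "(\<integral>x. \<theta> * (norm (U x))\<^sup>2 \<partial>torus L) = \<theta> * l2 L U" unfolding l2_def by (rule integral_mult_right_zero)
  finally show ?thesis .
qed

text \<open>A subsequence of the partial sums with rapidly decreasing gaps converges almost
  everywhere, and Fatou's lemma turns this into convergence in L^2. The result provides the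
  projection onto H that \<open>leray\<close> selects.\<close>

theorem Riesz_Fischer:
  assumes c: "real_coefs c" "c 0 = 0" "hs_summable L 0 c"
  obtains h where "h \<in> space_H L" "coef L h = c"
proof -
  define T where "T N = texp L (mbox N) c" for N
  define r where "r N = hs L 0 c - (\<Sum>n\<in>mbox N. (cmod (c n))\<^sup>2)" for N
  have su: "(\<lambda>n. (cmod (c n))\<^sup>2) summable_on UNIV" using c(3) by (simp add: hs0_summable_iff)
  have rlim: "(\<lambda>N. L\<^sup>2 * r N) \<longlonglongrightarrow> 0"
  proof -
    have "(\<lambda>N. \<Sum>n\<in>mbox N. (cmod (c n))\<^sup>2) \<longlonglongrightarrow> hs L 0 c" unfolding hs0_eq by (intro mbox_sum_tendsto has_sum_infsum su)
    then have "(\<lambda>N. L\<^sup>2 * (hs L 0 c - (\<Sum>n\<in>mbox N. (cmod (c n))\<^sup>2))) \<longlonglongrightarrow> L\<^sup>2 * (hs L 0 c - hs L 0 c)" by (intro tendsto_intros)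
    then show ?thesis by (simp add: r_def)
  qed
  have TL: "T N \<in> L2_space L" for N unfolding T_def by (rule texp_L2)
  have cT: "coef L (T N) n = (if n \<in> mbox N then c n else 0)" for N n
    unfolding T_def coef_texp(2)[OF sym_set_mbox c(1)] using c(2) by auto
  have dist: "l2 L (\<lambda>x. T M x - T N x) \<le> L\<^sup>2 * r N" if MN: "N \<le> M" for M N
  proof -
    have sub: "mbox N \<subseteq> mbox M" using MN by (auto simp: mbox_def)
    have s1: "(\<Sum>n\<in>mbox N. (cmod (coef L (T M) n))\<^sup>2) = (\<Sum>n\<in>mbox N. (cmod (c n))\<^sup>2)"
      using sub by (intro sum.cong refl) (auto simp: cT)
    have s2: "(\<Sum>n\<in>mbox N. (cmod (coef L (T M) n - c n))\<^sup>2) = 0"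
      using sub by (intro sum.neutral) (auto simp: cT)
    have "l2 L (\<lambda>x. T M x - T N x) = l2 L (T M) - L\<^sup>2 * (\<Sum>n\<in>mbox N. (cmod (c n))\<^sup>2)"
      using l2_texp_distance[OF TL[of M] sym_set_mbox[of N] c(1,2)] s1 s2 by (simp add: T_def)
    also have "l2 L (T M) = L\<^sup>2 * (\<Sum>n\<in>mbox M. (cmod (c n))\<^sup>2)" unfolding T_def by (rule l2_texp[OF sym_set_mbox c(1,2)])
    also have "\<dots> \<le> L\<^sup>2 * hs L 0 c" unfolding hs0_eq by (intro mult_left_mono finite_sum_le_infsum su) auto
    finally show ?thesis by (simp add: r_def right_diff_distrib)
  qed
  have "\<exists>f. \<forall>i. \<forall>N\<ge>f i. L\<^sup>2 * r N \<le> (1 / 4) ^ i"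
  proof -
    have "\<exists>N0. \<forall>N\<ge>N0. L\<^sup>2 * r N \<le> (1 / 4) ^ i" for i
    proof -
      have "\<forall>\<^sub>F N in sequentially. L\<^sup>2 * r N < (1 / 4) ^ i" by (rule order_tendstoD(2)[OF rlim]) simp
      then show ?thesis unfolding eventually_sequentially by (meson less_imp_le)
    qed
    then show ?thesis by metis
  qed
  then obtain f where f: "\<And>i N. N \<ge> f i \<Longrightarrow> L\<^sup>2 * r N \<le> (1 / 4) ^ i" by blast
  \<comment> \<open>A monotone choice of boxes beyond \<open>f i\<close>; the summand
    \<open>i\<close> makes them exhaust all modes.\<close>
  define K where "K i = i + (\<Sum>j\<le>i. f j)" for i :: nat
  have Kf: "f i \<le> K i" "i \<le> K i" for i unfolding K_def using member_le_sum[of i "{..i}" f] by auto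
  have Km: "K i \<le> K j" if "i \<le> j" for i j
    unfolding K_def using that by (intro add_mono sum_mono2) auto
  define g where "g i = T (K i)" for i
  have gL: "g i \<in> L2_space L" for i unfolding g_def by (rule TL)
  have gd: "l2 L (\<lambda>x. g j x - g i x) \<le> (1 / 4) ^ i" if "i \<le> j" for i j
    unfolding g_def using dist[OF Km[OF that]] f[OF Kf(1)[of i]] by linarith
  have gm: "g i \<in> borel_measurable (torus L)" for i by (rule L2_spaceD(1)[OF gL])
  define V where "V = measure (torus L) (space (torus L))"
  have V0: "0 \<le> V" unfolding V_def by (rule measure_nonneg)
  have L1: "(\<integral>\<^sup>+x. ennreal (norm (g (Suc i) x - g i x)) \<partial>torus L) \<le> ennreal ((1 + V) * (1 / 2) ^ i)" for i
  proof -
    have "(\<integral>\<^sup>+x. ennreal (norm (g (Suc i) x - g i x)) \<partial>torus L) \<le> ennreal (2 ^ i * l2 L (\<lambda>x. g (Suc i) x - g i x) + V / 2 ^ i)"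
      unfolding V_def by (rule torus_L1_le[OF L2_space_diff(1)[OF gL gL]]) simp
    also have "\<dots> \<le> ennreal (2 ^ i * (1 / 4) ^ i + V / 2 ^ i)"
      using gd[of i "Suc i"] by (intro ennreal_leI add_right_mono mult_left_mono) auto
    also have "2 ^ i * (1 / 4) ^ i + V / 2 ^ i = (1 + V) * (1 / 2) ^ i"
    proof -
      have "(2::real) ^ i * (1 / 4) ^ i = (1 / 2) ^ i" by (simp add: power_mult_distrib[symmetric])
      moreover have "V / 2 ^ i = V * (1 / 2) ^ i" by (simp add: power_one_over)
      ultimately show ?thesis by (simp only: distrib_right mult_1_left)
    qed
    finally show ?thesis .
  qed
  have "(\<integral>\<^sup>+x. (\<Sum>i. ennreal (norm (g (Suc i) x - g i x))) \<partial>torus L) = (\<Sum>i. \<integral>\<^sup>+x. ennreal (norm (g (Suc i) x - g i x)) \<partial>torus L)"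
    using gm by (intro nn_integral_suminf) simp
  also have "\<dots> \<le> (\<Sum>i. ennreal ((1 + V) * (1 / 2) ^ i))" by (intro suminf_le L1) auto
  also have "\<dots> = ennreal (\<Sum>i. (1 + V) * (1 / 2) ^ i)"
  proof (rule suminf_ennreal2)
    show "summable (\<lambda>i. (1 + V) * (1 / 2 :: real) ^ i)" by (intro summable_mult summable_geometric) simp
    show "0 \<le> (1 + V) * (1 / 2) ^ i" for i using V0 by simp
  qed
  also have "\<dots> < \<infinity>" by simp
  finally have fin: "(\<integral>\<^sup>+x. (\<Sum>i. ennreal (norm (g (Suc i) x - g i x))) \<partial>torus L) \<noteq> \<infinity>" by simp
  have "AE x in torus L. (\<Sum>i. ennreal (norm (g (Suc i) x - g i x))) \<noteq> \<infinity>"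
    using gm by (intro nn_integral_PInf_AE fin borel_measurable_suminf) simp
  then have conv: "AE x in torus L. convergent (\<lambda>i. g i x)"
  proof eventually_elim
    case (elim x)
    have "summable (\<lambda>i. norm (g (Suc i) x - g i x))"
      using elim by (intro summable_suminf_not_top) auto
    then have "summable (\<lambda>i. g (Suc i) x - g i x)" by (rule summable_norm_cancel)
    then have "convergent (\<lambda>n. \<Sum>i<n. g (Suc i) x - g i x)" by (simp add: summable_iff_convergent)
    moreover have "(\<Sum>i<n. g (Suc i) x - g i x) = g n x - g 0 x" for n by (rule sum_lessThan_telescope)
    ultimately have "convergent (\<lambda>n. g n x - g 0 x)" by (simp only:)
    then have "convergent (\<lambda>n. g 0 x + (g n x - g 0 x))" by (intro convergent_add convergent_const)
    then show ?case by simp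
  qed
  define h where "h x = lim (\<lambda>i. g i x)" for x
  have hm: "h \<in> borel_measurable (torus L)" unfolding h_def by (rule borel_measurable_lim_metric) (rule gm)
  have hg: "L2_sq L (\<lambda>x. h x - g i x) \<le> ennreal ((1 / 4) ^ i)" for i
  proof -
    have "AE x in torus L. ennreal ((norm (h x - g i x))\<^sup>2) = liminf (\<lambda>j. ennreal ((norm (g j x - g i x))\<^sup>2))"
      using conv
    proof eventually_elim
      case (elim x)
      then have "(\<lambda>j. g j x) \<longlonglongrightarrow> h x" by (simp add: h_def convergent_LIMSEQ_iff)
      then have "(\<lambda>j. ennreal ((norm (g j x - g i x))\<^sup>2)) \<longlonglongrightarrow> ennreal ((norm (h x - g i x))\<^sup>2)"
        by (intro tendsto_ennrealI tendsto_intros)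
      then show ?case by (intro lim_imp_Liminf[symmetric]) auto
    qed
    then have "L2_sq L (\<lambda>x. h x - g i x) = (\<integral>\<^sup>+x. liminf (\<lambda>j. ennreal ((norm (g j x - g i x))\<^sup>2)) \<partial>torus L)"
      unfolding L2_sq_def by (rule nn_integral_cong_AE)
    also have "\<dots> \<le> liminf (\<lambda>j. \<integral>\<^sup>+x. ennreal ((norm (g j x - g i x))\<^sup>2) \<partial>torus L)"
      using gm by (intro nn_integral_liminf) simp
    also have "\<dots> \<le> ennreal ((1 / 4) ^ i)"
    proof (rule Liminf_le)
      show "\<forall>\<^sub>F j in sequentially. (\<integral>\<^sup>+x. ennreal ((norm (g j x - g i x))\<^sup>2) \<partial>torus L) \<le> ennreal ((1 / 4) ^ i)"
      proof (rule eventually_sequentiallyI[of i])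
        fix j assume j: "i \<le> j"
        have "(\<integral>\<^sup>+x. ennreal ((norm (g j x - g i x))\<^sup>2) \<partial>torus L) = ennreal (l2 L (\<lambda>x. g j x - g i x))"
          using L2_spaceD(3)[OF L2_space_diff(1)[OF gL gL]] by (simp add: L2_sq_def)
        also have "\<dots> \<le> ennreal ((1 / 4) ^ i)" by (intro ennreal_leI gd j)
        finally show "(\<integral>\<^sup>+x. ennreal ((norm (g j x - g i x))\<^sup>2) \<partial>torus L) \<le> ennreal ((1 / 4) ^ i)" .
      qed
    qed simp
    finally show ?thesis .
  qed
  have hgL: "(\<lambda>x. h x - g i x) \<in> L2_space L" for i
  proof -
    have "(\<lambda>x. h x - g i x) \<in> borel_measurable (torus L)" by (intro borel_measurable_diff hm gm)
    moreover have "L2_sq L (\<lambda>x. h x - g i x) < \<infinity>" using hg[of i] by (simp add: le_less_trans)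
    ultimately show ?thesis by (simp add: L2_space_def)
  qed
  have hL: "h \<in> L2_space L" using L2_space_add(1)[OF hgL[of 0] gL[of 0]] by simp
  have hl: "l2 L (\<lambda>x. h x - g i x) \<le> (1 / 4) ^ i" for i
    using hg[of i] unfolding L2_spaceD(3)[OF hgL] by (simp add: ennreal_le_iff)
  have q: "(\<lambda>i. (1 / 4 :: real) ^ i) \<longlonglongrightarrow> 0" by (rule LIMSEQ_power_zero) simp
  have lim: "(\<lambda>i. l2 L (\<lambda>x. h x - g i x)) \<longlonglongrightarrow> 0" by (rule tendsto_zero_bounded[OF l2_nonneg hl q])
  have H: "h \<in> space_H L"
  proof (rule space_HI[OF hL _ lim])
    show "g i \<in> trig_V L" for i unfolding g_def T_def by (intro texp_trig_V) simp
  qed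
  have "coef L h n = c n" for n
  proof -
    obtain N0 where N0: "{n} \<subseteq> mbox N0" using mbox_superset[of "{n}"] by auto
    have b: "L\<^sup>2 * (cmod (coef L h n - c n))\<^sup>2 \<le> (1 / 4) ^ i" if i: "i \<ge> N0" for i
    proof -
      have "mbox N0 \<subseteq> mbox (K i)" using i Kf(2)[of i] by (auto simp: mbox_def)
      then have e: "coef L (\<lambda>x. h x - g i x) n = coef L h n - c n"
        unfolding coef_diff[OF hL gL] using N0 by (auto simp: g_def cT)
      have "(cmod (coef L h n - c n))\<^sup>2 \<le> hs L 0 (coef L (\<lambda>x. h x - g i x))"
        using hs_term_le[OF coef_bessel(1)[OF hgL[of i]], of n] by (simp add: e)
      then have "L\<^sup>2 * (cmod (coef L h n - c n))\<^sup>2 \<le> L\<^sup>2 * hs L 0 (coef L (\<lambda>x. h x - g i x))" by (rule mult_left_mono) simp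
      also have "\<dots> \<le> (1 / 4) ^ i" using coef_bessel(2)[OF hgL[of i]] hl[of i] by linarith
      finally show ?thesis .
    qed
    then have "\<forall>\<^sub>F i in sequentially. L\<^sup>2 * (cmod (coef L h n - c n))\<^sup>2 \<le> (1 / 4) ^ i"
      by (intro eventually_sequentiallyI[of N0])
    then have "L\<^sup>2 * (cmod (coef L h n - c n))\<^sup>2 \<le> 0" by (intro tendsto_lowerbound[OF q]) auto
    then show ?thesis using L_pos by (simp add: mult_le_0_iff)
  qed
  then show ?thesis using H by (intro that) auto
qed

lemma tmode_H: "texp L {n} (\<lambda>_. c) \<in> space_H L"
  by (intro trig_V_H texp_trig_V) simp

text \<open>With \<open>c = 1\<close> and \<open>c = \<i>\<close> such a test field reads off the
  real and the imaginary part of one coefficient.\<close>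

lemma inner_tmode: "U \<in> L2_space L \<Longrightarrow> L2_inner L U (texp L {n} (\<lambda>_. c)) = L\<^sup>2 * Re (c * cnj (coef L U n))"
  by (subst inner_texp) auto

text \<open>The field from \<open>Riesz_Fischer\<close> with the coefficients of \<open>g\<close>
  satisfies the defining condition, so the choice in \<open>leray\<close> is meaningful. Testing
  that condition with single modes identifies the coefficients of whichever field is chosen.\<close>

lemma leray_properties:
  assumes g: "g \<in> L2_space L"
  shows "leray L g \<in> space_H L" "\<And>\<phi>. \<phi> \<in> space_H L \<Longrightarrow> L2_inner L (leray L g) \<phi> = L2_inner L g \<phi>"
    and "coef L (leray L g) = coef L g"
proof -
  obtain h where h: "h \<in> space_H L" "coef L h = coef L g"
    using Riesz_Fischer[OF coef_real coef_zero coef_bessel(1)[OF g]] by blast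
  have hL: "h \<in> L2_space L" using space_H_proj(1)[OF h(1)] .
  have ex: "h \<in> space_H L \<and> (\<forall>\<phi>\<in>space_H L. L2_inner L (\<lambda>x. g x - h x) \<phi> = 0)"
    by (intro conjI ballI h inner_H_zero L2_space_diff g hL) (simp add: coef_diff[OF g hL] h)
  have P: "leray L g \<in> space_H L \<and> (\<forall>\<phi>\<in>space_H L. L2_inner L (\<lambda>x. g x - leray L g x) \<phi> = 0)"
    unfolding leray_def by (rule someI[of "\<lambda>h. h \<in> space_H L \<and> (\<forall>\<phi>\<in>space_H L. L2_inner L (\<lambda>x. g x - h x) \<phi> = 0)", OF ex])
  then show *: "leray L g \<in> space_H L" by blast
  have lL: "leray L g \<in> L2_space L" using space_H_proj(1)[OF *] .
  show **: "L2_inner L (leray L g) \<phi> = L2_inner L g \<phi>" if "\<phi> \<in> space_H L" for \<phi>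
    using P that L2_inner_diff_left[OF g lL space_H_proj(1)[OF that]] by simp
  show "coef L (leray L g) = coef L g"
  proof
    fix n
    have e: "Re (c * cnj (coef L (leray L g) n)) = Re (c * cnj (coef L g n))" for c
      using **[OF tmode_H[of n c]] L_pos unfolding inner_tmode[OF g] inner_tmode[OF lL] by simp
    show "coef L (leray L g) n = coef L g n"
      using e[of 1] e[of \<i>] by (simp add: complex_eq_iff)
  qed
qed

end

section \<open>The Navier--Stokes equations mode by mode\<close>

lemma esqrt_less_imp: "esqrt x < ennreal e \<Longrightarrow> x < ennreal (e\<^sup>2)"
proof -
  assume a: "esqrt x < ennreal e"
  then have "x \<noteq> \<infinity>" by (auto simp: esqrt_def)
  then obtain r where r: "r \<ge> 0" "x = ennreal r" by (cases x) auto
  have lt: "sqrt r < e" using a r by (simp add: esqrt_def ennreal_less_iff)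
  have "(sqrt r)\<^sup>2 < e\<^sup>2" using lt r by (intro power_strict_mono) auto
  then show ?thesis using r by (simp add: ennreal_less_iff)
qed

text \<open>One factor is changed at a time, with the derivative on the output mode. As only norms
  of H enter, the bound serves the limit that defines \<open>convect\<close> as well as continuity
  in time.\<close>

lemma advect_continuity:
  assumes a: "hs_summable L 0 a" "hs_summable L 0 a0" and b: "hs_summable L 0 b" "hs_summable L 0 b0"
  shows "cmod (advect L a b k - advect L a0 b0 k) \<le> kap L k *
    (sqrt (hs L 0 (\<lambda>n. a n - a0 n)) * sqrt (2 * hs L 0 b0 + 2 * hs L 0 (\<lambda>n. b n - b0 n)) +
     sqrt (hs L 0 a0) * sqrt (hs L 0 (\<lambda>n. b n - b0 n)))"
proof -
  let ?da = "\<lambda>n. a n - a0 n" and ?db = "\<lambda>n. b n - b0 n"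
  have da: "hs_summable L 0 ?da" and db: "hs_summable L 0 ?db" by (intro hs_diff a b)+
  have e: "advect L a b k - advect L a0 b0 k = advect L ?da b k + advect L a0 ?db k"
    by (simp add: advect_diff_left advect_diff_right a b)
  have hb: "hs L 0 b \<le> 2 * hs L 0 b0 + 2 * hs L 0 ?db" using hs_add(2)[OF b(2) db] by simp
  have "cmod (advect L a b k - advect L a0 b0 k) \<le> cmod (advect L ?da b k) + cmod (advect L a0 ?db k)"
    unfolding e by (rule norm_triangle_ineq)
  also have "\<dots> \<le> kap L k * (sqrt (hs L 0 ?da) * sqrt (hs L 0 b)) + kap L k * (sqrt (hs L 0 a0) * sqrt (hs L 0 ?db))"
    by (intro add_mono advect_summable da db a b)
  also have "\<dots> \<le> kap L k * (sqrt (hs L 0 ?da) * sqrt (2 * hs L 0 b0 + 2 * hs L 0 ?db)) + kap L k * (sqrt (hs L 0 a0) * sqrt (hs L 0 ?db))"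
    using hb by (intro add_right_mono mult_left_mono real_sqrt_le_mono) auto
  finally show ?thesis by (simp add: distrib_left)
qed

context torus_domain begin

definition low :: "real \<Rightarrow> (int \<times> int) set" where
  "low lam = {n \<in> modes. (norm (wave L n))\<^sup>2 \<le> lam}"

lemma sym_set_low: "sym_set (low lam)"
proof -
  have "finite (low lam)"
    by (rule finite_subset[OF _ finite_low_modes[of lam]]) (auto simp: low_def kap_def)
  moreover have "- n \<in> low lam \<longleftrightarrow> n \<in> low lam" for n
    by (simp add: low_def modes_def prod_eq_iff wave_uminus)
  ultimately show ?thesis unfolding sym_set_def by blast
qed

lemma spectral_proj_H:
  assumes h: "h \<in> space_H L"
  shows "spectral_proj L lam h = texp L (low lam) (coef L h)"
proof
  fix x
  have "Re (\<Sum>n\<in>low lam. fcoef L h n b * cis (wave L n \<bullet> x)) = texp L (low lam) (coef L h) x \<bullet> b" for b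
    unfolding texp_inner Re_sum space_H_fcoef[OF h] emode_def
    by (intro sum.cong refl) (simp add: algebra_simps)
  then have "spectral_proj L lam h x = (\<Sum>b\<in>Basis. (texp L (low lam) (coef L h) x \<bullet> b) *\<^sub>R b)"
    unfolding spectral_proj_def low_def[symmetric] by simp
  then show "spectral_proj L lam h x = texp L (low lam) (coef L h) x" by (simp only: euclidean_representation)
qed

lemma filter_J_properties:
  assumes g: "I X \<in> L2_space L"
  shows "filter_J L lam I X \<in> space_H L"
    and "coef L (filter_J L lam I X) n = (if n \<in> low lam then coef L (I X) n else 0)"
proof -
  have e: "filter_J L lam I X = texp L (low lam) (coef L (I X))"
    unfolding filter_J_def spectral_proj_H[OF leray_properties(1)[OF g]] leray_properties(3)[OF g] ..
  show "filter_J L lam I X \<in> space_H L" unfolding e by (intro trig_V_H texp_trig_V sym_setD(1)[OF sym_set_low])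
  show "coef L (filter_J L lam I X) n = (if n \<in> low lam then coef L (I X) n else 0)"
    unfolding e coef_texp(2)[OF sym_set_low coef_real] by auto
qed

lemma eventually_V_nhds:
  assumes u: "u \<in> L2_space L" and e: "e > 0"
  shows "\<forall>\<^sub>F p in V_nhds L u. p \<in> trig_V L \<and> l2 L (\<lambda>x. p x - u x) < e"
proof -
  have r: "sqrt e > 0" using e by simp
  let ?S = "{p \<in> trig_V L. H1_norm L (\<lambda>x. p x - u x) < ennreal (sqrt e)}"
  have "V_nhds L u \<le> principal ?S" unfolding V_nhds_def by (rule INF_lower2[of "sqrt e"]) (use r in auto)
  moreover have "\<forall>\<^sub>F p in principal ?S. p \<in> trig_V L \<and> l2 L (\<lambda>x. p x - u x) < e"
    unfolding eventually_principal
  proof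
    fix p assume "p \<in> ?S"
    then have p: "p \<in> trig_V L" and H: "H1_norm L (\<lambda>x. p x - u x) < ennreal (sqrt e)" by auto
    have "L2_sq L (\<lambda>x. p x - u x) + sob_sq L 1 (\<lambda>x. p x - u x) < ennreal ((sqrt e)\<^sup>2)"
      using H unfolding H1_norm_def by (rule esqrt_less_imp)
    then have "L2_sq L (\<lambda>x. p x - u x) < ennreal e" using e by (simp add: le_less_trans[OF add_increasing2[OF zero_le order_refl]])
    then show "p \<in> trig_V L \<and> l2 L (\<lambda>x. p x - u x) < e"
      using p e by (simp add: L2_spaceD(3)[OF L2_space_diff(1)[OF trig_V_L2[OF p] u]] ennreal_less_iff)
  qed
  ultimately show ?thesis by (rule filter_leD)
qed

text \<open>Convergence determines \<open>Lim\<close> only along a nontrivial filter; this one is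
  nontrivial because trigonometric polynomials are dense in V.\<close>

lemma V_nhds_not_bot:
  assumes u: "u \<in> space_V L"
  shows "V_nhds L u \<noteq> bot"
  unfolding V_nhds_def
proof (rule INF_filter_not_bot)
  fix X :: "real set" assume X: "X \<subseteq> {0<..}" "finite X"
  let ?S = "\<lambda>\<epsilon>. {p \<in> trig_V L. H1_norm L (\<lambda>x. p x - u x) < ennreal \<epsilon>}"
  define e where "e = Min (insert 1 X)"
  have e: "e > 0" "\<And>x. x \<in> X \<Longrightarrow> e \<le> x" using X by (auto simp: e_def)
  obtain p where p: "p \<in> trig_V L" "H1_norm L (\<lambda>x. p x - u x) < ennreal e" using u e(1) unfolding space_V_def by blast
  have "p \<in> (\<Inter>x\<in>X. ?S x)" using p e(2) by (auto intro: less_le_trans ennreal_leI)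
  then show "(INF \<epsilon>\<in>X. principal (?S \<epsilon>)) \<noteq> bot"
    unfolding INF_principal_finite[OF X(2)] by (auto simp: principal_eq_bot_iff)
qed

lemma V_nhds_hs0:
  assumes u: "u \<in> L2_space L"
  shows "((\<lambda>p. hs L 0 (\<lambda>n. coef L p n - coef L u n)) \<longlongrightarrow> 0) (V_nhds L u)"
proof (rule order_tendstoI)
  fix e :: real assume e: "e > 0"
  then have "L\<^sup>2 * e > 0" using L_pos by simp
  from eventually_V_nhds[OF u this]
  show "\<forall>\<^sub>F p in V_nhds L u. hs L 0 (\<lambda>n. coef L p n - coef L u n) < e"
  proof eventually_elim
    case (elim p)
    then have p: "p \<in> L2_space L" by (intro trig_V_L2) simp
    have "L\<^sup>2 * hs L 0 (coef L (\<lambda>x. p x - u x)) \<le> l2 L (\<lambda>x. p x - u x)" by (rule coef_bessel(2)[OF L2_space_diff(1)[OF p u]])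
    then have "L\<^sup>2 * hs L 0 (\<lambda>n. coef L p n - coef L u n) < L\<^sup>2 * e"
      using elim unfolding coef_diff[OF p u, abs_def] by linarith
    then show ?case using L_pos by simp
  qed
next
  fix e :: real assume "e < 0"
  then show "\<forall>\<^sub>F p in V_nhds L u. e < hs L 0 (\<lambda>n. coef L p n - coef L u n)"
    by (intro always_eventually allI less_le_trans[OF _ hs_nonneg])
qed

lemma V_nhds_trig_V: "u \<in> L2_space L \<Longrightarrow> \<forall>\<^sub>F p in V_nhds L u. p \<in> trig_V L"
  using eventually_V_nhds[of u 1] by (auto elim: eventually_mono)

lemma space_V_L2: "u \<in> space_V L \<Longrightarrow> u \<in> L2_space L"
  by (simp add: space_V_def)

lemma real_coefs_deriv: "real_coefs c \<Longrightarrow> real_coefs (\<lambda>n. \<i> * of_real (wave L n $ i) * c n)"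
  unfolding real_coefs_def wave_uminus by simp

lemma stokes0_tmode:
  assumes p: "p \<in> trig_V L"
  shows "L2_inner L (stokes0 L p) (texp L {n} (\<lambda>_. c)) = L\<^sup>2 * Re (c * cnj (of_real ((kap L n)\<^sup>2) * coef L p n))"
proof -
  obtain F where F: "sym_set F" "p = texp L F (coef L p)" "\<And>n. n \<notin> F \<Longrightarrow> coef L p n = 0"
    using trig_V_expansion[OF p] by blast
  let ?d = "\<lambda>n. of_real ((kap L n)\<^sup>2) * coef L p n"
  have "(\<lambda>x. - (\<Sum>i\<in>UNIV. pderiv_dir i (pderiv_dir i p) x)) = texp L F ?d"
  proof
    fix x
    have pp: "pderiv_dir i (pderiv_dir i p) x = texp L F (\<lambda>n. \<i> * of_real (wave L n $ i) * (\<i> * of_real (wave L n $ i) * coef L p n)) x" for i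
      by (subst F(2)) (simp only: pderiv_texp)
    have kk: "(kap L n)\<^sup>2 = (wave L n $ 1)\<^sup>2 + (wave L n $ 2)\<^sup>2" for n
      by (simp add: kap_def power2_norm_eq_inner inner_real2 power2_eq_square[symmetric])
    have t: "- (Re (\<i> * of_real (wave L n $ 1) * (\<i> * of_real (wave L n $ 1) * coef L p n) * emode L n x) +
       Re (\<i> * of_real (wave L n $ 2) * (\<i> * of_real (wave L n $ 2) * coef L p n) * emode L n x)) = Re (?d n * emode L n x)" for n
      unfolding kk by (simp add: power2_eq_square algebra_simps)
    show "- (\<Sum>i\<in>UNIV. pderiv_dir i (pderiv_dir i p) x) = texp L F ?d x"
      unfolding pp sum_2 texp_def sum.distrib[symmetric] sum_negf[symmetric] scaleR_add_left[symmetric] scaleR_minus_left[symmetric] t ..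
  qed
  then have s: "stokes0 L p = leray L (texp L F ?d)" by (simp only: stokes0_def)
  have rc: "real_coefs ?d" using coef_real[of p] unfolding real_coefs_def by simp
  have "coef L (texp L F ?d) n = ?d n" unfolding coef_texp(2)[OF F(1) rc] using F(3)[of n] by auto
  then show ?thesis unfolding s leray_properties(2)[OF texp_L2 tmode_H] inner_tmode[OF texp_L2] by simp
qed

lemma tendsto_coef_V_nhds:
  assumes u: "u \<in> L2_space L"
  shows "((\<lambda>p. coef L p n) \<longlongrightarrow> coef L u n) (V_nhds L u)"
proof -
  have "((\<lambda>p. sqrt (hs L 0 (\<lambda>n. coef L p n - coef L u n))) \<longlongrightarrow> sqrt 0) (V_nhds L u)"
    by (intro tendsto_intros V_nhds_hs0 u)
  then have l: "((\<lambda>p. sqrt (hs L 0 (\<lambda>n. coef L p n - coef L u n))) \<longlongrightarrow> 0) (V_nhds L u)" by simp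
  have "\<forall>\<^sub>F p in V_nhds L u. cmod (coef L p n - coef L u n) \<le> sqrt (hs L 0 (\<lambda>n. coef L p n - coef L u n))"
    using V_nhds_trig_V[OF u]
  proof eventually_elim
    case (elim p)
    have "hs_summable L 0 (\<lambda>n. coef L p n - coef L u n)" by (intro hs_diff coef_bessel trig_V_L2 elim u)
    from hs_term_le[OF this, of n] show ?case by (simp add: real_le_rsqrt)
  qed
  then have "((\<lambda>p. coef L p n - coef L u n) \<longlongrightarrow> 0) (V_nhds L u)" by (rule Lim_null_comparison[OF _ l])
  then show ?thesis by (rule LIM_zero_cancel)
qed

text \<open>Against a fixed mode the Stokes term is a continuous function of one coefficient, so the
  convergence of coefficients along \<open>V_nhds\<close> identifies the extension.\<close>

lemma stokes_tmode:
  assumes u: "u \<in> space_V L"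
  shows "stokes L u (texp L {n} (\<lambda>_. c)) = L\<^sup>2 * Re (c * cnj (of_real ((kap L n)\<^sup>2) * coef L u n))"
  unfolding stokes_def
proof (rule tendsto_Lim[OF V_nhds_not_bot[OF u]])
  note uL = space_V_L2[OF u]
  have "((\<lambda>p. L\<^sup>2 * Re (c * cnj (of_real ((kap L n)\<^sup>2) * coef L p n))) \<longlongrightarrow> L\<^sup>2 * Re (c * cnj (of_real ((kap L n)\<^sup>2) * coef L u n))) (V_nhds L u)"
    by (intro tendsto_intros tendsto_coef_V_nhds uL)
  moreover have "\<forall>\<^sub>F p in V_nhds L u. L\<^sup>2 * Re (c * cnj (of_real ((kap L n)\<^sup>2) * coef L p n)) = L2_inner L (stokes0 L p) (texp L {n} (\<lambda>_. c))"
    using V_nhds_trig_V[OF uL] by eventually_elim (simp only: stokes0_tmode)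
  ultimately show "((\<lambda>p. L2_inner L (stokes0 L p) (texp L {n} (\<lambda>_. c))) \<longlongrightarrow> L\<^sup>2 * Re (c * cnj (of_real ((kap L n)\<^sup>2) * coef L u n))) (V_nhds L u)"
    by (rule Lim_transform_eventually)
qed

text \<open>When the two finite expansions are multiplied, orthogonality keeps the pairs of modes
  with \<open>j + l = n\<close>.\<close>

lemma convect0_coef:
  assumes p: "p \<in> trig_V L" and q: "q \<in> trig_V L"
  defines "g \<equiv> \<lambda>x. \<Sum>i\<in>UNIV. (p x $ i) *\<^sub>R pderiv_dir i q x"
  shows "g \<in> L2_space L" and "coef L g n = advect L (coef L p) (coef L q) n"
proof -
  obtain F where F: "sym_set F" "p = texp L F (coef L p)" "\<And>n. n \<notin> F \<Longrightarrow> coef L p n = 0"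
    using trig_V_expansion[OF p] by blast
  obtain G where G: "sym_set G" "q = texp L G (coef L q)" "\<And>n. n \<notin> G \<Longrightarrow> coef L q n = 0"
    using trig_V_expansion[OF q] by blast
  let ?a = "coef L p" and ?b = "coef L q"
  have fF: "finite F" and fG: "finite G" by (rule sym_setD(1)[OF F(1)], rule sym_setD(1)[OF G(1)])
  have dq: "pderiv_dir i q = texp L G (\<lambda>n. \<i> * of_real (wave L n $ i) * ?b n)" for i
    by (subst G(2)) (rule pderiv_texp)
  have cp: "continuous_on UNIV p" by (subst F(2)) (intro continuous_intros)
  show gL: "g \<in> L2_space L" unfolding g_def dq by (intro continuous_L2 continuous_intros cp)
  let ?t = "\<lambda>j l. \<i> * of_real ((ev L j \<bullet> wave L l) * (ev L l \<bullet> ev L n)) * ?a j * ?b l"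
  have ex: "complex_of_real (g x \<bullet> ev L n) = (\<Sum>(j, l)\<in>F \<times> G. ?t j l * emode L (j + l) x)" for x
  proof -
    have pi: "complex_of_real (p x $ i) = (\<Sum>j\<in>F. (?a j * of_real (ev L j $ i)) * emode L j x)" for i
      using texp_inner_complex[where L=L and x=x and y="axis i 1", OF F(1) coef_real[of p]]
      unfolding F(2)[symmetric] by (simp add: inner_axis)
    have qi: "complex_of_real (pderiv_dir i q x \<bullet> ev L n) = (\<Sum>l\<in>G. (\<i> * of_real (wave L l $ i) * ?b l * of_real (ev L l \<bullet> ev L n)) * emode L l x)" for i
      unfolding dq by (rule texp_inner_complex[OF G(1) real_coefs_deriv[OF coef_real]])
    have prod_term: "(?a j * of_real (ev L j $ 1)) * emode L j x * ((\<i> * of_real (wave L l $ 1) * ?b l * of_real (ev L l \<bullet> ev L n)) * emode L l x)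
       + (?a j * of_real (ev L j $ 2)) * emode L j x * ((\<i> * of_real (wave L l $ 2) * ?b l * of_real (ev L l \<bullet> ev L n)) * emode L l x)
       = ?t j l * emode L (j + l) x" for j l
      unfolding inner_real2[of "ev L j" "wave L l"] emode_add by (simp add: algebra_simps)
    have "complex_of_real (g x \<bullet> ev L n) = (\<Sum>i\<in>UNIV. complex_of_real (p x $ i) * complex_of_real (pderiv_dir i q x \<bullet> ev L n))"
      unfolding g_def by (simp add: inner_sum_left)
    also have "\<dots> = (\<Sum>j\<in>F. \<Sum>l\<in>G. ?t j l * emode L (j + l) x)"
      unfolding pi qi sum_2 sum_product sum.distrib[symmetric] prod_term ..
    finally show ?thesis by (simp only: sum.cartesian_product)
  qed
  have i: "integrable (torus L) (\<lambda>x. emode L (j + l) x * cnj (emode L n x))" for j l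
    by (intro continuous_integrable_torus continuous_intros)
  have "(\<integral>x. of_real (g x \<bullet> ev L n) * cnj (emode L n x) \<partial>torus L) =
      (\<integral>x. (\<Sum>(j, l)\<in>F \<times> G. ?t j l * (emode L (j + l) x * cnj (emode L n x))) \<partial>torus L)"
    unfolding ex sum_distrib_right by (intro Bochner_Integration.integral_cong refl sum.cong) (auto simp only: split_beta mult.assoc)
  also have "\<dots> = (\<Sum>(j, l)\<in>F \<times> G. ?t j l * (\<integral>x. emode L (j + l) x * cnj (emode L n x) \<partial>torus L))"
    unfolding case_prod_unfold
    by (subst Bochner_Integration.integral_sum, intro integrable_mult_right i) (simp only: integral_mult_right_zero)
  also have "\<dots> = (\<Sum>l\<in>G. \<Sum>j\<in>F. ?t j l * (if j = n - l then of_real (L\<^sup>2) else 0))"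
    unfolding emode_orthogonal sum.cartesian_product[symmetric] eq_diff_eq by (rule sum.swap)
  also have "\<dots> = (\<Sum>l\<in>G. if n - l \<in> F then ?t (n - l) l * of_real (L\<^sup>2) else 0)"
  proof (intro sum.cong refl)
    fix l
    have "(\<Sum>j\<in>F. ?t j l * (if j = n - l then of_real (L\<^sup>2) else 0)) = (\<Sum>j\<in>F. if j = n - l then ?t j l * of_real (L\<^sup>2) else 0)"
      by (intro sum.cong) auto
    then show "(\<Sum>j\<in>F. ?t j l * (if j = n - l then of_real (L\<^sup>2) else 0)) = (if n - l \<in> F then ?t (n - l) l * of_real (L\<^sup>2) else 0)"
      using fF by simp
  qed
  also have "\<dots> = (\<Sum>l\<in>G. ?t (n - l) l) * of_real (L\<^sup>2)"
    unfolding sum_distrib_right by (intro sum.cong refl) (auto simp: F(3))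
  finally have c1: "coef L g n = (\<Sum>l\<in>G. ?t (n - l) l)"
    unfolding coef_def fcoef_emode using L_pos by simp
  \<comment> \<open>\<open>ev L (n - l)\<close> is orthogonal to \<open>wave L (n - l)\<close>, so
    the derivative factor passes from the input mode to the output mode, as in
    \<open>advect_coef\<close>.\<close>
  have tt: "?t (n - l) l = \<i> * of_real (advect_coef L n l) * ?a (n - l) * ?b l" for l
  proof -
    have "ev L (n - l) \<bullet> wave L n = ev L (n - l) \<bullet> wave L l"
      using ev_inner_wave[of L "n - l"] by (simp add: wave_diff inner_diff_right)
    then show ?thesis by (simp add: advect_coef_def)
  qed
  have "advect L ?a ?b n = (\<Sum>\<^sub>\<infinity>l\<in>G. ?t (n - l) l)"
    unfolding advect_def tt by (rule infsum_cong_neutral) (auto simp: G(3))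
  then show "coef L g n = advect L ?a ?b n" using c1 fG by simp
qed

lemma convect_tmode:
  assumes u: "u \<in> space_V L"
  shows "convect L u u (texp L {n} (\<lambda>_. c)) = L\<^sup>2 * Re (c * cnj (advect L (coef L u) (coef L u) n))"
  unfolding convect_def
proof (rule tendsto_Lim)
  note uL = space_V_L2[OF u]
  let ?F = "V_nhds L u \<times>\<^sub>F V_nhds L u"
  show "?F \<noteq> bot" by (simp add: prod_filter_eq_bot V_nhds_not_bot[OF u])
  let ?a = "coef L u"
  let ?d = "\<lambda>p. hs L 0 (\<lambda>n. coef L p n - ?a n)"
  have d1: "((\<lambda>z. ?d (fst z)) \<longlongrightarrow> 0) ?F" by (rule filterlim_compose[OF V_nhds_hs0[OF uL] filterlim_fst])
  have d2: "((\<lambda>z. ?d (snd z)) \<longlongrightarrow> 0) ?F" by (rule filterlim_compose[OF V_nhds_hs0[OF uL] filterlim_snd])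
  let ?B = "\<lambda>z. kap L n * (sqrt (?d (fst z)) * sqrt (2 * hs L 0 ?a + 2 * ?d (snd z)) + sqrt (hs L 0 ?a) * sqrt (?d (snd z)))"
  have "(?B \<longlongrightarrow> kap L n * (sqrt 0 * sqrt (2 * hs L 0 ?a + 2 * 0) + sqrt (hs L 0 ?a) * sqrt 0)) ?F"
    by (intro tendsto_intros d1 d2)
  then have B: "(?B \<longlongrightarrow> 0) ?F" by simp
  have ev: "\<forall>\<^sub>F z in ?F. fst z \<in> trig_V L \<and> snd z \<in> trig_V L"
    using eventually_prodI[OF V_nhds_trig_V[OF uL] V_nhds_trig_V[OF uL]] .
  have "\<forall>\<^sub>F z in ?F. norm (advect L (coef L (fst z)) (coef L (snd z)) n - advect L ?a ?a n) \<le> ?B z"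
    using ev by eventually_elim (intro advect_continuity coef_bessel trig_V_L2 uL, auto)
  then have "((\<lambda>z. advect L (coef L (fst z)) (coef L (snd z)) n - advect L ?a ?a n) \<longlongrightarrow> 0) ?F"
    by (rule Lim_null_comparison[OF _ B])
  then have lim: "((\<lambda>z. advect L (coef L (fst z)) (coef L (snd z)) n) \<longlongrightarrow> advect L ?a ?a n) ?F"
    by (rule LIM_zero_cancel)
  have "((\<lambda>z. L\<^sup>2 * Re (c * cnj (advect L (coef L (fst z)) (coef L (snd z)) n))) \<longlongrightarrow> L\<^sup>2 * Re (c * cnj (advect L ?a ?a n))) ?F"
    by (intro tendsto_intros lim)
  moreover have "\<forall>\<^sub>F z in ?F. L\<^sup>2 * Re (c * cnj (advect L (coef L (fst z)) (coef L (snd z)) n)) = (case z of (p, q) \<Rightarrow> L2_inner L (convect0 L p q) (texp L {n} (\<lambda>_. c)))"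
    using ev
  proof eventually_elim
    case (elim z)
    note g = convect0_coef[OF conjunct1[OF elim] conjunct2[OF elim]]
    show ?case
      unfolding case_prod_unfold convect0_def leray_properties(2)[OF g(1) tmode_H] inner_tmode[OF g(1)] g(2) ..
  qed
  ultimately show "((\<lambda>(p, q). L2_inner L (convect0 L p q) (texp L {n} (\<lambda>_. c))) \<longlongrightarrow> L\<^sup>2 * Re (c * cnj (advect L ?a ?a n))) ?F"
    by (rule Lim_transform_eventually)
qed

end

lemma tendsto_advect:
  assumes a: "\<And>r. r \<in> S \<Longrightarrow> hs_summable L 0 (a r)" and b: "\<And>r. r \<in> S \<Longrightarrow> hs_summable L 0 (b r)" and t: "t \<in> S"
    and la: "((\<lambda>r. hs L 0 (\<lambda>n. a r n - a t n)) \<longlongrightarrow> 0) (at t within S)"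
    and lb: "((\<lambda>r. hs L 0 (\<lambda>n. b r n - b t n)) \<longlongrightarrow> 0) (at t within S)"
  shows "((\<lambda>r. advect L (a r) (b r) k) \<longlongrightarrow> advect L (a t) (b t) k) (at t within S)"
proof -
  let ?B = "\<lambda>r. kap L k * (sqrt (hs L 0 (\<lambda>n. a r n - a t n)) * sqrt (2 * hs L 0 (b t) + 2 * hs L 0 (\<lambda>n. b r n - b t n)) +
     sqrt (hs L 0 (a t)) * sqrt (hs L 0 (\<lambda>n. b r n - b t n)))"
  have "(?B \<longlongrightarrow> kap L k * (sqrt 0 * sqrt (2 * hs L 0 (b t) + 2 * 0) + sqrt (hs L 0 (a t)) * sqrt 0)) (at t within S)"
    by (intro tendsto_intros la lb)
  then have B: "(?B \<longlongrightarrow> 0) (at t within S)" by simp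
  have "\<forall>\<^sub>F r in at t within S. norm (advect L (a r) (b r) k - advect L (a t) (b t) k) \<le> ?B r"
    unfolding eventually_at_filter by (rule always_eventually) (blast intro: advect_continuity a b t)
  then have "((\<lambda>r. advect L (a r) (b r) k - advect L (a t) (b t) k) \<longlongrightarrow> 0) (at t within S)"
    by (rule Lim_null_comparison[OF _ B])
  then show ?thesis by (rule LIM_zero_cancel)
qed

lemma tendsto_hs0_component:
  assumes a: "\<And>r. r \<in> S \<Longrightarrow> hs_summable L 0 (a r)" and t: "t \<in> S"
    and la: "((\<lambda>r. hs L 0 (\<lambda>n. a r n - a t n)) \<longlongrightarrow> 0) (at t within S)"
  shows "((\<lambda>r. a r k) \<longlongrightarrow> a t k) (at t within S)"
proof -
  have "((\<lambda>r. sqrt (hs L 0 (\<lambda>n. a r n - a t n))) \<longlongrightarrow> sqrt 0) (at t within S)" by (intro tendsto_intros la)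
  then have l: "((\<lambda>r. sqrt (hs L 0 (\<lambda>n. a r n - a t n))) \<longlongrightarrow> 0) (at t within S)" by simp
  have "norm (a r k - a t k) \<le> sqrt (hs L 0 (\<lambda>n. a r n - a t n))" if "r \<in> S" for r
    using hs_term_le[OF hs_diff(1)[OF a[OF that] a[OF t]], of k] by (simp add: real_le_rsqrt)
  then have "\<forall>\<^sub>F r in at t within S. norm (a r k - a t k) \<le> sqrt (hs L 0 (\<lambda>n. a r n - a t n))"
    unfolding eventually_at_filter by (intro always_eventually) blast
  then have "((\<lambda>r. a r k - a t k) \<longlongrightarrow> 0) (at t within S)" by (rule Lim_null_comparison[OF _ l])
  then show ?thesis by (rule LIM_zero_cancel)
qed

section \<open>From the weak equation to the equation of the error\<close>

context torus_domain begin

lemma NSE_solutionD: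
  assumes u: "NSE_solution L \<nu> f s u"
  shows "\<And>r. r \<ge> s \<Longrightarrow> u r \<in> space_H L" "\<And>r. r \<ge> s \<Longrightarrow> u r \<in> L2_space L"
    and "\<And>t. t \<ge> s \<Longrightarrow> ((\<lambda>r. hs L 0 (\<lambda>n. coef L (u r) n - coef L (u t) n)) \<longlongrightarrow> 0) (at t within {s..})"
    and "\<And>\<phi> t. \<phi> \<in> space_V L \<Longrightarrow> t \<ge> s \<Longrightarrow> has_bochner_integral (lebesgue_on {s..t})
          (\<lambda>r. L2_inner L (f r) \<phi> - \<nu> * stokes L (u r) \<phi> - convect L (u r) (u r) \<phi>)
          (L2_inner L (u t) \<phi> - L2_inner L (u s) \<phi>)"
proof -
  show H: "\<And>r. r \<ge> s \<Longrightarrow> u r \<in> space_H L" using u unfolding NSE_solution_def by blast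
  then show L2: "\<And>r. r \<ge> s \<Longrightarrow> u r \<in> L2_space L" by (blast intro: space_H_proj(1))
  show "\<And>\<phi> t. \<phi> \<in> space_V L \<Longrightarrow> t \<ge> s \<Longrightarrow> has_bochner_integral (lebesgue_on {s..t})
          (\<lambda>r. L2_inner L (f r) \<phi> - \<nu> * stokes L (u r) \<phi> - convect L (u r) (u r) \<phi>)
          (L2_inner L (u t) \<phi> - L2_inner L (u s) \<phi>)" using u unfolding NSE_solution_def by blast
  show "((\<lambda>r. hs L 0 (\<lambda>n. coef L (u r) n - coef L (u t) n)) \<longlongrightarrow> 0) (at t within {s..})" if t: "t \<ge> s" for t
  proof (rule order_tendstoI)
    fix e :: real assume e: "e > 0"
    have c: "((\<lambda>r. L2_norm L (\<lambda>x. u r x - u t x)) \<longlongrightarrow> 0) (at t within {s..})"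
      using u t unfolding NSE_solution_def by blast
    have Le: "L * sqrt e > 0" using L_pos e by simp
    then have "\<forall>\<^sub>F r in at t within {s..}. L2_norm L (\<lambda>x. u r x - u t x) < ennreal (L * sqrt e)"
      by (intro order_tendstoD(2)[OF c]) simp
    moreover have "\<forall>\<^sub>F r in at t within {s..}. r \<in> {s..}" by (simp add: eventually_at_filter)
    ultimately show "\<forall>\<^sub>F r in at t within {s..}. hs L 0 (\<lambda>n. coef L (u r) n - coef L (u t) n) < e"
    proof eventually_elim
      case (elim r)
      then have r: "u r \<in> L2_space L" using L2[of r] by simp
      note D = L2_space_diff(1)[OF r L2[OF t]]
      have "l2 L (\<lambda>x. u r x - u t x) < (L * sqrt e)\<^sup>2" using elim(1) L2_norm_less[OF D Le] by simp
      also have "(L * sqrt e)\<^sup>2 = L\<^sup>2 * e" using e by (simp add: power_mult_distrib)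
      finally have "L\<^sup>2 * hs L 0 (coef L (\<lambda>x. u r x - u t x)) < L\<^sup>2 * e" using coef_bessel(2)[OF D] by linarith
      then show ?case using L_pos by (simp add: coef_diff[OF r L2[OF t], abs_def])
    qed
  next
    fix e :: real assume "e < 0"
    then show "\<forall>\<^sub>F r in at t within {s..}. e < hs L 0 (\<lambda>n. coef L (u r) n - coef L (u t) n)"
      by (intro always_eventually allI less_le_trans[OF _ hs_nonneg])
  qed
qed

lemma tmode_V: "texp L {n} (\<lambda>_. c) \<in> space_V L"
proof (rule hs1_imp_space_V[OF tmode_H])
  show "hs_summable L 1 (coef L (texp L {n} (\<lambda>_. c)))"
  proof (rule finite_support_summable(1))
    obtain F where F: "sym_set F" "\<And>m. m \<notin> F \<Longrightarrow> coef L (texp L {n} (\<lambda>_. c)) m = 0"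
      using trig_V_expansion[OF texp_trig_V[of "{n}" "\<lambda>_. c", OF finite.insertI[OF finite.emptyI]]] by metis
    show "finite {m. coef L (texp L {n} (\<lambda>_. c)) m \<noteq> 0}"
      by (rule finite_subset[OF _ sym_setD(1)[OF F(1)]]) (use F(2) in blast)
  qed
qed

text \<open>The equation is given on intervals that start at the initial time \<open>t0\<close>.
  Subtracting two of them leaves the half-open interval between later times, so that solutions with
  different initial times can be compared.\<close>

lemma NSE_mode_integral:
  assumes u: "NSE_solution L \<nu> f t0 u" and s: "t0 \<le> s" "s \<le> t" and \<phi>: "\<phi> \<in> space_V L"
  shows "has_bochner_integral lebesgue
     (\<lambda>r. indicator {s<..t} r *\<^sub>R (L2_inner L (f r) \<phi> - \<nu> * stokes L (u r) \<phi> - convect L (u r) (u r) \<phi>))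
     (L2_inner L (u t) \<phi> - L2_inner L (u s) \<phi>)"
proof -
  let ?g = "\<lambda>r. L2_inner L (f r) \<phi> - \<nu> * stokes L (u r) \<phi> - convect L (u r) (u r) \<phi>"
  have h: "has_bochner_integral lebesgue (\<lambda>r. indicator {t0..t} r *\<^sub>R ?g r) (L2_inner L (u t) \<phi> - L2_inner L (u t0) \<phi>)" if "t \<ge> t0" for t
    using NSE_solutionD(4)[OF u \<phi> that] by (subst (asm) has_bochner_integral_restrict_space) auto
  have "has_bochner_integral lebesgue (\<lambda>r. indicator {t0..t} r *\<^sub>R ?g r - indicator {t0..s} r *\<^sub>R ?g r)
     (L2_inner L (u t) \<phi> - L2_inner L (u t0) \<phi> - (L2_inner L (u s) \<phi> - L2_inner L (u t0) \<phi>))"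
    using s by (intro has_bochner_integral_diff h) auto
  moreover have "indicator {t0..t} r *\<^sub>R ?g r - indicator {t0..s} r *\<^sub>R ?g r = indicator {s<..t} r *\<^sub>R ?g r" for r
    using s by (auto simp: indicator_def)
  ultimately show ?thesis by simp
qed

text \<open>In the difference of the two tested equations the forcing, merely measurable in time,
  cancels. What remains is continuous up to \<open>s\<close>, because each coefficient of the
  advection term is continuous with respect to the norm of H. Hence the integrated equation can be
  differentiated at every time after \<open>s\<close>.\<close>

lemma NSE_difference_derivative:
  assumes U: "NSE_solution L \<nu> f t0 U" and u: "NSE_solution L \<nu> f s u" and s: "t0 \<le> s"
    and V: "\<And>r. r > s \<Longrightarrow> U r \<in> space_V L" "\<And>r. r > s \<Longrightarrow> u r \<in> space_V L"
  defines "v \<equiv> \<lambda>r. coef L (\<lambda>x. U r x - u r x)"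
  shows "continuous_on {s..} (\<lambda>r. pert L (coef L (U r)) (v r) n)"
    and "\<And>t. t \<ge> s \<Longrightarrow> ((\<lambda>r. hs L 0 (\<lambda>n. v r n - v t n)) \<longlongrightarrow> 0) (at t within {s..})"
    and "\<And>r. r > s \<Longrightarrow> ((\<lambda>r. v r n) has_vector_derivative
        (- of_real (\<nu> * (kap L n)\<^sup>2) * v r n - pert L (coef L (U r)) (v r) n)) (at r)"
proof -
  have UL: "U r \<in> L2_space L" and uL: "u r \<in> L2_space L" if "r \<ge> s" for r
    using that s by (auto intro: NSE_solutionD(2)[OF U] NSE_solutionD(2)[OF u])
  have ve: "v r n = coef L (U r) n - coef L (u r) n" if "r \<ge> s" for r n
    unfolding v_def by (rule coef_diff[OF UL[OF that] uL[OF that]])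
  have ve': "v r = (\<lambda>n. coef L (U r) n - coef L (u r) n)" if "r \<ge> s" for r using ve[OF that] by auto
  have sU: "hs_summable L 0 (coef L (U r))" and su: "hs_summable L 0 (coef L (u r))" if "r \<in> {s..}" for r
    using that by (auto intro: coef_bessel(1) UL uL)
  have lU: "((\<lambda>r. hs L 0 (\<lambda>n. coef L (U r) n - coef L (U t) n)) \<longlongrightarrow> 0) (at t within {s..})" if t: "t \<ge> s" for t
    by (rule tendsto_within_subset[OF NSE_solutionD(3)[OF U]]) (use t s in auto)
  have lu: "((\<lambda>r. hs L 0 (\<lambda>n. coef L (u r) n - coef L (u t) n)) \<longlongrightarrow> 0) (at t within {s..})" if t: "t \<ge> s" for t
    by (rule NSE_solutionD(3)[OF u t])
  show lv: "((\<lambda>r. hs L 0 (\<lambda>n. v r n - v t n)) \<longlongrightarrow> 0) (at t within {s..})" if t: "t \<ge> s" for t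
  proof (rule Lim_null_comparison)
    have "((\<lambda>r. 2 * hs L 0 (\<lambda>n. coef L (U r) n - coef L (U t) n) + 2 * hs L 0 (\<lambda>n. coef L (u r) n - coef L (u t) n)) \<longlongrightarrow> 2 * 0 + 2 * 0) (at t within {s..})"
      by (intro tendsto_intros lU lu t)
    then show "((\<lambda>r. 2 * hs L 0 (\<lambda>n. coef L (U r) n - coef L (U t) n) + 2 * hs L 0 (\<lambda>n. coef L (u r) n - coef L (u t) n)) \<longlongrightarrow> 0) (at t within {s..})"
      by simp
    have "norm (hs L 0 (\<lambda>n. v r n - v t n)) \<le> 2 * hs L 0 (\<lambda>n. coef L (U r) n - coef L (U t) n) + 2 * hs L 0 (\<lambda>n. coef L (u r) n - coef L (u t) n)"
      if r: "r \<in> {s..}" for r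
    proof -
      have e: "(\<lambda>n. v r n - v t n) = (\<lambda>n. (coef L (U r) n - coef L (U t) n) - (coef L (u r) n - coef L (u t) n))"
        using r t by (simp add: ve fun_eq_iff)
      have "hs L 0 (\<lambda>n. v r n - v t n) \<le> 2 * hs L 0 (\<lambda>n. coef L (U r) n - coef L (U t) n) + 2 * hs L 0 (\<lambda>n. coef L (u r) n - coef L (u t) n)"
        unfolding e using r t by (intro hs_diff(2) hs_diff(1) sU su) auto
      then show ?thesis by simp
    qed
    then show "\<forall>\<^sub>F r in at t within {s..}. norm (hs L 0 (\<lambda>n. v r n - v t n)) \<le> 2 * hs L 0 (\<lambda>n. coef L (U r) n - coef L (U t) n) + 2 * hs L 0 (\<lambda>n. coef L (u r) n - coef L (u t) n)"
      unfolding eventually_at_filter by (intro always_eventually) blast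
  qed
  have sv: "hs_summable L 0 (v r)" if "r \<in> {s..}" for r
    using that ve'[of r] by (simp add: hs_diff sU su)
  have pe: "pert L (coef L (U r)) (v r) n = advect L (coef L (U r)) (coef L (U r)) n - advect L (coef L (u r)) (coef L (u r)) n" if "r \<in> {s..}" for r n
    using that ve'[of r] advect_difference[OF sU[OF that] su[OF that], of n] by simp
  have cp: "continuous_on {s..} (\<lambda>r. pert L (coef L (U r)) (v r) n)" for n
  proof -
    have "continuous_on {s..} (\<lambda>r. advect L (coef L (U r)) (coef L (U r)) n - advect L (coef L (u r)) (coef L (u r)) n)"
      unfolding continuous_on_def
      by (intro ballI tendsto_diff tendsto_advect sU su lU lu) auto
    then show ?thesis by (rule continuous_on_eq) (simp add: pe)
  qed
  then show "continuous_on {s..} (\<lambda>r. pert L (coef L (U r)) (v r) n)" .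
  have cv: "continuous_on {s..} (\<lambda>r. v r n)" for n
    unfolding continuous_on_def by (intro ballI tendsto_hs0_component[where L=L] sv lv) auto
  let ?G = "\<lambda>r. - of_real (\<nu> * (kap L n)\<^sup>2) * v r n - pert L (coef L (U r)) (v r) n"
  have cG: "continuous_on {s..} ?G" by (intro continuous_intros cv cp)
  \<comment> \<open>The weak equation yields real pairings; \<open>c = 1\<close> and
    \<open>c = \<i>\<close> together give the complex derivative.\<close>
  have real_der: "((\<lambda>r. Re (c * cnj (v r n))) has_vector_derivative Re (c * cnj (?G r))) (at r)" if r: "r > s" for r c
  proof -
    let ?\<phi> = "texp L {n} (\<lambda>_. c)"
    let ?\<gamma> = "\<lambda>r. L\<^sup>2 * Re (c * cnj (?G r))"
    have c\<gamma>: "continuous_on {s..} ?\<gamma>" by (intro continuous_intros cG)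
    have int: "L\<^sup>2 * Re (c * cnj (v t n)) - L\<^sup>2 * Re (c * cnj (v s n)) = integral {s..t} ?\<gamma>" if t: "t \<ge> s" for t
    proof -
      let ?I = "\<lambda>u r. L2_inner L (f r) ?\<phi> - \<nu> * stokes L (u r) ?\<phi> - convect L (u r) (u r) ?\<phi>"
      have bi: "has_bochner_integral lebesgue (\<lambda>r. indicator {s<..t} r *\<^sub>R ?I U r - indicator {s<..t} r *\<^sub>R ?I u r)
         (L2_inner L (U t) ?\<phi> - L2_inner L (U s) ?\<phi> - (L2_inner L (u t) ?\<phi> - L2_inner L (u s) ?\<phi>))"
        by (intro has_bochner_integral_diff NSE_mode_integral[OF U s t tmode_V] NSE_mode_integral[OF u order_refl t tmode_V])
      have ptw: "indicator {s<..t} r *\<^sub>R ?I U r - indicator {s<..t} r *\<^sub>R ?I u r = indicator {s<..t} r *\<^sub>R ?\<gamma> r" for r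
      proof (cases "r \<in> {s<..t}")
        case True
        then have r: "r > s" "r \<ge> s" "r \<in> {s..}" by auto
        have "?I U r - ?I u r = ?\<gamma> r"
          unfolding stokes_tmode[OF V(1)[OF r(1)]] stokes_tmode[OF V(2)[OF r(1)]] convect_tmode[OF V(1)[OF r(1)]] convect_tmode[OF V(2)[OF r(1)]]
            pe[OF r(3)] ve[OF r(2)]
          by (simp add: algebra_simps)
        then show ?thesis using True by simp
      qed simp
      have val: "L2_inner L (U t) ?\<phi> - L2_inner L (U s) ?\<phi> - (L2_inner L (u t) ?\<phi> - L2_inner L (u s) ?\<phi>) = L\<^sup>2 * Re (c * cnj (v t n)) - L\<^sup>2 * Re (c * cnj (v s n))"
        unfolding inner_tmode[OF UL[OF t]] inner_tmode[OF uL[OF t]] inner_tmode[OF UL[OF order_refl]] inner_tmode[OF uL[OF order_refl]] ve[OF t] ve[OF order_refl]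
        by (simp add: algebra_simps)
      have h1: "has_bochner_integral lebesgue (\<lambda>r. indicator {s<..t} r *\<^sub>R ?\<gamma> r) (L\<^sup>2 * Re (c * cnj (v t n)) - L\<^sup>2 * Re (c * cnj (v s n)))"
        using bi unfolding ptw val .
      have "continuous_on {s..t} ?\<gamma>" by (rule continuous_on_subset[OF c\<gamma>]) auto
      then have ci: "integrable lborel (\<lambda>r. indicator {s..t} r *\<^sub>R ?\<gamma> r)" by (intro borel_integrable_compact) auto
      have "integral {s..t} ?\<gamma> = (\<integral>r. indicator {s..t} r *\<^sub>R ?\<gamma> r \<partial>lborel)"
        by (rule set_borel_integral_eq_integral(2)[unfolded set_integrable_def set_lebesgue_integral_def, OF ci, symmetric])
      also have "\<dots> = (\<integral>r. indicator {s..t} r *\<^sub>R ?\<gamma> r \<partial>lebesgue)"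
        by (rule integral_completion[symmetric]) (use borel_measurable_integrable[OF ci] in simp)
      also have "\<dots> = (\<integral>r. indicator {s<..t} r *\<^sub>R ?\<gamma> r \<partial>lebesgue)"
      proof (rule integral_cong_AE)
        show "AE r in lebesgue. indicator {s..t} r *\<^sub>R ?\<gamma> r = indicator {s<..t} r *\<^sub>R ?\<gamma> r"
          by (rule AE_I'[of "{s}"]) (auto simp: indicator_def)
        show "(\<lambda>r. indicator {s..t} r *\<^sub>R ?\<gamma> r) \<in> borel_measurable lebesgue"
          using borel_measurable_integrable[OF ci] by (rule measurable_completion)
        show "(\<lambda>r. indicator {s<..t} r *\<^sub>R ?\<gamma> r) \<in> borel_measurable lebesgue"
          using h1 by (auto simp: has_bochner_integral_iff dest: borel_measurable_integrable)
      qed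
      also have "\<dots> = L\<^sup>2 * Re (c * cnj (v t n)) - L\<^sup>2 * Re (c * cnj (v s n))" using h1 by (rule has_bochner_integral_integral_eq)
      finally show ?thesis by simp
    qed
    have "((\<lambda>t. integral {s..t} ?\<gamma>) has_vector_derivative ?\<gamma> r) (at r within {s..r + 1})"
      by (rule integral_has_vector_derivative[OF continuous_on_subset[OF c\<gamma>]]) (use r in auto)
    then have "((\<lambda>t. integral {s..t} ?\<gamma>) has_vector_derivative ?\<gamma> r) (at r)"
      using r by (subst (asm) at_within_interior) auto
    then have d: "((\<lambda>t. (integral {s..t} ?\<gamma> + L\<^sup>2 * Re (c * cnj (v s n))) / L\<^sup>2) has_vector_derivative ?\<gamma> r / L\<^sup>2) (at r)"
      by (intro has_vector_derivative_divide has_vector_derivative_add_const[THEN iffD2])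
    have e: "(integral {s..t} ?\<gamma> + L\<^sup>2 * Re (c * cnj (v s n))) / L\<^sup>2 = Re (c * cnj (v t n))" if "t \<in> {s<..}" for t
      using int[of t] that L_pos by (simp add: field_simps)
    have "((\<lambda>r. Re (c * cnj (v r n))) has_vector_derivative ?\<gamma> r / L\<^sup>2) (at r)"
      by (rule has_vector_derivative_transform_within_open[OF d, of "{s<..}"]) (use r e in auto)
    then show ?thesis using L_pos by simp
  qed
  show "((\<lambda>r. v r n) has_vector_derivative ?G r) (at r)" if r: "r > s" for r
  proof -
    have 1: "((\<lambda>r. Re (v r n)) has_vector_derivative Re (?G r)) (at r)" using real_der[OF r, of 1] by simp
    have 2: "((\<lambda>r. Im (v r n)) has_vector_derivative Im (?G r)) (at r)" using real_der[OF r, of \<i>] by simp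
    have "((\<lambda>r. of_real (Re (v r n)) + \<i> * of_real (Im (v r n))) has_vector_derivative (of_real (Re (?G r)) + \<i> * of_real (Im (?G r)))) (at r)"
      by (intro has_vector_derivative_add has_vector_derivative_mult_right has_vector_derivative_of_real 1[folded has_real_derivative_iff_has_vector_derivative]
          2[folded has_real_derivative_iff_has_vector_derivative])
    then show ?thesis by (simp only: complex_eq[symmetric])
  qed
qed

text \<open>Continuity of each coefficient makes the extended norm measurable in time through
  \<open>hs_sup\<close>; finiteness of its integral then forces summability at almost every
  time.\<close>

lemma field_time_integral:
  fixes s' t :: real
  assumes H: "\<And>r. r \<in> {s'..t} \<Longrightarrow> w r \<in> space_H L" and c: "\<And>n. continuous_on {s'..t} (\<lambda>r. coef L (w r) n)"
    and fin: "(\<integral>\<^sup>+ r\<in>{s'..t}. sob_sq L m (w r) \<partial>lborel) < \<infinity>"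
  shows "AE r in lborel. r \<in> {s'..t} \<longrightarrow> hs_summable L m (coef L (w r))"
    and "integrable lborel (\<lambda>r. indicator {s'..t} r * hs L m (coef L (w r)))"
proof -
  let ?c = "\<lambda>r n. indicator {s'..t} r *\<^sub>R coef L (w r) n"
  have cm: "(\<lambda>r. ?c r n) \<in> borel_measurable lborel" for n
    by (rule borel_measurable_integrable) (intro borel_integrable_compact c compact_Icc)
  define E where "E r = hs_sup L m (?c r)" for r
  have Em: "E \<in> borel_measurable lborel" unfolding E_def[abs_def] by (rule hs_sup_measurable[OF cm])
  have ES: "ennreal (L\<^sup>2) * E r = sob_sq L m (w r) * indicator {s'..t} r" for r
  proof (cases "r \<in> {s'..t}")
    case True
    then have e: "E r = hs_sup L m (coef L (w r))" by (simp add: E_def)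
    show ?thesis
    proof (cases "hs_summable L m (coef L (w r))")
      case s: True
      show ?thesis unfolding e hs_sup_eq(1)[OF s] sob_sq_H(1)[OF H[OF True] s] using True by (simp add: ennreal_mult)
    next
      case s: False
      then have "sob_sq L m (w r) = \<infinity>" using sob_sq_H(2)[OF H[OF True], of m] by (metis infinity_ennreal_def less_top)
      then show ?thesis unfolding e hs_sup_eq(2)[OF s] using True L_pos by (simp add: ennreal_mult_top)
    qed
  next
    case False
    have "?c r = (\<lambda>n. 0)" using False by simp
    moreover have "hs_sup L m (\<lambda>n. 0) = 0" by (simp add: hs_sup_def)
    ultimately have "E r = 0" by (simp only: E_def)
    then show ?thesis using False by simp
  qed
  have EI: "(\<integral>\<^sup>+ r. E r \<partial>lborel) < \<infinity>"
  proof -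
    have "ennreal (L\<^sup>2) * (\<integral>\<^sup>+ r. E r \<partial>lborel) = (\<integral>\<^sup>+ r. ennreal (L\<^sup>2) * E r \<partial>lborel)"
      by (rule nn_integral_cmult[OF Em, symmetric])
    also have "\<dots> < \<infinity>" unfolding ES using fin by simp
    finally show ?thesis using L_pos by (auto simp: ennreal_mult_less_top)
  qed
  have "AE r in lborel. E r \<noteq> \<infinity>" by (rule nn_integral_PInf_AE[OF Em]) (use EI in simp)
  then show "AE r in lborel. r \<in> {s'..t} \<longrightarrow> hs_summable L m (coef L (w r))"
  proof eventually_elim
    case (elim r)
    show ?case
    proof
      assume r: "r \<in> {s'..t}"
      then have "E r = hs_sup L m (coef L (w r))" by (simp add: E_def)
      then show "hs_summable L m (coef L (w r))" using elim hs_sup_eq(2) by force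
    qed
  qed
  have e: "indicator {s'..t} r * hs L m (coef L (w r)) = enn2real (E r)" for r
    unfolding E_def hs_eq_enn2real[symmetric] by (cases "r \<in> {s'..t}") simp_all
  have "(\<lambda>r. enn2real (E r)) \<in> borel_measurable lborel" using Em by measurable
  moreover have "(\<integral>\<^sup>+ r. ennreal (norm (enn2real (E r))) \<partial>lborel) < \<infinity>"
  proof -
    have "(\<integral>\<^sup>+ r. ennreal (norm (enn2real (E r))) \<partial>lborel) \<le> (\<integral>\<^sup>+ r. E r \<partial>lborel)"
      by (intro nn_integral_mono) (simp add: ennreal_enn2real_if)
    then show ?thesis using EI by (rule le_less_trans)
  qed
  ultimately show "integrable lborel (\<lambda>r. indicator {s'..t} r * hs L m (coef L (w r)))"
    unfolding e by (rule integrableI_bounded)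
qed

end

text \<open>\<open>ennreal\<close> sends negative numbers to 0, and the signs of the bounds in
  \<open>reference_bounds\<close> are not prescribed; hence \<open>max 0 r\<close>.\<close>

lemma esqrt_le_imp: "esqrt x \<le> ennreal r \<Longrightarrow> x \<le> ennreal ((max 0 r)\<^sup>2)"
proof -
  assume a: "esqrt x \<le> ennreal r"
  then have "x \<noteq> \<infinity>" by (auto simp: esqrt_def top_unique)
  then obtain y where y: "y \<ge> 0" "x = ennreal y" by (cases x) auto
  have "ennreal r = ennreal (max 0 r)" by (simp add: max_def ennreal_neg)
  then have "ennreal (sqrt y) \<le> ennreal (max 0 r)" using a y by (simp add: esqrt_def)
  then have "sqrt y \<le> max 0 r" by (subst (asm) ennreal_le_iff) auto
  then have "(sqrt y)\<^sup>2 \<le> (max 0 r)\<^sup>2" using y by (intro power_mono) auto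
  then show ?thesis using y by (simp add: ennreal_leI)
qed

lemma esqrt_finite: "esqrt x < \<infinity> \<Longrightarrow> x < \<infinity>"
  by (auto simp: esqrt_def less_top split: if_splits)

context torus_domain begin

text \<open>One summand for each kind of norm in \<open>ref_coefs\<close>, all derived from a bound
  \<open>R\<close> of \<open>hs L 2\<close> by Poincare and \<open>ls0_bound\<close>.\<close>

definition ref_bound :: "real \<Rightarrow> real" where
  "ref_bound R = sqrt R + sqrt ((1 / kap1)\<^sup>2 * R) + sqrt (csob * R)"

lemma ref_coefsI:
  assumes a: "real_coefs a" "a 0 = 0" "hs_summable L 2 a" "hs L 2 a \<le> R"
  shows "ref_coefs (ref_bound R) a"
proof -
  have R: "R \<ge> 0" using a(4) hs_nonneg[of L 2 a] by linarith
  have s2: "hs_summable L (1 + 1) a" using a(3) by (simp only: one_add_one)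
  note D1 = hs_down[OF s2 a(2)]
  have D0: "hs_summable L 0 a" using hs_down(1)[of 0 2 a] a by simp
  note l = ls0_bound[OF a(3,2)]
  have p: "0 \<le> sqrt R" "0 \<le> sqrt ((1 / kap1)\<^sup>2 * R)" "0 \<le> sqrt (csob * R)" using R csob_nonneg by auto
  have "(ls L 0 a)\<^sup>2 \<le> csob * R" using l(2) mult_left_mono[OF a(4) csob_nonneg] by linarith
  then have b0: "ls L 0 a \<le> ref_bound R" using p real_le_rsqrt[of "ls L 0 a" "csob * R"] unfolding ref_bound_def by linarith
  have "hs L 1 a \<le> (1 / kap1)\<^sup>2 * hs L 2 a" using D1(2) by (simp only: one_add_one power_one_right)
  also have "\<dots> \<le> (1 / kap1)\<^sup>2 * R" using a(4) by (intro mult_left_mono) auto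
  also have "\<dots> = (sqrt ((1 / kap1)\<^sup>2 * R))\<^sup>2" using R by simp
  also have "\<dots> \<le> (ref_bound R)\<^sup>2" using p by (intro power_mono) (auto simp: ref_bound_def)
  finally have b1: "hs L 1 a \<le> (ref_bound R)\<^sup>2" .
  have "R = (sqrt R)\<^sup>2" using R by simp
  also have "\<dots> \<le> (ref_bound R)\<^sup>2" using p by (intro power_mono) (auto simp: ref_bound_def)
  finally have b2: "hs L 2 a \<le> (ref_bound R)\<^sup>2" using a(4) by linarith
  show ?thesis unfolding ref_coefs_def using a D0 D1(1) l(1) b0 b1 b2 by blast
qed

lemma sob_norm_le_imp:
  assumes u: "u \<in> space_H L" and le: "sob_norm L m u \<le> ennreal r"
  shows "hs_summable L m (coef L u)" "hs L m (coef L u) \<le> (max 0 r)\<^sup>2 / L\<^sup>2"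
proof -
  have sq: "sob_sq L m u \<le> ennreal ((max 0 r)\<^sup>2)" using le unfolding sob_norm_def by (rule esqrt_le_imp)
  then have "sob_sq L m u < \<infinity>" by (simp add: le_less_trans)
  then show s: "hs_summable L m (coef L u)" by (rule sob_sq_H(2)[OF u])
  have "L\<^sup>2 * hs L m (coef L u) \<le> (max 0 r)\<^sup>2" using sq unfolding sob_sq_H(1)[OF u s] by (simp add: ennreal_le_iff)
  then show "hs L m (coef L u) \<le> (max 0 r)\<^sup>2 / L\<^sup>2" using L_pos by (simp add: field_simps)
qed

lemma coef_cong_AE:
  assumes "f \<in> L2_space L" "g \<in> L2_space L" "AE x in torus L. f x = g x"
  shows "coef L f = coef L g"
proof
  fix n
  have "(\<integral>x. of_real (f x \<bullet> ev L n) * cnj (emode L n x) \<partial>torus L) = (\<integral>x. of_real (g x \<bullet> ev L n) * cnj (emode L n x) \<partial>torus L)"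
  proof (rule integral_cong_AE)
    show "AE x in torus L. of_real (f x \<bullet> ev L n) * cnj (emode L n x) = of_real (g x \<bullet> ev L n) * cnj (emode L n x)"
      using assms(3) by (rule AE_mp) (auto intro!: AE_I2)
  qed (intro borel_measurable_integrable L2_integrable_mult assms continuous_intros)+
  then show "coef L f n = coef L g n" unfolding coef_def fcoef_emode by simp
qed

lemma nn_integral_subinterval:
  assumes "(\<integral>\<^sup>+ r\<in>{s'..t'}. F r \<partial>lborel) < \<infinity>" "(t::real) \<le> t'"
  shows "(\<integral>\<^sup>+ r\<in>{s'..t}. F r \<partial>lborel) < (\<infinity>::ennreal)"
proof -
  have "(\<integral>\<^sup>+ r\<in>{s'..t}. F r \<partial>lborel) \<le> (\<integral>\<^sup>+ r\<in>{s'..t'}. F r \<partial>lborel)"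
    using assms(2) by (intro nn_integral_mono) (auto simp: indicator_def)
  then show ?thesis using assms(1) by (rule le_less_trans)
qed

text \<open>The reference solution brings the bound in terms of \<open>\<rho>A\<close>; the other
  solution brings only the finiteness from \<open>solutions_regular\<close>, which begins strictly
  after \<open>s\<close>. Dividing by \<open>L^2\<close> converts the given norms into
  \<open>hs\<close>.\<close>

lemma pert_flow_NSE:
  assumes \<nu>: "\<nu> > 0" and U: "NSE_solution L \<nu> f t0 U" and u: "NSE_solution L \<nu> f s u" and s: "t0 \<le> s"
    and reg: "solutions_regular L \<nu> f t0" and rb: "reference_bounds L \<nu> t0 \<rho>H \<rho>V \<rho>A U"
  shows "pert_flow L \<nu> (ref_bound ((max 0 \<rho>A)\<^sup>2 / L\<^sup>2)) s (\<lambda>r. coef L (U r)) (\<lambda>r. coef L (\<lambda>x. U r x - u r x))"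
proof -
  let ?R = "(max 0 \<rho>A)\<^sup>2 / L\<^sup>2"
  have UH: "U r \<in> space_H L" and UL: "U r \<in> L2_space L" if "r \<ge> s" for r
    using NSE_solutionD(1,2)[OF U, of r] that s by auto
  have uH: "u r \<in> space_H L" and uL: "u r \<in> L2_space L" if "r \<ge> s" for r
    using NSE_solutionD(1,2)[OF u, of r] that by auto
  have wH: "(\<lambda>x. U r x - u r x) \<in> space_H L" if "r \<ge> s" for r by (rule space_H_diff[OF UH[OF that] uH[OF that]])
  have ve: "coef L (\<lambda>x. U r x - u r x) = (\<lambda>n. coef L (U r) n - coef L (u r) n)" if "r \<ge> s" for r
    using coef_diff[OF UL[OF that] uL[OF that]] by auto
  have U2: "hs_summable L 2 (coef L (U r))" "hs L 2 (coef L (U r)) \<le> ?R" if r: "r \<ge> s" for r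
  proof -
    have "sob_norm L 2 (U r) \<le> ennreal \<rho>A" using rb r s unfolding reference_bounds_def by (meson order_trans)
    then show "hs_summable L 2 (coef L (U r))" "hs L 2 (coef L (U r)) \<le> ?R" by (rule sob_norm_le_imp[OF UH[OF r]])+
  qed
  have regu: "\<forall>t>s. sob_norm L 2 (u t) < \<infinity> \<and> (\<forall>\<delta>>0. (\<integral>\<^sup>+ r\<in>{t..t+\<delta>}. sob_sq L 2 (u r) \<partial>lborel) < \<infinity> \<and>
                   (\<integral>\<^sup>+ r\<in>{t..t+\<delta>}. sob_sq L 3 (u r) \<partial>lborel) < \<infinity>)"
    using reg s u unfolding solutions_regular_def by blast
  have u2: "hs_summable L 2 (coef L (u r))" if r: "r > s" for r
  proof -
    have "sob_norm L 2 (u r) < \<infinity>" using regu r by blast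
    then have "sob_sq L 2 (u r) < \<infinity>" unfolding sob_norm_def by (rule esqrt_finite)
    then show ?thesis using r by (intro sob_sq_H(2) uH) auto
  qed
  have fin: "(\<integral>\<^sup>+ r\<in>{s'..t}. sob_sq L m (U r) \<partial>lborel) < \<infinity>" "(\<integral>\<^sup>+ r\<in>{s'..t}. sob_sq L m (u r) \<partial>lborel) < \<infinity>"
    if s': "s < s'" and m: "m = 2 \<or> m = 3" for s' t m
  proof -
    \<comment> \<open>The assumptions speak of intervals of positive length; \<open>max 1\<close>
      supplies one that contains \<open>{s'..t}\<close>, even when the latter is empty.\<close>
    define \<delta> where "\<delta> = max 1 (t - s')"
    have \<delta>: "\<delta> > 0" "t \<le> s' + \<delta>" by (auto simp: \<delta>_def)
    have "(\<integral>\<^sup>+ r\<in>{s'..s'+\<delta>}. sob_sq L 2 (U r) \<partial>lborel) \<le> ennreal ((1 / \<nu> + \<delta> * (2 * pi / L)^2 / 2) * \<rho>V^2)"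
      "(\<integral>\<^sup>+ r\<in>{s'..s'+\<delta>}. sob_sq L 3 (U r) \<partial>lborel) < \<infinity>"
      using rb s' s \<delta>(1) unfolding reference_bounds_def by (meson order_trans less_imp_le)+
    then have "(\<integral>\<^sup>+ r\<in>{s'..s'+\<delta>}. sob_sq L m (U r) \<partial>lborel) < \<infinity>" using m by (auto intro: le_less_trans)
    then show "(\<integral>\<^sup>+ r\<in>{s'..t}. sob_sq L m (U r) \<partial>lborel) < \<infinity>" by (rule nn_integral_subinterval[OF _ \<delta>(2)])
    have "(\<integral>\<^sup>+ r\<in>{s'..s'+\<delta>}. sob_sq L m (u r) \<partial>lborel) < \<infinity>" using regu s' \<delta>(1) m by blast
    then show "(\<integral>\<^sup>+ r\<in>{s'..t}. sob_sq L m (u r) \<partial>lborel) < \<infinity>" by (rule nn_integral_subinterval[OF _ \<delta>(2)])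
  qed
  have cU: "continuous_on {s'..t} (\<lambda>r. coef L (U r) n)" if "s < s'" for s' t n
  proof (rule continuous_on_subset)
    show "continuous_on {t0..} (\<lambda>r. coef L (U r) n)" unfolding continuous_on_def
      by (intro ballI tendsto_hs0_component[where L=L] NSE_solutionD(3)[OF U] coef_bessel(1) NSE_solutionD(2)[OF U]) auto
  qed (use that s in auto)
  have cu: "continuous_on {s'..t} (\<lambda>r. coef L (u r) n)" if "s < s'" for s' t n
  proof (rule continuous_on_subset)
    show "continuous_on {s..} (\<lambda>r. coef L (u r) n)" unfolding continuous_on_def
      by (intro ballI tendsto_hs0_component[where L=L] NSE_solutionD(3)[OF u] coef_bessel(1) NSE_solutionD(2)[OF u]) auto
  qed (use that in auto)
  let ?v = "\<lambda>r. coef L (\<lambda>x. U r x - u r x)"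
  have int: "(AE r in lborel. r \<in> {s'..t} \<longrightarrow> hs_summable L m (?v r)) \<and> integrable lborel (\<lambda>r. indicator {s'..t} r * hs L m (?v r))"
    if s': "s < s'" and m: "m = 2 \<or> m = 3" for s' t m
  proof -
    have H: "U r \<in> space_H L" "u r \<in> space_H L" if "r \<in> {s'..t}" for r using that s' UH uH by auto
    have IU: "AE r in lborel. r \<in> {s'..t} \<longrightarrow> hs_summable L m (coef L (U r))" "integrable lborel (\<lambda>r. indicator {s'..t} r * hs L m (coef L (U r)))"
      by (rule field_time_integral[where s'=s' and t=t, OF H(1) cU[OF s'] fin(1)[OF s' m]], assumption)+
    have Iu: "AE r in lborel. r \<in> {s'..t} \<longrightarrow> hs_summable L m (coef L (u r))" "integrable lborel (\<lambda>r. indicator {s'..t} r * hs L m (coef L (u r)))"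
      by (rule field_time_integral[where s'=s' and t=t, OF H(2) cu[OF s'] fin(2)[OF s' m]], assumption)+
    have ae: "AE r in lborel. r \<in> {s'..t} \<longrightarrow> hs_summable L m (coef L (U r)) \<and> hs_summable L m (coef L (u r))"
      using IU(1) Iu(1) by eventually_elim blast
    have b: "hs_summable L m (?v r)" "hs L m (?v r) \<le> 2 * hs L m (coef L (U r)) + 2 * hs L m (coef L (u r))"
      if "r \<in> {s'..t}" "hs_summable L m (coef L (U r))" "hs_summable L m (coef L (u r))" for r
      using ve[of r] that s' hs_diff[OF that(2,3)] by auto
    have ae1: "AE r in lborel. r \<in> {s'..t} \<longrightarrow> hs_summable L m (?v r)"
      using ae by eventually_elim (use b(1) in blast)
    have vm: "(\<lambda>r. indicator {s'..t} r *\<^sub>R ?v r n) \<in> borel_measurable lborel" for n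
    proof (rule borel_measurable_integrable, rule borel_integrable_compact[OF compact_Icc])
      have "continuous_on {s'..t} (\<lambda>r. coef L (U r) n - coef L (u r) n)" by (intro continuous_intros cU cu s')
      then show "continuous_on {s'..t} (\<lambda>r. ?v r n)" by (rule continuous_on_eq) (use ve s' in auto)
    qed
    have "hs L m (\<lambda>n. indicator {s'..t} r *\<^sub>R ?v r n) = indicator {s'..t} r * hs L m (?v r)" for r
      by (cases "r \<in> {s'..t}") simp_all
    then have mm: "(\<lambda>r. indicator {s'..t} r * hs L m (?v r)) \<in> borel_measurable lborel"
      using hs_measurable[of "\<lambda>r n. indicator {s'..t} r *\<^sub>R ?v r n" lborel L m, OF vm] by simp
    have i: "integrable lborel (\<lambda>r. 2 * (indicator {s'..t} r * hs L m (coef L (U r))) + 2 * (indicator {s'..t} r * hs L m (coef L (u r))))"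
      by (intro Bochner_Integration.integrable_add integrable_mult_right IU(2) Iu(2))
    have "integrable lborel (\<lambda>r. indicator {s'..t} r * hs L m (?v r))"
    proof (rule Bochner_Integration.integrable_bound[OF i mm])
      show "AE r in lborel. norm (indicator {s'..t} r * hs L m (?v r)) \<le> norm (2 * (indicator {s'..t} r * hs L m (coef L (U r))) + 2 * (indicator {s'..t} r * hs L m (coef L (u r))))"
        using ae
      proof eventually_elim
        case (elim r)
        show ?case using elim b(2)[of r] by (cases "r \<in> {s'..t}") auto
      qed
    qed
    then show ?thesis using ae1 by blast
  qed
  have VU: "U r \<in> space_V L" and Vu: "u r \<in> space_V L" if r: "r > s" for r
  proof -
    show "U r \<in> space_V L" using hs2_imp_domain_A[OF UH U2(1)] r by (simp add: domain_A_def)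
    show "u r \<in> space_V L" using hs2_imp_domain_A[OF uH u2] r by (simp add: domain_A_def)
  qed
  note D = NSE_difference_derivative[OF U u s VU Vu]
  show ?thesis
  proof (unfold_locales)
    show "ref_coefs (ref_bound ?R) (coef L (U r))" if "r \<ge> s" for r
      by (intro ref_coefsI coef_real coef_zero U2 that)
    show "hs_summable L 0 (?v r)" if "r \<ge> s" for r by (intro coef_bessel(1) space_H_proj(1) wH that)
    show "hs_summable L 2 (?v r)" if "r > s" for r using ve[of r] hs_diff(1)[OF U2(1)[of r] u2[OF that]] that by simp
    show "continuous_on {s<..} (\<lambda>r. pert L (coef L (U r)) (?v r) n)" for n
      by (rule continuous_on_subset[OF D(1)]) auto
  qed (use \<nu> D(2,3) int coef_real in \<open>auto simp del: One_nat_def\<close>)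
qed

section \<open>Data assimilation\<close>

text \<open>At an assimilation time the low modes of the error are replaced by those of the observation
  error \<open>V - I V\<close>, and the high modes are untouched.\<close>

lemma assimilation_jump:
  assumes I: "type_II_observable L c1 h I" and V: "V \<in> space_H L" "hs_summable L 2 (coef L V)" and lam: "lam > 0"
    and v: "\<And>n. v n = coef L V n - (if n \<in> low lam then coef L (I V) n else 0)"
  defines "B \<equiv> c1 * h\<^sup>2 * ((1 / kap1)\<^sup>2 + h\<^sup>2)"
  shows "hs_summable L 2 v" "hs L 0 v \<le> (B + 1 / lam\<^sup>2) * hs L 2 (coef L V)" "hs L 2 v \<le> (lam\<^sup>2 * B + 1) * hs L 2 (coef L V)"
proof -
  let ?a = "coef L V"
  have dom: "V \<in> domain_A L" by (rule hs2_imp_domain_A[OF V])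
  have VL: "V \<in> L2_space L" by (rule space_H_proj(1)[OF V(1)])
  have IL: "I V \<in> L2_space L" and c: "c1 > 0" "h > 0"
    and obs: "L2_sq L (\<lambda>x. V x - I V x) \<le> ennreal (c1 * h\<^sup>2) * (sob_sq L 1 V + ennreal (h\<^sup>2) * sob_sq L 2 V)"
    using I dom unfolding type_II_observable_def by blast+
  have s2: "hs_summable L (1 + 1) ?a" using V(2) by (simp only: one_add_one)
  have s1: "hs_summable L 1 ?a" "hs L 1 ?a \<le> (1 / kap1)\<^sup>2 * hs L 2 ?a"
    using hs_down[OF s2 coef_zero] by (simp_all only: one_add_one power_one_right)
  define w where "w = coef L (\<lambda>x. V x - I V x)"
  have we: "w n = ?a n - coef L (I V) n" for n unfolding w_def by (rule coef_diff[OF VL IL])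
  note D = L2_space_diff(1)[OF VL IL]
  have ws: "hs_summable L 0 w" unfolding w_def by (rule coef_bessel(1)[OF D])
  \<comment> \<open>Poincare bounds both terms of the observable inequality by the second-order
    norm, which turns its constants into \<open>B\<close>.\<close>
  have wb: "hs L 0 w \<le> B * hs L 2 ?a"
  proof -
    have "ennreal (l2 L (\<lambda>x. V x - I V x)) \<le> ennreal (c1 * h\<^sup>2) * (ennreal (L\<^sup>2 * hs L 1 ?a) + ennreal (h\<^sup>2) * ennreal (L\<^sup>2 * hs L 2 ?a))"
      using obs unfolding L2_spaceD(3)[OF D] sob_sq_H(1)[OF V(1) s1(1)] sob_sq_H(1)[OF V(1,2)] .
    also have "\<dots> = ennreal (c1 * h\<^sup>2 * (L\<^sup>2 * hs L 1 ?a + h\<^sup>2 * (L\<^sup>2 * hs L 2 ?a)))"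
      using c by (simp add: ennreal_mult'[symmetric] ennreal_plus[symmetric] del: ennreal_plus)
    finally have "l2 L (\<lambda>x. V x - I V x) \<le> c1 * h\<^sup>2 * (L\<^sup>2 * hs L 1 ?a + h\<^sup>2 * (L\<^sup>2 * hs L 2 ?a))"
      using c by (subst (asm) ennreal_le_iff) (auto intro!: mult_nonneg_nonneg add_nonneg_nonneg)
    then have "L\<^sup>2 * hs L 0 w \<le> L\<^sup>2 * (c1 * h\<^sup>2 * (hs L 1 ?a + h\<^sup>2 * hs L 2 ?a))"
      using coef_bessel(2)[OF D] by (simp add: w_def algebra_simps)
    then have "hs L 0 w \<le> c1 * h\<^sup>2 * (hs L 1 ?a + h\<^sup>2 * hs L 2 ?a)" using L_pos by simp
    also have "\<dots> \<le> c1 * h\<^sup>2 * ((1 / kap1)\<^sup>2 * hs L 2 ?a + h\<^sup>2 * hs L 2 ?a)"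
      using c s1(2) by (intro mult_left_mono add_right_mono) auto
    finally show ?thesis by (simp add: B_def algebra_simps)
  qed
  have B0: "B \<ge> 0" using c by (simp add: B_def)
  have vl: "v n = w n" if "n \<in> low lam" for n using that by (simp add: v we)
  have vh: "v n = ?a n" if "n \<notin> low lam" for n using that by (simp add: v)
  have lown: "n = 0 \<or> (kap L n)\<^sup>2 > lam" if "n \<notin> low lam" for n
    using that by (auto simp: low_def modes_def kap_def zero_mode)
  \<comment> \<open>Low modes carry the observation error \<open>w\<close>. The other nonzero modes
    have \<open>kap^2 > lam\<close>, so their energy is at most \<open>1 / lam^2\<close> times the
    second-order norm.\<close>
  have le0: "(kap L n ^ 0 * cmod (v n))\<^sup>2 \<le> 1 * (cmod (w n))\<^sup>2 + 1 / lam\<^sup>2 * (kap L n ^ 2 * cmod (?a n))\<^sup>2" for n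
  proof (cases "n \<in> low lam")
    case True
    then show ?thesis by (simp add: vl)
  next
    case False
    have "(cmod (?a n))\<^sup>2 \<le> 1 / lam\<^sup>2 * (kap L n ^ 2 * cmod (?a n))\<^sup>2"
    proof (cases "n = 0")
      case nz: False
      then have "lam \<le> (kap L n)\<^sup>2" using lown[OF False] by simp
      then have "lam * cmod (?a n) \<le> (kap L n)\<^sup>2 * cmod (?a n)" by (intro mult_right_mono) auto
      then have "(lam * cmod (?a n))\<^sup>2 \<le> ((kap L n)\<^sup>2 * cmod (?a n))\<^sup>2" using lam by (intro power_mono) auto
      then show ?thesis using lam by (simp add: power_mult_distrib field_simps)
    qed simp
    then show ?thesis using vh[OF False] by (simp add: add_increasing)
  qed
  \<comment> \<open>On low modes \<open>kap^2 \<le> lam\<close>, so passing from the energy of the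
    observation error to its second-order norm costs \<open>lam^2\<close>.\<close>
  have le2: "(kap L n ^ 2 * cmod (v n))\<^sup>2 \<le> lam\<^sup>2 * (cmod (w n))\<^sup>2 + 1 * (kap L n ^ 2 * cmod (?a n))\<^sup>2" for n
  proof (cases "n \<in> low lam")
    case True
    then have "(kap L n)\<^sup>2 \<le> lam" by (simp add: low_def kap_def)
    then have "(kap L n)\<^sup>2 * cmod (w n) \<le> lam * cmod (w n)" by (intro mult_right_mono) auto
    then have "((kap L n)\<^sup>2 * cmod (w n))\<^sup>2 \<le> (lam * cmod (w n))\<^sup>2" by (intro power_mono) auto
    then show ?thesis using True by (simp add: vl power_mult_distrib add_increasing2)
  qed (simp add: vh)
  note f = ws[unfolded hs0_summable_iff] V(2)[unfolded hs_summable_def]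
  note l0 = infsum_lincomb[OF f, of 1 "1 / lam\<^sup>2"] and l2 = infsum_lincomb[OF f, of "lam\<^sup>2" 1]
  have "hs L 0 v \<le> 1 * hs L 0 w + 1 / lam\<^sup>2 * hs L 2 ?a"
    using infsum_mono_real(2)[OF l0(1) le0] l0(2) by (simp add: hs0_eq hs_def[of L 0 v] hs_def[of L 2])
  also have "\<dots> \<le> 1 * (B * hs L 2 ?a) + 1 / lam\<^sup>2 * hs L 2 ?a" by (intro add_right_mono mult_left_mono wb) auto
  finally show "hs L 0 v \<le> (B + 1 / lam\<^sup>2) * hs L 2 ?a" by (simp add: algebra_simps)
  show "hs_summable L 2 v" using infsum_mono_real(1)[OF l2(1) le2] by (simp add: hs_summable_def)
  have "hs L 2 v \<le> lam\<^sup>2 * hs L 0 w + 1 * hs L 2 ?a"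
    using infsum_mono_real(2)[OF l2(1) le2] l2(2) by (simp add: hs0_eq hs_def[of L 2])
  also have "\<dots> \<le> lam\<^sup>2 * (B * hs L 2 ?a) + 1 * hs L 2 ?a" by (intro add_right_mono mult_left_mono wb) auto
  finally show "hs L 2 v \<le> (lam\<^sup>2 * B + 1) * hs L 2 ?a" by (simp add: algebra_simps)
qed

end

lemma esqrt_leI: "x \<le> ennreal (r\<^sup>2) \<Longrightarrow> r \<ge> 0 \<Longrightarrow> esqrt x \<le> ennreal r"
proof -
  assume a: "x \<le> ennreal (r\<^sup>2)" "r \<ge> 0"
  then have "x \<noteq> \<infinity>" by (auto simp: top_unique)
  then obtain y where y: "y \<ge> 0" "x = ennreal y" by (cases x) auto
  then have "y \<le> r\<^sup>2" using a by simp
  then have "sqrt y \<le> r" using a(2) by (simp add: real_le_lsqrt)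
  then show ?thesis using y by (simp add: esqrt_def ennreal_leI)
qed

section \<open>Vorticity and the assimilation recursion\<close>

context torus_domain begin

text \<open>The curl of \<open>ev L n\<close> times the exponential of the mode \<open>n\<close> is
  \<open>\<i> kap L n\<close> times that exponential. As \<open>is_curl\<close> tests with real
  functions, the values \<open>c = 1\<close> and \<open>c = \<i>\<close> are combined.\<close>

lemma fcoef_curl:
  assumes \<Phi>: "\<Phi> \<in> space_H L" and \<omega>: "is_curl L \<Phi> \<omega>" and n: "n \<noteq> 0"
  shows "fcoef L \<omega> n 1 = \<i> * of_real (kap L n) * coef L \<Phi> n"
proof -
  have \<omega>L: "\<omega> \<in> L2_space L" using \<omega> by (simp add: is_curl_def)
  have i: "integrable (torus L) (\<lambda>x. of_real (\<omega> x \<bullet> 1) * emode L n x)"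
    by (intro L2_integrable_mult \<omega>L continuous_intros)
  have k: "kap L n > 0" by (rule kap_pos[OF n])
  have test: "Re (c * cnj (fcoef L \<omega> n 1)) = Re (c * cnj (\<i> * of_real (kap L n) * coef L \<Phi> n))" for c
  proof -
    let ?\<phi> = "\<lambda>x. Re (c * emode L n x)"
    have "trig_poly L ?\<phi>" unfolding trig_poly_def
      by (rule exI[of _ "{n}"], rule exI[of _ "\<lambda>_ _. c"]) (simp add: emode_def)
    then have "L2_inner L \<omega> ?\<phi> = (\<integral> x. \<Phi> x $ 1 * pderiv_dir 2 ?\<phi> x - \<Phi> x $ 2 * pderiv_dir 1 ?\<phi> x \<partial>torus L)"
      using \<omega> unfolding is_curl_def by blast
    also have "\<dots> = (\<integral> x. - kap L n * (\<Phi> x \<bullet> texp L {n} (\<lambda>_. \<i> * c) x) \<partial>torus L)"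
    proof (rule Bochner_Integration.integral_cong[OF refl])
      fix x
      have d: "pderiv_dir j ?\<phi> x = wave L n $ j * Re (\<i> * c * emode L n x)" for j
        unfolding pderiv_dirI[OF emode_has_derivative] by (simp add: inner_axis algebra_simps)
      have e: "\<Phi> x \<bullet> ev L n = (\<Phi> x $ 2 * wave L n $ 1 - \<Phi> x $ 1 * wave L n $ 2) / kap L n"
        using k by (simp add: ev_def inner_real2 field_simps)
      have t: "\<Phi> x \<bullet> texp L {n} (\<lambda>_. \<i> * c) x = Re (\<i> * c * emode L n x) * (\<Phi> x \<bullet> ev L n)"
        by (simp add: texp_def)
      show "\<Phi> x $ 1 * pderiv_dir 2 ?\<phi> x - \<Phi> x $ 2 * pderiv_dir 1 ?\<phi> x = - kap L n * (\<Phi> x \<bullet> texp L {n} (\<lambda>_. \<i> * c) x)"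
        unfolding d t e using k by (simp add: field_simps)
    qed
    also have "\<dots> = - kap L n * L2_inner L \<Phi> (texp L {n} (\<lambda>_. \<i> * c))"
      unfolding L2_inner_def by (rule integral_mult_right_zero)
    also have "\<dots> = L\<^sup>2 * Re (c * cnj (\<i> * of_real (kap L n) * coef L \<Phi> n))"
      unfolding inner_tmode[OF space_H_proj(1)[OF \<Phi>]] by (simp add: algebra_simps)
    finally have 1: "L2_inner L \<omega> ?\<phi> = L\<^sup>2 * Re (c * cnj (\<i> * of_real (kap L n) * coef L \<Phi> n))" .
    have "L2_inner L \<omega> ?\<phi> = (\<integral> x. Re (c * (of_real (\<omega> x \<bullet> 1) * emode L n x)) \<partial>torus L)"
      unfolding L2_inner_def by (intro Bochner_Integration.integral_cong refl) (simp add: algebra_simps)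
    also have "\<dots> = Re (c * (\<integral> x. of_real (\<omega> x \<bullet> 1) * emode L n x \<partial>torus L))"
      using integral_Re[OF integrable_mult_right[OF i, of c]] by (simp only: integral_mult_right_zero)
    also have "(\<integral> x. of_real (\<omega> x \<bullet> 1) * emode L n x \<partial>torus L) = of_real (L\<^sup>2) * fcoef L \<omega> (- n) 1"
      unfolding fcoef_emode emode_uminus complex_cnj_cnj using L_pos by simp
    finally have "L2_inner L \<omega> ?\<phi> = L\<^sup>2 * Re (c * cnj (fcoef L \<omega> n 1))"
      unfolding fcoef_uminus_mode by (simp add: algebra_simps)
    then show ?thesis using 1 L_pos by simp
  qed
  have "cnj (fcoef L \<omega> n 1) = cnj (\<i> * of_real (kap L n) * coef L \<Phi> n)"
    using test[of 1] test[of \<i>] by (simp add: complex_eq_iff)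
  then show ?thesis by (simp only: complex_cnj_cancel_iff)
qed

text \<open>By \<open>fcoef_curl\<close> the curl multiplies each coefficient of the difference by a
  number of modulus \<open>kap L n\<close>, which raises the order by one.\<close>

lemma sob_sq_curl:
  assumes \<Phi>: "\<Phi> \<in> space_H L" "is_curl L \<Phi> \<omega>" and \<Psi>: "\<Psi> \<in> space_H L" "is_curl L \<Psi> \<eta>"
  shows "sob_sq L 1 (\<lambda>x. \<omega> x - \<eta> x) = sob_sq L 2 (\<lambda>x. \<Phi> x - \<Psi> x)"
proof -
  have l: "\<omega> \<in> L2_space L" "\<eta> \<in> L2_space L" using \<Phi>(2) \<Psi>(2) by (simp_all add: is_curl_def)
  have "norm (wave L n) ^ (2 * 1) * (\<Sum>b\<in>Basis. (cmod (fcoef L (\<lambda>x. \<omega> x - \<eta> x) n b))\<^sup>2) =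
      (kap L n ^ 2 * cmod (coef L (\<lambda>x. \<Phi> x - \<Psi> x) n))\<^sup>2" if "n \<in> modes" for n
  proof -
    have n: "n \<noteq> 0" using that by (simp add: modes_def zero_mode)
    have f: "fcoef L (\<lambda>x. \<omega> x - \<eta> x) n 1 = \<i> * of_real (kap L n) * coef L (\<lambda>x. \<Phi> x - \<Psi> x) n"
      unfolding fcoef_diff[OF l] fcoef_curl[OF \<Phi> n] fcoef_curl[OF \<Psi> n]
        coef_diff[OF space_H_proj(1)[OF \<Phi>(1)] space_H_proj(1)[OF \<Psi>(1)]]
      by (rule right_diff_distrib[symmetric])
    then show ?thesis by (simp add: norm_mult kap_def[symmetric] power_mult_distrib power2_eq_square)
  qed
  then have "(\<Sum>\<^sub>\<infinity>n\<in>modes. ennreal (norm (wave L n) ^ (2 * 1) * (\<Sum>b\<in>Basis. (cmod (fcoef L (\<lambda>x. \<omega> x - \<eta> x) n b))\<^sup>2))) =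
     (\<Sum>\<^sub>\<infinity>n\<in>modes. ennreal ((kap L n ^ 2 * cmod (coef L (\<lambda>x. \<Phi> x - \<Psi> x) n))\<^sup>2))"
    by (intro infsum_cong arg_cong[where f=ennreal])
  then show ?thesis unfolding sob_sq_infsum[OF space_H_diff[OF \<Phi>(1) \<Psi>(1)]] by (simp only: sob_sq_def)
qed

text \<open>The new error is \<open>(Y - X) - J (Y - X)\<close>. The observable is linear on
  \<open>domain_A\<close> and up to null sets, so linearity is used through coefficients, after all
  three fields have been placed in the domain.\<close>

lemma filter_correction:
  fixes lam :: real
  assumes I: "type_II_observable L c1 h I"
    and X: "X \<in> space_H L" "hs_summable L 2 (coef L X)" and Y: "Y \<in> space_H L" "hs_summable L 2 (coef L Y)"
  defines "Z \<equiv> \<lambda>x. filter_E L lam I X x + filter_J L lam I Y x"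
  shows "Z \<in> space_H L"
    and "coef L (\<lambda>x. Y x - Z x) k = coef L (\<lambda>x. Y x - X x) k - (if k \<in> low lam then coef L (I (\<lambda>x. Y x - X x)) k else 0)"
proof -
  have XL: "X \<in> L2_space L" and YL: "Y \<in> L2_space L" using X(1) Y(1) by (blast intro: space_H_proj(1))+
  have DX: "X \<in> domain_A L" and DY: "Y \<in> domain_A L" by (rule hs2_imp_domain_A[OF X] hs2_imp_domain_A[OF Y])+
  have YX: "(\<lambda>x. Y x - X x) \<in> space_H L" by (rule space_H_diff[OF Y(1) X(1)])
  have "coef L (\<lambda>x. Y x - X x) = (\<lambda>n. coef L Y n - coef L X n)" using coef_diff[OF YL XL] by auto
  then have "hs_summable L 2 (coef L (\<lambda>x. Y x - X x))" using hs_diff(1)[OF Y(2) X(2)] by simp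
  note DYX = hs2_imp_domain_A[OF YX this]
  have IX: "I X \<in> L2_space L" and IY: "I Y \<in> L2_space L" and IYX: "I (\<lambda>x. Y x - X x) \<in> L2_space L"
    using I DX DY DYX unfolding type_II_observable_def by blast+
  have "AE x in torus L. I (\<lambda>y. 1 *\<^sub>R Y y + (- 1) *\<^sub>R X y) x = 1 *\<^sub>R I Y x + (- 1) *\<^sub>R I X x"
    using I DX DY unfolding type_II_observable_def by blast
  then have "AE x in torus L. I (\<lambda>x. Y x - X x) x = I Y x - I X x" by simp
  then have lin: "coef L (I (\<lambda>x. Y x - X x)) = coef L (\<lambda>x. I Y x - I X x)"
    by (rule coef_cong_AE[OF IYX L2_space_diff(1)[OF IY IX]])
  note JX = filter_J_properties[where lam=lam and I=I and X=X, OF IX] and JY = filter_J_properties[where lam=lam and I=I and X=Y, OF IY]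
  have E: "(\<lambda>x. X x - filter_J L lam I X x) \<in> space_H L" by (rule space_H_diff[OF X(1) JX(1)])
  show Z: "Z \<in> space_H L" unfolding Z_def filter_E_def by (rule space_H_add[OF E JY(1)])
  note h2 = space_H_proj(1)
  have cZ: "coef L Z k = coef L X k - coef L (filter_J L lam I X) k + coef L (filter_J L lam I Y) k"
    unfolding Z_def filter_E_def coef_add[OF h2[OF E] h2[OF JY(1)]] coef_diff[OF XL h2[OF JX(1)]] ..
  show "coef L (\<lambda>x. Y x - Z x) k = coef L (\<lambda>x. Y x - X x) k - (if k \<in> low lam then coef L (I (\<lambda>x. Y x - X x)) k else 0)"
    unfolding coef_diff[OF YL h2[OF Z]] coef_diff[OF YL XL] cZ lin coef_diff[OF IY IX] JX(2) JY(2) by simp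
qed

text \<open>The initialization has the form of a correction of the state 0, so the recursion for the
  error can start from \<open>U t0\<close> itself.\<close>

lemma filter_initial:
  assumes I: "type_II_observable L c1 h I" and Y: "Y \<in> space_H L" "hs_summable L 2 (coef L Y)"
  shows "filter_J L lam I Y \<in> space_H L"
    and "coef L (\<lambda>x. Y x - filter_J L lam I Y x) k = coef L Y k - (if k \<in> low lam then coef L (I Y) k else 0)"
proof -
  have "I Y \<in> L2_space L" using I hs2_imp_domain_A[OF Y] unfolding type_II_observable_def by blast
  note J = filter_J_properties[where lam=lam and I=I and X=Y, OF this]
  show "filter_J L lam I Y \<in> space_H L" by (rule J)
  show "coef L (\<lambda>x. Y x - filter_J L lam I Y x) k = coef L Y k - (if k \<in> low lam then coef L (I Y) k else 0)"
    unfolding coef_diff[OF space_H_proj(1)[OF Y(1)] space_H_proj(1)[OF J(1)]] J(2) ..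
qed

text \<open>First \<open>lam\<close> makes \<open>1 / lam^2\<close> small; then \<open>h\<close>
  makes the factor of the observation error smaller than both \<open>q / 2\<close> and
  \<open>1 / lam^2\<close>. The latter counters the amplification of the observation error by
  \<open>lam^2\<close> in the second-order norm.\<close>

lemma assimilation_parameters:
  assumes c1: "c1 > (0::real)" and q: "q > 0"
  obtains lam h where "lam > 0" "h > 0" "c1 * h\<^sup>2 * ((1 / kap1)\<^sup>2 + h\<^sup>2) + 1 / lam\<^sup>2 \<le> q"
    "lam\<^sup>2 * (c1 * h\<^sup>2 * ((1 / kap1)\<^sup>2 + h\<^sup>2)) + 1 \<le> 2"
proof -
  define lam where "lam = max 1 (2 / q)"
  have lam: "lam \<ge> 1" "lam \<ge> 2 / q" by (simp_all add: lam_def)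
  have "lam * 1 \<le> lam * lam" using lam by (intro mult_left_mono) auto
  then have "2 / q \<le> lam\<^sup>2" unfolding power2_eq_square using lam(2) by linarith
  then have l2: "1 / lam\<^sup>2 \<le> q / 2" using q lam by (simp add: field_simps)
  define m where "m = min (q / 2) (1 / lam\<^sup>2)"
  have m: "m > 0" "m \<le> q / 2" "m \<le> 1 / lam\<^sup>2" using q lam by (auto simp: m_def)
  let ?d = "c1 * ((1 / kap1)\<^sup>2 + 1)"
  have d: "?d > 0" using c1 by (intro mult_pos_pos add_nonneg_pos) auto
  \<comment> \<open>\<open>h \<le> 1\<close> makes the factor of the observation error at most
    linear in \<open>h\<close>, with slope \<open>?d\<close>.\<close>
  define h where "h = min 1 (m / ?d)"
  have h: "h > 0" "h \<le> 1" "h \<le> m / ?d" using m d by (auto simp: h_def)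
  have hh: "h\<^sup>2 \<le> h" using h mult_left_mono[of h 1 h] by (simp add: power2_eq_square)
  have "c1 * h\<^sup>2 * ((1 / kap1)\<^sup>2 + h\<^sup>2) \<le> c1 * h * ((1 / kap1)\<^sup>2 + 1)"
    using c1 h hh by (intro mult_mono add_left_mono) auto
  also have "\<dots> = h * ?d" by simp
  also have "\<dots> \<le> m" using h(3) d by (simp add: pos_le_divide_eq)
  finally have B: "c1 * h\<^sup>2 * ((1 / kap1)\<^sup>2 + h\<^sup>2) \<le> m" .
  have "lam\<^sup>2 * (c1 * h\<^sup>2 * ((1 / kap1)\<^sup>2 + h\<^sup>2)) \<le> lam\<^sup>2 * (1 / lam\<^sup>2)"
    using B m(3) by (intro mult_left_mono) auto
  also have "\<dots> = 1" using lam by simp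
  finally have 2: "lam\<^sup>2 * (c1 * h\<^sup>2 * ((1 / kap1)\<^sup>2 + h\<^sup>2)) + 1 \<le> 2" by simp
  have 1: "c1 * h\<^sup>2 * ((1 / kap1)\<^sup>2 + h\<^sup>2) + 1 / lam\<^sup>2 \<le> q" using B m(2) l2 by simp
  show thesis by (rule that[OF _ h(1) 1 2]) (use lam in simp)
qed

text \<open>The parameters are fixed before \<open>I\<close>, from the bounds for \<open>U\<close>
  and the flow constants. In each step the correction turns the second-order norm into a small
  energy, and the flow turns energy back into a second-order norm; the product of the two constants
  is at most \<open>1 / 2\<close>.\<close>

lemma downscaling_error:
  assumes \<nu>: "\<nu> > 0" and S: "semi_process L \<nu> f t0 S" and reg: "solutions_regular L \<nu> f t0"
    and U: "NSE_solution L \<nu> f t0 U" and rb: "reference_bounds L \<nu> t0 \<rho>H \<rho>V \<rho>A U" and c1: "c1 > 0" and \<delta>: "\<delta> > 0"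
  obtains lam h K where "lam > 0" "h > 0" "K \<ge> 0"
    "\<And>I t. type_II_observable L c1 h I \<Longrightarrow> t \<ge> t0 \<Longrightarrow>
       downscaling L S t0 \<delta> lam I U t \<in> space_H L \<and>
       sob_sq L 2 (\<lambda>x. U t x - downscaling L S t0 \<delta> lam I U t x) \<le> ennreal (L\<^sup>2 * (K * (1/2) ^ nat \<lfloor>(t - t0) / \<delta>\<rfloor>))"
proof -
  define R where "R = (max 0 \<rho>A)\<^sup>2 / L\<^sup>2"
  have R: "R \<ge> 0" by (simp add: R_def)
  obtain \<kappa> C2 where \<kappa>: "\<kappa> > 0" and C2: "C2 \<ge> 0"
    and smoothing: "\<And>s a v. pert_flow L \<nu> (ref_bound R) s a v \<Longrightarrow> hs L 0 (v s) \<le> \<kappa> \<Longrightarrow> hs L 2 (v (s + \<delta>)) \<le> C2 * hs L 0 (v s)"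
    and persistence: "\<And>M. M \<ge> 0 \<Longrightarrow> \<exists>C3\<ge>0. \<forall>s a v t. pert_flow L \<nu> (ref_bound R) s a v \<longrightarrow> hs L 0 (v s) \<le> \<kappa> \<longrightarrow>
       hs_summable L 2 (v s) \<longrightarrow> hs L 2 (v s) \<le> M \<longrightarrow> s \<le> t \<longrightarrow> t \<le> s + \<delta> \<longrightarrow> hs L 2 (v t) \<le> C3 * hs L 2 (v s)"
    by (rule flow_estimates[OF \<nu> \<delta>, of "ref_bound R"]) blast
  \<comment> \<open>Before each correction \<open>hs L 2\<close> will be at most \<open>R\<close>,
    and the correction at most doubles it.\<close>
  obtain C3 where C3: "C3 \<ge> 0" and persist: "\<And>s a v t. pert_flow L \<nu> (ref_bound R) s a v \<Longrightarrow> hs L 0 (v s) \<le> \<kappa> \<Longrightarrow>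
       hs_summable L 2 (v s) \<Longrightarrow> hs L 2 (v s) \<le> 2 * R \<Longrightarrow> s \<le> t \<Longrightarrow> t \<le> s + \<delta> \<Longrightarrow> hs L 2 (v t) \<le> C3 * hs L 2 (v s)"
    using persistence[of "2 * R"] R by auto
  \<comment> \<open>The first entry gives the contraction \<open>C2 * q \<le> 1 / 2\<close>. The
    second gives \<open>q * R \<le> \<kappa>\<close>: after every correction, the initial one
    included, the energy is below the threshold of the flow estimates.\<close>
  define q where "q = min (1 / (2 * (C2 + 1))) (\<kappa> / (R + 1))"
  have q: "q > 0" "q \<le> 1 / (2 * (C2 + 1))" "q \<le> \<kappa> / (R + 1)" using C2 \<kappa> R by (auto simp: q_def)
  have C2q: "C2 * q \<le> 1 / 2"
  proof -
    have "C2 * q \<le> C2 * (1 / (2 * (C2 + 1)))" by (rule mult_left_mono[OF q(2) C2])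
    also have "\<dots> \<le> 1 / 2" using C2 by (simp add: field_simps)
    finally show ?thesis .
  qed
  have qR: "q * R \<le> \<kappa>"
  proof -
    have "q * R \<le> q * (R + 1)" using q(1) by simp
    also have "\<dots> \<le> \<kappa>" using q(3) R by (simp add: pos_le_divide_eq)
    finally show ?thesis .
  qed
  obtain lam h where lam: "lam > 0" and h: "h > 0" and p1: "c1 * h\<^sup>2 * ((1 / kap1)\<^sup>2 + h\<^sup>2) + 1 / lam\<^sup>2 \<le> q"
    and p2: "lam\<^sup>2 * (c1 * h\<^sup>2 * ((1 / kap1)\<^sup>2 + h\<^sup>2)) + 1 \<le> 2"
    using assimilation_parameters[OF c1 q(1)] by metis
  have UH: "U t \<in> space_H L" and U2: "hs_summable L 2 (coef L (U t))" "hs L 2 (coef L (U t)) \<le> R" if t: "t \<ge> t0" for t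
  proof -
    show H: "U t \<in> space_H L" by (rule NSE_solutionD(1)[OF U t])
    have "sob_norm L 2 (U t) \<le> ennreal \<rho>A" using rb t unfolding reference_bounds_def by blast
    then show "hs_summable L 2 (coef L (U t))" "hs L 2 (coef L (U t)) \<le> R"
      unfolding R_def by (rule sob_norm_le_imp[OF H])+
  qed
  have SN: "NSE_solution L \<nu> f s (\<lambda>t. S t s w)" and Ss: "AE x in torus L. S s s w x = w x"
    if "s \<ge> t0" "w \<in> space_H L" for s w
    using S that unfolding semi_process_def by blast+
  have S2: "hs_summable L 2 (coef L (S t s w))" if "s \<ge> t0" "w \<in> space_H L" "t > s" for s t w
  proof (rule sob_sq_H(2))
    show "S t s w \<in> space_H L" using NSE_solutionD(1)[OF SN[OF that(1,2)]] that by simp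
    have "sob_norm L 2 (S t s w) < \<infinity>" using reg SN[OF that(1,2)] that(1,3) unfolding solutions_regular_def by blast
    then show "sob_sq L 2 (S t s w) < \<infinity>" unfolding sob_norm_def by (rule esqrt_finite)
  qed
  have main: "downscaling L S t0 \<delta> lam I U t \<in> space_H L \<and>
       sob_sq L 2 (\<lambda>x. U t x - downscaling L S t0 \<delta> lam I U t x) \<le> ennreal (L\<^sup>2 * (C3 * 2 * R * (1/2) ^ nat \<lfloor>(t - t0) / \<delta>\<rfloor>))"
    if I: "type_II_observable L c1 h I" and t: "t \<ge> t0" for I t
  proof -
    define \<tau> where "\<tau> n = t0 + real n * \<delta>" for n
    define st where "st = downscaling_state L S t0 \<delta> lam I U"
    \<comment> \<open>\<open>V 0\<close> is the error of the state 0 before the initialization, so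
      that \<open>corr\<close> has the same form for all \<open>n\<close>.\<close>
    define V where "V n = (case n of 0 \<Rightarrow> U t0 | Suc m \<Rightarrow> \<lambda>x. U (\<tau> (Suc m)) x - S (\<tau> (Suc m)) (\<tau> m) (st m) x)" for n
    have \<tau>: "\<tau> 0 = t0" "\<tau> (Suc n) = \<tau> n + \<delta>" "\<tau> n \<ge> t0" for n using \<delta> by (simp_all add: \<tau>_def algebra_simps)
    have V: "V 0 = U t0" "V (Suc n) = (\<lambda>x. U (\<tau> (Suc n)) x - S (\<tau> (Suc n)) (\<tau> n) (st n) x)" for n
      by (simp_all add: V_def)
    have st_Suc: "st (Suc n) = (\<lambda>x. filter_E L lam I (S (\<tau> (Suc n)) (\<tau> n) (st n)) x + filter_J L lam I (U (\<tau> (Suc n))) x)" for n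
      by (simp only: st_def \<tau>_def downscaling_state.simps)
    have corr: "st n \<in> space_H L \<and> V n \<in> space_H L \<and> hs_summable L 2 (coef L (V n)) \<and>
       (\<forall>k. coef L (\<lambda>x. U (\<tau> n) x - st n x) k = coef L (V n) k - (if k \<in> low lam then coef L (I (V n)) k else 0))" for n
    proof (induction n)
      case 0
      note i = filter_initial[OF I UH[OF order_refl] U2(1)[OF order_refl]]
      show ?case unfolding \<tau> V st_def downscaling_state.simps using i UH U2 by blast
    next
      case (Suc n)
      let ?X = "S (\<tau> (Suc n)) (\<tau> n) (st n)"
      have w: "st n \<in> space_H L" using Suc.IH by blast
      have lt: "\<tau> n < \<tau> (Suc n)" using \<delta> by (simp add: \<tau>(2))
      have X: "?X \<in> space_H L" using NSE_solutionD(1)[OF SN[OF \<tau>(3) w]] lt by simp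
      have X2: "hs_summable L 2 (coef L ?X)" by (rule S2[OF \<tau>(3) w lt])
      note Y = UH[OF \<tau>(3), of "Suc n"] U2(1)[OF \<tau>(3), of "Suc n"]
      note c = filter_correction[OF I X X2 Y, where lam=lam]
      have "coef L (V (Suc n)) = (\<lambda>k. coef L (U (\<tau> (Suc n))) k - coef L ?X k)"
        unfolding V using coef_diff[OF space_H_proj(1)[OF Y(1)] space_H_proj(1)[OF X]] by auto
      then have "hs_summable L 2 (coef L (V (Suc n)))" using hs_diff(1)[OF Y(2) X2] by simp
      then show ?case unfolding st_Suc V(2) using c space_H_diff[OF Y(1) X] by blast
    qed
    have stH: "st n \<in> space_H L" for n using corr by blast
    define v where "v n r = coef L (\<lambda>x. U r x - S r (\<tau> n) (st n) x)" for n r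
    have flow: "pert_flow L \<nu> (ref_bound R) (\<tau> n) (\<lambda>r. coef L (U r)) (v n)" for n
      unfolding v_def[abs_def] R_def by (rule pert_flow_NSE[OF \<nu> U SN[OF \<tau>(3) stH] \<tau>(3) reg rb])
    \<comment> \<open>\<open>S\<close> returns its initial value up to a null set, which the
      coefficients do not see.\<close>
    have v_start: "v n (\<tau> n) = coef L (\<lambda>x. U (\<tau> n) x - st n x)" for n
    proof -
      have SH: "S (\<tau> n) (\<tau> n) (st n) \<in> space_H L" by (rule NSE_solutionD(1)[OF SN[OF \<tau>(3) stH] order_refl])
      show ?thesis unfolding v_def
      proof (rule coef_cong_AE)
        show "AE x in torus L. U (\<tau> n) x - S (\<tau> n) (\<tau> n) (st n) x = U (\<tau> n) x - st n x"
          using Ss[OF \<tau>(3) stH[of n], of n] by eventually_elim simp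
      qed (intro space_H_proj(1) space_H_diff UH \<tau>(3) SH stH)+
    qed
    have jump: "hs_summable L 2 (v n (\<tau> n))" "hs L 0 (v n (\<tau> n)) \<le> q * hs L 2 (coef L (V n))" "hs L 2 (v n (\<tau> n)) \<le> 2 * hs L 2 (coef L (V n))" for n
    proof -
      have c: "V n \<in> space_H L" "hs_summable L 2 (coef L (V n))"
        "\<And>k. v n (\<tau> n) k = coef L (V n) k - (if k \<in> low lam then coef L (I (V n)) k else 0)"
        using corr[of n] unfolding v_start by blast+
      note j = assimilation_jump[OF I c(1,2) lam c(3)]
      show "hs_summable L 2 (v n (\<tau> n))" by (rule j)
      show "hs L 0 (v n (\<tau> n)) \<le> q * hs L 2 (coef L (V n))" by (rule order_trans[OF j(2) mult_right_mono[OF p1 hs_nonneg]])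
      show "hs L 2 (v n (\<tau> n)) \<le> 2 * hs L 2 (coef L (V n))" by (rule order_trans[OF j(3) mult_right_mono[OF p2 hs_nonneg]])
    qed
    have small: "hs L 0 (v n (\<tau> n)) \<le> \<kappa>" if "hs L 2 (coef L (V n)) \<le> (1/2) ^ n * R" for n
    proof -
      have "(1/2) ^ n * R \<le> 1 * R" using R by (intro mult_right_mono power_le_one) auto
      then have "q * hs L 2 (coef L (V n)) \<le> q * R" using that q(1) by (intro mult_left_mono) auto
      then show ?thesis using jump(2)[of n] qR by linarith
    qed
    \<comment> \<open>The induction also maintains smallness: the bound at step \<open>n\<close>
      keeps the energy after the correction below \<kappa>, which licenses \<open>smoothing\<close>
      for the next step.\<close>
    have decay: "hs L 2 (coef L (V n)) \<le> (1/2) ^ n * R" for n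
    proof (induction n)
      case 0
      show ?case using U2(2)[OF order_refl] by (simp add: V)
    next
      case (Suc n)
      have "hs L 2 (coef L (V (Suc n))) = hs L 2 (v n (\<tau> n + \<delta>))" by (simp add: v_def V \<tau>)
      also have "\<dots> \<le> C2 * hs L 0 (v n (\<tau> n))" by (rule smoothing[OF flow small[OF Suc.IH]])
      also have "\<dots> \<le> C2 * (q * hs L 2 (coef L (V n)))" by (rule mult_left_mono[OF jump(2) C2])
      also have "\<dots> = C2 * q * hs L 2 (coef L (V n))" by simp
      also have "\<dots> \<le> 1/2 * hs L 2 (coef L (V n))" by (rule mult_right_mono[OF C2q hs_nonneg])
      also have "\<dots> \<le> 1/2 * ((1/2) ^ n * R)" using Suc.IH by simp
      finally show ?case by simp
    qed
    define n where "n = nat \<lfloor>(t - t0) / \<delta>\<rfloor>"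
    have "real n \<le> (t - t0) / \<delta>" "(t - t0) / \<delta> < real n + 1"
      using t \<delta> unfolding n_def by (auto simp: of_nat_nat zero_le_floor)
    then have tn: "\<tau> n \<le> t" "t \<le> \<tau> n + \<delta>" using \<delta> by (simp_all add: \<tau>_def field_simps)
    have ds: "downscaling L S t0 \<delta> lam I U t = S t (\<tau> n) (st n)"
      by (simp only: downscaling_def Let_def n_def \<tau>_def st_def)
    have SH: "S t (\<tau> n) (st n) \<in> space_H L" by (rule NSE_solutionD(1)[OF SN[OF \<tau>(3) stH] tn(1)])
    have WH: "(\<lambda>x. U t x - S t (\<tau> n) (st n) x) \<in> space_H L" by (rule space_H_diff[OF UH[OF t] SH])
    \<comment> \<open>At an assimilation time the second-order norm is finite by the correction,
      afterwards by the regularity of the flow.\<close>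
    have v2: "hs_summable L 2 (v n t)"
    proof (cases "t = \<tau> n")
      case True
      then show ?thesis using jump(1) by simp
    next
      case False
      then show ?thesis using pert_flow.v_hs2[OF flow[of n], of t] tn(1) by simp
    qed
    have dn: "hs L 2 (coef L (V n)) \<le> 1 * R"
      by (rule order_trans[OF decay]) (use R in \<open>intro mult_right_mono power_le_one; simp\<close>)
    have "hs L 2 (v n t) \<le> C3 * hs L 2 (v n (\<tau> n))"
      by (rule persist[OF flow small[OF decay] jump(1) _ tn]) (use jump(3)[of n] dn in linarith)
    also have "\<dots> \<le> C3 * (2 * ((1/2) ^ n * R))" using jump(3)[of n] decay[of n] by (intro mult_left_mono C3) linarith
    finally have "L\<^sup>2 * hs L 2 (v n t) \<le> L\<^sup>2 * (C3 * 2 * R * (1/2) ^ n)" by (intro mult_left_mono) (simp_all add: algebra_simps)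
    then have "sob_sq L 2 (\<lambda>x. U t x - S t (\<tau> n) (st n) x) \<le> ennreal (L\<^sup>2 * (C3 * 2 * R * (1/2) ^ n))"
      unfolding sob_sq_H(1)[OF WH v2[unfolded v_def]] v_def by (rule ennreal_leI)
    then show ?thesis unfolding ds n_def[symmetric] using SH by blast
  qed
  have "C3 * 2 * R \<ge> 0" using C3 R by simp
  then show thesis using that[OF lam h _ main] by blast
qed

end

section \<open>Exponential convergence of the vorticity\<close>

theorem theorem4p1:
  fixes L \<nu> t0 c1 \<rho>H \<rho>V \<rho>A :: real
    and f U :: "real \<Rightarrow> vfield"
    and S :: "real \<Rightarrow> real \<Rightarrow> vfield \<Rightarrow> vfield"
  assumes "L > 0" and "\<nu> > 0"
    and "forcing L t0 f"
    and "semi_process L \<nu> f t0 S"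
    and "solutions_regular L \<nu> f t0"
    and "NSE_solution L \<nu> f t0 U"
    and "reference_bounds L \<nu> t0 \<rho>H \<rho>V \<rho>A U"
    and "c1 > 0"
  shows "\<forall>\<delta>>0. \<exists>lam>0. \<exists>h>0. \<forall>I u W w.
     type_II_observable L c1 h I \<longrightarrow>
     (\<forall>t\<ge>t0. u t = downscaling L S t0 \<delta> lam I U t) \<longrightarrow>
     (\<forall>t\<ge>t0. is_curl L (U t) (W t)) \<longrightarrow>
     (\<forall>t\<ge>t0. is_curl L (u t) (w t)) \<longrightarrow>
     ((\<lambda>t. sob_norm L 1 (\<lambda>x. W t x - w t x)) \<longlongrightarrow> 0) at_top \<and>
     (\<exists>K>0. \<exists>\<alpha>>0. \<forall>t\<ge>t0.
        sob_norm L 1 (\<lambda>x. W t x - w t x) \<le> ennreal (K * exp (- \<alpha> * (t - t0))))"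
proof (intro allI impI)
  fix \<delta> :: real assume \<delta>: "\<delta> > 0"
  interpret torus_domain L by unfold_locales (rule assms(1))
  obtain lam h K0 where lam: "lam > 0" and h: "h > 0" and K0: "K0 \<ge> 0"
    and err: "\<And>I t. type_II_observable L c1 h I \<Longrightarrow> t \<ge> t0 \<Longrightarrow>
       downscaling L S t0 \<delta> lam I U t \<in> space_H L \<and>
       sob_sq L 2 (\<lambda>x. U t x - downscaling L S t0 \<delta> lam I U t x) \<le> ennreal (L\<^sup>2 * (K0 * (1/2) ^ nat \<lfloor>(t - t0) / \<delta>\<rfloor>))"
    by (rule downscaling_error[OF assms(2,4-8) \<delta>]) blast
  \<comment> \<open>The bound on \<open>sob_sq\<close> is halved once per \<delta>; the 2 in the
    denominator passes from the square to the norm.\<close>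
  define \<alpha> where "\<alpha> = ln 2 / (2 * \<delta>)"
  \<comment> \<open>The 2 under the root pays for the floor in \<open>half\<close>; adding 1 keeps
    \<open>K\<close> positive when \<open>K0 = 0\<close>.\<close>
  define K where "K = L * sqrt (2 * K0) + 1"
  have \<alpha>: "\<alpha> > 0" using \<delta> by (simp add: \<alpha>_def)
  have K: "K > 0" using assms(1) K0 by (simp add: K_def add_nonneg_pos)
  \<comment> \<open>Rounding down loses less than one interval, that is at most one factor
    \<open>1 / 2\<close>.\<close>
  have half: "(1/2::real) ^ nat \<lfloor>(t - t0) / \<delta>\<rfloor> \<le> 2 * (exp (- \<alpha> * (t - t0)))\<^sup>2" if "t \<ge> t0" for t
  proof -
    let ?n = "nat \<lfloor>(t - t0) / \<delta>\<rfloor>"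
    have "(t - t0) / \<delta> - 1 < real ?n" by linarith
    then have "ln 2 * ((t - t0) / \<delta> - 1) \<le> ln 2 * real ?n" by (intro mult_left_mono) auto
    then have l: "- (real ?n * ln 2) \<le> ln 2 + 2 * (- \<alpha> * (t - t0))" using \<delta> by (simp add: \<alpha>_def field_simps)
    have "(1/2::real) ^ ?n = exp (- (real ?n * ln 2))"
      by (simp add: exp_minus exp_of_nat_mult power_one_over inverse_eq_divide)
    also have "\<dots> \<le> exp (ln 2 + 2 * (- \<alpha> * (t - t0)))" using l by simp
    also have "\<dots> = 2 * (exp (- \<alpha> * (t - t0)))\<^sup>2" by (simp only: exp_add exp_double) simp
    finally show ?thesis .
  qed
  show "\<exists>lam>0. \<exists>h>0. \<forall>I u W w.
     type_II_observable L c1 h I \<longrightarrow>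
     (\<forall>t\<ge>t0. u t = downscaling L S t0 \<delta> lam I U t) \<longrightarrow>
     (\<forall>t\<ge>t0. is_curl L (U t) (W t)) \<longrightarrow>
     (\<forall>t\<ge>t0. is_curl L (u t) (w t)) \<longrightarrow>
     ((\<lambda>t. sob_norm L 1 (\<lambda>x. W t x - w t x)) \<longlongrightarrow> 0) at_top \<and>
     (\<exists>K>0. \<exists>\<alpha>>0. \<forall>t\<ge>t0.
        sob_norm L 1 (\<lambda>x. W t x - w t x) \<le> ennreal (K * exp (- \<alpha> * (t - t0))))"
  proof (rule exI[of _ lam], rule conjI[OF lam], rule exI[of _ h], rule conjI[OF h], intro allI impI)
    fix I :: "vfield \<Rightarrow> vfield" and u :: "real \<Rightarrow> vfield" and W w :: "real \<Rightarrow> real^2 \<Rightarrow> real"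
    assume I: "type_II_observable L c1 h I" and u: "\<forall>t\<ge>t0. u t = downscaling L S t0 \<delta> lam I U t"
      and W: "\<forall>t\<ge>t0. is_curl L (U t) (W t)" and w: "\<forall>t\<ge>t0. is_curl L (u t) (w t)"
    have bound: "sob_norm L 1 (\<lambda>x. W t x - w t x) \<le> ennreal (K * exp (- \<alpha> * (t - t0)))" if t: "t \<ge> t0" for t
    proof -
      let ?e = "exp (- \<alpha> * (t - t0))"
      have uH: "u t \<in> space_H L" and ub: "sob_sq L 2 (\<lambda>x. U t x - u t x) \<le> ennreal (L\<^sup>2 * (K0 * (1/2) ^ nat \<lfloor>(t - t0) / \<delta>\<rfloor>))"
        using err[OF I t] u t by auto
      have "sob_sq L 1 (\<lambda>x. W t x - w t x) = sob_sq L 2 (\<lambda>x. U t x - u t x)"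
        using W w t uH NSE_solutionD(1)[OF assms(6) t] by (intro sob_sq_curl) auto
      also have "\<dots> \<le> ennreal (L\<^sup>2 * (K0 * (1/2) ^ nat \<lfloor>(t - t0) / \<delta>\<rfloor>))" by (rule ub)
      also have "\<dots> \<le> ennreal (L\<^sup>2 * (K0 * (2 * ?e\<^sup>2)))" by (intro ennreal_leI mult_left_mono half t K0) simp
      also have "L\<^sup>2 * (K0 * (2 * ?e\<^sup>2)) = (L * sqrt (2 * K0) * ?e)\<^sup>2" using K0 by (simp add: power_mult_distrib)
      finally have "sob_norm L 1 (\<lambda>x. W t x - w t x) \<le> ennreal (L * sqrt (2 * K0) * ?e)"
        unfolding sob_norm_def by (rule esqrt_leI) (use assms(1) K0 in simp)
      also have "\<dots> \<le> ennreal (K * ?e)" by (intro ennreal_leI mult_right_mono) (simp_all add: K_def)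
      finally show ?thesis .
    qed
    have "((\<lambda>t. K * exp (- \<alpha> * (t - t0))) \<longlongrightarrow> K * 0) at_top"
    proof (intro tendsto_mult tendsto_const)
      have "filterlim (\<lambda>t. - \<alpha> * (t - t0)) at_bot at_top"
        by (rule filterlim_tendsto_neg_mult_at_bot[OF tendsto_const])
          (use \<alpha> filterlim_tendsto_add_at_top[OF tendsto_const[of "- t0"] filterlim_ident] in simp_all)
      then show "((\<lambda>t. exp (- \<alpha> * (t - t0))) \<longlongrightarrow> 0) at_top" by (rule filterlim_compose[OF exp_at_bot])
    qed
    then have lim: "((\<lambda>t. ennreal (K * exp (- \<alpha> * (t - t0)))) \<longlongrightarrow> 0) at_top"
      using tendsto_ennrealI by fastforce
    have "((\<lambda>t. sob_norm L 1 (\<lambda>x. W t x - w t x)) \<longlongrightarrow> 0) at_top"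
    proof (rule tendsto_sandwich[OF _ _ tendsto_const lim])
      show "\<forall>\<^sub>F t in at_top. sob_norm L 1 (\<lambda>x. W t x - w t x) \<le> ennreal (K * exp (- \<alpha> * (t - t0)))"
        using eventually_ge_at_top[of t0] by eventually_elim (rule bound)
    qed simp
    then show "((\<lambda>t. sob_norm L 1 (\<lambda>x. W t x - w t x)) \<longlongrightarrow> 0) at_top \<and>
     (\<exists>K>0. \<exists>\<alpha>>0. \<forall>t\<ge>t0. sob_norm L 1 (\<lambda>x. W t x - w t x) \<le> ennreal (K * exp (- \<alpha> * (t - t0))))"
      using K \<alpha> bound by blast
  qed
qed

end
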